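(* Let $(M,J)$ be an almost complex manifold of complex dimension $n$ and let $\Omega\subset M$ be a smoothly bounded domain with boundary $b\Omega$. Let $E\subset b\Omega$ be a generic submanifold and let $K\subset E$ be a subset with non-empty interior with respect to $E$. Then the function $p\mapsto \omega_*(p,K,\Omega)$ (the plurisuperharmonic measure of $K$ with respect to $\Omega$) does not vanish identically on $\Omega$.
   Context: All manifolds and almost complex structures are of class $C^\infty$. An almost complex manifold $(M,J)$ of complex dimension $n$ is a smooth $2n$-dimensional manifold with a smooth field $J$ of endomorphisms of the tangent spaces, $J(p):T_pM\to T_pM$, $J(p)^2=-I$. Fix a Riemannian metric on $M$; $dist$ is the associated distance. A real submanifold $E$ of $M$ is generic if for each $p\in E$ the complex span $T_pE+J(p)T_pE$ is all of $T_pM$. Let $\mathbb{D}=\{\zeta\in\mathbb{C}:|\zeta|<1\}$ with its standard complex structure $J_{st}$. A $J$-complex disc is a $C^1$ map $f:\mathbb{D}\to M$ with $df\circ J_{st}=J\circ df$. An upper semicontinuous function $u:\Omega\to[-\infty,+\infty)$ is plurisubharmonic if $u\circ f$ is subharmonic on $\mathbb{D}$ for every $J$-complex disc $f:\mathbb{D}\to\Omega$ (the function $\equiv-\infty$ is allowed). A function $v$ is plurisuperharmonic if $-v$ is plurisubharmonic. For $q\in b\Omega$ and $\alpha\ge 1$ put $A_\alpha(q)=\{p\in\Omega: dist(p,q)\le \alpha\, d_q(p)\}$, where $d_q(p)$ is the distance from $p$ to the tangent plane $T_q(b\Omega)$ to $b\Omega$ at $q$ (realized as a hyperplane in a local coordinate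 chart near $q$; only points $p$ near $q$ matter). For a plurisuperharmonic function $u$ on $\Omega$ the non-tangential lower boundary extension $u_*$ is $u_*(q)=u(q)$ for $q\in\Omega$ and $u_*(q)=\inf_{\alpha>1}\big(\liminf_{A_\alpha(q)\ni p\to q}u(p)\big)$ for $q\in b\Omega$. For $K\subset\overline\Omega$ let $P(K)$ be the class of all plurisuperharmonic functions $u$ on $\Omega$ with $u\ge 0$ on $\Omega$ and $u_*(q)\ge 1$ for each $q\in K$. Put $\omega(q,K,\Omega)=\inf_{u\in P(K)}u(q)$ for $q\in\Omega$, and define the plurisuperharmonic measure of $K$ with respect to $\Omega$ by $\omega_*(p,K,\Omega)=\liminf_{q\to p}\omega(q,K,\Omega)$, $p\in\Omega$. *)

theory Defs
  imports "HOL-Analysis.Analysis"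
begin

section \<open>Maps of class \<open>C\<^sup>k\<close> on open subsets of Euclidean spaces\<close>

primrec Ck_on :: "nat \<Rightarrow> 'a::euclidean_space set \<Rightarrow> ('a \<Rightarrow> 'b::euclidean_space) \<Rightarrow> bool" where
  "Ck_on 0 S f \<longleftrightarrow> continuous_on S f"
| "Ck_on (Suc k) S f \<longleftrightarrow>
     (\<forall>x\<in>S. f differentiable (at x)) \<and> (\<forall>v. Ck_on k S (\<lambda>x. frechet_derivative f (at x) v))"

definition smooth_on :: "'a::euclidean_space set \<Rightarrow> ('a \<Rightarrow> 'b::euclidean_space) \<Rightarrow> bool" where
  "smooth_on S f \<longleftrightarrow> (\<forall>k. Ck_on k S f)"


section \<open>Smooth manifolds\<close>

text \<open>
  The point set of the manifold is the whole type \<open>'m\<close>, which carries a Hausdorff, second countable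
  topology; \<open>'e\<close> is the Euclidean model space. A chart is a pair of an open domain and a map
  that is only relevant on that domain.
\<close>

type_synonym ('m, 'e) chart = "'m set \<times> ('m \<Rightarrow> 'e)"

definition is_chart :: "('m::topological_space, 'e::euclidean_space) chart \<Rightarrow> bool" where
  "is_chart c \<longleftrightarrow> open (fst c) \<and> open (snd c ` fst c) \<and>
     (\<exists>\<psi>. homeomorphism (fst c) (snd c ` fst c) (snd c) \<psi>)"

definition chart_inv :: "('m, 'e) chart \<Rightarrow> 'e \<Rightarrow> 'm" where
  "chart_inv c = inv_into (fst c) (snd c)"

definition compatible :: "('m, 'e::euclidean_space) chart \<Rightarrow> ('m, 'e) chart \<Rightarrow> bool" where
  "compatible c c' \<longleftrightarrow>
     smooth_on (snd c ` (fst c \<inter> fst c')) (snd c' \<circ> chart_inv c) \<and>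
     smooth_on (snd c' ` (fst c \<inter> fst c')) (snd c \<circ> chart_inv c')"

definition smooth_atlas ::
  "('m::{t2_space,second_countable_topology}, 'e::euclidean_space) chart set \<Rightarrow> bool" where
  "smooth_atlas A \<longleftrightarrow>
     (\<forall>c\<in>A. is_chart c) \<and> (\<Union>c\<in>A. fst c) = UNIV \<and> (\<forall>c\<in>A. \<forall>c'\<in>A. compatible c c')"

definition charts :: "('m::topological_space, 'e::euclidean_space) chart set \<Rightarrow> ('m, 'e) chart set" where
  "charts A = {c. is_chart c \<and> (\<forall>c'\<in>A. compatible c c')}"

definition charts_at ::
  "('m::topological_space, 'e::euclidean_space) chart set \<Rightarrow> 'm \<Rightarrow> ('m, 'e) chart set" where
  "charts_at A p = {c \<in> charts A. p \<in> fst c}"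

definition Ck_map ::
  "('m::topological_space, 'e::euclidean_space) chart set \<Rightarrow> nat \<Rightarrow>
     'a::euclidean_space set \<Rightarrow> ('a \<Rightarrow> 'm) \<Rightarrow> bool" where
  "Ck_map A k S f \<longleftrightarrow> continuous_on S f \<and>
     (\<forall>c\<in>charts A. Ck_on k {x \<in> S. f x \<in> fst c} (snd c \<circ> f))"


section \<open>Tangent vectors\<close>

text \<open>
  A tangent vector at \<open>p\<close> is the family of its coordinate vectors in all charts of the maximal atlas
  around \<open>p\<close>, subject to the usual transformation law under change of charts (and normalised to
  \<open>0\<close> at pairs that are not charts around \<open>p\<close>). The linear structure is the pointwise one.
\<close>

type_synonym ('m, 'e) tvec = "('m, 'e) chart \<Rightarrow> 'e"

definition tangent_space ::
  "('m::topological_space, 'e::euclidean_space) chart set \<Rightarrow> 'm \<Rightarrow> ('m, 'e) tvec set" where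
  "tangent_space A p = {v.
     (\<forall>c. c \<notin> charts_at A p \<longrightarrow> v c = 0) \<and>
     (\<forall>c\<in>charts_at A p. \<forall>c'\<in>charts_at A p.
        v c' = frechet_derivative (snd c' \<circ> chart_inv c) (at (snd c p)) (v c))}"

definition differential ::
  "('m::topological_space, 'e::euclidean_space) chart set \<Rightarrow>
     ('a::euclidean_space \<Rightarrow> 'm) \<Rightarrow> 'a \<Rightarrow> 'a \<Rightarrow> ('m, 'e) tvec" where
  "differential A f x w =
     (\<lambda>c. if c \<in> charts_at A (f x) then frechet_derivative (snd c \<circ> f) (at x) w else 0)"

abbreviation velocity ::
  "('m::topological_space, 'e::euclidean_space) chart set \<Rightarrow> (real \<Rightarrow> 'm) \<Rightarrow> real \<Rightarrow> ('m, 'e) tvec"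
  where "velocity A \<gamma> t \<equiv> differential A \<gamma> t 1"

text \<open>The tangent space \<open>T\<^sub>pE\<close> of a subset \<open>E\<close> that is a submanifold, as a subset of \<open>T\<^sub>pM\<close>.\<close>

definition tangent_space_of ::
  "('m::topological_space, 'e::euclidean_space) chart set \<Rightarrow> 'm set \<Rightarrow> 'm \<Rightarrow> ('m, 'e) tvec set" where
  "tangent_space_of A E p = {velocity A \<gamma> 0 | \<gamma>.
     \<gamma> 0 = p \<and> (\<exists>\<epsilon>>0. Ck_map A 1 {-\<epsilon><..<\<epsilon>} \<gamma> \<and> \<gamma> ` {-\<epsilon><..<\<epsilon>} \<subseteq> E)}"


section \<open>Almost complex structures, generic submanifolds, smoothly bounded domains\<close>

text \<open>
  Smoothness of a tensor field is smoothness of its components with respect to the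
  coordinate vector fields \<open>x \<mapsto> differential A (chart_inv c) x a\<close> of every chart \<open>c\<close>.
\<close>

definition almost_complex_structure ::
  "('m::topological_space, 'e::euclidean_space) chart set \<Rightarrow>
     ('m \<Rightarrow> ('m, 'e) tvec \<Rightarrow> ('m, 'e) tvec) \<Rightarrow> bool" where
  "almost_complex_structure A J \<longleftrightarrow>
     (\<forall>p. \<forall>v\<in>tangent_space A p. J p v \<in> tangent_space A p \<and> J p (J p v) = (\<lambda>c. - v c)) \<and>
     (\<forall>p. \<forall>v\<in>tangent_space A p. \<forall>w\<in>tangent_space A p. \<forall>a b::real.
        J p (\<lambda>c. a *\<^sub>R v c + b *\<^sub>R w c) = (\<lambda>c. a *\<^sub>R J p v c + b *\<^sub>R J p w c)) \<and>
     (\<forall>c\<in>charts A. \<forall>a.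
        smooth_on (snd c ` fst c) (\<lambda>x. J (chart_inv c x) (differential A (chart_inv c) x a) c))"

definition almost_complex_manifold ::
  "nat \<Rightarrow> ('m::{t2_space,second_countable_topology}, 'e::euclidean_space) chart set \<Rightarrow>
     ('m \<Rightarrow> ('m, 'e) tvec \<Rightarrow> ('m, 'e) tvec) \<Rightarrow> bool" where
  "almost_complex_manifold n A J \<longleftrightarrow>
     DIM('e) = 2 * n \<and> smooth_atlas A \<and> almost_complex_structure A J"

definition submanifold ::
  "('m::topological_space, 'e::euclidean_space) chart set \<Rightarrow> nat \<Rightarrow> 'm set \<Rightarrow> bool" where
  "submanifold A k E \<longleftrightarrow> (\<forall>p\<in>E. \<exists>c\<in>charts_at A p. \<exists>S. subspace S \<and> dim S = k \<and>
     snd c ` (E \<inter> fst c) = (snd c ` fst c) \<inter> S)"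

definition generic_submanifold ::
  "('m::topological_space, 'e::euclidean_space) chart set \<Rightarrow>
     ('m \<Rightarrow> ('m, 'e) tvec \<Rightarrow> ('m, 'e) tvec) \<Rightarrow> 'm set \<Rightarrow> bool" where
  "generic_submanifold A J E \<longleftrightarrow> (\<exists>k. submanifold A k E) \<and>
     (\<forall>p\<in>E. {(\<lambda>c. v c + J p w c) | v w. v \<in> tangent_space_of A E p \<and> w \<in> tangent_space_of A E p}
              = tangent_space A p)"

text \<open>
  A domain whose boundary is smooth: near each boundary point it is the sublevel set
  \<open>\<rho> < 0\<close> of a smooth local defining function with nonvanishing differential.
  Relative compactness is not required.
\<close>

definition smoothly_bounded_domain ::
  "('m::topological_space, 'e::euclidean_space) chart set \<Rightarrow> 'm set \<Rightarrow> bool" where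
  "smoothly_bounded_domain A \<Omega> \<longleftrightarrow> open \<Omega> \<and> connected \<Omega> \<and> \<Omega> \<noteq> {} \<and>
     (\<forall>q\<in>frontier \<Omega>. \<exists>c\<in>charts_at A q. \<exists>\<rho>::'e \<Rightarrow> real.
        smooth_on (snd c ` fst c) \<rho> \<and>
        (\<forall>x\<in>snd c ` fst c. \<exists>v. frechet_derivative \<rho> (at x) v \<noteq> 0) \<and>
        \<Omega> \<inter> fst c = {p \<in> fst c. \<rho> (snd c p) < 0})"


section \<open>Riemannian metrics and distance\<close>

definition riemannian_metric ::
  "('m::topological_space, 'e::euclidean_space) chart set \<Rightarrow>
     ('m \<Rightarrow> ('m, 'e) tvec \<Rightarrow> ('m, 'e) tvec \<Rightarrow> real) \<Rightarrow> bool" where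
  "riemannian_metric A g \<longleftrightarrow>
     (\<forall>p. \<forall>v\<in>tangent_space A p. \<forall>w\<in>tangent_space A p. g p v w = g p w v) \<and>
     (\<forall>p. \<forall>u\<in>tangent_space A p. \<forall>v\<in>tangent_space A p. \<forall>w\<in>tangent_space A p. \<forall>a b::real.
        g p (\<lambda>c. a *\<^sub>R v c + b *\<^sub>R w c) u = a * g p v u + b * g p w u) \<and>
     (\<forall>p. \<forall>v\<in>tangent_space A p. v \<noteq> (\<lambda>c. 0) \<longrightarrow> g p v v > 0) \<and>
     (\<forall>c\<in>charts A. \<forall>a b. smooth_on (snd c ` fst c)
        (\<lambda>x. g (chart_inv c x) (differential A (chart_inv c) x a) (differential A (chart_inv c) x b)))"

definition piecewise_C1_path ::
  "('m::topological_space, 'e::euclidean_space) chart set \<Rightarrow> (real \<Rightarrow> 'm) \<Rightarrow> bool" where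
  "piecewise_C1_path A \<gamma> \<longleftrightarrow>
     continuous_on {0..1} \<gamma> \<and> (\<exists>F. finite F \<and> Ck_map A 1 ({0<..<1} - F) \<gamma>)"

text \<open>
  Length is a nonnegative Lebesgue integral, so that paths with non-integrable speed have length
  \<open>\<infinity>\<close>. The distance between points of different connected components is \<open>\<infinity>\<close>.
\<close>

definition curve_length ::
  "('m::topological_space, 'e::euclidean_space) chart set \<Rightarrow>
     ('m \<Rightarrow> ('m, 'e) tvec \<Rightarrow> ('m, 'e) tvec \<Rightarrow> real) \<Rightarrow> (real \<Rightarrow> 'm) \<Rightarrow> ennreal" where
  "curve_length A g \<gamma> =
     (\<integral>\<^sup>+t\<in>{0..1}. ennreal (sqrt (g (\<gamma> t) (velocity A \<gamma> t) (velocity A \<gamma> t))) \<partial>lborel)"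

definition riemannian_dist ::
  "('m::topological_space, 'e::euclidean_space) chart set \<Rightarrow>
     ('m \<Rightarrow> ('m, 'e) tvec \<Rightarrow> ('m, 'e) tvec \<Rightarrow> real) \<Rightarrow> 'm \<Rightarrow> 'm \<Rightarrow> ennreal" where
  "riemannian_dist A g p q =
     (INF \<gamma> \<in> {\<gamma>. piecewise_C1_path A \<gamma> \<and> \<gamma> 0 = p \<and> \<gamma> 1 = q}. curve_length A g \<gamma>)"


section \<open>Plurisubharmonic functions\<close>

definition usc_on :: "'a::topological_space set \<Rightarrow> ('a \<Rightarrow> ereal) \<Rightarrow> bool" where
  "usc_on S u \<longleftrightarrow> (\<forall>a. openin (top_of_set S) {x \<in> S. u x < a})"

text \<open>
  Mean value over a circle. For the upper semicontinuous functions with values in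
  \<open>[-\<infinity>, \<infinity>)\<close> considered below the positive part has a finite integral, so the difference is
  never \<open>\<infinity> - \<infinity>\<close>. Note that \<^const>\<open>e2ennreal\<close> sends negative numbers to \<open>0\<close>.
\<close>

definition circle_mean :: "(complex \<Rightarrow> ereal) \<Rightarrow> complex \<Rightarrow> real \<Rightarrow> ereal" where
  "circle_mean u a r =
     (enn2ereal (\<integral>\<^sup>+t\<in>{0..2*pi}. e2ennreal (u (a + of_real r * cis t)) \<partial>lborel)
      - enn2ereal (\<integral>\<^sup>+t\<in>{0..2*pi}. e2ennreal (- u (a + of_real r * cis t)) \<partial>lborel))
     / ereal (2 * pi)"

definition subharmonic_on :: "complex set \<Rightarrow> (complex \<Rightarrow> ereal) \<Rightarrow> bool" where
  "subharmonic_on D u \<longleftrightarrow> usc_on D u \<and> (\<forall>z\<in>D. u z < \<infinity>) \<and>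
     (\<forall>a r. 0 < r \<and> cball a r \<subseteq> D \<longrightarrow> u a \<le> circle_mean u a r)"

definition J_disc ::
  "('m::topological_space, 'e::euclidean_space) chart set \<Rightarrow>
     ('m \<Rightarrow> ('m, 'e) tvec \<Rightarrow> ('m, 'e) tvec) \<Rightarrow> (complex \<Rightarrow> 'm) \<Rightarrow> bool" where
  "J_disc A J f \<longleftrightarrow> Ck_map A 1 (ball 0 1) f \<and>
     (\<forall>z\<in>ball 0 1. \<forall>w. differential A f z (\<i> * w) = J (f z) (differential A f z w))"

definition plurisubharmonic_on ::
  "('m::topological_space, 'e::euclidean_space) chart set \<Rightarrow>
     ('m \<Rightarrow> ('m, 'e) tvec \<Rightarrow> ('m, 'e) tvec) \<Rightarrow> 'm set \<Rightarrow> ('m \<Rightarrow> ereal) \<Rightarrow> bool" where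
  "plurisubharmonic_on A J \<Omega> u \<longleftrightarrow> usc_on \<Omega> u \<and> (\<forall>p\<in>\<Omega>. u p < \<infinity>) \<and>
     (\<forall>f. J_disc A J f \<and> f ` ball 0 1 \<subseteq> \<Omega> \<longrightarrow> subharmonic_on (ball 0 1) (u \<circ> f))"

definition plurisuperharmonic_on ::
  "('m::topological_space, 'e::euclidean_space) chart set \<Rightarrow>
     ('m \<Rightarrow> ('m, 'e) tvec \<Rightarrow> ('m, 'e) tvec) \<Rightarrow> 'm set \<Rightarrow> ('m \<Rightarrow> ereal) \<Rightarrow> bool" where
  "plurisuperharmonic_on A J \<Omega> v \<longleftrightarrow> plurisubharmonic_on A J \<Omega> (\<lambda>p. - v p)"


section \<open>Non-tangential boundary extension and plurisuperharmonic measure\<close>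

text \<open>
  The tangent plane \<open>T\<^sub>q(b\<Omega>)\<close> realised as an affine hyperplane in the chart \<open>c\<close> around
  \<open>q\<close>, and the distance to it measured in that chart.
\<close>

definition tangent_plane_in_chart ::
  "('m::topological_space, 'e::euclidean_space) chart set \<Rightarrow> 'm set \<Rightarrow> ('m, 'e) chart \<Rightarrow> 'm \<Rightarrow> 'e set" where
  "tangent_plane_in_chart A \<Omega> c q = {snd c q + v c | v. v \<in> tangent_space_of A (frontier \<Omega>) q}"

definition dist_to_tangent_plane ::
  "('m::topological_space, 'e::euclidean_space) chart set \<Rightarrow> 'm set \<Rightarrow> ('m, 'e) chart \<Rightarrow> 'm \<Rightarrow> 'm \<Rightarrow> real" where
  "dist_to_tangent_plane A \<Omega> c q p = infdist (snd c p) (tangent_plane_in_chart A \<Omega> c q)"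

text \<open>
  Below, \<open>\<kappa>\<close> assigns to each boundary point \<open>q\<close> the chart around \<open>q\<close> used to realise the tangent
  plane. \<open>A\<^sub>\<alpha>(q)\<close> is restricted to the domain of that chart.
\<close>

definition approach_region ::
  "('m::topological_space, 'e::euclidean_space) chart set \<Rightarrow>
     ('m \<Rightarrow> ('m, 'e) tvec \<Rightarrow> ('m, 'e) tvec \<Rightarrow> real) \<Rightarrow> ('m \<Rightarrow> ('m, 'e) chart) \<Rightarrow> 'm set \<Rightarrow>
     real \<Rightarrow> 'm \<Rightarrow> 'm set" where
  "approach_region A g \<kappa> \<Omega> \<alpha> q = {p \<in> \<Omega> \<inter> fst (\<kappa> q).
     riemannian_dist A g p q \<le> ennreal (\<alpha> * dist_to_tangent_plane A \<Omega> (\<kappa> q) q p)}"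

definition lower_boundary_extension ::
  "('m::topological_space, 'e::euclidean_space) chart set \<Rightarrow>
     ('m \<Rightarrow> ('m, 'e) tvec \<Rightarrow> ('m, 'e) tvec \<Rightarrow> real) \<Rightarrow> ('m \<Rightarrow> ('m, 'e) chart) \<Rightarrow> 'm set \<Rightarrow>
     ('m \<Rightarrow> ereal) \<Rightarrow> 'm \<Rightarrow> ereal" where
  "lower_boundary_extension A g \<kappa> \<Omega> u q =
     (if q \<in> \<Omega> then u q
      else (INF \<alpha>\<in>{1<..}. Liminf (at q within approach_region A g \<kappa> \<Omega> \<alpha> q) u))"

definition psh_measure_class ::
  "('m::topological_space, 'e::euclidean_space) chart set \<Rightarrow>
     ('m \<Rightarrow> ('m, 'e) tvec \<Rightarrow> ('m, 'e) tvec) \<Rightarrow>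
     ('m \<Rightarrow> ('m, 'e) tvec \<Rightarrow> ('m, 'e) tvec \<Rightarrow> real) \<Rightarrow> ('m \<Rightarrow> ('m, 'e) chart) \<Rightarrow> 'm set \<Rightarrow> 'm set \<Rightarrow>
     ('m \<Rightarrow> ereal) set" where
  "psh_measure_class A J g \<kappa> K \<Omega> = {u. plurisuperharmonic_on A J \<Omega> u \<and> (\<forall>p\<in>\<Omega>. u p \<ge> 0) \<and>
     (\<forall>q\<in>K. lower_boundary_extension A g \<kappa> \<Omega> u q \<ge> 1)}"

definition omega_pre ::
  "('m::topological_space, 'e::euclidean_space) chart set \<Rightarrow>
     ('m \<Rightarrow> ('m, 'e) tvec \<Rightarrow> ('m, 'e) tvec) \<Rightarrow>
     ('m \<Rightarrow> ('m, 'e) tvec \<Rightarrow> ('m, 'e) tvec \<Rightarrow> real) \<Rightarrow> ('m \<Rightarrow> ('m, 'e) chart) \<Rightarrow>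
     'm \<Rightarrow> 'm set \<Rightarrow> 'm set \<Rightarrow> ereal" where
  "omega_pre A J g \<kappa> q K \<Omega> = (INF u\<in>psh_measure_class A J g \<kappa> K \<Omega>. u q)"

text \<open>
  The limit inferior is the lower semicontinuous regularisation, hence taken over full
  (not punctured) neighbourhoods.
\<close>

definition plurisuperharmonic_measure ::
  "('m::topological_space, 'e::euclidean_space) chart set \<Rightarrow>
     ('m \<Rightarrow> ('m, 'e) tvec \<Rightarrow> ('m, 'e) tvec) \<Rightarrow>
     ('m \<Rightarrow> ('m, 'e) tvec \<Rightarrow> ('m, 'e) tvec \<Rightarrow> real) \<Rightarrow> ('m \<Rightarrow> ('m, 'e) chart) \<Rightarrow>
     'm \<Rightarrow> 'm set \<Rightarrow> 'm set \<Rightarrow> ereal" where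
  "plurisuperharmonic_measure A J g \<kappa> p K \<Omega> = Liminf (nhds p) (\<lambda>q. omega_pre A J g \<kappa> q K \<Omega>)"

end

theory Submission
  imports Defs
begin

text \<open>
  A set with interior in \<open>E\<close> contains \<open>E \<inter> B\<close> for an open set \<open>B\<close> meeting \<open>E\<close>. The theorem follows from the
  existence of a non-empty open set \<open>V\<close> of points \<open>p\<close> that are centres of \<open>J\<close>-complex discs \<open>\<Phi>\<close> in
  \<open>\<Omega>\<close> which are attached to \<open>E \<inter> B\<close> along the lower half of the unit circle: at every point of this
  arc the radius is mapped to a curve that ends in \<open>E \<inter> B\<close> and stays in some approach region of its end point
  (\<open>attached_J_discs\<close>). For \<open>u\<close> in the class that defines the measure, \<open>u \<circ> \<Phi>\<close> is superharmonic and
  non-negative, and its radial lower limits are at least \<open>1\<close> on half of the circle. The mean value inequality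
  on circles of radius tending to \<open>1\<close> and Fatou's lemma give \<open>u p \<ge> 1/2\<close>
  (\<open>superharmonic_center_bound\<close>). This bound is uniform in \<open>u\<close> and in \<open>p \<in> V\<close>, so it survives the infimum and the
  lower semicontinuous regularisation.

  The discs are built in a chart in which \<open>E\<close> is a linear subspace \<open>S\<close>. Genericity gives a basis of the form
  \<open>X \<union> J(p0) X\<close> with \<open>X \<subseteq> S\<close>. Hence there are coordinates in which \<open>J(p0)\<close> is orthogonal and a conjugation \<open>\<tau>\<close>
  whose fixed vectors lie in \<open>S\<close> (\<open>complex_frame\<close>). After rescaling around \<open>p0\<close>, a map \<open>F(x + i y)\<close> is
  \<open>J\<close>-complex if \<open>F\<^sub>y = J F\<^sub>x + G(F) F\<^sub>x\<close>, where \<open>J\<close> is now constant and \<open>G\<close> is as small as desired. For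
  \<open>G = 0\<close> the maps \<open>a + sin(z) b\<close> with \<open>\<tau> a = a\<close>, \<open>\<tau> b = b\<close> are solutions which are fixed by \<open>\<tau>\<close> on the real axis.
  They are periodic, and if \<open>J b\<close> points into \<open>\<Omega>\<close> they enter \<open>\<Omega>\<close> transversally near \<open>z = 0\<close>, since the real part of
  \<open>cos z\<close> is positive there. The theorem \<open>strip_solution\<close> perturbs them: for small \<open>G\<close> there is
  a \<open>2 pi\<close>-periodic solution in the strip \<open>0 \<le> y \<le> 1\<close> which is fixed by \<open>\<tau>\<close> on the real axis, takes a prescribed value \<open>v\<close>
  at \<open>i t0\<close> and stays \<open>C\<^sup>1\<close>-close to the unperturbed one. As \<open>v\<close> is arbitrary in a ball, the values at \<open>i t0\<close> fill an
  open set.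

  The equation in the strip is solved by Fourier series in \<open>x\<close>. With right-hand side \<open>\<gamma>\<close>, the \<open>k\<close>-th coefficient
  satisfies \<open>F\<^sub>k' = - k F\<^sub>k + \<gamma>\<^sub>k\<close>. For \<open>k < 0\<close> one prescribes \<open>F\<^sub>k(1) = 0\<close>, for \<open>k > 0\<close> the reality condition on the real
  axis prescribes \<open>F\<^sub>k(0) = \<tau>(F\<^bsub>-k\<^esub>(0))\<close>; in both cases the equation is solved in its stable direction and an
  energy estimate gains one derivative (\<open>mode_sup\<close>), which makes up for the derivative in \<open>G(F) F\<^sub>x\<close>.
  The iteration \<open>\<gamma> \<mapsto> G(F) F\<^sub>x\<close> therefore preserves a ball in a norm that controls two derivatives of \<open>\<gamma>\<close>
  (\<open>sobolev4_rhs_coef\<close>) and is contracting in a norm that controls one (\<open>sobolev2_rhs_coef_diff\<close>). The \<open>n\<close>-th iterate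
  is truncated to the frequencies \<open>\<bar>k\<bar> \<le> n\<close>, so that only finite sums occur before the passage to the limit; the
  truncation errors are controlled by the stronger norm.

  Finally, a conformal map of the disc onto the upper half disc (\<open>half_disc_map\<close>) turns the solution in the strip into a
  disc attached along an arc, and the linear rate at which a defining function decreases along the disc away from \<open>E\<close> makes the
  approach non-tangential (\<open>nontangential_approach\<close>).
\<close>

section \<open>Fourier coefficients of vector-valued functions\<close>

text \<open>
  A complex structure \<open>J\<close> with a conjugation \<open>\<tau>\<close>, both isometric. The vectors fixed by \<open>\<tau>\<close> form a totally real
  subspace of maximal dimension; discs will be attached to it.
\<close>

locale real_structure =
  fixes J \<tau> :: "'v::euclidean_space \<Rightarrow> 'v"
  assumes linear_J: "linear J" and J_J [simp]: "J (J v) = - v" and norm_J [simp]: "norm (J v) = norm v"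
    and linear_\<tau>: "linear \<tau>" and \<tau>_\<tau> [simp]: "\<tau> (\<tau> v) = v" and norm_\<tau> [simp]: "norm (\<tau> v) = norm v"
    and \<tau>_J: "\<tau> (J v) = - J (\<tau> v)"
begin

definition cm :: "complex \<Rightarrow> 'v \<Rightarrow> 'v" where
  "cm z v = Re z *\<^sub>R v + Im z *\<^sub>R J v"

lemma J_add: "J (u + v) = J u + J v" and J_scale: "J (r *\<^sub>R v) = r *\<^sub>R J v"
  and J_minus: "J (- v) = - J v" and J_diff: "J (u - v) = J u - J v" and J_0 [simp]: "J 0 = 0"
  using linear_J by (simp_all add: linear_add linear_scale linear_neg linear_diff linear_0)

lemma \<tau>_add: "\<tau> (u + v) = \<tau> u + \<tau> v" and \<tau>_scale: "\<tau> (r *\<^sub>R v) = r *\<^sub>R \<tau> v"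
  and \<tau>_minus: "\<tau> (- v) = - \<tau> v" and \<tau>_diff: "\<tau> (u - v) = \<tau> u - \<tau> v" and \<tau>_0 [simp]: "\<tau> 0 = 0"
  using linear_\<tau> by (simp_all add: linear_add linear_scale linear_neg linear_diff linear_0)

lemma inner_J_J: "inner (J u) (J v) = inner u v"
proof -
  have *: "inner (J w) (J w) = inner w w" for w
    using norm_J[of w] by (simp only: norm_eq_sqrt_inner real_sqrt_eq_iff)
  show ?thesis
    using *[of "u + v"] *[of u] *[of v] by (simp add: J_add inner_add inner_commute)
qed

lemma inner_J_left: "inner (J u) v = - inner u (J v)"
  using inner_J_J[of u "J v"] by simp

lemma inner_J_self [simp]: "inner v (J v) = 0" "inner (J v) v = 0"
  using inner_J_left[of v v] by (simp_all add: inner_commute)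

text \<open>
  \<open>v\<close> and \<open>J v\<close> are orthogonal and of equal length, so complex scalars act as conformal maps.
\<close>

lemma norm_cm: "norm (cm z v) = norm z * norm v"
proof -
  have "(norm (cm z v))\<^sup>2 = (Re z)\<^sup>2 * (norm v)\<^sup>2 + (Im z)\<^sup>2 * (norm v)\<^sup>2"
    by (simp add: cm_def power2_norm_eq_inner inner_add inner_J_J)
       (simp add: power2_eq_square algebra_simps)
  also have "\<dots> = (norm z * norm v)\<^sup>2"
    by (simp add: cmod_power2 power_mult_distrib algebra_simps)
  finally show ?thesis by (simp add: power2_eq_iff_nonneg)
qed

lemma bounded_bilinear_cm: "bounded_bilinear cm"
  by (rule bounded_bilinear.intro)
     (auto simp: cm_def algebra_simps J_add J_scale norm_cm[unfolded cm_def] intro!: exI[of _ 1])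

sublocale cm: bounded_bilinear cm by (rule bounded_bilinear_cm)

lemma cm_cm: "cm z (cm w v) = cm (z * w) v"
  by (simp add: cm_def J_add J_scale algebra_simps)

lemma J_cm: "J (cm z v) = cm (\<i> * z) v"
  by (simp add: cm_def J_add J_scale)

lemma \<tau>_cm: "\<tau> (cm z v) = cm (cnj z) (\<tau> v)"
  by (simp add: cm_def \<tau>_add \<tau>_scale \<tau>_J)

lemma inner_cm_left: "inner (cm z u) v = inner u (cm (cnj z) v)"
  by (simp add: cm_def inner_add inner_diff inner_J_left)

lemma bounded_linear_J: "bounded_linear J" and bounded_linear_\<tau>: "bounded_linear \<tau>"
  using linear_J linear_\<tau> linear_conv_bounded_linear by blast+

abbreviation ek :: "int \<Rightarrow> real \<Rightarrow> complex" where "ek k x \<equiv> cis (of_int k * x)"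

lemma ek_periodic: "ek k (x + 2 * pi) = ek k x"
proof -
  have "of_int k * (x + 2 * pi) = of_int k * x + of_int k * (2*pi)" by (simp add: algebra_simps)
  moreover have "cis (of_int k * (2*pi)) = 1"
    by (metis cis_multiple_2pi Ints_of_int mult.commute)
  ultimately show ?thesis by (simp add: cis_mult[symmetric])
qed

lemma ek_mult: "ek k x * ek l x = ek (k + l) x"
  by (simp add: cis_mult algebra_simps)

lemma ek_has_vector_derivative:
  "((\<lambda>x. ek k x) has_vector_derivative (\<i> * of_int k * ek k x)) (at x within S)"
proof -
  have "((\<lambda>x. exp (\<i> * of_int k * of_real x)) has_vector_derivative
      (\<i> * of_int k * exp (\<i> * of_int k * of_real x))) (at x within S)"
    by (rule has_vector_derivative_real_field) (auto intro!: derivative_eq_intros)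
  then show ?thesis by (simp add: cis_conv_exp algebra_simps)
qed

lemma integral_ek: "((\<lambda>x. ek k x) has_integral (if k = 0 then of_real (2 * pi) else 0)) {-pi..pi}"
proof (cases "k = 0")
  case True
  have "((\<lambda>x::real. 1::complex) has_integral (pi - (-pi)) *\<^sub>R 1) {-pi..pi}"
    using has_integral_const_real[of "1::complex" "-pi" pi] by simp
  then show ?thesis using True by (simp add: scaleR_conv_of_real)
next
  case False
  have "((\<lambda>x. ek k x / (\<i> * of_int k)) has_vector_derivative ek k x) (at x within S)" for x S
    using has_vector_derivative_divide[OF ek_has_vector_derivative[of k x S], of "\<i> * of_int k"] False
    by simp
  then have "((\<lambda>x. ek k x) has_integral ek k pi / (\<i> * of_int k) - ek k (-pi) / (\<i> * of_int k)) {-pi..pi}"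
    by (intro fundamental_theorem_of_calculus) auto
  moreover have "ek k pi = ek k (-pi)" using ek_periodic[of k "-pi"] by simp
  ultimately show ?thesis using False by simp
qed

lemma integral_cm_ek: "integral {-pi..pi} (\<lambda>x. cm (ek k x) v) = (if k = 0 then (2 * pi) *\<^sub>R v else 0)"
  using has_integral_linear[OF integral_ek cm.bounded_linear_left[of v], of k]
  by (auto simp: o_def integral_unique cm_def split: if_splits)

lemma continuous_on_ek [continuous_intros]:
  "continuous_on S f \<Longrightarrow> continuous_on S (\<lambda>x. ek k (f x))"
  by (intro continuous_on_cis continuous_intros)

lemma continuous_on_cm [continuous_intros]:
  "continuous_on S f \<Longrightarrow> continuous_on S g \<Longrightarrow> continuous_on S (\<lambda>x. cm (f x) (g x))"
  by (rule cm.continuous_on)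

definition coef :: "(real \<Rightarrow> 'v) \<Rightarrow> int \<Rightarrow> 'v" where
  "coef h k = (1 / (2 * pi)) *\<^sub>R integral {-pi..pi} (\<lambda>x. cm (ek (- k) x) (h x))"

lemma coef_diff:
  assumes "continuous_on {-pi..pi} h" "continuous_on {-pi..pi} h'"
  shows "coef (\<lambda>x. h x - h' x) k = coef h k - coef h' k"
proof -
  have "integral {-pi..pi} (\<lambda>x. cm (ek (- k) x) (h x - h' x))
     = integral {-pi..pi} (\<lambda>x. cm (ek (- k) x) (h x)) - integral {-pi..pi} (\<lambda>x. cm (ek (- k) x) (h' x))"
    unfolding cm.diff_right
    by (intro integral_diff integrable_continuous_interval continuous_intros assms)
  then show ?thesis by (simp only: coef_def scaleR_diff_right)
qed

lemma coef_sum_ek: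
  assumes "finite I"
  shows "coef (\<lambda>x. \<Sum>k\<in>I. cm (ek k x) (c k)) l = (if l \<in> I then c l else 0)"
proof -
  have "integral {-pi..pi} (\<lambda>x. cm (ek (- l) x) (\<Sum>k\<in>I. cm (ek k x) (c k)))
     = integral {-pi..pi} (\<lambda>x. \<Sum>k\<in>I. cm (ek (k - l) x) (c k))"
    unfolding cm.sum_right cm_cm ek_mult by simp
  also have "\<dots> = (\<Sum>k\<in>I. integral {-pi..pi} (\<lambda>x. cm (ek (k - l) x) (c k)))"
    by (intro integral_sum assms integrable_continuous_interval continuous_intros)
  also have "\<dots> = (\<Sum>k\<in>I. if k = l then (2*pi) *\<^sub>R c l else 0)"
    unfolding integral_cm_ek by (intro sum.cong) auto
  also have "\<dots> = (if l \<in> I then (2*pi) *\<^sub>R c l else 0)" using assms by simp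
  finally show ?thesis by (simp add: coef_def)
qed

lemma integral_inner_trig:
  assumes "finite I" "continuous_on {-pi..pi} h"
  shows "integral {-pi..pi} (\<lambda>x. inner (h x) (\<Sum>k\<in>I. cm (ek k x) (c k)))
    = 2 * pi * (\<Sum>k\<in>I. inner (coef h k) (c k))"
proof -
  have *: "inner (h x) (\<Sum>k\<in>I. cm (ek k x) (c k)) = (\<Sum>k\<in>I. inner (cm (ek (-k) x) (h x)) (c k))" for x
    by (simp add: inner_sum_right inner_cm_left cis_cnj)
  have "integral {-pi..pi} (\<lambda>x. \<Sum>k\<in>I. inner (cm (ek (-k) x) (h x)) (c k))
     = (\<Sum>k\<in>I. integral {-pi..pi} (\<lambda>x. inner (cm (ek (-k) x) (h x)) (c k)))"
    by (intro integral_sum assms integrable_continuous_interval continuous_intros)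
  also have "\<dots> = (\<Sum>k\<in>I. inner (integral {-pi..pi} (\<lambda>x. cm (ek (-k) x) (h x))) (c k))"
    by (intro sum.cong refl integral_linear[OF _ bounded_linear_inner_left, unfolded o_def]
        integrable_continuous_interval continuous_intros assms)
  also have "\<dots> = 2 * pi * (\<Sum>k\<in>I. inner (coef h k) (c k))"
    by (simp add: coef_def sum_distrib_left)
  finally show ?thesis unfolding * .
qed

lemma parseval:
  assumes "finite I"
  shows "integral {-pi..pi} (\<lambda>x. (norm (\<Sum>k\<in>I. cm (ek k x) (c k)))\<^sup>2) = 2 * pi * (\<Sum>k\<in>I. (norm (c k))\<^sup>2)"
proof -
  have c: "continuous_on {-pi..pi} (\<lambda>x. \<Sum>k\<in>I. cm (ek k x) (c k))"
    by (intro continuous_intros)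
  show ?thesis
    using integral_inner_trig[OF assms c, of c] coef_sum_ek[OF assms, of c]
    by (simp add: power2_norm_eq_inner cong: sum.cong)
qed

text \<open>
  Expand the square of the distance from \<open>h\<close> to its partial Fourier sum.
\<close>

lemma bessel:
  assumes I: "finite I" and h: "continuous_on {-pi..pi} h"
  shows "(\<Sum>k\<in>I. (norm (coef h k))\<^sup>2) \<le> (1 / (2 * pi)) * integral {-pi..pi} (\<lambda>x. (norm (h x))\<^sup>2)"
proof -
  define p where "p x = (\<Sum>k\<in>I. cm (ek k x) (coef h k))" for x
  have p: "continuous_on {-pi..pi} p" unfolding p_def by (intro continuous_intros)
  have "0 \<le> integral {-pi..pi} (\<lambda>x. (norm (h x - p x))\<^sup>2)"
    by (intro integral_nonneg integrable_continuous_interval continuous_intros h p) auto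
  also have "(\<lambda>x. (norm (h x - p x))\<^sup>2) = (\<lambda>x. (norm (h x))\<^sup>2 - 2 * inner (h x) (p x) + (norm (p x))\<^sup>2)"
    by (auto simp: power2_norm_eq_inner algebra_simps inner_commute)
  also have "integral {-pi..pi} \<dots> = integral {-pi..pi} (\<lambda>x. (norm (h x))\<^sup>2)
      - 2 * integral {-pi..pi} (\<lambda>x. inner (h x) (p x)) + integral {-pi..pi} (\<lambda>x. (norm (p x))\<^sup>2)"
    by (subst integral_add integral_diff integral_mult_right;
        (intro integrable_continuous_interval continuous_intros h p)?)+ simp
  also have "integral {-pi..pi} (\<lambda>x. inner (h x) (p x)) = 2 * pi * (\<Sum>k\<in>I. (norm (coef h k))\<^sup>2)"
    unfolding p_def integral_inner_trig[OF I h] by (simp add: power2_norm_eq_inner)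
  also have "integral {-pi..pi} (\<lambda>x. (norm (p x))\<^sup>2) = 2 * pi * (\<Sum>k\<in>I. (norm (coef h k))\<^sup>2)"
    unfolding p_def by (rule parseval[OF I])
  finally show ?thesis by (simp add: field_simps)
qed

text \<open>
  Integration by parts; the boundary terms cancel by periodicity.
\<close>

lemma coef_deriv:
  assumes h: "\<And>x. x \<in> {-pi..pi} \<Longrightarrow> (h has_vector_derivative h' x) (at x within {-pi..pi})"
    and h': "continuous_on {-pi..pi} h'" and per: "h (-pi) = h pi"
  shows "coef h' k = cm (\<i> * of_int k) (coef h k)"
proof -
  have hc: "continuous_on {-pi..pi} h"
    using h by (meson continuous_on_eq_continuous_within has_vector_derivative_continuous)
  let ?d = "\<lambda>x. cm (ek (-k) x) (h' x) + cm (\<i> * of_int (-k) * ek (-k) x) (h x)"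
  have "(?d has_integral cm (ek (-k) pi) (h pi) - cm (ek (-k) (-pi)) (h (-pi))) {-pi..pi}"
  proof (rule fundamental_theorem_of_calculus)
    fix x assume "x \<in> {-pi..pi}"
    show "((\<lambda>x. cm (ek (-k) x) (h x)) has_vector_derivative ?d x) (at x within {-pi..pi})"
      using cm.has_vector_derivative[OF ek_has_vector_derivative h[OF \<open>x \<in> _\<close>], of "-k"] by simp
  qed simp
  moreover have "ek (-k) pi = ek (-k) (-pi)" using ek_periodic[of "-k" "-pi"] by simp
  ultimately have "integral {-pi..pi} ?d = 0" by (simp add: per integral_unique)
  moreover have "integral {-pi..pi} ?d = integral {-pi..pi} (\<lambda>x. cm (ek (-k) x) (h' x))
      + integral {-pi..pi} (\<lambda>x. cm (\<i> * of_int (-k) * ek (-k) x) (h x))"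
    by (intro integral_add integrable_continuous_interval continuous_intros h' hc)
  moreover have "integral {-pi..pi} (\<lambda>x. cm (\<i> * of_int (-k) * ek (-k) x) (h x))
      = cm (\<i> * of_int (-k)) (integral {-pi..pi} (\<lambda>x. cm (ek (-k) x) (h x)))"
    unfolding cm_cm[symmetric, of "\<i> * of_int (-k)"]
    by (intro integral_linear[OF _ cm.bounded_linear_right, unfolded o_def]
        integrable_continuous_interval continuous_intros hc)
  ultimately have "integral {-pi..pi} (\<lambda>x. cm (ek (-k) x) (h' x))
     = cm (\<i> * of_int k) (integral {-pi..pi} (\<lambda>x. cm (ek (-k) x) (h x)))"
    by (simp add: cm.minus_left)
  then show ?thesis by (simp add: coef_def cm.scaleR_right)
qed

end

text \<open>
  Multiplication by \<open>cis x\<close> or its conjugate shifts the index of the Fourier coefficients, so multiplication by \<open>cos x\<close> or \<open>sin x\<close>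
  preserves the property that all of them vanish. Hence \<open>h\<close> is orthogonal to every polynomial in \<open>cos x\<close> and \<open>sin x\<close>. A periodic function is a continuous
  function on the unit circle, where the Stone-Weierstrass theorem approximates \<open>h\<close> itself by such polynomials; so
  \<open>h\<close> is orthogonal to itself.
\<close>

lemma trig_complete_complex:
  fixes h :: "real \<Rightarrow> complex"
  assumes hU: "continuous_on UNIV h" and per: "\<And>x. h (x + 2 * pi) = h x"
    and z: "\<And>k::int. integral {-pi..pi} (\<lambda>x. h x * cis (of_int k * x)) = 0"
    and x: "x \<in> {-pi..pi}"
  shows "h x = 0"
proof -
  have h: "continuous_on {-pi..pi} h" using hU continuous_on_subset by blast
  \<comment> \<open>\<open>M t\<close>: multiplication by \<open>t\<close> preserves the vanishing of all Fourier coefficients. Such \<open>t\<close> form an algebra.\<close>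
  define M where "M t \<longleftrightarrow> continuous_on UNIV t \<and> (\<forall>h. continuous_on {-pi..pi} h \<longrightarrow>
     (\<forall>k::int. integral {-pi..pi} (\<lambda>x. h x * cis (of_int k * x)) = 0) \<longrightarrow>
     (\<forall>k::int. integral {-pi..pi} (\<lambda>x. h x * of_real (t x) * cis (of_int k * x)) = 0))"
    for t :: "real \<Rightarrow> real"
  have Mc: "M (\<lambda>x. c)" for c
  proof -
    have "integral {-pi..pi} (\<lambda>x. h x * of_real c * cis (of_int k * x)) = of_real c * integral {-pi..pi} (\<lambda>x. h x * cis (of_int k * x))"
      for h :: "real \<Rightarrow> complex" and k :: int
      by (subst integral_mult_right[symmetric]) (simp add: mult_ac)
    then show ?thesis by (simp add: M_def)
  qed
  have Madd: "M (\<lambda>x. s x + t x)" if s: "M s" and t: "M t" for s t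
    unfolding M_def
  proof (intro conjI allI impI)
    show "continuous_on UNIV (\<lambda>x. s x + t x)" using s t by (auto simp: M_def intro!: continuous_intros)
    fix h :: "real \<Rightarrow> complex" and k :: int
    assume h: "continuous_on {-pi..pi} h" and z: "\<forall>k::int. integral {-pi..pi} (\<lambda>x. h x * cis (of_int k * x)) = 0"
    have c: "continuous_on {-pi..pi} s" "continuous_on {-pi..pi} t"
      using s t by (auto simp: M_def intro: continuous_on_subset)
    have "integral {-pi..pi} (\<lambda>x. h x * of_real (s x + t x) * cis (of_int k * x))
       = integral {-pi..pi} (\<lambda>x. h x * of_real (s x) * cis (of_int k * x) + h x * of_real (t x) * cis (of_int k * x))"
      by (simp add: algebra_simps)
    also have "\<dots> = integral {-pi..pi} (\<lambda>x. h x * of_real (s x) * cis (of_int k * x)) + integral {-pi..pi} (\<lambda>x. h x * of_real (t x) * cis (of_int k * x))"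
      by (intro integral_add integrable_continuous_interval continuous_intros continuous_on_cis c h)
    finally show "integral {-pi..pi} (\<lambda>x. h x * of_real (s x + t x) * cis (of_int k * x)) = 0"
      using s t h z by (simp add: M_def)
  qed
  have Mmul: "M (\<lambda>x. s x * t x)" if s: "M s" and t: "M t" for s t
    unfolding M_def
  proof (intro conjI allI impI)
    show "continuous_on UNIV (\<lambda>x. s x * t x)" using s t by (auto simp: M_def intro!: continuous_intros)
    fix h :: "real \<Rightarrow> complex" and k :: int
    assume h: "continuous_on {-pi..pi} h" and z: "\<forall>k::int. integral {-pi..pi} (\<lambda>x. h x * cis (of_int k * x)) = 0"
    have c: "continuous_on {-pi..pi} s"
      using s by (auto simp: M_def intro: continuous_on_subset)
    have "continuous_on {-pi..pi} (\<lambda>x. h x * of_real (s x))" by (intro continuous_intros h c)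
    moreover have "\<forall>k::int. integral {-pi..pi} (\<lambda>x. h x * of_real (s x) * cis (of_int k * x)) = 0"
      using s h z by (auto simp: M_def)
    ultimately show "integral {-pi..pi} (\<lambda>x. h x * of_real (s x * t x) * cis (of_int k * x)) = 0"
      using t by (auto simp: M_def mult.assoc)
  qed
  have Mshift: "integral {-pi..pi} (\<lambda>x. h x * of_real (Re (cis x)) * cis (of_int k * x)) = 0
       \<and> integral {-pi..pi} (\<lambda>x. h x * of_real (Im (cis x)) * cis (of_int k * x)) = 0"
    if h: "continuous_on {-pi..pi} h" and z: "\<forall>k::int. integral {-pi..pi} (\<lambda>x. h x * cis (of_int k * x)) = 0"
    for h :: "real \<Rightarrow> complex" and k :: int
  proof -
    have i: "(\<lambda>x. h x * cis (of_int m * x)) integrable_on {-pi..pi}" for m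
      by (intro integrable_continuous_interval continuous_intros continuous_on_cis h)
    have 1: "cis (of_int (k+1) * x) = cis x * cis (of_int k * x)" "cis (of_int (k-1) * x) = cnj (cis x) * cis (of_int k * x)" for x
      by (simp_all add: cis_mult cis_cnj algebra_simps)
    have re: "a * complex_of_real (Re w) * c = (1/2) * (a * (w * c) + a * (cnj w * c))"
      and im: "a * complex_of_real (Im w) * c = (1/(2 * \<i>)) * (a * (w * c) - a * (cnj w * c))" for a w c
    proof -
      have "complex_of_real (Re w) = (w + cnj w) / 2" "complex_of_real (Im w) = (w - cnj w) / (2 * \<i>)"
        by (simp_all add: complex_eq_iff Re_divide Im_divide)
      then show "a * complex_of_real (Re w) * c = (1/2) * (a * (w * c) + a * (cnj w * c))"
        "a * complex_of_real (Im w) * c = (1/(2 * \<i>)) * (a * (w * c) - a * (cnj w * c))"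
        by (simp_all only: add_divide_distrib diff_divide_distrib) (simp_all add: algebra_simps)
    qed
    have A: "integral {-pi..pi} (\<lambda>x. h x * of_real (Re (cis x)) * cis (of_int k * x)) = 0"
      unfolding re 1[symmetric] integral_mult_right integral_add[OF i i] using z by (simp only: z) simp
    have B: "integral {-pi..pi} (\<lambda>x. h x * of_real (Im (cis x)) * cis (of_int k * x)) = 0"
      unfolding im 1[symmetric] integral_mult_right integral_diff[OF i i] using z by (simp only: z) simp
    show ?thesis using A B by simp
  qed
  have Mpoly: "M (\<lambda>x. p (cis x))" if "real_polynomial_function p" for p
    using that
  proof (induction p rule: real_polynomial_function.induct)
    case (linear f)
    then interpret bounded_linear f .
    have "f (cis x) = f 1 * Re (cis x) + f \<i> * Im (cis x)" for x
    proof -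
      have "cis x = Re (cis x) *\<^sub>R 1 + Im (cis x) *\<^sub>R \<i>" by (simp add: complex_eq_iff)
      then have "f (cis x) = f (Re (cis x) *\<^sub>R 1 + Im (cis x) *\<^sub>R \<i>)" by simp
      then show ?thesis by (simp only: add scaleR) simp
    qed
    moreover have "M (\<lambda>x. Re (cis x))" "M (\<lambda>x. Im (cis x))"
      unfolding M_def using Mshift by (auto intro!: continuous_intros simp del: cis.sel)
    ultimately have e: "(\<lambda>x. f (cis x)) = (\<lambda>x. f 1 * Re (cis x) + f \<i> * Im (cis x))"
      and m: "M (\<lambda>x. Re (cis x))" "M (\<lambda>x. Im (cis x))" by auto
    show ?case unfolding e by (rule Madd; rule Mmul; (rule Mc m))
  next
    case (const c)
    show ?case by (rule Mc)
  next
    case (add f g)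
    show ?case by (rule Madd) (fact add)+
  next
    case (mult f g)
    show ?case by (rule Mmul) (fact mult)+
  qed
  \<comment> \<open>The function on the circle that corresponds to \<open>h\<close>. Its continuity at \<open>-1\<close>, where \<open>Arg\<close> jumps, needs the other branch \<open>Arg2pi\<close>.\<close>
  define H where "H z = h (Arg z)" for z
  have cis_eq: "h s = h t" if "cis s = cis t" "s \<in> {-pi<..pi}" "t \<in> {0..<2*pi}" for s t
  proof -
    have "t = s \<or> t = s + 2 * pi"
    proof (cases "t \<le> pi")
      case True
      then have "Arg (cis t) = t" "Arg (cis s) = s" using that pi_gt_zero by (intro Arg_cis; simp del: that(1))+
      then show ?thesis using that by simp
    next
      case False
      have "cis (t - 2 * pi) = cis t" by (simp add: cis_divide[symmetric])
      moreover have "Arg (cis (t - 2 * pi)) = t - 2 * pi" using that False by (intro Arg_cis) auto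
      moreover have "Arg (cis s) = s" using that by (intro Arg_cis) auto
      ultimately show ?thesis using that by simp
    qed
    then show ?thesis using per by auto
  qed
  have H2: "H z = h (Arg2pi z)" if "z \<noteq> 0" for z
    unfolding H_def
  proof (rule cis_eq)
    have "of_real (norm z) * cis (Arg2pi z) = z" using Arg2pi_eq[of z] by (simp add: cis_conv_exp)
    moreover have "of_real (norm z) * cis (Arg z) = z" using that by (metis rcis_cmod_Arg rcis_def)
    ultimately show "cis (Arg z) = cis (Arg2pi z)" using that
      by (metis mult_left_cancel norm_eq_zero of_real_eq_0_iff)
  qed (use Arg_bounded[of z] Arg2pi_ge_0 Arg2pi_lt_2pi in auto)
  have Hcont: "continuous_on (sphere 0 1) H"
  proof (rule continuous_at_imp_continuous_on, rule ballI)
    fix z :: complex assume z: "z \<in> sphere 0 1"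
    have hc: "isCont h t" for t using hU by (simp add: continuous_on_eq_continuous_at)
    show "isCont H z"
    proof (cases "z \<in> \<real>\<^sub>\<le>\<^sub>0")
      case False
      then show ?thesis unfolding H_def by (intro isCont_o2[OF continuous_at_Arg hc])
    next
      case True
      then have z0: "z \<notin> \<real>\<^sub>\<ge>\<^sub>0" "z \<noteq> 0" using z by (auto simp: complex_nonpos_Reals_iff complex_nonneg_Reals_iff complex_eq_iff cmod_def)
      have "isCont (\<lambda>z. h (Arg2pi z)) z" by (intro isCont_o2[OF continuous_at_Arg2pi hc] z0)
      moreover have "eventually (\<lambda>w. H w = h (Arg2pi w)) (nhds z)"
        using z0 H2 by (intro eventually_nhds_in_open[of "- {0}", THEN eventually_mono]) auto
      ultimately show ?thesis using isCont_cong[of H "\<lambda>w. h (Arg2pi w)" z] by simp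
    qed
  qed
  have Hcis: "H (cis x) = h x" if "x \<in> {-pi<..pi}" for x
    unfolding H_def using Arg_cis[OF that] by simp
  have zp: "integral {-pi..pi} (\<lambda>x. of_real (p (cis x)) * h x) = 0" if "real_polynomial_function p" for p
  proof -
    have "integral {-pi..pi} (\<lambda>x. h x * of_real (p (cis x)) * cis (of_int 0 * x)) = 0"
      using Mpoly[OF that] h z unfolding M_def by blast
    then show ?thesis by (simp add: mult.commute)
  qed
  have zc: "integral {-pi..pi} (\<lambda>x. cnj (p (cis x)) * h x) = 0" if "polynomial_function p" for p :: "complex \<Rightarrow> complex"
  proof -
    have r: "real_polynomial_function (\<lambda>x. Re (p x))" "real_polynomial_function (\<lambda>x. Im (p x))"
      using that by (auto simp: polynomial_function_def o_def intro: bounded_linear_Re bounded_linear_Im)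
    have "continuous_on {-pi..pi} (\<lambda>x. p (cis x))"
      by (rule continuous_on_compose2[OF continuous_on_polymonial_function[OF that, of UNIV]])
        (auto intro!: continuous_intros)
    then have c: "continuous_on {-pi..pi} (\<lambda>x. Re (p (cis x)))" "continuous_on {-pi..pi} (\<lambda>x. Im (p (cis x)))"
      by (auto intro!: continuous_intros)
    have "cnj w * a = of_real (Re w) * a - \<i> * (of_real (Im w) * a)" for w a
      by (simp add: complex_eq_iff algebra_simps)
    then have "integral {-pi..pi} (\<lambda>x. cnj (p (cis x)) * h x) =
       integral {-pi..pi} (\<lambda>x. of_real (Re (p (cis x))) * h x - \<i> * (of_real (Im (p (cis x))) * h x))" by simp
    also have "\<dots> = integral {-pi..pi} (\<lambda>x. of_real (Re (p (cis x))) * h x) - integral {-pi..pi} (\<lambda>x. \<i> * (of_real (Im (p (cis x))) * h x))"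
      by (intro integral_diff integrable_continuous_interval continuous_intros c h)
    also have "\<dots> = 0" using zp[OF r(1)] zp[OF r(2)] by simp
    finally show ?thesis .
  qed
  have "integral {-pi..pi} (\<lambda>x. (norm (h x))\<^sup>2) \<le> e * integral {-pi..pi} (\<lambda>x. norm (h x))" if "e > 0" for e
  proof -
    obtain p where p: "polynomial_function p" "\<And>z. z \<in> sphere 0 1 \<Longrightarrow> norm (H z - p z) < e"
      using Stone_Weierstrass_polynomial_function[OF compact_sphere Hcont \<open>e > 0\<close>] by blast
    have cp: "continuous_on {-pi..pi} (\<lambda>x. p (cis x))"
      by (rule continuous_on_compose2[OF continuous_on_polymonial_function[OF p(1), of UNIV]])
        (auto intro!: continuous_intros)
    have b: "norm (h x - p (cis x)) \<le> e" if "x \<in> {-pi..pi}" for x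
    proof (cases "x = -pi")
      case True
      have "h (-pi) = h pi" using per[of "-pi"] by simp
      moreover have "cis (-pi) = cis pi" by (simp add: complex_eq_iff)
      ultimately show ?thesis using p(2)[of "cis pi"] Hcis[of pi] True by (auto simp del: cis_pi)
    next
      case False
      then show ?thesis using p(2)[of "cis x"] Hcis[of x] that by auto
    qed
    have i: "(\<lambda>x. cnj (h x) * h x) integrable_on {-pi..pi}" "(\<lambda>x. cnj (p (cis x)) * h x) integrable_on {-pi..pi}"
      by (intro integrable_continuous_interval continuous_intros cp h)+
    have "integral {-pi..pi} (\<lambda>x. (norm (h x))\<^sup>2) = norm (integral {-pi..pi} (\<lambda>x. complex_of_real ((norm (h x))\<^sup>2)))"
    proof -
      have "integral {-pi..pi} (\<lambda>x. complex_of_real ((norm (h x))\<^sup>2)) = of_real (integral {-pi..pi} (\<lambda>x. (norm (h x))\<^sup>2))"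
        by (intro integral_linear[OF _ bounded_linear_of_real, unfolded o_def]
            integrable_continuous_interval continuous_intros h)
      moreover have "integral {-pi..pi} (\<lambda>x. (norm (h x))\<^sup>2) \<ge> 0"
        by (intro integral_nonneg integrable_continuous_interval continuous_intros h) auto
      ultimately show ?thesis by simp
    qed
    also have "(\<lambda>x. complex_of_real ((norm (h x))\<^sup>2)) = (\<lambda>x. cnj (h x) * h x)"
      using complex_norm_square by (metis mult.commute)
    also have "integral {-pi..pi} \<dots> = integral {-pi..pi} (\<lambda>x. cnj (h x - p (cis x)) * h x)"
      using zc[OF p(1)] integral_diff[OF i] by (simp add: left_diff_distrib)
    also have "norm \<dots> \<le> integral {-pi..pi} (\<lambda>x. e * norm (h x))"
      using b by (intro integral_norm_bound_integral integrable_continuous_interval continuous_intros h cp)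
        (auto simp: norm_mult simp del: complex_cnj_diff intro!: mult_right_mono)
    finally show ?thesis by simp
  qed
  note est = this
  have "integral {-pi..pi} (\<lambda>x. (norm (h x))\<^sup>2) \<le> 0"
  proof (rule field_le_epsilon)
    fix d :: real assume "d > 0"
    define I where "I = integral {-pi..pi} (\<lambda>x. norm (h x))"
    have I: "I \<ge> 0" unfolding I_def by (intro integral_nonneg integrable_continuous_interval continuous_intros h) auto
    have "d / (I + 1) * I \<le> d" using I \<open>d > 0\<close> by (simp add: field_simps)
    then show "integral {-pi..pi} (\<lambda>x. (norm (h x))\<^sup>2) \<le> 0 + d"
      using est[of "d / (I + 1)"] I \<open>d > 0\<close> by (simp add: I_def)
  qed
  moreover have "integral {-pi..pi} (\<lambda>x. (norm (h x))\<^sup>2) \<ge> 0"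
    by (intro integral_nonneg integrable_continuous_interval continuous_intros h) auto
  ultimately have i0: "integral {-pi..pi} (\<lambda>x. (norm (h x))\<^sup>2) = 0" by simp
  have 0: "h x = 0" if "x \<in> {-pi..pi}" for x
  proof -
    have c: "continuous_on {-pi..pi} (\<lambda>x. (norm (h x))\<^sup>2)" by (intro continuous_intros h)
    have "(norm (h x))\<^sup>2 = 0" using integral_eq_0_iff[OF c] i0 that by simp
    then show ?thesis by simp
  qed
  show ?thesis using 0 x by blast
qed

section \<open>The Cauchy-Riemann equation in a strip, mode by mode\<close>

text \<open>
  The derivative of \<open>\<bar>F\<bar>\<^sup>2\<close> is \<open>-2 k \<bar>F\<bar>\<^sup>2 + 2 \<langle>F, \<gamma>\<rangle>\<close>. If Young's inequality spends all of the damping term, the first bound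
  results; if it spends half of it, the other half bounds the \<open>L\<^sup>2\<close>-norm of \<open>F\<close>.
\<close>

lemma mode_energy_forward:
  fixes F \<gamma> :: "real \<Rightarrow> 'v::euclidean_space"
  assumes k: "k > 0" and \<gamma>: "continuous_on {0..1} \<gamma>"
    and F: "\<And>y. y \<in> {0..1} \<Longrightarrow> (F has_vector_derivative (- k *\<^sub>R F y + \<gamma> y)) (at y within {0..1})"
  shows "y \<in> {0..1} \<Longrightarrow> (norm (F y))\<^sup>2 \<le> (norm (F 0))\<^sup>2 + integral {0..1} (\<lambda>s. (norm (\<gamma> s))\<^sup>2) / (2 * k)"
    and "k\<^sup>2 * integral {0..1} (\<lambda>s. (norm (F s))\<^sup>2) \<le> k * (norm (F 0))\<^sup>2 + integral {0..1} (\<lambda>s. (norm (\<gamma> s))\<^sup>2)"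
proof -
  have Fc: "continuous_on {0..1} F"
    using F by (meson continuous_on_eq_continuous_within has_vector_derivative_continuous)
  let ?D = "\<lambda>s. - 2 * k * (norm (F s))\<^sup>2 + 2 * inner (F s) (\<gamma> s)"
  have D: "(?D has_integral (norm (F y))\<^sup>2 - (norm (F 0))\<^sup>2) {0..y}" if y: "y \<in> {0..1}" for y
  proof (rule fundamental_theorem_of_calculus)
    fix s assume s: "s \<in> {0..y}"
    have "(F has_vector_derivative (- k *\<^sub>R F s + \<gamma> s)) (at s within {0..y})"
      using F[of s] s y by (auto intro: has_vector_derivative_within_subset[of F _ s "{0..1}"])
    from bounded_bilinear.has_vector_derivative[OF bounded_bilinear_inner this this]
    have "((\<lambda>s. (norm (F s))\<^sup>2) has_vector_derivative (inner (F s) (- k *\<^sub>R F s + \<gamma> s) + inner (- k *\<^sub>R F s + \<gamma> s) (F s))) (at s within {0..y})"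
      by (simp only: power2_norm_eq_inner)
    then show "((\<lambda>s. (norm (F s))\<^sup>2) has_vector_derivative ?D s) (at s within {0..y})"
      by (simp add: power2_norm_eq_inner inner_diff_left inner_diff_right inner_commute[of "\<gamma> s"] mult.assoc)
  qed (use y in auto)
  have i: "f integrable_on {a..b}" if "continuous_on {0..1} f" "0 \<le> a" "b \<le> 1" for f :: "real \<Rightarrow> real" and a b
    using that by (intro integrable_continuous_interval continuous_on_subset[OF that(1)]) auto
  have young: "2 * inner u v \<le> c * (norm u)\<^sup>2 + (norm v)\<^sup>2 / c" if "c > 0" for c and u v :: 'v
  proof -
    have "0 \<le> (c * norm u - norm v)\<^sup>2 / c" using that by simp
    also have "\<dots> = c * (norm u)\<^sup>2 + (norm v)\<^sup>2 / c - 2 * (norm u * norm v)"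
      using that by (simp add: field_simps power2_eq_square)
    finally show ?thesis using norm_cauchy_schwarz[of u v] by simp
  qed
  show "(norm (F y))\<^sup>2 \<le> (norm (F 0))\<^sup>2 + integral {0..1} (\<lambda>s. (norm (\<gamma> s))\<^sup>2) / (2 * k)" if y: "y \<in> {0..1}"
  proof -
    have "(norm (F y))\<^sup>2 - (norm (F 0))\<^sup>2 \<le> integral {0..y} (\<lambda>s. (norm (\<gamma> s))\<^sup>2 / (2 * k))"
    proof (rule has_integral_le[OF D[OF y]])
      show "((\<lambda>s. (norm (\<gamma> s))\<^sup>2 / (2 * k)) has_integral integral {0..y} (\<lambda>s. (norm (\<gamma> s))\<^sup>2 / (2 * k))) {0..y}"
        using y k by (intro integrable_integral i continuous_intros \<gamma>) auto
      show "?D s \<le> (norm (\<gamma> s))\<^sup>2 / (2 * k)" for s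
        using young[of "2*k" "F s" "\<gamma> s"] k by simp
    qed
    also have "\<dots> \<le> integral {0..1} (\<lambda>s. (norm (\<gamma> s))\<^sup>2 / (2 * k))"
      using y k by (intro integral_subset_le i continuous_intros \<gamma>) auto
    finally show ?thesis by simp
  qed
  have "(norm (F 1))\<^sup>2 - (norm (F 0))\<^sup>2 \<le> integral {0..1} (\<lambda>s. (norm (\<gamma> s))\<^sup>2 / k - k * (norm (F s))\<^sup>2)"
  proof (rule has_integral_le[OF D])
    show "((\<lambda>s. (norm (\<gamma> s))\<^sup>2 / k - k * (norm (F s))\<^sup>2) has_integral integral {0..1} (\<lambda>s. (norm (\<gamma> s))\<^sup>2 / k - k * (norm (F s))\<^sup>2)) {0..1}"
      using k by (intro integrable_integral i continuous_intros \<gamma> Fc) auto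
    show "?D s \<le> (norm (\<gamma> s))\<^sup>2 / k - k * (norm (F s))\<^sup>2" for s
      using young[of k "F s" "\<gamma> s"] k by simp
  qed simp
  also have "\<dots> = integral {0..1} (\<lambda>s. (norm (\<gamma> s))\<^sup>2 / k) - integral {0..1} (\<lambda>s. k * (norm (F s))\<^sup>2)"
    using k by (intro integral_diff i continuous_intros \<gamma> Fc) auto
  finally have "k * integral {0..1} (\<lambda>s. (norm (F s))\<^sup>2) \<le> (norm (F 0))\<^sup>2 + integral {0..1} (\<lambda>s. (norm (\<gamma> s))\<^sup>2) / k"
    using zero_le_power2[of "norm (F 1)"] by (simp del: zero_le_power2 zero_le_square) (use zero_le_power2[of "norm (F 1)"] in linarith)
  from mult_left_mono[OF this, of k]
  show "k\<^sup>2 * integral {0..1} (\<lambda>s. (norm (F s))\<^sup>2) \<le> k * (norm (F 0))\<^sup>2 + integral {0..1} (\<lambda>s. (norm (\<gamma> s))\<^sup>2)"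
    using k by (simp add: power2_eq_square algebra_simps)
qed

text \<open>
  This is the forward estimate after the reflection \<open>y \<mapsto> 1 - y\<close>.
\<close>

lemma mode_energy_backward:
  fixes F \<gamma> :: "real \<Rightarrow> 'v::euclidean_space"
  assumes k: "k > 0" and \<gamma>: "continuous_on {0..1} \<gamma>"
    and F: "\<And>y. y \<in> {0..1} \<Longrightarrow> (F has_vector_derivative (k *\<^sub>R F y + \<gamma> y)) (at y within {0..1})"
    and F1: "F 1 = 0"
  shows "y \<in> {0..1} \<Longrightarrow> (norm (F y))\<^sup>2 \<le> integral {0..1} (\<lambda>s. (norm (\<gamma> s))\<^sup>2) / (2 * k)"
    and "k\<^sup>2 * integral {0..1} (\<lambda>s. (norm (F s))\<^sup>2) \<le> integral {0..1} (\<lambda>s. (norm (\<gamma> s))\<^sup>2)"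
proof -
  define G where "G y = F (1 - y)" for y
  define \<delta> where "\<delta> y = - \<gamma> (1 - y)" for y
  have \<delta>: "continuous_on {0..1} \<delta>" unfolding \<delta>_def
    by (intro continuous_intros continuous_on_compose2[OF \<gamma>]) auto
  have im: "(\<lambda>y. 1 - y) ` {0..1} = {0..1::real}"
    by (force simp: image_iff intro!: bexI[of _ "1 - x" for x])
  have G: "(G has_vector_derivative (- k *\<^sub>R G y + \<delta> y)) (at y within {0..1})" if "y \<in> {0..1}" for y
  proof -
    have 1: "((\<lambda>y. 1 - y) has_vector_derivative - 1) (at y within {0..1})" for y :: real
      by (auto intro!: derivative_eq_intros)
    have 2: "(F has_vector_derivative (k *\<^sub>R F (1 - y) + \<gamma> (1 - y))) (at (1 - y) within (\<lambda>y. 1 - y) ` {0..1})"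
      unfolding im using that by (intro F) auto
    from vector_diff_chain_within[OF 1 2]
    show ?thesis by (simp add: G_def[abs_def] \<delta>_def o_def algebra_simps)
  qed
  have refl: "integral {0..1} (\<lambda>s. f (1 - s)) = integral {0..1} f" if "continuous_on {0..1} f" for f :: "real \<Rightarrow> real"
    using integral_shift_real_ivl[of "-1" "-1" 0 "\<lambda>s. f (-s)"] Henstock_Kurzweil_Integration.integral_reflect_real[of 1 0 f] by simp
  have Fc: "continuous_on {0..1} F"
    using F by (meson continuous_on_eq_continuous_within has_vector_derivative_continuous)
  have e: "integral {0..1} (\<lambda>s. (norm (\<delta> s))\<^sup>2) = integral {0..1} (\<lambda>s. (norm (\<gamma> s))\<^sup>2)"
    using refl[of "\<lambda>s. (norm (\<gamma> s))\<^sup>2"] by (simp add: \<delta>_def continuous_intros \<gamma>)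
  have e': "integral {0..1} (\<lambda>s. (norm (G s))\<^sup>2) = integral {0..1} (\<lambda>s. (norm (F s))\<^sup>2)"
    using refl[of "\<lambda>s. (norm (F s))\<^sup>2"] by (simp add: G_def continuous_intros Fc)
  have G0: "G 0 = 0" by (simp add: G_def F1)
  show "y \<in> {0..1} \<Longrightarrow> (norm (F y))\<^sup>2 \<le> integral {0..1} (\<lambda>s. (norm (\<gamma> s))\<^sup>2) / (2 * k)"
    using mode_energy_forward(1)[OF k \<delta> G, of "1 - y"] by (simp add: G0 e) (simp add: G_def)
  show "k\<^sup>2 * integral {0..1} (\<lambda>s. (norm (F s))\<^sup>2) \<le> integral {0..1} (\<lambda>s. (norm (\<gamma> s))\<^sup>2)"
    using mode_energy_forward(2)[OF k \<delta> G] by (simp add: G0 e e')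
qed

lemma integral_square_le:
  fixes \<gamma> :: "real \<Rightarrow> 'v::euclidean_space"
  assumes "continuous_on {0..1} \<gamma>" "y \<in> {0..1}"
  shows "(norm (integral {0..y} \<gamma>))\<^sup>2 \<le> integral {0..1} (\<lambda>s. (norm (\<gamma> s))\<^sup>2)"
proof -
  define m where "m = integral {0..1} (\<lambda>s. norm (\<gamma> s))"
  have i: "f integrable_on {0..1}" if "continuous_on {0..1} f" for f :: "real \<Rightarrow> real"
    using that by (intro integrable_continuous_interval)
  have c: "continuous_on {0..y} \<gamma>" using assms by (auto elim: continuous_on_subset)
  have "norm (integral {0..y} \<gamma>) \<le> integral {0..y} (\<lambda>s. norm (\<gamma> s))"
    by (intro integral_norm_bound_integral integrable_continuous_interval continuous_intros c) auto
  also have "\<dots> \<le> m" unfolding m_def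
    using assms by (intro integral_subset_le integrable_continuous_interval continuous_intros c) auto
  finally have 1: "norm (integral {0..y} \<gamma>) \<le> m" .
  have "0 \<le> integral {0..1} (\<lambda>s. (norm (\<gamma> s) - m)\<^sup>2)"
    by (intro integral_nonneg i continuous_intros assms) auto
  also have "(\<lambda>s. (norm (\<gamma> s) - m)\<^sup>2) = (\<lambda>s. (norm (\<gamma> s))\<^sup>2 - 2 * m * norm (\<gamma> s) + m\<^sup>2)"
    by (auto simp: power2_eq_square algebra_simps)
  also have "integral {0..1} \<dots> = integral {0..1} (\<lambda>s. (norm (\<gamma> s))\<^sup>2) - 2 * m * m + m\<^sup>2"
    by (subst integral_add integral_diff; (intro i continuous_intros assms)?)+ (simp add: m_def)
  finally have "m\<^sup>2 \<le> integral {0..1} (\<lambda>s. (norm (\<gamma> s))\<^sup>2)" by (simp add: power2_eq_square)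
  then show ?thesis using power_mono[OF 1, of 2] by simp
qed

context real_structure begin

text \<open>
  Duhamel's formula for \<open>F' = - k F + \<gamma>\<close>, \<open>F(0) = c\<close>.
\<close>

definition mode_solution :: "real \<Rightarrow> 'v \<Rightarrow> (real \<Rightarrow> 'v) \<Rightarrow> real \<Rightarrow> 'v" where
  "mode_solution k c \<gamma> y = exp (- (k * y)) *\<^sub>R (c + integral {0..y} (\<lambda>s. exp (k * s) *\<^sub>R \<gamma> s))"

lemma mode_solution_has_vector_derivative:
  assumes "continuous_on {0..1} \<gamma>" "y \<in> {0..1}"
  shows "(mode_solution k c \<gamma> has_vector_derivative (- k *\<^sub>R mode_solution k c \<gamma> y + \<gamma> y)) (at y within {0..1})"
proof -
  have 1: "((\<lambda>y. c + integral {0..y} (\<lambda>s. exp (k * s) *\<^sub>R \<gamma> s)) has_vector_derivative 0 + exp (k * y) *\<^sub>R \<gamma> y) (at y within {0..1})"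
    using assms by (intro has_vector_derivative_add has_vector_derivative_const integral_has_vector_derivative continuous_intros) auto
  have 2: "((\<lambda>y. exp (- (k * y))) has_real_derivative - k * exp (- (k * y))) (at y within {0..1})"
    by (auto intro!: derivative_eq_intros)
  from has_vector_derivative_scaleR[OF 2 1]
  show ?thesis by (simp add: mode_solution_def[abs_def] exp_add[symmetric] mult_exp_exp)
qed

text \<open>
  For \<open>k < 0\<close> this initial value is the one for which the solution vanishes at \<open>y = 1\<close>. The values at \<open>k\<close> and \<open>- k\<close> are
  conjugate under \<open>\<tau>\<close>, which makes the sum over all modes real for \<open>y = 0\<close>.
\<close>

definition mode_init :: "(int \<Rightarrow> real \<Rightarrow> 'v) \<Rightarrow> int \<Rightarrow> 'v" where
  "mode_init \<gamma> k = (if k < 0 then - integral {0..1} (\<lambda>s. exp (of_int k * s) *\<^sub>R \<gamma> k s)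
     else if k > 0 then \<tau> (- integral {0..1} (\<lambda>s. exp (of_int (-k) * s) *\<^sub>R \<gamma> (-k) s)) else 0)"

definition mode :: "(int \<Rightarrow> real \<Rightarrow> 'v) \<Rightarrow> int \<Rightarrow> real \<Rightarrow> 'v" where
  "mode \<gamma> k = mode_solution (of_int k) (mode_init \<gamma> k) (\<gamma> k)"

definition energy :: "(int \<Rightarrow> real \<Rightarrow> 'v) \<Rightarrow> int \<Rightarrow> real" where
  "energy \<gamma> k = integral {0..1} (\<lambda>y. (norm (\<gamma> k y))\<^sup>2)"

abbreviation continuous_modes :: "(int \<Rightarrow> real \<Rightarrow> 'v) \<Rightarrow> bool" where "continuous_modes \<gamma> \<equiv> \<forall>k. continuous_on {0..1} (\<gamma> k)"

lemma mode_has_vector_derivative: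
  "continuous_modes \<gamma> \<Longrightarrow> y \<in> {0..1} \<Longrightarrow> (mode \<gamma> k has_vector_derivative (- of_int k *\<^sub>R mode \<gamma> k y + \<gamma> k y)) (at y within {0..1})"
  unfolding mode_def by (rule mode_solution_has_vector_derivative) auto

lemma continuous_on_mode: "continuous_modes \<gamma> \<Longrightarrow> continuous_on {0..1} (mode \<gamma> k)"
  using mode_has_vector_derivative by (meson continuous_on_eq_continuous_within has_vector_derivative_continuous)

lemma energy_nonneg: "continuous_modes \<gamma> \<Longrightarrow> energy \<gamma> k \<ge> 0"
  unfolding energy_def by (intro integral_nonneg integrable_continuous_interval continuous_intros) auto

lemma mode_0: "mode \<gamma> k 0 = mode_init \<gamma> k" by (simp add: mode_def mode_solution_def)

lemma mode_init_symm: "\<tau> (mode_init \<gamma> k) = mode_init \<gamma> (- k)" by (simp add: mode_init_def)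

lemma mode_1: "k < 0 \<Longrightarrow> mode \<gamma> k 1 = 0" by (simp add: mode_def mode_solution_def mode_init_def)

text \<open>
  This is the gain of one derivative. A negative mode is estimated backwards from its zero at \<open>y = 1\<close>. A positive mode
  \<open>k\<close> is estimated forwards from \<open>y = 0\<close>, where it is as large as the mode \<open>- k\<close>; therefore both energies occur on the right.
\<close>

lemma mode_sup:
  assumes "continuous_modes \<gamma>" "y \<in> {0..1}"
  shows "max 1 \<bar>of_int k\<bar> * (norm (mode \<gamma> k y))\<^sup>2 \<le> energy \<gamma> k + energy \<gamma> (-k)"
    and "(of_int k)\<^sup>2 * integral {0..1} (\<lambda>y. (norm (mode \<gamma> k y))\<^sup>2) \<le> energy \<gamma> k + energy \<gamma> (-k)"
proof -
  have neg: "(norm (mode \<gamma> k y))\<^sup>2 \<le> energy \<gamma> k / (2 * (- of_int k))"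
    "(of_int k)\<^sup>2 * integral {0..1} (\<lambda>y. (norm (mode \<gamma> k y))\<^sup>2) \<le> energy \<gamma> k" if "k < 0" "y \<in> {0..1}" for k y
  proof -
    have k: "- real_of_int k > 0" using that by simp
    have D: "(mode \<gamma> k has_vector_derivative (- real_of_int k) *\<^sub>R mode \<gamma> k y + \<gamma> k y) (at y within {0..1})" if "y \<in> {0..1}" for y
      using mode_has_vector_derivative[OF assms(1) that] by simp
    show "(norm (mode \<gamma> k y))\<^sup>2 \<le> energy \<gamma> k / (2 * (- of_int k))"
      using mode_energy_backward(1)[OF k _ D mode_1] assms(1) that by (simp add: energy_def)
    show "(of_int k)\<^sup>2 * integral {0..1} (\<lambda>y. (norm (mode \<gamma> k y))\<^sup>2) \<le> energy \<gamma> k"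
      using mode_energy_backward(2)[OF k _ D mode_1] assms(1) that by (simp add: energy_def)
  qed
  consider "k < 0" | "k = 0" | "k > 0" by linarith
  then have "max 1 \<bar>of_int k\<bar> * (norm (mode \<gamma> k y))\<^sup>2 \<le> energy \<gamma> k + energy \<gamma> (-k) \<and>
     (of_int k)\<^sup>2 * integral {0..1} (\<lambda>y. (norm (mode \<gamma> k y))\<^sup>2) \<le> energy \<gamma> k + energy \<gamma> (-k)"
  proof cases
    case 1
    have "max 1 \<bar>real_of_int k\<bar> = - of_int k" using 1 by simp
    moreover have "- of_int k * (norm (mode \<gamma> k y))\<^sup>2 \<le> energy \<gamma> k / 2"
      using mult_left_mono[OF neg(1)[OF 1 assms(2)], of "- of_int k"] 1 by simp
    ultimately show ?thesis using neg(2)[OF 1 assms(2)] energy_nonneg[OF assms(1), of k] energy_nonneg[OF assms(1), of "-k"] by (smt (verit) field_sum_of_halves)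
  next
    case 2
    have "mode \<gamma> 0 y = integral {0..y} (\<gamma> 0)" by (simp add: mode_def mode_solution_def mode_init_def)
    then show ?thesis using 2 integral_square_le[of "\<gamma> 0" y] assms energy_nonneg[OF assms(1), of 0] by (auto simp: energy_def)
  next
    case 3
    then have k: "real_of_int k > 0" and k': "-k < 0" by simp_all
    have D: "(mode \<gamma> k has_vector_derivative - real_of_int k *\<^sub>R mode \<gamma> k y + \<gamma> k y) (at y within {0..1})" if "y \<in> {0..1}" for y
      using mode_has_vector_derivative[OF assms(1) that] by simp
    have "norm (mode \<gamma> k 0) = norm (mode \<gamma> (-k) 0)" by (metis mode_0 mode_init_symm norm_\<tau>)
    then have 0: "of_int k * (norm (mode \<gamma> k 0))\<^sup>2 \<le> energy \<gamma> (-k) / 2"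
      using mult_left_mono[OF neg(1)[OF k', of 0], of "of_int k"] k by simp
    have a: "of_int k * (norm (mode \<gamma> k y))\<^sup>2 \<le> of_int k * (norm (mode \<gamma> k 0))\<^sup>2 + energy \<gamma> k / 2"
      using mult_left_mono[OF mode_energy_forward(1)[OF k _ D assms(2)], of "of_int k"] assms(1) k
      by (simp add: energy_def algebra_simps)
    have b: "(of_int k)\<^sup>2 * integral {0..1} (\<lambda>y. (norm (mode \<gamma> k y))\<^sup>2) \<le> of_int k * (norm (mode \<gamma> k 0))\<^sup>2 + energy \<gamma> k"
      using mode_energy_forward(2)[OF k _ D] assms(1) by (simp add: energy_def)
    have "max 1 \<bar>real_of_int k\<bar> = of_int k" using 3 by simp
    then show ?thesis using 0 a b energy_nonneg[OF assms(1), of k] energy_nonneg[OF assms(1), of "-k"] by (smt (verit) field_sum_of_halves)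
  qed
  then show "max 1 \<bar>of_int k\<bar> * (norm (mode \<gamma> k y))\<^sup>2 \<le> energy \<gamma> k + energy \<gamma> (-k)"
    "(of_int k)\<^sup>2 * integral {0..1} (\<lambda>y. (norm (mode \<gamma> k y))\<^sup>2) \<le> energy \<gamma> k + energy \<gamma> (-k)" by auto
qed

end

text \<open>
  The term \<open>2 / real N\<close> makes the telescoping induction close; what matters later is the bound \<open>5\<close> for all \<open>N\<close>.
\<close>

lemma sum_inverse_square_int: "(\<Sum>k\<in>{-int N..int N}. (1 / max 1 \<bar>real_of_int k\<bar>)\<^sup>2) \<le> 5 - 2 / real N"
proof (induction N)
  case 0
  then show ?case by simp
next
  case (Suc N)
  have "{-int (Suc N)..int (Suc N)} = insert (int (Suc N)) (insert (- int (Suc N)) {-int N..int N})" by auto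
  then have *: "(\<Sum>k\<in>{-int (Suc N)..int (Suc N)}. (1 / max 1 \<bar>real_of_int k\<bar>)\<^sup>2)
     = 2 * (1 / (real N + 1))\<^sup>2 + (\<Sum>k\<in>{-int N..int N}. (1 / max 1 \<bar>real_of_int k\<bar>)\<^sup>2)"
    by (simp add: max_def)
  show ?case
  proof (cases "N = 0")
    case True
    then show ?thesis by (subst *) simp
  next
    case False
    have "2 * (1 / (real N + 1))\<^sup>2 \<le> 2 / (real N * (real N + 1))"
      using False by (simp add: power2_eq_square divide_simps)
    also have "\<dots> = 2 / real N - 2 / (real N + 1)" using False by (simp add: divide_simps)
    finally show ?thesis using Suc by (subst *) (simp add: add.commute)
  qed
qed

abbreviation Zs :: "(real \<times> real) set" where "Zs \<equiv> cbox (-pi, 0) (pi, 1)"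

lemma integral_Zs:
  fixes f :: "real \<times> real \<Rightarrow> real"
  assumes "continuous_on Zs f"
  shows "integral Zs f = integral {0..1} (\<lambda>y. integral {-pi..pi} (\<lambda>x. f (x, y)))"
proof -
  have "integral Zs f = integral (cbox (-pi) pi) (\<lambda>x. integral (cbox 0 1) (\<lambda>y. f (x, y)))"
    by (rule integral_prod_continuous[OF assms])
  also have "\<dots> = integral (cbox 0 1) (\<lambda>y. integral (cbox (-pi) pi) (\<lambda>x. f (x, y)))"
    by (rule integral_swap_continuous) (simp add: assms)
  finally show ?thesis by simp
qed

context real_structure begin

lemma continuous_modes_diff: "continuous_modes \<gamma> \<Longrightarrow> continuous_modes \<gamma>' \<Longrightarrow> continuous_modes (\<lambda>k y. \<gamma> k y - \<gamma>' k y)" by (auto intro: continuous_intros)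

lemma mode_diff:
  assumes "continuous_modes \<gamma>" "continuous_modes \<gamma>'" "y \<in> {0..1}"
  shows "mode (\<lambda>k y. \<gamma> k y - \<gamma>' k y) k y = mode \<gamma> k y - mode \<gamma>' k y"
proof -
  have i: "(\<lambda>s. exp (r * s) *\<^sub>R \<gamma> k s) integrable_on {0..b}" if "continuous_modes \<gamma>" "b \<le> 1" for r b \<gamma> k
  proof -
    have "continuous_on {0..b} (\<gamma> k)" using that by (auto intro: continuous_on_subset[of "{0..1}"])
    then show ?thesis by (intro integrable_continuous_interval continuous_intros)
  qed
  have I: "integral {0..b} (\<lambda>s. exp (r * s) *\<^sub>R (\<gamma> k s - \<gamma>' k s))
     = integral {0..b} (\<lambda>s. exp (r * s) *\<^sub>R \<gamma> k s) - integral {0..b} (\<lambda>s. exp (r * s) *\<^sub>R \<gamma>' k s)" if "b \<le> 1" for r b k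
    unfolding scaleR_diff_right by (intro integral_diff i assms that)
  have "mode_init (\<lambda>k y. \<gamma> k y - \<gamma>' k y) k = mode_init \<gamma> k - mode_init \<gamma>' k"
    unfolding mode_init_def using I[of 1 "- real_of_int k" "-k"] by (auto simp: I \<tau>_diff \<tau>_minus)
  moreover have "integral {0..y} (\<lambda>s. exp (of_int k * s) *\<^sub>R (\<gamma> k s - \<gamma>' k s))
     = integral {0..y} (\<lambda>s. exp (of_int k * s) *\<^sub>R \<gamma> k s) - integral {0..y} (\<lambda>s. exp (of_int k * s) *\<^sub>R \<gamma>' k s)"
    using assms(3) by (intro I) auto
  ultimately show ?thesis unfolding mode_def mode_solution_def by (simp only:) (simp add: algebra_simps)
qed

text \<open>
  \<open>wave m \<gamma> N\<close> is the \<open>m\<close>-th derivative with respect to \<open>x\<close> of the solution that belongs to the right-hand side with the Fourier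
  coefficients \<open>\<gamma> k\<close>, \<open>\<bar>k\<bar> \<le> N\<close>. The size of such a right-hand side is measured by \<open>sobolev p\<close>, a squared norm with frequency
  weight of order \<open>p\<close>, thus controlling \<open>p / 2\<close> derivatives in \<open>x\<close>.
\<close>

definition wave :: "nat \<Rightarrow> (int \<Rightarrow> real \<Rightarrow> 'v) \<Rightarrow> nat \<Rightarrow> real \<Rightarrow> real \<Rightarrow> 'v" where
  "wave m \<gamma> N x y = (\<Sum>k\<in>{-int N..int N}. cm ((\<i> * of_int k) ^ m * ek k x) (mode \<gamma> k y))"

definition sobolev :: "nat \<Rightarrow> (int \<Rightarrow> real \<Rightarrow> 'v) \<Rightarrow> nat \<Rightarrow> real" where
  "sobolev p \<gamma> N = (\<Sum>k\<in>{-int N..int N}. (1 + \<bar>of_int k\<bar> ^ p) * energy \<gamma> k)"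

lemma wave_has_vector_derivative_x:
  "((\<lambda>x. wave m \<gamma> N x y) has_vector_derivative wave (Suc m) \<gamma> N x y) (at x within S)"
proof -
  have "((\<lambda>x. (\<i> * of_int k) ^ m * ek k x) has_vector_derivative (\<i> * of_int k) ^ m * (\<i> * of_int k * ek k x)) (at x within S)" for k
    by (intro has_vector_derivative_mult_right ek_has_vector_derivative)
  then have "((\<lambda>x. cm ((\<i> * of_int k) ^ m * ek k x) v) has_vector_derivative cm ((\<i> * of_int k) ^ m * (\<i> * of_int k * ek k x)) v) (at x within S)" for k v
    by (rule bounded_linear.has_vector_derivative[OF cm.bounded_linear_left])
  then show ?thesis unfolding wave_def
    by (intro has_vector_derivative_sum) (simp add: mult_ac)
qed

text \<open>
  Multiplication of the mode \<open>k\<close> by \<open>- k\<close> is the composition of \<open>J\<close> with the derivative in \<open>x\<close>.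
\<close>

lemma wave_has_vector_derivative_y:
  assumes "continuous_modes \<gamma>" "y \<in> {0..1}"
  shows "((\<lambda>y. wave 0 \<gamma> N x y) has_vector_derivative J (wave 1 \<gamma> N x y) + (\<Sum>k\<in>{-int N..int N}. cm (ek k x) (\<gamma> k y))) (at y within {0..1})"
proof -
  have "((\<lambda>y. wave 0 \<gamma> N x y) has_vector_derivative (\<Sum>k\<in>{-int N..int N}. cm (ek k x) (- of_int k *\<^sub>R mode \<gamma> k y + \<gamma> k y))) (at y within {0..1})"
    unfolding wave_def using mode_has_vector_derivative[OF assms]
    by (intro has_vector_derivative_sum) (simp add: bounded_linear.has_vector_derivative[OF cm.bounded_linear_right])
  also have "(\<Sum>k\<in>{-int N..int N}. cm (ek k x) (- of_int k *\<^sub>R mode \<gamma> k y + \<gamma> k y))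
     = J (wave 1 \<gamma> N x y) + (\<Sum>k\<in>{-int N..int N}. cm (ek k x) (\<gamma> k y))"
  proof -
    have "cm (ek k x) (- of_int k *\<^sub>R mode \<gamma> k y) = J (cm ((\<i> * of_int k) ^ 1 * ek k x) (mode \<gamma> k y))" for k
      by (simp add: J_cm cm.scaleR_right cm.minus_right cm.minus_left mult.assoc[symmetric] flip: cm.scaleR_left)
         (simp add: scaleR_conv_of_real)
    then show ?thesis unfolding wave_def linear_sum[OF linear_J] sum.distrib[symmetric]
      by (simp only: cm.add_right)
  qed
  finally show ?thesis .
qed

lemma wave_periodic: "wave m \<gamma> N (x + 2 * pi) y = wave m \<gamma> N x y"
  unfolding wave_def ek_periodic ..

lemma wave_real: "\<tau> (wave 0 \<gamma> N x 0) = wave 0 \<gamma> N x 0"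
proof -
  have "\<tau> (wave 0 \<gamma> N x 0) = (\<Sum>k\<in>{-int N..int N}. cm (ek (-k) x) (mode_init \<gamma> (-k)))"
    unfolding wave_def by (simp add: linear_sum[OF linear_\<tau>] \<tau>_cm mode_0 mode_init_symm cis_cnj)
  also have "\<dots> = (\<Sum>k\<in>{-int N..int N}. cm (ek k x) (mode_init \<gamma> k))"
    by (rule sum.reindex_bij_witness[of _ uminus uminus]) auto
  finally show ?thesis by (simp add: wave_def mode_0)
qed

lemma continuous_on_wave [continuous_intros]:
  assumes "continuous_modes \<gamma>" "continuous_on S f" "continuous_on S g" "g ` S \<subseteq> {0..1}"
  shows "continuous_on S (\<lambda>p. wave m \<gamma> N (f p) (g p))"
  unfolding wave_def using assms
  by (intro continuous_intros continuous_on_compose2[OF continuous_on_mode[OF assms(1)] assms(3,4)]) auto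

lemma wave_diff:
  assumes "continuous_modes \<gamma>" "continuous_modes \<gamma>'" "y \<in> {0..1}"
  shows "wave m (\<lambda>k y. \<gamma> k y - \<gamma>' k y) N x y = wave m \<gamma> N x y - wave m \<gamma>' N x y"
  unfolding wave_def mode_diff[OF assms] by (simp add: cm.diff_right sum_subtractf)

lemma mode_zero: "\<gamma> k = (\<lambda>_. 0) \<Longrightarrow> \<gamma> (-k) = (\<lambda>_. 0) \<Longrightarrow> mode \<gamma> k y = 0"
  by (simp add: mode_def mode_solution_def mode_init_def)

lemma wave_zero: "wave m (\<lambda>k y. 0) N x y = 0" by (simp add: wave_def mode_zero cm.zero_right)

lemma wave_support:
  assumes "\<And>k. \<bar>k\<bar> > int n \<Longrightarrow> \<gamma> k = (\<lambda>_. 0)" "n \<le> N"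
  shows "wave m \<gamma> N x y = wave m \<gamma> n x y"
proof -
  have "mode \<gamma> k y = 0" if "\<bar>k\<bar> > int n" for k
    using that by (intro mode_zero assms(1)) auto
  then show ?thesis
    unfolding wave_def using assms(2)
    by (intro sum.mono_neutral_right ballI) (auto simp: cm.zero_right)
qed

lemma sobolev_mono:
  assumes "continuous_modes \<gamma>" "p \<le> q" "p > 0" shows "sobolev p \<gamma> N \<le> sobolev q \<gamma> N"
  unfolding sobolev_def
proof (intro sum_mono mult_right_mono energy_nonneg assms)
  show "1 + \<bar>real_of_int k\<bar> ^ p \<le> 1 + \<bar>of_int k\<bar> ^ q" for k
  proof (cases "k = 0")
    case False
    then have "\<bar>real_of_int k\<bar> \<ge> 1" by linarith
    then show ?thesis using assms(2) by (simp add: power_increasing)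
  qed (use assms in \<open>auto simp: power_0_left\<close>)
qed

lemma sum_symm:
  "(\<Sum>k\<in>{-int N..int N}. w \<bar>k\<bar> * (g k + g (-k))) = 2 * (\<Sum>k\<in>{-int N..int N}. w \<bar>k\<bar> * (g k :: real))"
proof -
  have "(\<Sum>k\<in>{-int N..int N}. w \<bar>k\<bar> * g (-k)) = (\<Sum>k\<in>{-int N..int N}. w \<bar>k\<bar> * g k)"
    by (rule sum.reindex_bij_witness[of _ uminus uminus]) auto
  then show ?thesis by (simp add: algebra_simps sum.distrib)
qed

lemma sobolev_symm: "(\<Sum>k\<in>{-int N..int N}. (1 + \<bar>of_int k\<bar> ^ p) * (energy \<gamma> k + energy \<gamma> (-k))) = 2 * sobolev p \<gamma> N"
  unfolding sobolev_def using sum_symm[of "\<lambda>k. 1 + of_int k ^ p" "energy \<gamma>" N] by simp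

text \<open>
  The absolute sum over the modes is estimated by Cauchy-Schwarz against the square-summable sequence
  \<open>1 / max 1 \<bar>k\<bar>\<close>. This costs a weight \<open>\<bar>k\<bar>\<^sup>2\<close>, of which \<open>mode_sup\<close> supplies one power.
\<close>

lemma wave_sup:
  assumes "continuous_modes \<gamma>" "y \<in> {0..1}"
  shows "(norm (wave 0 \<gamma> N x y))\<^sup>2 \<le> 10 * sobolev 2 \<gamma> N" and "(norm (wave 1 \<gamma> N x y))\<^sup>2 \<le> 10 * sobolev 3 \<gamma> N"
proof -
  let ?I = "{-int N..int N}" and ?M = "\<lambda>k. max 1 \<bar>real_of_int k\<bar>"
  have main: "(norm (wave m \<gamma> N x y))\<^sup>2 \<le> 5 * (\<Sum>k\<in>?I. (?M k * (\<bar>real_of_int k\<bar> ^ m * norm (mode \<gamma> k y)))\<^sup>2)" for m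
  proof -
    have "norm (wave m \<gamma> N x y) \<le> (\<Sum>k\<in>?I. \<bar>real_of_int k\<bar> ^ m * norm (mode \<gamma> k y))"
      unfolding wave_def by (rule sum_norm_le) (simp add: norm_cm norm_mult norm_power)
    also have "\<dots> = (\<Sum>k\<in>?I. (1 / ?M k) * (?M k * (\<bar>real_of_int k\<bar> ^ m * norm (mode \<gamma> k y))))"
      by (intro sum.cong) (auto simp: max_def)
    finally have "(norm (wave m \<gamma> N x y))\<^sup>2 \<le> (\<Sum>k\<in>?I. (1 / ?M k) * (?M k * (\<bar>real_of_int k\<bar> ^ m * norm (mode \<gamma> k y))))\<^sup>2"
      by (rule power_mono) auto
    also have "\<dots> \<le> (\<Sum>k\<in>?I. (1 / ?M k)\<^sup>2) * (\<Sum>k\<in>?I. (?M k * (\<bar>real_of_int k\<bar> ^ m * norm (mode \<gamma> k y)))\<^sup>2)"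
      by (rule Cauchy_Schwarz_ineq_sum)
    also have "\<dots> \<le> 5 * (\<Sum>k\<in>?I. (?M k * (\<bar>real_of_int k\<bar> ^ m * norm (mode \<gamma> k y)))\<^sup>2)"
      using sum_inverse_square_int[of N] by (intro mult_right_mono sum_nonneg) (auto elim: order_trans)
    finally show ?thesis .
  qed
  have 0: "(?M k * (\<bar>real_of_int k\<bar> ^ 0 * norm (mode \<gamma> k y)))\<^sup>2 \<le> (1 + \<bar>of_int k\<bar> ^ 2) * (energy \<gamma> k + energy \<gamma> (-k))" for k
  proof -
    have "(?M k * (\<bar>real_of_int k\<bar> ^ 0 * norm (mode \<gamma> k y)))\<^sup>2 = ?M k * (?M k * (norm (mode \<gamma> k y))\<^sup>2)"
      by (simp add: power2_eq_square)
    also have "\<dots> \<le> ?M k * (energy \<gamma> k + energy \<gamma> (-k))" by (intro mult_left_mono mode_sup assms) auto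
    also have "\<dots> \<le> (1 + \<bar>of_int k\<bar> ^ 2) * (energy \<gamma> k + energy \<gamma> (-k))"
    proof (intro mult_right_mono add_nonneg_nonneg energy_nonneg assms)
      show "?M k \<le> 1 + \<bar>of_int k\<bar> ^ 2"
        using self_le_power[of "\<bar>real_of_int k\<bar>" 2] by (auto simp: max_def)
    qed
    finally show ?thesis .
  qed
  have 1: "(?M k * (\<bar>real_of_int k\<bar> ^ 1 * norm (mode \<gamma> k y)))\<^sup>2 \<le> (1 + \<bar>of_int k\<bar> ^ 3) * (energy \<gamma> k + energy \<gamma> (-k))" for k
  proof (cases "k = 0")
    case True
    then show ?thesis using energy_nonneg[OF assms(1)] by simp
  next
    case False
    then have M: "?M k = \<bar>of_int k\<bar>" by (auto simp: max_def)
    have "(?M k * (\<bar>real_of_int k\<bar> ^ 1 * norm (mode \<gamma> k y)))\<^sup>2 = \<bar>real_of_int k\<bar> ^ 3 * (?M k * (norm (mode \<gamma> k y))\<^sup>2)"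
      unfolding M by (simp add: power2_eq_square power3_eq_cube)
    also have "\<dots> \<le> \<bar>real_of_int k\<bar> ^ 3 * (energy \<gamma> k + energy \<gamma> (-k))" by (intro mult_left_mono mode_sup assms) auto
    also have "\<dots> \<le> (1 + \<bar>of_int k\<bar> ^ 3) * (energy \<gamma> k + energy \<gamma> (-k))"
      by (intro mult_right_mono add_nonneg_nonneg energy_nonneg assms) auto
    finally show ?thesis .
  qed
  show "(norm (wave 0 \<gamma> N x y))\<^sup>2 \<le> 10 * sobolev 2 \<gamma> N"
  proof -
    have "(\<Sum>k\<in>?I. (?M k * (\<bar>real_of_int k\<bar> ^ 0 * norm (mode \<gamma> k y)))\<^sup>2) \<le> (\<Sum>k\<in>?I. (1 + \<bar>of_int k\<bar> ^ 2) * (energy \<gamma> k + energy \<gamma> (-k)))"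
      by (intro sum_mono 0)
    then show ?thesis using main[of 0] sobolev_symm[of 2 \<gamma> N] by linarith
  qed
  show "(norm (wave 1 \<gamma> N x y))\<^sup>2 \<le> 10 * sobolev 3 \<gamma> N"
  proof -
    have "(\<Sum>k\<in>?I. (?M k * (\<bar>real_of_int k\<bar> ^ 1 * norm (mode \<gamma> k y)))\<^sup>2) \<le> (\<Sum>k\<in>?I. (1 + \<bar>of_int k\<bar> ^ 3) * (energy \<gamma> k + energy \<gamma> (-k)))"
      by (intro sum_mono 1)
    then show ?thesis using main[of 1] sobolev_symm[of 3 \<gamma> N] by linarith
  qed
qed

lemma parseval2:
  assumes I: "finite I" and c: "\<And>k. k \<in> I \<Longrightarrow> continuous_on {0..1} (c k)"
  shows "integral Zs (\<lambda>p. (norm (\<Sum>k\<in>I. cm (ek k (fst p)) (c k (snd p))))\<^sup>2) = 2 * pi * (\<Sum>k\<in>I. integral {0..1} (\<lambda>y. (norm (c k y))\<^sup>2))"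
proof -
  have "continuous_on Zs (\<lambda>p. (norm (\<Sum>k\<in>I. cm (ek k (fst p)) (c k (snd p))))\<^sup>2)"
    by (intro continuous_intros continuous_on_compose2[OF c, of _ _ snd]) (auto simp: cbox_Pair_eq)
  from integral_Zs[OF this]
  have "integral Zs (\<lambda>p. (norm (\<Sum>k\<in>I. cm (ek k (fst p)) (c k (snd p))))\<^sup>2)
     = integral {0..1} (\<lambda>y. 2 * pi * (\<Sum>k\<in>I. (norm (c k y))\<^sup>2))"
    by (simp add: parseval[OF I])
  also have "\<dots> = 2 * pi * integral {0..1} (\<lambda>y. \<Sum>k\<in>I. (norm (c k y))\<^sup>2)" by simp
  also have "integral {0..1} (\<lambda>y. \<Sum>k\<in>I. (norm (c k y))\<^sup>2) = (\<Sum>k\<in>I. integral {0..1} (\<lambda>y. (norm (c k y))\<^sup>2))"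
    by (intro integral_sum I integrable_continuous_interval continuous_intros c)
  finally show ?thesis .
qed

text \<open>
  By Parseval, \<open>m\<close> derivatives produce the weight \<open>\<bar>k\<bar>\<close> to the power \<open>2 m\<close>, and the second part of \<open>mode_sup\<close> absorbs two of these powers.
\<close>

lemma wave_L2:
  assumes "continuous_modes \<gamma>"
  shows "m \<le> 2 \<Longrightarrow> integral Zs (\<lambda>p. (norm (wave m \<gamma> N (fst p) (snd p)))\<^sup>2) \<le> 4 * pi * sobolev 2 \<gamma> N"
    and "m \<le> 3 \<Longrightarrow> integral Zs (\<lambda>p. (norm (wave m \<gamma> N (fst p) (snd p)))\<^sup>2) \<le> 4 * pi * sobolev 4 \<gamma> N"
proof -
  let ?I = "{-int N..int N}"
  have main: "integral Zs (\<lambda>p. (norm (wave m \<gamma> N (fst p) (snd p)))\<^sup>2) \<le> 4 * pi * sobolev q \<gamma> N" if "2 * m \<le> q + 2" "q > 0" for q m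
  proof -
    have "integral Zs (\<lambda>p. (norm (wave m \<gamma> N (fst p) (snd p)))\<^sup>2)
       = integral Zs (\<lambda>p. (norm (\<Sum>k\<in>?I. cm (ek k (fst p)) (cm ((\<i> * of_int k) ^ m) (mode \<gamma> k (snd p)))))\<^sup>2)"
      by (simp add: wave_def cm_cm mult.commute)
    also have "\<dots> = 2 * pi * (\<Sum>k\<in>?I. integral {0..1} (\<lambda>y. (norm (cm ((\<i> * of_int k) ^ m) (mode \<gamma> k y)))\<^sup>2))"
      by (intro parseval2 continuous_intros continuous_on_mode assms) auto
    also have "\<dots> = 2 * pi * (\<Sum>k\<in>?I. \<bar>of_int k\<bar> ^ (2 * m) * integral {0..1} (\<lambda>y. (norm (mode \<gamma> k y))\<^sup>2))"
      by (simp add: norm_cm norm_mult norm_power power_mult_distrib power_mult[symmetric] mult.commute[of m] flip: power_mult)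
    also have "\<dots> \<le> 2 * pi * (\<Sum>k\<in>?I. (1 + \<bar>of_int k\<bar> ^ q) * (energy \<gamma> k + energy \<gamma> (-k)))"
    proof (intro mult_left_mono sum_mono)
      fix k
      have ea: "energy \<gamma> k + energy \<gamma> (-k) \<ge> 0" using energy_nonneg[OF assms] by simp
      show "\<bar>of_int k\<bar> ^ (2 * m) * integral {0..1} (\<lambda>y. (norm (mode \<gamma> k y))\<^sup>2) \<le> (1 + \<bar>of_int k\<bar> ^ q) * (energy \<gamma> k + energy \<gamma> (-k))"
      proof (cases "m = 0")
        case True
        have "integral {0..1} (\<lambda>y. (norm (mode \<gamma> k y))\<^sup>2) \<le> integral {0..1} (\<lambda>y::real. energy \<gamma> k + energy \<gamma> (-k))"
        proof (intro integral_le integrable_continuous_interval continuous_intros continuous_on_mode assms)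
          fix y :: real assume y: "y \<in> {0..1}"
          have "1 * (norm (mode \<gamma> k y))\<^sup>2 \<le> max 1 \<bar>of_int k\<bar> * (norm (mode \<gamma> k y))\<^sup>2" by (intro mult_right_mono) auto
          then show "(norm (mode \<gamma> k y))\<^sup>2 \<le> energy \<gamma> k + energy \<gamma> (-k)" using mode_sup(1)[OF assms y, of k] by simp
        qed
        also have "\<dots> \<le> (1 + \<bar>of_int k\<bar> ^ q) * (energy \<gamma> k + energy \<gamma> (-k))"
          using mult_right_mono[OF _ ea, of 1 "1 + \<bar>of_int k\<bar> ^ q"] by simp
        finally show ?thesis using True by simp
      next
        case False
        then obtain j where j: "m = Suc j" by (cases m) auto
        have "\<bar>real_of_int k\<bar> ^ (2 * m) * integral {0..1} (\<lambda>y. (norm (mode \<gamma> k y))\<^sup>2)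
           = \<bar>of_int k\<bar> ^ (2 * j) * ((of_int k)\<^sup>2 * integral {0..1} (\<lambda>y. (norm (mode \<gamma> k y))\<^sup>2))"
          by (simp add: j power2_eq_square)
        also have "\<dots> \<le> \<bar>of_int k\<bar> ^ (2 * j) * (energy \<gamma> k + energy \<gamma> (-k))"
          using mode_sup(2)[OF assms, of 0 k] by (intro mult_left_mono) auto
        also have "\<dots> \<le> (1 + \<bar>of_int k\<bar> ^ q) * (energy \<gamma> k + energy \<gamma> (-k))"
        proof (intro mult_right_mono ea)
          show "\<bar>real_of_int k\<bar> ^ (2 * j) \<le> 1 + \<bar>of_int k\<bar> ^ q"
          proof (cases "k = 0")
            case True then show ?thesis by (cases j) auto
          next
            case False
            then have "\<bar>real_of_int k\<bar> \<ge> 1" by linarith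
            then have "\<bar>real_of_int k\<bar> ^ (2 * j) \<le> \<bar>of_int k\<bar> ^ q" using that j by (intro power_increasing) auto
            then show ?thesis by simp
          qed
        qed
        finally show ?thesis .
      qed
    qed simp
    also have "\<dots> = 4 * pi * sobolev q \<gamma> N" by (simp add: sobolev_symm)
    finally show ?thesis .
  qed
  show "m \<le> 2 \<Longrightarrow> integral Zs (\<lambda>p. (norm (wave m \<gamma> N (fst p) (snd p)))\<^sup>2) \<le> 4 * pi * sobolev 2 \<gamma> N"
    and "m \<le> 3 \<Longrightarrow> integral Zs (\<lambda>p. (norm (wave m \<gamma> N (fst p) (snd p)))\<^sup>2) \<le> 4 * pi * sobolev 4 \<gamma> N"
    by (rule main; simp)+
qed

lemma bessel2:
  assumes I: "finite I" and h: "continuous_on (UNIV \<times> {0..1}) (\<lambda>p. h (fst p) (snd p))"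
  shows "continuous_on {0..1} (\<lambda>y. coef (\<lambda>x. h x y) k)"
    and "(\<Sum>k\<in>I. integral {0..1} (\<lambda>y. (norm (coef (\<lambda>x. h x y) k))\<^sup>2)) \<le> (1 / (2 * pi)) * integral Zs (\<lambda>p. (norm (h (fst p) (snd p)))\<^sup>2)"
proof -
  have hy: "continuous_on {-pi..pi} (\<lambda>x. h x y)" if "y \<in> {0..1}" for y
    using that by (intro continuous_on_compose2[OF h, of _ "\<lambda>x. (x, y)", simplified] continuous_intros) auto
  show c: "continuous_on {0..1} (\<lambda>y. coef (\<lambda>x. h x y) k)" for k
    unfolding coef_def
  proof (intro continuous_intros)
    have "continuous_on ({0..1} \<times> cbox (-pi) pi) (\<lambda>(y, x). cm (ek (- k) x) (h x y))"
      unfolding case_prod_unfold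
      by (intro continuous_intros continuous_on_compose2[OF h, of _ "\<lambda>q. (snd q, fst q)", simplified]) auto
    from integral_continuous_on_param[OF this]
    show "continuous_on {0..1} (\<lambda>y. integral {-pi..pi} (\<lambda>x. cm (ek (- k) x) (h x y)))" by simp
  qed
  have hZ: "continuous_on Zs (\<lambda>p. (norm (h (fst p) (snd p)))\<^sup>2)"
    by (intro continuous_intros continuous_on_subset[OF h]) (auto simp: cbox_Pair_eq)
  have cI: "continuous_on {0..1} (\<lambda>y. integral {-pi..pi} (\<lambda>x. (norm (h x y))\<^sup>2))"
  proof -
    have "continuous_on ({0..1} \<times> cbox (-pi) pi) (\<lambda>(y, x). (norm (h x y))\<^sup>2)"
      unfolding case_prod_unfold
      by (intro continuous_intros continuous_on_compose2[OF h, of _ "\<lambda>q. (snd q, fst q)", simplified]) auto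
    from integral_continuous_on_param[OF this] show ?thesis by simp
  qed
  have "(\<Sum>k\<in>I. integral {0..1} (\<lambda>y. (norm (coef (\<lambda>x. h x y) k))\<^sup>2)) = integral {0..1} (\<lambda>y. \<Sum>k\<in>I. (norm (coef (\<lambda>x. h x y) k))\<^sup>2)"
    by (intro integral_sum[symmetric] I integrable_continuous_interval continuous_intros c)
  also have "\<dots> \<le> integral {0..1} (\<lambda>y. (1 / (2 * pi)) * integral {-pi..pi} (\<lambda>x. (norm (h x y))\<^sup>2))"
    by (intro integral_le integrable_continuous_interval continuous_intros c cI bessel I hy)
  also have "\<dots> = (1 / (2 * pi)) * integral Zs (\<lambda>p. (norm (h (fst p) (snd p)))\<^sup>2)"
    by (simp add: integral_Zs[OF hZ])
  finally show "(\<Sum>k\<in>I. integral {0..1} (\<lambda>y. (norm (coef (\<lambda>x. h x y) k))\<^sup>2)) \<le> (1 / (2 * pi)) * integral Zs (\<lambda>p. (norm (h (fst p) (snd p)))\<^sup>2)" .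
qed

end

section \<open>Approximate solutions with a prescribed value\<close>

definition strip_point :: "real \<Rightarrow> real \<Rightarrow> complex" where "strip_point x y = of_real x + \<i> * of_real y"

text \<open>
  The \<open>m\<close>-th derivative of the sine at \<open>x + i y\<close>.
\<close>

definition sine :: "nat \<Rightarrow> real \<Rightarrow> real \<Rightarrow> complex" where
  "sine m x y = sin (strip_point x y + of_real (real m * (pi / 2)))"

lemma sine_derivs:
  "((\<lambda>x. sine m x y) has_vector_derivative sine (Suc m) x y) (at x within S)"
  "((\<lambda>y. sine m x y) has_vector_derivative \<i> * sine (Suc m) x y) (at y within S)"
proof -
  have c: "cos z = sin (z + of_real (pi / 2))" for z :: complex
    by (simp only: sin_add cos_of_real sin_of_real) simp
  have e: "cos (strip_point x y + of_real (real m * (pi / 2))) = sine (Suc m) x y"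
  proof -
    have r: "real (Suc m) * (pi / 2) = real m * (pi / 2) + pi / 2" by (simp add: algebra_simps add_divide_distrib)
    show ?thesis unfolding sine_def c r by (simp only: of_real_add add.assoc)
  qed
  show "((\<lambda>x. sine m x y) has_vector_derivative sine (Suc m) x y) (at x within S)"
    unfolding sine_def[of m] strip_point_def e[unfolded strip_point_def, symmetric]
    by (rule has_vector_derivative_real_field) (auto intro!: derivative_eq_intros)
  show "((\<lambda>y. sine m x y) has_vector_derivative \<i> * sine (Suc m) x y) (at y within S)"
    unfolding sine_def[of m] strip_point_def e[unfolded strip_point_def, symmetric]
    by (rule has_vector_derivative_real_field) (auto intro!: derivative_eq_intros)
qed

lemma sine_periodic: "sine m (x + 2 * pi) y = sine m x y"
proof -
  have "sin (z + of_real (2 * pi)) = sin z" for z :: complex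
    by (simp only: sin_add cos_of_real sin_of_real) simp
  from this[of "strip_point x y + of_real (real m * (pi / 2))"] show ?thesis
    by (simp add: sine_def strip_point_def algebra_simps)
qed

lemma norm_sine: "y \<in> {0..1} \<Longrightarrow> norm (sine m x y) \<le> 3"
  using cmod_sin_le_exp[of 1 "strip_point x y + of_real (real m * (pi / 2))"] exp_le
  by (auto simp: sine_def strip_point_def intro: order_trans[where y = "exp 1"] order_trans[where y = "exp y"])

lemma sine_real: "cnj (sine m x 0) = sine m x 0"
  unfolding sine_def strip_point_def by (simp only: of_real_0 mult_zero_right add_0_right of_real_add[symmetric] sin_of_real complex_cnj_complex_of_real)

lemma sine_center: "sine 0 0 t = \<i> * of_real (sinh t)"
  by (simp add: sine_def strip_point_def sin_i_times sinh_field_def exp_of_real[symmetric] exp_minus)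

lemma continuous_on_sine [continuous_intros]:
  "continuous_on S f \<Longrightarrow> continuous_on S g \<Longrightarrow> continuous_on S (\<lambda>p. sine m (f p) (g p))"
  unfolding sine_def strip_point_def
  by (intro continuous_on_compose2[OF continuous_on_sin[OF continuous_on_id, of UNIV]] continuous_intros) auto

lemma integral_Zs_const: "integral Zs (\<lambda>p. c) = 2 * pi * (c::real)"
  by (simp add: content_Pair)

text \<open>
  The point \<open>i t0\<close> of the strip is the one at which the value of the solutions is prescribed.
\<close>

locale centred_real_structure = real_structure J \<tau>
  for J \<tau> :: "'v::euclidean_space \<Rightarrow> 'v" +
  fixes t0 :: real
  assumes t0: "0 < t0" "t0 \<le> 1"
begin

text \<open>
  Since \<open>sin (i t0) = i sinh t0\<close>, the vectors \<open>a = even_part w\<close> and \<open>b = odd_part w\<close> are the \<open>\<tau>\<close>-fixed solutions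
  of \<open>a + sin (i t0) b = w\<close>. They serve to correct the value of a wave at \<open>i t0\<close>, which misses \<open>v\<close> by \<open>defect\<close>. The
  function \<open>approx m\<close> is the \<open>m\<close>-th derivative in \<open>x\<close> of the corrected solution.
\<close>

definition even_part :: "'v \<Rightarrow> 'v" where "even_part v = (1/2) *\<^sub>R (v + \<tau> v)"
definition odd_part :: "'v \<Rightarrow> 'v" where "odd_part v = - (1 / (2 * sinh t0)) *\<^sub>R J (v - \<tau> v)"
definition defect :: "(int \<Rightarrow> real \<Rightarrow> 'v) \<Rightarrow> nat \<Rightarrow> 'v \<Rightarrow> 'v" where "defect \<gamma> N v = v - wave 0 \<gamma> N 0 t0"
definition approx :: "nat \<Rightarrow> (int \<Rightarrow> real \<Rightarrow> 'v) \<Rightarrow> nat \<Rightarrow> 'v \<Rightarrow> real \<Rightarrow> real \<Rightarrow> 'v" where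
  "approx m \<gamma> N v x y = (if m = 0 then even_part (defect \<gamma> N v) else 0) + cm (sine m x y) (odd_part (defect \<gamma> N v)) + wave m \<gamma> N x y"

lemma sinh_pos: "sinh t0 > 0" using t0 by simp

lemma approx_has_vector_derivative_x:
  "((\<lambda>x. approx m \<gamma> N v x y) has_vector_derivative approx (Suc m) \<gamma> N v x y) (at x within S)"
proof -
  have "((\<lambda>x. (if m = 0 then even_part (defect \<gamma> N v) else 0) + cm (sine m x y) (odd_part (defect \<gamma> N v)) + wave m \<gamma> N x y) has_vector_derivative
      0 + cm (sine (Suc m) x y) (odd_part (defect \<gamma> N v)) + wave (Suc m) \<gamma> N x y) (at x within S)"
    by (intro has_vector_derivative_add has_vector_derivative_const wave_has_vector_derivative_x
        bounded_linear.has_vector_derivative[OF cm.bounded_linear_left] sine_derivs)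
  then show ?thesis by (simp add: approx_def)
qed

lemma approx_has_vector_derivative_y:
  assumes "continuous_modes \<gamma>" "y \<in> {0..1}"
  shows "((\<lambda>y. approx 0 \<gamma> N v x y) has_vector_derivative J (approx 1 \<gamma> N v x y) + (\<Sum>k\<in>{-int N..int N}. cm (ek k x) (\<gamma> k y))) (at y within {0..1})"
proof -
  have "((\<lambda>y. even_part (defect \<gamma> N v) + cm (sine 0 x y) (odd_part (defect \<gamma> N v)) + wave 0 \<gamma> N x y) has_vector_derivative
      0 + cm (\<i> * sine (Suc 0) x y) (odd_part (defect \<gamma> N v)) + (J (wave 1 \<gamma> N x y) + (\<Sum>k\<in>{-int N..int N}. cm (ek k x) (\<gamma> k y)))) (at y within {0..1})"
    by (intro has_vector_derivative_add has_vector_derivative_const wave_has_vector_derivative_y assms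
        bounded_linear.has_vector_derivative[OF cm.bounded_linear_left] sine_derivs)
  then show ?thesis by (simp add: approx_def J_add J_cm add.assoc)
qed

lemma approx_periodic: "approx m \<gamma> N v (x + 2 * pi) y = approx m \<gamma> N v x y"
  by (simp add: approx_def sine_periodic wave_periodic)

lemma \<tau>_even_part: "\<tau> (even_part v) = even_part v" and \<tau>_odd_part: "\<tau> (odd_part v) = odd_part v"
  by (simp_all add: even_part_def odd_part_def \<tau>_scale \<tau>_add \<tau>_diff \<tau>_J \<tau>_minus J_diff J_minus algebra_simps)

lemma approx_real: "\<tau> (approx 0 \<gamma> N v x 0) = approx 0 \<gamma> N v x 0"
  by (simp add: approx_def \<tau>_add \<tau>_cm \<tau>_even_part \<tau>_odd_part sine_real wave_real)

lemma approx_center: "approx 0 \<gamma> N v 0 t0 = v"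
proof -
  have "cm (sine 0 0 t0) (odd_part w) = sinh t0 *\<^sub>R J (odd_part w)" for w
    by (simp add: sine_center cm_def)
  also have "\<dots> w = (1/2) *\<^sub>R (w - \<tau> w)" for w
    using sinh_pos by (simp add: odd_part_def J_scale J_minus algebra_simps)
  finally have "even_part w + cm (sine 0 0 t0) (odd_part w) = w" for w
    by (simp add: even_part_def algebra_simps) (simp flip: scaleR_add_left)
  then show ?thesis by (simp add: approx_def defect_def)
qed

lemma even_part_diff: "even_part (v - w) = even_part v - even_part w" and odd_part_diff: "odd_part (v - w) = odd_part v - odd_part w"
  by (simp_all add: even_part_def odd_part_def \<tau>_diff J_diff J_add algebra_simps)

text \<open>
  The map from \<open>(\<gamma>, v)\<close> to the corrected solution is linear.
\<close>

lemma approx_diff: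
  assumes "continuous_modes \<gamma>" "continuous_modes \<gamma>'" "y \<in> {0..1}"
  shows "approx m (\<lambda>k y. \<gamma> k y - \<gamma>' k y) N (v - v') x y = approx m \<gamma> N v x y - approx m \<gamma>' N v' x y"
proof -
  have "defect (\<lambda>k y. \<gamma> k y - \<gamma>' k y) N (v - v') = defect \<gamma> N v - defect \<gamma>' N v'"
    unfolding defect_def using t0 by (subst wave_diff[OF assms(1,2)]) auto
  then show ?thesis
    by (simp add: approx_def wave_diff[OF assms] even_part_diff odd_part_diff cm.diff_right)
qed

lemma continuous_on_approx [continuous_intros]:
  assumes "continuous_modes \<gamma>" "continuous_on S a" "continuous_on S b" "b ` S \<subseteq> {0..1}"
  shows "continuous_on S (\<lambda>p. approx m \<gamma> N v (a p) (b p))"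
  unfolding approx_def by (intro continuous_intros assms)

lemma approx_support:
  assumes "\<And>k. \<bar>k\<bar> > int n \<Longrightarrow> \<gamma> k = (\<lambda>_. 0)" "n \<le> N"
  shows "approx m \<gamma> N v x y = approx m \<gamma> n v x y"
  using wave_support[OF assms] by (simp add: approx_def defect_def)

text \<open>
  \<open>c0\<close> bounds the correction terms and all their derivatives by the size of the vector that they represent; \<open>C0\<close>
  bounds squared norms of \<open>approx m \<gamma> N 0\<close> by norms of \<open>\<gamma>\<close>.
\<close>

definition c0 :: real where "c0 = 1 + 3 / sinh t0"
definition C0 :: real where "C0 = 40 * pi * (c0\<^sup>2 + 1)"

lemma c0: "c0 \<ge> 1" using sinh_pos by (simp add: c0_def)
lemma C0: "C0 \<ge> 1"
proof -
  have "1 * 1 \<le> (40 * pi) * (c0\<^sup>2 + 1)" using pi_gt3 by (intro mult_mono) auto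
  then show ?thesis by (simp add: C0_def)
qed

lemma norm_even_part: "norm (even_part v) \<le> norm v"
  using norm_triangle_ineq[of v "\<tau> v"] by (simp add: even_part_def)

lemma norm_odd_part: "norm (odd_part v) \<le> norm v / sinh t0"
  using norm_triangle_ineq4[of v "\<tau> v"] sinh_pos by (simp add: odd_part_def field_simps)

lemma approx_bound:
  assumes "y \<in> {0..1}"
  shows "norm (approx m \<gamma> N v x y) \<le> c0 * norm (defect \<gamma> N v) + norm (wave m \<gamma> N x y)"
proof -
  let ?w = "defect \<gamma> N v"
  have "norm (cm (sine m x y) (odd_part ?w)) \<le> 3 * (norm ?w / sinh t0)"
    unfolding norm_cm using norm_sine[OF assms] norm_odd_part by (intro mult_mono) auto
  moreover have "norm (if m = 0 then even_part ?w else 0) \<le> norm ?w" using norm_even_part by auto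
  ultimately have "norm (approx m \<gamma> N v x y) \<le> norm ?w + 3 * (norm ?w / sinh t0) + norm (wave m \<gamma> N x y)"
    unfolding approx_def by (intro norm_triangle_le add_mono) auto
  then show ?thesis by (simp add: c0_def algebra_simps)
qed

lemma approx_zero_bound:
  assumes "y \<in> {0..1}" shows "norm (approx m (\<lambda>k y. 0) N v x y) \<le> c0 * norm v"
  using approx_bound[OF assms, of m "\<lambda>k y. 0" N v x] by (simp add: defect_def wave_zero)

lemma sobolev_nonneg: "continuous_modes \<gamma> \<Longrightarrow> sobolev p \<gamma> N \<ge> 0"
  unfolding sobolev_def by (intro sum_nonneg mult_nonneg_nonneg energy_nonneg) auto

lemma approx_square_bound:
  assumes "continuous_modes \<gamma>" "y \<in> {0..1}"
  shows "(norm (approx m \<gamma> N 0 x y))\<^sup>2 \<le> 20 * c0\<^sup>2 * sobolev 2 \<gamma> N + 2 * (norm (wave m \<gamma> N x y))\<^sup>2"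
proof -
  have "(norm (approx m \<gamma> N 0 x y))\<^sup>2 \<le> (c0 * norm (defect \<gamma> N 0) + norm (wave m \<gamma> N x y))\<^sup>2"
    by (intro power_mono approx_bound assms) auto
  also have "\<dots> \<le> 2 * (c0 * norm (defect \<gamma> N 0))\<^sup>2 + 2 * (norm (wave m \<gamma> N x y))\<^sup>2"
    by (rule sum_squares_bound[THEN le_iff_diff_le_0[THEN iffD1], THEN le_iff_diff_le_0[THEN iffD2], elim_format])
       (smt (verit) power2_sum sum_squares_bound)
  also have "(c0 * norm (defect \<gamma> N 0))\<^sup>2 \<le> c0\<^sup>2 * (10 * sobolev 2 \<gamma> N)"
    unfolding power_mult_distrib using wave_sup(1)[OF assms(1), of t0 N 0] t0
    by (intro mult_left_mono) (auto simp: defect_def)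
  finally show ?thesis by simp
qed

lemma approx0_sup:
  assumes "continuous_modes \<gamma>" "y \<in> {0..1}"
  shows "(norm (approx 0 \<gamma> N 0 x y))\<^sup>2 \<le> C0 * sobolev 2 \<gamma> N" and "(norm (approx 1 \<gamma> N 0 x y))\<^sup>2 \<le> C0 * sobolev 3 \<gamma> N"
proof -
  have c: "20 * c0\<^sup>2 + 20 \<le> C0"
    using mult_right_mono[of 20 "40 * pi" "c0\<^sup>2 + 1"] pi_gt3 by (simp add: C0_def algebra_simps)
  have E23: "sobolev 2 \<gamma> N \<le> sobolev 3 \<gamma> N" by (rule sobolev_mono[OF assms(1)]) auto
  show "(norm (approx 0 \<gamma> N 0 x y))\<^sup>2 \<le> C0 * sobolev 2 \<gamma> N"
    using approx_square_bound[OF assms, of 0 N x] wave_sup(1)[OF assms, of N x] mult_right_mono[OF c sobolev_nonneg[OF assms(1), of 2 N]]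
    by (simp add: algebra_simps)
  have "20 * c0\<^sup>2 * sobolev 2 \<gamma> N \<le> 20 * c0\<^sup>2 * sobolev 3 \<gamma> N" using E23 by (intro mult_left_mono) auto
  then show "(norm (approx 1 \<gamma> N 0 x y))\<^sup>2 \<le> C0 * sobolev 3 \<gamma> N"
    using approx_square_bound[OF assms, of 1 N x] wave_sup(2)[OF assms, of N x] mult_right_mono[OF c sobolev_nonneg[OF assms(1), of 3 N]]
    by (simp add: algebra_simps)
qed

lemma Zs_snd: "p \<in> Zs \<Longrightarrow> snd p \<in> {0..1}" by (auto simp: cbox_Pair_eq)

lemma integrable_Zs: "continuous_on Zs q \<Longrightarrow> q integrable_on Zs" for q :: "_ \<Rightarrow> real"
  by (rule integrable_continuous)

lemma approx0_L2:
  assumes "continuous_modes \<gamma>"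
  shows "m \<le> 2 \<Longrightarrow> integral Zs (\<lambda>p. (norm (approx m \<gamma> N 0 (fst p) (snd p)))\<^sup>2) \<le> C0 * sobolev 2 \<gamma> N"
    and "m \<le> 3 \<Longrightarrow> integral Zs (\<lambda>p. (norm (approx m \<gamma> N 0 (fst p) (snd p)))\<^sup>2) \<le> C0 * sobolev 4 \<gamma> N"
proof -
  have m: "integral Zs (\<lambda>p. (norm (approx m \<gamma> N 0 (fst p) (snd p)))\<^sup>2) \<le> 40 * pi * c0\<^sup>2 * sobolev 2 \<gamma> N + 2 * integral Zs (\<lambda>p. (norm (wave m \<gamma> N (fst p) (snd p)))\<^sup>2)" for m
  proof -
    have "integral Zs (\<lambda>p. (norm (approx m \<gamma> N 0 (fst p) (snd p)))\<^sup>2) \<le> integral Zs (\<lambda>p. 20 * c0\<^sup>2 * sobolev 2 \<gamma> N + 2 * (norm (wave m \<gamma> N (fst p) (snd p)))\<^sup>2)"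
      by (intro integral_le integrable_Zs continuous_intros assms approx_square_bound Zs_snd) (auto simp: cbox_Pair_eq)
    also have "\<dots> = integral Zs (\<lambda>p. 20 * c0\<^sup>2 * sobolev 2 \<gamma> N) + integral Zs (\<lambda>p. 2 * (norm (wave m \<gamma> N (fst p) (snd p)))\<^sup>2)"
      by (intro integral_add integrable_Zs continuous_intros assms) (auto simp: cbox_Pair_eq)
    finally show ?thesis unfolding integral_Zs_const by simp
  qed
  have E24: "sobolev 2 \<gamma> N \<le> sobolev 4 \<gamma> N" by (rule sobolev_mono[OF assms(1)]) auto
  have CE: "C0 * x = 40 * pi * c0\<^sup>2 * x + 40 * (pi * x)" for x by (simp add: C0_def algebra_simps)
  show "integral Zs (\<lambda>p. (norm (approx m \<gamma> N 0 (fst p) (snd p)))\<^sup>2) \<le> C0 * sobolev 2 \<gamma> N" if "m \<le> 2"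
    using m[of m] wave_L2(1)[OF assms that, of N] mult_nonneg_nonneg[OF pi_ge_zero sobolev_nonneg[OF assms, of 2 N]]
    unfolding CE by linarith
  have "40 * pi * c0\<^sup>2 * sobolev 2 \<gamma> N \<le> 40 * pi * c0\<^sup>2 * sobolev 4 \<gamma> N" using E24 by (intro mult_left_mono) auto
  then show "integral Zs (\<lambda>p. (norm (approx m \<gamma> N 0 (fst p) (snd p)))\<^sup>2) \<le> C0 * sobolev 4 \<gamma> N" if "m \<le> 3"
    using m[of m] wave_L2(2)[OF assms that, of N] mult_nonneg_nonneg[OF pi_ge_zero sobolev_nonneg[OF assms, of 4 N]]
    unfolding CE by linarith
qed

end

section \<open>The perturbed equation: invariant ball and contraction\<close>

lemma has_vector_derivative_compose_total:
  assumes "(c has_vector_derivative c') (at x within S)" "(G has_derivative D) (at (c x))"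
  shows "((\<lambda>x. G (c x)) has_vector_derivative D c') (at x within S)"
proof -
  interpret D: bounded_linear D using assms(2) by (rule has_derivative_bounded_linear)
  show ?thesis
    using has_derivative_compose[OF assms(1)[unfolded has_vector_derivative_def] assms(2)]
    by (simp add: has_vector_derivative_def D.scaleR)
qed

text \<open>
  The equation to be solved is \<open>F\<^sub>y = J F\<^sub>x + G(F) F\<^sub>x\<close> with \<open>F(i t0) = v\<close>. The derivatives of \<open>G\<close> are \<open>G1\<close> and \<open>G2\<close>, all bounded by \<open>\<sigma>\<close>.
  The ball of radius \<open>R\<close> is large enough for all approximate solutions and their first derivatives, and \<open>\<mu>\<close> is the radius of the
  invariant ball of the iteration. The two smallness conditions on \<open>\<sigma>\<close> give its invariance (\<open>small1\<close>) and the contraction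
  (\<open>small2\<close>); their coefficients are those which the estimates of the derivatives of \<open>G(F) F\<^sub>x\<close> produce.
\<close>

locale strip_equation = centred_real_structure J \<tau> t0
  for J \<tau> :: "'v::euclidean_space \<Rightarrow> 'v" and t0 :: real +
  fixes G :: "'v \<Rightarrow> 'v \<Rightarrow>\<^sub>L 'v" and G1 :: "'v \<Rightarrow> 'v \<Rightarrow>\<^sub>L ('v \<Rightarrow>\<^sub>L 'v)"
    and G2 :: "'v \<Rightarrow> 'v \<Rightarrow>\<^sub>L ('v \<Rightarrow>\<^sub>L ('v \<Rightarrow>\<^sub>L 'v))"
    and R \<sigma> \<mu> :: real and v :: 'v
  assumes G_deriv: "\<And>X. X \<in> ball 0 R \<Longrightarrow> (G has_derivative blinfun_apply (G1 X)) (at X)"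
    and G1_deriv: "\<And>X. X \<in> ball 0 R \<Longrightarrow> (G1 has_derivative blinfun_apply (G2 X)) (at X)"
    and G2_cont: "continuous_on (ball 0 R) G2"
    and norm_G: "\<And>X. X \<in> ball 0 R \<Longrightarrow> norm (G X) \<le> \<sigma>"
    and norm_G1: "\<And>X. X \<in> ball 0 R \<Longrightarrow> norm (G1 X) \<le> \<sigma>"
    and norm_G2: "\<And>X. X \<in> ball 0 R \<Longrightarrow> norm (G2 X) \<le> \<sigma>"
    and \<mu>: "\<mu> > 0" and R: "c0 * norm v + sqrt C0 * \<mu> < R"
    and small1: "\<sigma>\<^sup>2 * (10 * R\<^sup>2 + 81 * R ^ 4 + 3 * R ^ 6) \<le> \<mu>\<^sup>2"
    and small2: "\<sigma>\<^sup>2 * C0 * (2 * (1 + R\<^sup>2) + 4 * (R ^ 4 + 22 * R\<^sup>2 + 1)) \<le> 1"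
begin

lemma R_pos: "R > 0" using R \<mu> C0 c0 by (smt (verit) mult_nonneg_nonneg norm_ge_zero real_sqrt_ge_zero mult_pos_pos)

lemma \<sigma>_nonneg: "\<sigma> \<ge> 0" using order_trans[OF norm_ge_zero norm_G[of 0]] R_pos by simp

abbreviation admissible :: "(int \<Rightarrow> real \<Rightarrow> 'v) \<Rightarrow> nat \<Rightarrow> bool" where "admissible \<gamma> N \<equiv> continuous_modes \<gamma> \<and> sobolev 4 \<gamma> N \<le> \<mu>\<^sup>2"

lemma approx_split:
  assumes "continuous_modes \<gamma>" "y \<in> {0..1}"
  shows "approx m \<gamma> N w x y = approx m (\<lambda>k y. 0) N w x y + approx m \<gamma> N 0 x y"
  using approx_diff[OF assms(1) _ assms(2), of "\<lambda>k y. 0" m N w w x] by (simp add: continuous_intros)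

lemma adm_approx0:
  assumes "admissible \<gamma> N" "y \<in> {0..1}" "m \<le> 1"
  shows "norm (approx m \<gamma> N 0 x y) \<le> sqrt C0 * \<mu>"
proof -
  have cc: "continuous_modes \<gamma>" using assms by blast
  have "(norm (approx m \<gamma> N 0 x y))\<^sup>2 \<le> C0 * sobolev 4 \<gamma> N"
  proof -
    have "sobolev 2 \<gamma> N \<le> sobolev 4 \<gamma> N" "sobolev 3 \<gamma> N \<le> sobolev 4 \<gamma> N" by (rule sobolev_mono[OF cc]; simp)+
    then have "C0 * sobolev 2 \<gamma> N \<le> C0 * sobolev 4 \<gamma> N" "C0 * sobolev 3 \<gamma> N \<le> C0 * sobolev 4 \<gamma> N" using C0 by auto
    moreover have "m = 0 \<or> m = 1" using assms(3) by auto
    ultimately show ?thesis using approx0_sup[OF cc assms(2), of N x] by auto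
  qed
  also have "\<dots> \<le> C0 * \<mu>\<^sup>2" using assms(1) C0 by (intro mult_left_mono) auto
  also have "\<dots> = (sqrt C0 * \<mu>)\<^sup>2" using C0 by (simp add: power_mult_distrib)
  finally show ?thesis by (rule power2_le_imp_le) (use C0 \<mu> in auto)
qed

lemma adm_approx:
  assumes "admissible \<gamma> N" "y \<in> {0..1}" "m \<le> 1"
  shows "norm (approx m \<gamma> N v x y) < R"
proof -
  have "approx m \<gamma> N v x y = approx m (\<lambda>k y. 0) N v x y + approx m \<gamma> N 0 x y" using assms by (intro approx_split) auto
  then show ?thesis
    using adm_approx0[OF assms, of x] approx_zero_bound[OF assms(2), of m N v x] R
      norm_triangle_ineq[of "approx m (\<lambda>k y. 0) N v x y" "approx m \<gamma> N 0 x y"] by simp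
qed

lemma adm_approx_ball:
  assumes "admissible \<gamma> N" "y \<in> {0..1}" shows "approx 0 \<gamma> N v x y \<in> ball 0 R"
  using adm_approx[OF assms, of 0 x] by simp

text \<open>
  The second and third derivatives are bounded in the square mean only, which is all that \<open>sobolev 4\<close> controls.
\<close>

lemma adm_L2:
  assumes "admissible \<gamma> N" "m \<le> 3"
  shows "integral Zs (\<lambda>p. (norm (approx m \<gamma> N v (fst p) (snd p)))\<^sup>2) \<le> 18 * R\<^sup>2"
proof -
  have cc: "continuous_modes \<gamma>" using assms by blast
  have b: "c0 * norm v \<le> R" "sqrt C0 * \<mu> \<le> R"
    using R c0 C0 \<mu> mult_nonneg_nonneg[of c0 "norm v"] mult_nonneg_nonneg[of "sqrt C0" \<mu>] norm_ge_zero[of v] real_sqrt_ge_zero[of C0] by linarith+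
  have "integral Zs (\<lambda>p. (norm (approx m \<gamma> N v (fst p) (snd p)))\<^sup>2)
     \<le> integral Zs (\<lambda>p. 2 * R\<^sup>2 + 2 * (norm (approx m \<gamma> N 0 (fst p) (snd p)))\<^sup>2)"
  proof (intro integral_le integrable_Zs continuous_intros cc)
    fix p :: "real \<times> real" assume "p \<in> Zs"
    then have y: "snd p \<in> {0..1}" by (rule Zs_snd)
    let ?a = "approx m (\<lambda>k y. 0) N v (fst p) (snd p)" and ?b = "approx m \<gamma> N 0 (fst p) (snd p)"
    have a: "(norm ?a)\<^sup>2 \<le> R\<^sup>2"
      using approx_zero_bound[OF y, of m N v "fst p"] b by (intro power_mono) auto
    have "(norm (?a + ?b))\<^sup>2 \<le> (norm ?a + norm ?b)\<^sup>2" by (intro power_mono norm_triangle_ineq) auto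
    also have "\<dots> \<le> 2 * (norm ?a)\<^sup>2 + 2 * (norm ?b)\<^sup>2"
      using sum_squares_bound[of "norm ?a" "norm ?b"] by (simp add: power2_sum)
    finally show "(norm (approx m \<gamma> N v (fst p) (snd p)))\<^sup>2 \<le> 2 * R\<^sup>2 + 2 * (norm ?b)\<^sup>2"
      using approx_split[OF cc y, of m N v "fst p"] a by simp
  qed (auto simp: cbox_Pair_eq)
  also have "\<dots> = integral Zs (\<lambda>p. 2 * R\<^sup>2) + integral Zs (\<lambda>p. 2 * (norm (approx m \<gamma> N 0 (fst p) (snd p)))\<^sup>2)"
    by (intro integral_add integrable_Zs continuous_intros cc) (auto simp: cbox_Pair_eq)
  also have "\<dots> \<le> 2 * pi * (2 * R\<^sup>2) + 2 * (C0 * \<mu>\<^sup>2)"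
  proof -
    have "C0 * sobolev 4 \<gamma> N \<le> C0 * \<mu>\<^sup>2" using assms(1) C0 by (intro mult_left_mono) auto
    then show ?thesis using approx0_L2(2)[OF cc assms(2), of N] unfolding integral_Zs_const integral_mult_right by linarith
  qed
  also have "C0 * \<mu>\<^sup>2 \<le> R\<^sup>2"
    using power_mono[OF b(2), of 2] \<mu> C0 by (simp add: power_mult_distrib)
  also have "2 * pi * (2 * R\<^sup>2) + 2 * R\<^sup>2 \<le> 18 * R\<^sup>2"
    using mult_right_mono[of "4 * pi + 2" 18 "R\<^sup>2"] pi_less_4 by (simp add: algebra_simps)
  finally show ?thesis by simp
qed

definition rhs :: "(int \<Rightarrow> real \<Rightarrow> 'v) \<Rightarrow> nat \<Rightarrow> real \<Rightarrow> real \<Rightarrow> 'v" where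
  "rhs \<gamma> N x y = G (approx 0 \<gamma> N v x y) (approx 1 \<gamma> N v x y)"
definition rhs_x :: "(int \<Rightarrow> real \<Rightarrow> 'v) \<Rightarrow> nat \<Rightarrow> real \<Rightarrow> real \<Rightarrow> 'v" where
  "rhs_x \<gamma> N x y = G (approx 0 \<gamma> N v x y) (approx 2 \<gamma> N v x y) + G1 (approx 0 \<gamma> N v x y) (approx 1 \<gamma> N v x y) (approx 1 \<gamma> N v x y)"
definition rhs_xx :: "(int \<Rightarrow> real \<Rightarrow> 'v) \<Rightarrow> nat \<Rightarrow> real \<Rightarrow> real \<Rightarrow> 'v" where
  "rhs_xx \<gamma> N x y = (G (approx 0 \<gamma> N v x y) (approx 3 \<gamma> N v x y) + G1 (approx 0 \<gamma> N v x y) (approx 1 \<gamma> N v x y) (approx 2 \<gamma> N v x y))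
    + (G1 (approx 0 \<gamma> N v x y) (approx 1 \<gamma> N v x y) (approx 2 \<gamma> N v x y)
     + (G1 (approx 0 \<gamma> N v x y) (approx 2 \<gamma> N v x y) + G2 (approx 0 \<gamma> N v x y) (approx 1 \<gamma> N v x y) (approx 1 \<gamma> N v x y)) (approx 1 \<gamma> N v x y))"

lemma rhs_deriv:
  assumes "admissible \<gamma> N" "y \<in> {0..1}"
  shows "((\<lambda>x. rhs \<gamma> N x y) has_vector_derivative rhs_x \<gamma> N x y) (at x within S)"
    and "((\<lambda>x. rhs_x \<gamma> N x y) has_vector_derivative rhs_xx \<gamma> N x y) (at x within S)"
proof -
  note B = bounded_bilinear.has_vector_derivative[OF bounded_bilinear_blinfun_apply]
  have b: "approx 0 \<gamma> N v x y \<in> ball 0 R" by (rule adm_approx_ball[OF assms])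
  have d: "((\<lambda>x. approx m \<gamma> N v x y) has_vector_derivative approx (Suc m) \<gamma> N v x y) (at x within S)" for m
    by (rule approx_has_vector_derivative_x)
  have d0: "((\<lambda>x. approx 0 \<gamma> N v x y) has_vector_derivative approx 1 \<gamma> N v x y) (at x within S)"
    and d1: "((\<lambda>x. approx 1 \<gamma> N v x y) has_vector_derivative approx 2 \<gamma> N v x y) (at x within S)"
    and d2: "((\<lambda>x. approx 2 \<gamma> N v x y) has_vector_derivative approx 3 \<gamma> N v x y) (at x within S)"
    using d[of 0] d[of 1] d[of 2] by (simp_all add: numeral_2_eq_2 numeral_3_eq_3)
  have g: "((\<lambda>x. G (approx 0 \<gamma> N v x y)) has_vector_derivative G1 (approx 0 \<gamma> N v x y) (approx 1 \<gamma> N v x y)) (at x within S)"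
    by (rule has_vector_derivative_compose_total[OF d0 G_deriv[OF b]])
  have g1: "((\<lambda>x. G1 (approx 0 \<gamma> N v x y)) has_vector_derivative G2 (approx 0 \<gamma> N v x y) (approx 1 \<gamma> N v x y)) (at x within S)"
    by (rule has_vector_derivative_compose_total[OF d0 G1_deriv[OF b]])
  show "((\<lambda>x. rhs \<gamma> N x y) has_vector_derivative rhs_x \<gamma> N x y) (at x within S)"
    unfolding rhs_def rhs_x_def by (rule B[OF g d1])
  show "((\<lambda>x. rhs_x \<gamma> N x y) has_vector_derivative rhs_xx \<gamma> N x y) (at x within S)"
    unfolding rhs_x_def rhs_xx_def by (intro has_vector_derivative_add B g g1 d1 d2)
qed

lemma continuous_on_Gs:
  assumes "admissible \<gamma> N" "continuous_on S a" "continuous_on S b" "b ` S \<subseteq> {0..1}"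
  shows "continuous_on S (\<lambda>p. G (approx 0 \<gamma> N v (a p) (b p)))"
    "continuous_on S (\<lambda>p. G1 (approx 0 \<gamma> N v (a p) (b p)))"
    "continuous_on S (\<lambda>p. G2 (approx 0 \<gamma> N v (a p) (b p)))"
proof -
  have "continuous_on (ball 0 R) G" "continuous_on (ball 0 R) G1"
    using G_deriv G1_deriv by (meson continuous_at_imp_continuous_on has_derivative_continuous)+
  moreover have "continuous_on S (\<lambda>p. approx 0 \<gamma> N v (a p) (b p))" using assms by (intro continuous_intros) auto
  moreover have "(\<lambda>p. approx 0 \<gamma> N v (a p) (b p)) ` S \<subseteq> ball 0 R" using adm_approx_ball[OF assms(1)] assms(4) by blast
  ultimately show "continuous_on S (\<lambda>p. G (approx 0 \<gamma> N v (a p) (b p)))"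
    "continuous_on S (\<lambda>p. G1 (approx 0 \<gamma> N v (a p) (b p)))"
    "continuous_on S (\<lambda>p. G2 (approx 0 \<gamma> N v (a p) (b p)))"
    using G2_cont by (auto intro: continuous_on_compose2)
qed

lemma continuous_on_rhs [continuous_intros]:
  assumes "admissible \<gamma> N" "continuous_on S a" "continuous_on S b" "b ` S \<subseteq> {0..1}"
  shows "continuous_on S (\<lambda>p. rhs \<gamma> N (a p) (b p))"
    "continuous_on S (\<lambda>p. rhs_x \<gamma> N (a p) (b p))"
    "continuous_on S (\<lambda>p. rhs_xx \<gamma> N (a p) (b p))"
  unfolding rhs_def rhs_x_def rhs_xx_def
  by (intro continuous_on_add bounded_bilinear.continuous_on[OF bounded_bilinear_blinfun_apply]
      continuous_on_Gs[OF assms] continuous_on_approx[OF _ assms(2-4)]; use assms(1) in blast)+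

lemma norm_Gb:
  assumes "X \<in> ball 0 R"
  shows "norm (G X a) \<le> \<sigma> * norm a" "norm (G1 X a) \<le> \<sigma> * norm a"  "norm (G1 X a b) \<le> \<sigma> * norm a * norm b"
    "norm (G2 X a b c) \<le> \<sigma> * norm a * norm b * norm c"
proof -
  have 1: "norm (B a) \<le> s * norm a" if "norm B \<le> s" for B :: "'c::real_normed_vector \<Rightarrow>\<^sub>L 'd::real_normed_vector" and s a
    using norm_blinfun[of B a] mult_right_mono[OF that norm_ge_zero[of a]] by linarith
  show "norm (G X a) \<le> \<sigma> * norm a" "norm (G1 X a) \<le> \<sigma> * norm a"  "norm (G1 X a b) \<le> \<sigma> * norm a * norm b"
    "norm (G2 X a b c) \<le> \<sigma> * norm a * norm b * norm c"
    by (intro 1 norm_G norm_G1 norm_G2 assms)+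
qed

lemma norm_rhs:
  assumes "admissible \<gamma> N" "y \<in> {0..1}" shows "norm (rhs \<gamma> N x y) \<le> \<sigma> * R"
  unfolding rhs_def
  using norm_Gb(1)[OF adm_approx_ball[OF assms], of x "approx 1 \<gamma> N v x y"] adm_approx[OF assms, of 1 x] \<sigma>_nonneg
  by (meson le_refl less_imp_le mult_left_mono order_trans)

lemma norm_rhs_xx:
  assumes "admissible \<gamma> N" "y \<in> {0..1}"
  shows "norm (rhs_xx \<gamma> N x y) \<le> \<sigma> * (R ^ 3 + 3 * R * norm (approx 2 \<gamma> N v x y) + norm (approx 3 \<gamma> N v x y))"
proof -
  let ?X = "approx 0 \<gamma> N v x y" and ?a = "approx 1 \<gamma> N v x y" and ?b = "approx 2 \<gamma> N v x y" and ?c = "approx 3 \<gamma> N v x y"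
  have X: "?X \<in> ball 0 R" by (rule adm_approx_ball[OF assms])
  have a: "norm ?a \<le> R" using adm_approx[OF assms, of 1 x] by simp
  have ab: "norm (G1 ?X ?a ?b) \<le> \<sigma> * R * norm ?b"
    by (rule order_trans[OF norm_Gb(3)[OF X]]) (intro mult_right_mono mult_left_mono a \<sigma>_nonneg norm_ge_zero)
  have ba: "norm (G1 ?X ?b ?a) \<le> \<sigma> * norm ?b * R"
    by (rule order_trans[OF norm_Gb(3)[OF X]]) (intro mult_left_mono a \<sigma>_nonneg mult_nonneg_nonneg norm_ge_zero)
  have aaa: "norm (G2 ?X ?a ?a ?a) \<le> \<sigma> * R * R * R"
    by (rule order_trans[OF norm_Gb(4)[OF X]]) (intro mult_mono a \<sigma>_nonneg mult_nonneg_nonneg norm_ge_zero order_refl; use R_pos in simp)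
  have "norm (rhs_xx \<gamma> N x y) \<le> (norm (G ?X ?c) + norm (G1 ?X ?a ?b)) + (norm (G1 ?X ?a ?b) + (norm (G1 ?X ?b ?a) + norm (G2 ?X ?a ?a ?a)))"
    unfolding rhs_xx_def blinfun.add_left by (intro norm_triangle_le add_mono norm_triangle_le order_refl)
  also have "\<dots> \<le> (\<sigma> * norm ?c + \<sigma> * R * norm ?b) + (\<sigma> * R * norm ?b + (\<sigma> * norm ?b * R + \<sigma> * R * R * R))"
    by (intro add_mono ab ba aaa norm_Gb(1)[OF X])
  also have "\<dots> = \<sigma> * (R ^ 3 + 3 * R * norm ?b + norm ?c)" by (simp add: algebra_simps power3_eq_cube)
  finally show ?thesis .
qed

lemma rhs_periodic: "rhs \<gamma> N (x + 2 * pi) y = rhs \<gamma> N x y" "rhs_x \<gamma> N (x + 2 * pi) y = rhs_x \<gamma> N x y"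
  by (simp_all add: rhs_def rhs_x_def approx_periodic)

lemma continuous_on_rhs_slice:
  assumes "admissible \<gamma> N" "y \<in> {0..1}"
  shows "continuous_on S (\<lambda>x. rhs \<gamma> N x y)" "continuous_on S (\<lambda>x. rhs_x \<gamma> N x y)" "continuous_on S (\<lambda>x. rhs_xx \<gamma> N x y)"
  using assms by (intro continuous_on_rhs continuous_on_id continuous_on_const; auto)+

lemma coef_rhs_x:
  assumes "admissible \<gamma> N" "y \<in> {0..1}"
  shows "coef (\<lambda>x. rhs_x \<gamma> N x y) k = cm (\<i> * of_int k) (coef (\<lambda>x. rhs \<gamma> N x y) k)"
    and "coef (\<lambda>x. rhs_xx \<gamma> N x y) k = cm (\<i> * of_int k) (coef (\<lambda>x. rhs_x \<gamma> N x y) k)"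
  using rhs_periodic[of \<gamma> N "-pi" y]
  by (intro coef_deriv rhs_deriv continuous_on_rhs_slice assms; simp)+

text \<open>
  The truncation to \<open>\<bar>k\<bar> \<le> n\<close> keeps every iterate a finite sum of modes.
\<close>

definition rhs_coef :: "(int \<Rightarrow> real \<Rightarrow> 'v) \<Rightarrow> nat \<Rightarrow> nat \<Rightarrow> int \<Rightarrow> real \<Rightarrow> 'v" where
  "rhs_coef \<gamma> N n k = (if \<bar>k\<bar> \<le> int n then (\<lambda>y. coef (\<lambda>x. rhs \<gamma> N x y) k) else (\<lambda>_. 0))"

lemma continuous_on_strip:
  assumes "admissible \<gamma> N"
  shows "continuous_on (UNIV \<times> {0..1}) (\<lambda>p. rhs \<gamma> N (fst p) (snd p))"
    "continuous_on (UNIV \<times> {0..1}) (\<lambda>p. rhs_x \<gamma> N (fst p) (snd p))"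
    "continuous_on (UNIV \<times> {0..1}) (\<lambda>p. rhs_xx \<gamma> N (fst p) (snd p))"
  by (intro continuous_on_rhs assms continuous_intros; auto)+

lemma continuous_modes_rhs_coef: "admissible \<gamma> N \<Longrightarrow> continuous_modes (rhs_coef \<gamma> N n)"
  unfolding rhs_coef_def using bessel2(1)[OF finite.emptyI continuous_on_strip(1)] by auto

text \<open>
  The weight \<open>\<bar>k\<bar>\<^sup>4\<close> turns the coefficients of the right-hand side into those of its second derivative, so by Bessel's inequality the
  left-hand side is bounded by the square integrals of \<open>rhs\<close> and \<open>rhs_xx\<close>. The derivative of third order that occurs in \<open>rhs_xx\<close> enters linearly, hence
  \<open>adm_L2\<close> suffices.
\<close>

lemma sobolev4_rhs_coef:
  assumes a: "admissible \<gamma> N" shows "sobolev 4 (rhs_coef \<gamma> N n) n \<le> \<mu>\<^sup>2"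
proof -
  let ?I = "{-int n..int n}"
  have c: "continuous_on Zs (\<lambda>p. (norm (approx m \<gamma> N v (fst p) (snd p)))\<^sup>2)" for m
    using a by (intro continuous_intros) (auto simp: cbox_Pair_eq)
  have "sobolev 4 (rhs_coef \<gamma> N n) n = (\<Sum>k\<in>?I. integral {0..1} (\<lambda>y. (norm (coef (\<lambda>x. rhs \<gamma> N x y) k))\<^sup>2))
      + (\<Sum>k\<in>?I. integral {0..1} (\<lambda>y. (norm (coef (\<lambda>x. rhs_xx \<gamma> N x y) k))\<^sup>2))"
  proof -
    have "integral {0..1} (\<lambda>y. (norm (coef (\<lambda>x. rhs_xx \<gamma> N x y) k))\<^sup>2)
       = integral {0..1} (\<lambda>y. \<bar>of_int k\<bar> ^ 4 * (norm (coef (\<lambda>x. rhs \<gamma> N x y) k))\<^sup>2)" for k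
    proof (rule integral_cong)
      fix y :: real assume y: "y \<in> {0..1}"
      show "(norm (coef (\<lambda>x. rhs_xx \<gamma> N x y) k))\<^sup>2 = \<bar>of_int k\<bar> ^ 4 * (norm (coef (\<lambda>x. rhs \<gamma> N x y) k))\<^sup>2"
        unfolding coef_rhs_x[OF a y] norm_cm norm_mult by (simp add: power2_eq_square power4_eq_xxxx)
    qed
    then show ?thesis
      unfolding sobolev_def sum.distrib[symmetric]
      by (intro sum.cong refl) (auto simp: energy_def rhs_coef_def algebra_simps)
  qed
  also have "\<dots> \<le> (1 / (2 * pi)) * integral Zs (\<lambda>p. (norm (rhs \<gamma> N (fst p) (snd p)))\<^sup>2)
      + (1 / (2 * pi)) * integral Zs (\<lambda>p. (norm (rhs_xx \<gamma> N (fst p) (snd p)))\<^sup>2)"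
    by (intro add_mono bessel2(2) continuous_on_strip a) auto
  also have "integral Zs (\<lambda>p. (norm (rhs \<gamma> N (fst p) (snd p)))\<^sup>2) \<le> integral Zs (\<lambda>p. (\<sigma> * R)\<^sup>2)"
    using a by (intro integral_le integrable_Zs continuous_intros power_mono norm_rhs Zs_snd) (auto simp: cbox_Pair_eq)
  also have "integral Zs (\<lambda>p. (norm (rhs_xx \<gamma> N (fst p) (snd p)))\<^sup>2) \<le>
      integral Zs (\<lambda>p. (3 * \<sigma>\<^sup>2) * (R ^ 6 + (9 * R\<^sup>2) * (norm (approx 2 \<gamma> N v (fst p) (snd p)))\<^sup>2 + (norm (approx 3 \<gamma> N v (fst p) (snd p)))\<^sup>2))"
  proof (intro integral_le integrable_Zs continuous_intros c)
    fix p :: "real \<times> real" assume "p \<in> Zs"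
    let ?b = "norm (approx 2 \<gamma> N v (fst p) (snd p))" and ?c = "norm (approx 3 \<gamma> N v (fst p) (snd p))"
    have "(norm (rhs_xx \<gamma> N (fst p) (snd p)))\<^sup>2 \<le> (\<sigma> * (R ^ 3 + 3 * R * ?b + ?c))\<^sup>2"
      using a \<open>p \<in> Zs\<close> by (intro power_mono norm_rhs_xx Zs_snd) auto
    also have "\<dots> = \<sigma>\<^sup>2 * (R ^ 3 + 3 * R * ?b + ?c)\<^sup>2" by (simp add: power_mult_distrib)
    also have "\<dots> \<le> \<sigma>\<^sup>2 * (3 * (R ^ 6 + 9 * R\<^sup>2 * ?b\<^sup>2 + ?c\<^sup>2))"
    proof (intro mult_left_mono)
      have 3: "(x + y + z)\<^sup>2 \<le> 3 * (x\<^sup>2 + y\<^sup>2 + z\<^sup>2)" for x y z :: real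
        using sum_squares_bound[of x y] sum_squares_bound[of x z] sum_squares_bound[of y z]
        by (simp add: power2_eq_square algebra_simps)
      show "(R ^ 3 + 3 * R * ?b + ?c)\<^sup>2 \<le> 3 * (R ^ 6 + 9 * R\<^sup>2 * ?b\<^sup>2 + ?c\<^sup>2)"
        using 3[of "R ^ 3" "3 * R * ?b" ?c] by (simp add: power_mult_distrib power_mult[symmetric])
    qed simp
    finally show "(norm (rhs_xx \<gamma> N (fst p) (snd p)))\<^sup>2 \<le> (3 * \<sigma>\<^sup>2) * (R ^ 6 + (9 * R\<^sup>2) * ?b\<^sup>2 + ?c\<^sup>2)" by (simp only: mult.assoc mult.left_commute)
  qed (use a in \<open>auto simp: cbox_Pair_eq\<close>)
  also have "integral Zs (\<lambda>p. (3 * \<sigma>\<^sup>2) * (R ^ 6 + (9 * R\<^sup>2) * (norm (approx 2 \<gamma> N v (fst p) (snd p)))\<^sup>2 + (norm (approx 3 \<gamma> N v (fst p) (snd p)))\<^sup>2))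
     = (3 * \<sigma>\<^sup>2) * (integral Zs (\<lambda>p. R ^ 6) + (9 * R\<^sup>2) * integral Zs (\<lambda>p. (norm (approx 2 \<gamma> N v (fst p) (snd p)))\<^sup>2) + integral Zs (\<lambda>p. (norm (approx 3 \<gamma> N v (fst p) (snd p)))\<^sup>2))"
    unfolding integral_mult_right
    by (subst integral_add integral_add; (intro integrable_Zs continuous_intros c)?)+ simp
  also have "\<dots> \<le> (3 * \<sigma>\<^sup>2) * (2 * pi * R ^ 6 + (9 * R\<^sup>2) * (18 * R\<^sup>2) + 18 * R\<^sup>2)"
    unfolding integral_Zs_const by (intro mult_left_mono add_mono adm_L2 a order_refl) auto
  finally have "sobolev 4 (rhs_coef \<gamma> N n) n \<le> (1 / (2 * pi)) * (2 * pi * (\<sigma> * R)\<^sup>2) + (1 / (2 * pi)) * ((3 * \<sigma>\<^sup>2) * (2 * pi * R ^ 6 + (9 * R\<^sup>2) * (18 * R\<^sup>2) + 18 * R\<^sup>2))"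
    unfolding integral_Zs_const by (simp add: divide_right_mono)
  also have "\<dots> = \<sigma>\<^sup>2 * (R\<^sup>2 + 3 * R ^ 6) + (1 / (2 * pi)) * (\<sigma>\<^sup>2 * (486 * R ^ 4 + 54 * R\<^sup>2))"
    by (simp add: field_simps power_mult_distrib)
  also have "\<dots> \<le> \<sigma>\<^sup>2 * (R\<^sup>2 + 3 * R ^ 6) + (1 / 6) * (\<sigma>\<^sup>2 * (486 * R ^ 4 + 54 * R\<^sup>2))"
    using pi_gt3 by (intro add_left_mono mult_right_mono) (auto simp: field_simps)
  also have "\<dots> = \<sigma>\<^sup>2 * (10 * R\<^sup>2 + 81 * R ^ 4 + 3 * R ^ 6)" by (simp add: algebra_simps)
  finally show ?thesis using small1 by simp
qed

lemma G_Lipschitz: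
  assumes "X \<in> ball 0 R" "Y \<in> ball 0 R"
  shows "norm (G X - G Y) \<le> \<sigma> * norm (X - Y)" "norm (G1 X - G1 Y) \<le> \<sigma> * norm (X - Y)"
  by (rule differentiable_bound[OF convex_ball[of 0 R] has_derivative_at_withinI[OF G_deriv] _ assms];
      simp add: norm_blinfun.rep_eq[symmetric] norm_G1)
     (rule differentiable_bound[OF convex_ball[of 0 R] has_derivative_at_withinI[OF G1_deriv] _ assms];
      simp add: norm_blinfun.rep_eq[symmetric] norm_G2)

text \<open>
  Here \<open>\<Delta> m\<close> is the difference of the \<open>m\<close>-th derivatives. The term in which a difference meets the derivative of
  second order, which has no uniform bound, is kept.
\<close>

lemma rhs_diff_bound:
  fixes x y :: real
  assumes a: "admissible \<gamma> N" and a': "admissible \<gamma>' N" and y: "y \<in> {0..1}"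
  defines "\<Delta> \<equiv> \<lambda>m. norm (approx m (\<lambda>k y. \<gamma> k y - \<gamma>' k y) N 0 x y)"
  shows "norm (rhs \<gamma> N x y - rhs \<gamma>' N x y) \<le> \<sigma> * (\<Delta> 1 + R * \<Delta> 0)"
    and "norm (rhs_x \<gamma> N x y - rhs_x \<gamma>' N x y) \<le> \<sigma> * (R\<^sup>2 * \<Delta> 0 + 2 * R * \<Delta> 1 + \<Delta> 2 + \<Delta> 0 * norm (approx 2 \<gamma>' N v x y))"
proof -
  define X where "X = approx 0 \<gamma> N v x y" define X' where "X' = approx 0 \<gamma>' N v x y"
  define p where "p = approx 1 \<gamma> N v x y" define p' where "p' = approx 1 \<gamma>' N v x y"
  define q where "q = approx 2 \<gamma> N v x y" define q' where "q' = approx 2 \<gamma>' N v x y"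
  have cc: "continuous_modes \<gamma>" "continuous_modes \<gamma>'" using a a' by auto
  have D: "\<Delta> 0 = norm (X - X')" "\<Delta> 1 = norm (p - p')" "\<Delta> 2 = norm (q - q')"
    unfolding \<Delta>_def X_def X'_def p_def p'_def q_def q'_def using approx_diff[OF cc y, of _ N v v x] by simp_all
  have X: "X \<in> ball 0 R" "X' \<in> ball 0 R" unfolding X_def X'_def using adm_approx_ball a a' y by blast+
  have p: "norm p \<le> R" "norm p' \<le> R" unfolding p_def p'_def using adm_approx[OF a y, of 1 x] adm_approx[OF a' y, of 1 x] by auto
  have GX: "norm ((G X - G X') w) \<le> \<sigma> * norm (X - X') * norm w" for w
    using norm_blinfun[of "G X - G X'" w] mult_right_mono[OF G_Lipschitz(1)[OF X] norm_ge_zero[of w]] by linarith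
  have G1X: "norm ((G1 X - G1 X') w w') \<le> \<sigma> * norm (X - X') * norm w * norm w'" for w w'
  proof -
    have "norm ((G1 X - G1 X') w w') \<le> norm ((G1 X - G1 X') w) * norm w'" by (rule norm_blinfun)
    also have "\<dots> \<le> (norm (G1 X - G1 X') * norm w) * norm w'" by (intro mult_right_mono norm_blinfun) auto
    also have "\<dots> \<le> (\<sigma> * norm (X - X') * norm w) * norm w'" by (intro mult_right_mono G_Lipschitz X) auto
    finally show ?thesis .
  qed
  have sm: "\<sigma> * norm (X - X') * norm p \<le> \<sigma> * norm (X - X') * R"
    using \<sigma>_nonneg p by (intro mult_left_mono) auto
  have "rhs \<gamma> N x y - rhs \<gamma>' N x y = G X' (p - p') + (G X - G X') p"
    by (simp add: rhs_def X_def X'_def p_def p'_def blinfun.diff_left blinfun.diff_right)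
  also have "norm \<dots> \<le> \<sigma> * norm (p - p') + \<sigma> * norm (X - X') * R"
    by (intro norm_triangle_le add_mono norm_Gb(1) X order_trans[OF GX sm])
  finally show "norm (rhs \<gamma> N x y - rhs \<gamma>' N x y) \<le> \<sigma> * (\<Delta> 1 + R * \<Delta> 0)"
    unfolding D by (simp add: algebra_simps)
  have "rhs_x \<gamma> N x y - rhs_x \<gamma>' N x y = (G X (q - q') + (G X - G X') q') + ((G1 X - G1 X') p p + (G1 X' (p - p') p + G1 X' p' (p - p')))"
    by (simp add: rhs_x_def X_def X'_def p_def p'_def q_def q'_def blinfun.diff_left blinfun.diff_right)
  also have "norm \<dots> \<le> (\<sigma> * norm (q - q') + \<sigma> * norm (X - X') * norm q') + (\<sigma> * norm (X - X') * R * R + (\<sigma> * norm (p - p') * R + \<sigma> * R * norm (p - p')))"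
  proof (intro norm_triangle_le add_mono norm_Gb(1) X GX)
    show "norm ((G1 X - G1 X') p p) \<le> \<sigma> * norm (X - X') * R * R"
      by (rule order_trans[OF G1X]) (intro mult_mono p mult_nonneg_nonneg \<sigma>_nonneg norm_ge_zero order_refl; use R_pos in simp)
    show "norm (G1 X' (p - p') p) \<le> \<sigma> * norm (p - p') * R"
      by (rule order_trans[OF norm_Gb(3)[OF X(2)]]) (intro mult_left_mono p mult_nonneg_nonneg \<sigma>_nonneg norm_ge_zero)
    show "norm (G1 X' p' (p - p')) \<le> \<sigma> * R * norm (p - p')"
      by (rule order_trans[OF norm_Gb(3)[OF X(2)]]) (intro mult_right_mono mult_left_mono p \<sigma>_nonneg norm_ge_zero)
  qed
  finally show "norm (rhs_x \<gamma> N x y - rhs_x \<gamma>' N x y) \<le> \<sigma> * (R\<^sup>2 * \<Delta> 0 + 2 * R * \<Delta> 1 + \<Delta> 2 + \<Delta> 0 * norm (approx 2 \<gamma>' N v x y))"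
    unfolding D by (simp add: algebra_simps q'_def power2_eq_square)
qed

end

context real_structure begin

text \<open>
  Apply the scalar result to the \<open>J\<close>-complex linear functionals \<open>L\<close> with real part \<open>\<lambda>w. inner w b\<close>.
\<close>

lemma coef_complete:
  assumes c: "continuous_on UNIV \<Phi>" and per: "\<And>x. \<Phi> (x + 2 * pi) = \<Phi> x"
    and z: "\<And>k. coef \<Phi> k = 0" and x: "x \<in> {-pi..pi}"
  shows "\<Phi> x = 0"
proof (rule euclidean_eqI)
  fix b :: 'v
  define L where "L w = Complex (inner w b) (- inner (J w) b)" for w
  have L: "bounded_linear L"
  proof -
    have "linear L" by (rule linearI) (simp_all add: L_def J_add J_scale inner_add_left complex_eq_iff)
    then show ?thesis by (simp add: linear_conv_bounded_linear)
  qed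
  have Lz: "L (\<Phi> x) * cis (of_int k * x) = L (cm (ek k x) (\<Phi> x))" for k x
    by (simp add: L_def complex_eq_iff cm_def J_add J_scale J_minus inner_add_left algebra_simps)
  have "L (\<Phi> x) = 0"
  proof (rule trig_complete_complex[OF _ _ _ x])
    show "continuous_on UNIV (\<lambda>x. L (\<Phi> x))" by (rule bounded_linear.continuous_on[OF L c])
    show "L (\<Phi> (x + 2 * pi)) = L (\<Phi> x)" for x using per by simp
    fix k
    have "integral {-pi..pi} (\<lambda>x. cm (ek k x) (\<Phi> x)) = 0" using z[of "-k"] by (simp add: coef_def)
    moreover have "integral {-pi..pi} (\<lambda>x. L (cm (ek k x) (\<Phi> x))) = L (integral {-pi..pi} (\<lambda>x. cm (ek k x) (\<Phi> x)))"
      by (intro integral_linear[OF _ L, unfolded o_def] integrable_continuous_interval continuous_intros continuous_on_subset[OF c]) auto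
    ultimately show "integral {-pi..pi} (\<lambda>x. L (\<Phi> x) * cis (of_int k * x)) = 0"
      unfolding Lz by (simp add: L_def complex_eq_iff)
  qed
  then show "inner (\<Phi> x) b = inner 0 b" by (simp add: L_def complex_eq_iff)
qed

lemma norm_coef_le:
  assumes "continuous_on {-pi..pi} h" "\<And>x. x \<in> {-pi..pi} \<Longrightarrow> norm (h x) \<le> B"
  shows "norm (coef h k) \<le> B"
proof -
  have "norm (integral {-pi..pi} (\<lambda>x. cm (ek (- k) x) (h x))) \<le> integral {-pi..pi} (\<lambda>x::real. B)"
    using assms by (intro integral_norm_bound_integral integrable_continuous_interval continuous_intros) (auto simp: norm_cm)
  then show ?thesis by (simp add: coef_def divide_simps mult.commute)
qed

lemma coef_integral:
  fixes y :: real
  assumes q: "continuous_on ({-pi..pi} \<times> {0..y}) (\<lambda>p. q (fst p) (snd p))"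
    and z: "\<And>s. s \<in> {0..y} \<Longrightarrow> coef (\<lambda>x. q x s) k = 0"
  shows "coef (\<lambda>x. integral {0..y} (q x)) k = 0"
proof -
  have qx: "q x integrable_on {0..y}" if "x \<in> {-pi..pi}" for x
  proof -
    have "continuous_on {0..y} (\<lambda>s. q (fst (x, s)) (snd (x, s)))"
      by (rule continuous_on_compose2[OF q]) (use that in \<open>auto intro!: continuous_intros\<close>)
    from integrable_continuous_interval[OF this] show ?thesis by simp
  qed
  have "integral {-pi..pi} (\<lambda>x. cm (ek (- k) x) (integral {0..y} (q x)))
     = integral {-pi..pi} (\<lambda>x. integral {0..y} (\<lambda>s. cm (ek (- k) x) (q x s)))"
    using integral_linear[OF qx cm.bounded_linear_right] by (intro integral_cong) (simp add: o_def)
  also have "\<dots> = integral {0..y} (\<lambda>s. integral {-pi..pi} (\<lambda>x. cm (ek (- k) x) (q x s)))"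
  proof -
    have "continuous_on (cbox (-pi, 0) (pi, y)) (\<lambda>(x, s). cm (ek (- k) x) (q x s))"
      unfolding case_prod_unfold cbox_Pair_eq using q by (intro continuous_intros) auto
    from integral_swap_continuous[OF this] show ?thesis by simp
  qed
  also have "\<dots> = integral {0..y} (\<lambda>s. 0)"
    using z by (intro integral_cong) (simp add: coef_def)
  finally show ?thesis by (simp add: coef_def)
qed

end

context strip_equation begin

text \<open>
  The left-hand side is the squared norm that controls one derivative of \<open>rhs\<close>. In the product left over by \<open>rhs_diff_bound\<close>, the difference is
  estimated uniformly and the second derivative in the square mean.
\<close>

lemma rhs_diff_L2:
  assumes a: "admissible \<gamma> N" and a': "admissible \<gamma>' N"
  shows "(1 / (2 * pi)) * integral Zs (\<lambda>p. (norm (rhs \<gamma> N (fst p) (snd p) - rhs \<gamma>' N (fst p) (snd p)))\<^sup>2)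
     + (1 / (2 * pi)) * integral Zs (\<lambda>p. (norm (rhs_x \<gamma> N (fst p) (snd p) - rhs_x \<gamma>' N (fst p) (snd p)))\<^sup>2)
     \<le> (1 / 4) * sobolev 2 (\<lambda>k y. \<gamma> k y - \<gamma>' k y) N"
proof -
  let ?d = "\<lambda>k y. \<gamma> k y - \<gamma>' k y"
  define K where "K = C0 * sobolev 2 ?d N"
  have cc: "continuous_modes ?d" using a a' by (intro continuous_modes_diff) auto
  define D where "D m p = (norm (approx m ?d N 0 (fst p) (snd p)))\<^sup>2" for m and p :: "real \<times> real"
  define b where "b p = (norm (approx 2 \<gamma>' N v (fst p) (snd p)))\<^sup>2" for p :: "real \<times> real"
  have cD: "continuous_on Zs (D m)" for m
    unfolding D_def using cc by (intro continuous_intros) (auto simp: cbox_Pair_eq)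
  have cb: "continuous_on Zs b"
    unfolding b_def using a' by (intro continuous_intros) (auto simp: cbox_Pair_eq)
  have iD: "integral Zs (D m) \<le> K" if "m \<le> 2" for m
    unfolding D_def K_def by (rule approx0_L2(1)[OF cc that])
  have ib: "integral Zs b \<le> 18 * R\<^sup>2"
    unfolding b_def by (rule adm_L2[OF a']) simp
  have K: "K \<ge> 0" unfolding K_def using C0 sobolev_nonneg[OF cc] by simp
  have D0: "D 0 p \<le> K" if "p \<in> Zs" for p
    unfolding D_def K_def by (intro approx0_sup(1) cc Zs_snd that)
  have "integral Zs (\<lambda>p. (norm (rhs \<gamma> N (fst p) (snd p) - rhs \<gamma>' N (fst p) (snd p)))\<^sup>2)
      + integral Zs (\<lambda>p. (norm (rhs_x \<gamma> N (fst p) (snd p) - rhs_x \<gamma>' N (fst p) (snd p)))\<^sup>2)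
     = integral Zs (\<lambda>p. (norm (rhs \<gamma> N (fst p) (snd p) - rhs \<gamma>' N (fst p) (snd p)))\<^sup>2 + (norm (rhs_x \<gamma> N (fst p) (snd p) - rhs_x \<gamma>' N (fst p) (snd p)))\<^sup>2)"
    by (intro integral_add[symmetric] integrable_Zs continuous_on_power continuous_on_norm continuous_on_diff continuous_on_rhs a a' continuous_intros) (auto simp: cbox_Pair_eq)
  also have "\<dots> \<le> integral Zs (\<lambda>p. \<sigma>\<^sup>2 * ((2 * R\<^sup>2 + 4 * R ^ 4) * D 0 p + (2 + 16 * R\<^sup>2) * D 1 p + 4 * D 2 p + 4 * K * b p))"
  proof (rule integral_le)
    show "(\<lambda>p. (norm (rhs \<gamma> N (fst p) (snd p) - rhs \<gamma>' N (fst p) (snd p)))\<^sup>2 + (norm (rhs_x \<gamma> N (fst p) (snd p) - rhs_x \<gamma>' N (fst p) (snd p)))\<^sup>2) integrable_on Zs"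
      by (intro integrable_Zs continuous_on_add continuous_on_power continuous_on_norm continuous_on_diff continuous_on_rhs a a' continuous_intros) (auto simp: cbox_Pair_eq)
    show "(\<lambda>p. \<sigma>\<^sup>2 * ((2 * R\<^sup>2 + 4 * R ^ 4) * D 0 p + (2 + 16 * R\<^sup>2) * D 1 p + 4 * D 2 p + 4 * K * b p)) integrable_on Zs"
      by (intro integrable_Zs continuous_intros cD cb)
    fix p :: "real \<times> real" assume p: "p \<in> Zs"
    define d where "d m = norm (approx m ?d N 0 (fst p) (snd p))" for m
    define c where "c = norm (approx 2 \<gamma>' N v (fst p) (snd p))"
    have Dd: "D m p = (d m)\<^sup>2" "b p = c\<^sup>2" for m by (simp_all add: D_def d_def b_def c_def)
    have "(norm (rhs \<gamma> N (fst p) (snd p) - rhs \<gamma>' N (fst p) (snd p)))\<^sup>2 \<le> (\<sigma> * (d 1 + R * d 0))\<^sup>2"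
      unfolding d_def by (intro power_mono rhs_diff_bound(1)[OF a a' Zs_snd[OF p]]) auto
    moreover have "(norm (rhs_x \<gamma> N (fst p) (snd p) - rhs_x \<gamma>' N (fst p) (snd p)))\<^sup>2 \<le> (\<sigma> * (R\<^sup>2 * d 0 + 2 * R * d 1 + d 2 + d 0 * c))\<^sup>2"
      unfolding d_def c_def by (intro power_mono rhs_diff_bound(2)[OF a a' Zs_snd[OF p]]) auto
    moreover have "(\<sigma> * (d 1 + R * d 0))\<^sup>2 \<le> \<sigma>\<^sup>2 * (2 * (d 1)\<^sup>2 + 2 * R\<^sup>2 * (d 0)\<^sup>2)"
      unfolding power_mult_distrib[of \<sigma>] using sum_squares_bound[of "d 1" "R * d 0"]
      by (intro mult_left_mono) (auto simp: power2_sum power_mult_distrib)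
    moreover have "(\<sigma> * (R\<^sup>2 * d 0 + 2 * R * d 1 + d 2 + d 0 * c))\<^sup>2 \<le> \<sigma>\<^sup>2 * (4 * R ^ 4 * (d 0)\<^sup>2 + 16 * R\<^sup>2 * (d 1)\<^sup>2 + 4 * (d 2)\<^sup>2 + 4 * K * c\<^sup>2)"
      unfolding power_mult_distrib[of \<sigma>]
    proof (intro mult_left_mono)
      have 4: "(x + y + z + w)\<^sup>2 \<le> 4 * (x\<^sup>2 + y\<^sup>2 + z\<^sup>2 + w\<^sup>2)" for x y z w :: real
        using sum_squares_bound[of x y] sum_squares_bound[of x z] sum_squares_bound[of y z] sum_squares_bound[of x w] sum_squares_bound[of y w] sum_squares_bound[of z w]
        by (simp add: power2_eq_square algebra_simps)
      have "(d 0 * c)\<^sup>2 \<le> K * c\<^sup>2" using D0[OF p] unfolding Dd power_mult_distrib by (intro mult_right_mono) auto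
      then show "(R\<^sup>2 * d 0 + 2 * R * d 1 + d 2 + d 0 * c)\<^sup>2 \<le> 4 * R ^ 4 * (d 0)\<^sup>2 + 16 * R\<^sup>2 * (d 1)\<^sup>2 + 4 * (d 2)\<^sup>2 + 4 * K * c\<^sup>2"
        using 4[of "R\<^sup>2 * d 0" "2 * R * d 1" "d 2" "d 0 * c"] by (simp add: power_mult_distrib power_mult[symmetric])
    qed simp
    ultimately show "(norm (rhs \<gamma> N (fst p) (snd p) - rhs \<gamma>' N (fst p) (snd p)))\<^sup>2 + (norm (rhs_x \<gamma> N (fst p) (snd p) - rhs_x \<gamma>' N (fst p) (snd p)))\<^sup>2
       \<le> \<sigma>\<^sup>2 * ((2 * R\<^sup>2 + 4 * R ^ 4) * D 0 p + (2 + 16 * R\<^sup>2) * D 1 p + 4 * D 2 p + 4 * K * b p)"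
      unfolding Dd by (simp add: algebra_simps)
  qed
  also have "\<dots> = \<sigma>\<^sup>2 * ((2 * R\<^sup>2 + 4 * R ^ 4) * integral Zs (D 0) + (2 + 16 * R\<^sup>2) * integral Zs (D 1) + 4 * integral Zs (D 2) + 4 * K * integral Zs b)"
    by (subst integral_mult_right, subst integral_add, (intro integrable_Zs continuous_intros cD cb)+,
        subst integral_add, (intro integrable_Zs continuous_intros cD cb)+,
        subst integral_add, (intro integrable_Zs continuous_intros cD cb)+) simp
  also have "\<dots> \<le> \<sigma>\<^sup>2 * ((2 * R\<^sup>2 + 4 * R ^ 4) * K + (2 + 16 * R\<^sup>2) * K + 4 * K + 4 * K * (18 * R\<^sup>2))"
    using K by (intro mult_left_mono add_mono iD ib) auto
  also have "\<dots> = (\<sigma>\<^sup>2 * C0 * (2 * (1 + R\<^sup>2) + 4 * (R ^ 4 + 22 * R\<^sup>2 + 1))) * sobolev 2 ?d N"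
    unfolding K_def by (simp add: algebra_simps)
  also have "\<dots> \<le> 1 * sobolev 2 ?d N" by (intro mult_right_mono small2 sobolev_nonneg cc)
  finally have "integral Zs (\<lambda>p. (norm (rhs \<gamma> N (fst p) (snd p) - rhs \<gamma>' N (fst p) (snd p)))\<^sup>2)
      + integral Zs (\<lambda>p. (norm (rhs_x \<gamma> N (fst p) (snd p) - rhs_x \<gamma>' N (fst p) (snd p)))\<^sup>2) \<le> sobolev 2 ?d N" by simp
  then have "(1 / (2 * pi)) * (integral Zs (\<lambda>p. (norm (rhs \<gamma> N (fst p) (snd p) - rhs \<gamma>' N (fst p) (snd p)))\<^sup>2)
      + integral Zs (\<lambda>p. (norm (rhs_x \<gamma> N (fst p) (snd p) - rhs_x \<gamma>' N (fst p) (snd p)))\<^sup>2)) \<le> (1 / 4) * sobolev 2 ?d N"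
    using sobolev_nonneg[OF cc, of 2 N] pi_gt3
    by (intro order_trans[OF mult_left_mono mult_right_mono]) (auto simp: field_simps)
  then show ?thesis by (simp only: distrib_left)
qed

text \<open>
  Frequencies \<open>\<bar>k\<bar> \<le> n\<close> are present on both sides and are contracted. Those with \<open>n < \<bar>k\<bar> \<le> m\<close> come from the first argument alone; there
  the weight of order \<open>2\<close> is at most \<open>2 / (n + 1)\<^sup>2\<close> times the weight of order \<open>4\<close>, for which the bound \<open>\<mu>\<^sup>2\<close> is known.
\<close>

lemma sobolev2_rhs_coef_diff:
  assumes a: "admissible \<gamma> N" and a': "admissible \<gamma>' N" and nm: "n \<le> m"
  shows "sobolev 2 (\<lambda>k y. rhs_coef \<gamma> N m k y - rhs_coef \<gamma>' N n k y) m
    \<le> (1 / 4) * sobolev 2 (\<lambda>k y. \<gamma> k y - \<gamma>' k y) N + 2 * \<mu>\<^sup>2 / (real n + 1)\<^sup>2"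
proof -
  let ?I = "{-int m..int m}"
  let ?d0 = "\<lambda>x y. rhs \<gamma> N x y - rhs \<gamma>' N x y" and ?d1 = "\<lambda>x y. rhs_x \<gamma> N x y - rhs_x \<gamma>' N x y"
  let ?e = "\<lambda>d k. integral {0..1} (\<lambda>y. (norm (coef (\<lambda>x. d x y) k))\<^sup>2)"
  let ?c = "\<lambda>k y. rhs_coef \<gamma> N m k y - rhs_coef \<gamma>' N n k y"
  have pos: "?e ?d0 k \<ge> 0" "?e ?d1 k \<ge> 0" for k
  proof -
    have "continuous_on (UNIV \<times> {0..1}) (\<lambda>p. ?d0 (fst p) (snd p))" "continuous_on (UNIV \<times> {0..1}) (\<lambda>p. ?d1 (fst p) (snd p))"
      by (intro continuous_on_diff continuous_on_strip a a')+
    from this[THEN bessel2(1)[OF finite.emptyI]]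
    show "?e ?d0 k \<ge> 0" "?e ?d1 k \<ge> 0" by (intro integral_nonneg integrable_continuous_interval continuous_intros; simp)+
  qed
  have cfp: "energy (rhs_coef \<gamma> N m) k \<ge> 0" for k by (rule energy_nonneg[OF continuous_modes_rhs_coef[OF a]])
  have tm: "(1 + \<bar>of_int k\<bar> ^ 2) * energy ?c k \<le> (?e ?d0 k + ?e ?d1 k) + (2 / (real n + 1)\<^sup>2) * ((1 + \<bar>of_int k\<bar> ^ 4) * energy (rhs_coef \<gamma> N m) k)"
    if k: "k \<in> ?I" for k
  proof (cases "\<bar>k\<bar> \<le> int n")
    case True
    have km: "\<bar>k\<bar> \<le> int m" using True nm by linarith
    have "?c k y = coef (\<lambda>x. ?d0 x y) k" if "y \<in> {0..1}" for y
      using True km coef_diff[OF continuous_on_rhs_slice(1)[OF a that] continuous_on_rhs_slice(1)[OF a' that]] by (simp add: rhs_coef_def)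
    then have e1: "energy ?c k = ?e ?d0 k" unfolding energy_def by (intro integral_cong) simp
    have "\<bar>of_int k\<bar> ^ 2 * ?e ?d0 k = integral {0..1} (\<lambda>y. \<bar>of_int k\<bar> ^ 2 * (norm (coef (\<lambda>x. ?d0 x y) k))\<^sup>2)" by simp
    also have "\<dots> = ?e ?d1 k"
    proof (rule integral_cong)
      fix y :: real assume y: "y \<in> {0..1}"
      have "coef (\<lambda>x. ?d1 x y) k = cm (\<i> * of_int k) (coef (\<lambda>x. ?d0 x y) k)"
        by (simp add: coef_diff continuous_on_rhs_slice a a' y[simplified] coef_rhs_x(1)[OF a y] coef_rhs_x(1)[OF a' y] cm.diff_right)
      then show "\<bar>of_int k\<bar> ^ 2 * (norm (coef (\<lambda>x. ?d0 x y) k))\<^sup>2 = (norm (coef (\<lambda>x. ?d1 x y) k))\<^sup>2"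
        by (simp add: norm_cm norm_mult power_mult_distrib)
    qed
    finally have "(1 + \<bar>of_int k\<bar> ^ 2) * energy ?c k = ?e ?d0 k + ?e ?d1 k" unfolding e1 by (simp add: distrib_right)
    moreover have "(2 / (real n + 1)\<^sup>2) * ((1 + \<bar>of_int k\<bar> ^ 4) * energy (rhs_coef \<gamma> N m) k) \<ge> 0"
      using cfp by simp
    ultimately show ?thesis by linarith
  next
    case False
    have e1: "energy ?c k = energy (rhs_coef \<gamma> N m) k" using False by (simp add: energy_def rhs_coef_def)
    have "real n + 1 \<le> \<bar>real_of_int k\<bar>" using False by linarith
    then have "(real n + 1)\<^sup>2 \<le> \<bar>real_of_int k\<bar>\<^sup>2" by (intro power_mono) auto
    then have "(real n + 1)\<^sup>2 * (1 + \<bar>of_int k\<bar> ^ 2) \<le> \<bar>real_of_int k\<bar>\<^sup>2 * (1 + \<bar>of_int k\<bar> ^ 2)" by (intro mult_right_mono) auto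
    also have "\<dots> \<le> 2 * (1 + \<bar>of_int k\<bar> ^ 4)"
      using sum_squares_bound[of "1" "(real_of_int k)\<^sup>2"] zero_le_power2[of "(real_of_int k)\<^sup>2"] by (simp add: power2_eq_square power4_eq_xxxx algebra_simps)
    finally have "1 + \<bar>of_int k\<bar> ^ 2 \<le> (2 / (real n + 1)\<^sup>2) * (1 + \<bar>of_int k\<bar> ^ 4)"
      by (simp add: field_simps)
    from mult_right_mono[OF this cfp[of k]] show ?thesis using pos[of k] unfolding e1 mult.assoc by linarith
  qed
  have "sobolev 2 ?c m \<le> (\<Sum>k\<in>?I. (?e ?d0 k + ?e ?d1 k) + (2 / (real n + 1)\<^sup>2) * ((1 + \<bar>of_int k\<bar> ^ 4) * energy (rhs_coef \<gamma> N m) k))"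
    unfolding sobolev_def by (rule sum_mono[OF tm])
  also have "\<dots> = ((\<Sum>k\<in>?I. ?e ?d0 k) + (\<Sum>k\<in>?I. ?e ?d1 k)) + (2 / (real n + 1)\<^sup>2) * sobolev 4 (rhs_coef \<gamma> N m) m"
    unfolding sobolev_def sum_distrib_left by (simp only: sum.distrib)
  also have "\<dots> \<le> (1 / 4) * sobolev 2 (\<lambda>k y. \<gamma> k y - \<gamma>' k y) N + (2 / (real n + 1)\<^sup>2) * \<mu>\<^sup>2"
  proof (intro add_mono mult_left_mono sobolev4_rhs_coef a)
    show "(\<Sum>k\<in>?I. ?e ?d0 k) + (\<Sum>k\<in>?I. ?e ?d1 k) \<le> (1 / 4) * sobolev 2 (\<lambda>k y. \<gamma> k y - \<gamma>' k y) N"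
      by (rule order_trans[OF add_mono rhs_diff_L2[OF a a']]) (intro bessel2(2) continuous_on_diff continuous_on_strip a a'; simp)+
  qed simp
  finally show ?thesis by simp
qed

section \<open>Convergence of the iteration\<close>

primrec iter :: "nat \<Rightarrow> int \<Rightarrow> real \<Rightarrow> 'v" where
  "iter 0 = (\<lambda>k y. 0)"
| "iter (Suc n) = rhs_coef (iter n) n (Suc n)"

lemma iter_support: "\<bar>k\<bar> > int n \<Longrightarrow> iter n k = (\<lambda>_. 0)"
  by (cases n) (auto simp: rhs_coef_def)

lemma sobolev_support:
  assumes "\<And>k. \<bar>k\<bar> > int n \<Longrightarrow> \<gamma> k = (\<lambda>_. 0)" "n \<le> N"
  shows "sobolev p \<gamma> N = sobolev p \<gamma> n"
  unfolding sobolev_def using assms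
  by (intro sum.mono_neutral_right ballI) (auto simp: energy_def)

lemma adm_iter: "n \<le> N \<Longrightarrow> admissible (iter n) N"
proof -
  have "admissible (iter n) n"
  proof (induction n)
    case 0
    then show ?case by (simp add: sobolev_def energy_def continuous_intros)
  next
    case (Suc n)
    then show ?case using continuous_modes_rhs_coef[OF Suc] sobolev4_rhs_coef[OF Suc] by simp
  qed
  then show "n \<le> N \<Longrightarrow> admissible (iter n) N" using sobolev_support[of n "iter n" N 4] iter_support[of n] by auto
qed

lemma rhs_support: "n \<le> N \<Longrightarrow> rhs (iter n) N = rhs (iter n) n"
  unfolding rhs_def using approx_support[of n "iter n" N] iter_support[of n] by (intro ext) auto

lemma rhs_coef_support: "n \<le> N \<Longrightarrow> rhs_coef (iter n) N m = rhs_coef (iter n) n m"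
  using rhs_support[of n N] by (intro ext) (auto simp: rhs_coef_def)

text \<open>
  Induction on \<open>n\<close>: the contraction factor \<open>1/4\<close> outweighs the growth of \<open>n + 1\<close>, and the truncation error decays quadratically.
\<close>

lemma iter_dist2: "n \<le> m \<Longrightarrow> sobolev 2 (\<lambda>k y. iter m k y - iter n k y) m \<le> 8 * \<mu>\<^sup>2 / (real n + 1)"
proof (induction n arbitrary: m)
  case 0
  have a: "admissible (iter m) m" by (rule adm_iter) simp
  then have "sobolev 2 (iter m) m \<le> sobolev 4 (iter m) m" by (intro sobolev_mono) auto
  also have "\<dots> \<le> \<mu>\<^sup>2" using a by simp
  also have "\<dots> \<le> 8 * \<mu>\<^sup>2" by simp
  finally show ?case by simp
next
  case (Suc n)
  then obtain m' where m: "m = Suc m'" "n \<le> m'" by (cases m) auto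
  have "sobolev 2 (\<lambda>k y. iter m k y - iter (Suc n) k y) m
     = sobolev 2 (\<lambda>k y. rhs_coef (iter m') m' (Suc m') k y - rhs_coef (iter n) m' (Suc n) k y) (Suc m')"
    using rhs_coef_support[OF m(2)] by (simp add: m(1))
  also have "\<dots> \<le> (1 / 4) * sobolev 2 (\<lambda>k y. iter m' k y - iter n k y) m' + 2 * \<mu>\<^sup>2 / (real (Suc n) + 1)\<^sup>2"
    using m(2) by (intro sobolev2_rhs_coef_diff adm_iter) auto
  also have "\<dots> \<le> (1 / 4) * (8 * \<mu>\<^sup>2 / (real n + 1)) + 2 * \<mu>\<^sup>2 / (real (Suc n) + 1)\<^sup>2"
    using Suc.IH[OF m(2)] by simp
  also have "\<dots> \<le> 4 * \<mu>\<^sup>2 / (real (Suc n) + 1) + 2 * \<mu>\<^sup>2 / (real (Suc n) + 1)"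
  proof (intro add_mono)
    have "(real n + 2) * (2 * \<mu>\<^sup>2) \<le> (2 * (real n + 1)) * (2 * \<mu>\<^sup>2)" by (intro mult_right_mono) auto
    then show "(1 / 4) * (8 * \<mu>\<^sup>2 / (real n + 1)) \<le> 4 * \<mu>\<^sup>2 / (real (Suc n) + 1)"
      by (simp add: field_simps)
    have "real (Suc n) + 1 \<le> (real (Suc n) + 1)\<^sup>2" by (simp add: power2_eq_square algebra_simps)
    then show "2 * \<mu>\<^sup>2 / (real (Suc n) + 1)\<^sup>2 \<le> 2 * \<mu>\<^sup>2 / (real (Suc n) + 1)"
      by (intro divide_left_mono) auto
  qed
  also have "\<dots> \<le> 8 * \<mu>\<^sup>2 / (real (Suc n) + 1)" by (simp add: divide_simps)
  finally show ?case .
qed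

text \<open>
  Uniform convergence of the first derivatives needs a norm stronger than the one in which the iteration contracts. Interpolate between that
  norm, which tends to zero, and \<open>sobolev 4\<close>, which stays bounded, by \<open>t\<^sup>3 \<le> s t\<^sup>2 + t\<^sup>4 / s\<close> with \<open>s = sqrt (n + 1)\<close>.
\<close>

lemma iter_dist3:
  assumes nm: "n \<le> m"
  shows "sobolev 3 (\<lambda>k y. iter m k y - iter n k y) m \<le> 12 * \<mu>\<^sup>2 / sqrt (real n + 1)"
proof -
  let ?d = "\<lambda>k y. iter m k y - iter n k y" and ?I = "{-int m..int m}"
  define s where "s = sqrt (real n + 1)"
  have s: "s \<ge> 1" "s * s = real n + 1" by (simp_all add: s_def)
  have a: "admissible (iter m) m" "admissible (iter n) m" using nm adm_iter[of m m] adm_iter[of n m] by blast+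
  have cc: "continuous_modes ?d" using a by (intro continuous_modes_diff) auto
  have "sobolev 4 ?d m \<le> 2 * sobolev 4 (iter m) m + 2 * sobolev 4 (iter n) m"
  proof -
    have "energy ?d k \<le> 2 * energy (iter m) k + 2 * energy (iter n) k" for k
    proof -
      have c: "continuous_on {0..1} (iter m k)" "continuous_on {0..1} (iter n k)" using a by auto
      have "energy ?d k \<le> integral {0..1} (\<lambda>y. 2 * (norm (iter m k y))\<^sup>2 + 2 * (norm (iter n k y))\<^sup>2)"
        unfolding energy_def
      proof (intro integral_le integrable_continuous_interval continuous_intros c)
        fix y
        have "(norm (iter m k y - iter n k y))\<^sup>2 \<le> (norm (iter m k y) + norm (iter n k y))\<^sup>2" by (intro power_mono norm_triangle_ineq4) auto
        then show "(norm (iter m k y - iter n k y))\<^sup>2 \<le> 2 * (norm (iter m k y))\<^sup>2 + 2 * (norm (iter n k y))\<^sup>2"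
          using sum_squares_bound[of "norm (iter m k y)" "norm (iter n k y)"] by (simp add: power2_sum)
      qed
      also have "\<dots> = integral {0..1} (\<lambda>y. 2 * (norm (iter m k y))\<^sup>2) + integral {0..1} (\<lambda>y. 2 * (norm (iter n k y))\<^sup>2)"
        by (intro integral_add integrable_continuous_interval continuous_intros c)
      finally show ?thesis by (simp add: energy_def)
    qed
    then have "sobolev 4 ?d m \<le> (\<Sum>k\<in>?I. (1 + \<bar>of_int k\<bar> ^ 4) * (2 * energy (iter m) k + 2 * energy (iter n) k))"
      unfolding sobolev_def by (intro sum_mono mult_left_mono) auto
    also have "\<dots> = (\<Sum>k\<in>?I. 2 * ((1 + \<bar>of_int k\<bar> ^ 4) * energy (iter m) k) + 2 * ((1 + \<bar>of_int k\<bar> ^ 4) * energy (iter n) k))"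
      by (intro sum.cong refl) (simp add: algebra_simps)
    also have "\<dots> = 2 * sobolev 4 (iter m) m + 2 * sobolev 4 (iter n) m"
      unfolding sobolev_def by (simp only: sum.distrib sum_distrib_left)
    finally show ?thesis .
  qed
  then have E4: "sobolev 4 ?d m \<le> 4 * \<mu>\<^sup>2" using a by linarith
  have "sobolev 3 ?d m \<le> (\<Sum>k\<in>?I. s * ((1 + \<bar>of_int k\<bar> ^ 2) * energy ?d k) + (1 / s) * ((1 + \<bar>of_int k\<bar> ^ 4) * energy ?d k))"
    unfolding sobolev_def
  proof (rule sum_mono)
    fix k
    define t where "t = \<bar>real_of_int k\<bar>"
    have t0': "t \<ge> 0" by (simp add: t_def)
    have "0 \<le> (s * t - t\<^sup>2)\<^sup>2 / s" using s by simp
    also have "\<dots> = s * t\<^sup>2 + t ^ 4 / s - 2 * t ^ 3"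
      using s by (simp add: field_simps power2_eq_square power3_eq_cube power4_eq_xxxx)
    finally have "t ^ 3 \<le> s * t\<^sup>2 + t ^ 4 / s" using zero_le_power[OF t0', of 3] by linarith
    then have "1 + t ^ 3 \<le> s * (1 + t ^ 2) + (1 / s) * (1 + t ^ 4)"
      using s by (simp add: algebra_simps add_divide_distrib) (smt (verit) divide_nonneg_nonneg)
    from mult_right_mono[OF this energy_nonneg[OF cc, of k]]
    show "(1 + \<bar>real_of_int k\<bar> ^ 3) * energy ?d k \<le> s * ((1 + \<bar>of_int k\<bar> ^ 2) * energy ?d k) + (1 / s) * ((1 + \<bar>of_int k\<bar> ^ 4) * energy ?d k)"
      by (simp add: t_def algebra_simps)
  qed
  also have "\<dots> = s * sobolev 2 ?d m + (1 / s) * sobolev 4 ?d m"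
    unfolding sobolev_def by (simp only: sum.distrib sum_distrib_left)
  also have "\<dots> \<le> s * (8 * \<mu>\<^sup>2 / (real n + 1)) + (1 / s) * (4 * \<mu>\<^sup>2)"
    using s by (intro add_mono mult_left_mono iter_dist2 nm E4) auto
  also have "\<dots> = 12 * \<mu>\<^sup>2 / s"
    using s(1) unfolding s(2)[symmetric] by (simp add: field_simps)
  finally show ?thesis by (simp add: s_def)
qed

text \<open>
  The difference of two iterates is an approximate solution with centre value \<open>0\<close>, to which \<open>approx0_sup\<close> applies.
\<close>

lemma approx_uniformly_Cauchy:
  assumes "i \<le> 1"
  shows "uniformly_Cauchy_on (UNIV \<times> {0..1}) (\<lambda>n p. approx i (iter n) n v (fst p) (snd p))"
proof (rule uniformly_Cauchy_onI')
  fix \<epsilon> :: real assume \<epsilon>: "\<epsilon> > 0"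
  have "(\<lambda>n. C0 * (12 * \<mu>\<^sup>2 / sqrt (real n + 1))) \<longlonglongrightarrow> 0"
  proof -
    have "filterlim (\<lambda>n. sqrt (1 + real n)) at_top sequentially"
      by (intro filterlim_compose[OF sqrt_at_top] filterlim_tendsto_add_at_top[OF tendsto_const] filterlim_real_sequentially)
    then show ?thesis
      by (intro tendsto_mult_right_zero tendsto_divide_0[OF tendsto_const] filterlim_at_top_imp_at_infinity)
        (simp add: add.commute)
  qed
  then have "eventually (\<lambda>n. C0 * (12 * \<mu>\<^sup>2 / sqrt (real n + 1)) < \<epsilon>\<^sup>2) sequentially"
    using \<epsilon> by (intro order_tendstoD) auto
  then obtain M where M: "\<And>n. n \<ge> M \<Longrightarrow> C0 * (12 * \<mu>\<^sup>2 / sqrt (real n + 1)) < \<epsilon>\<^sup>2"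
    by (auto simp: eventually_sequentially)
  show "\<exists>M. \<forall>p\<in>UNIV \<times> {0..1}. \<forall>m\<ge>M. \<forall>n>m. dist (approx i (iter m) m v (fst p) (snd p)) (approx i (iter n) n v (fst p) (snd p)) < \<epsilon>"
  proof (intro exI[of _ M] ballI allI impI)
    fix p :: "real \<times> real" and n m :: nat assume p: "p \<in> UNIV \<times> {0..1}" and "n \<ge> M" "n < m"
    let ?d = "\<lambda>k y. iter m k y - iter n k y"
    have y: "snd p \<in> {0..1}" using p by auto
    have a: "continuous_modes (iter m)" "continuous_modes (iter n)" using adm_iter[of m m] adm_iter[of n n] by auto
    have cc: "continuous_modes ?d" by (rule continuous_modes_diff[OF a])
    have "approx i (iter m) m v (fst p) (snd p) - approx i (iter n) n v (fst p) (snd p) = approx i ?d m 0 (fst p) (snd p)"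
      using approx_diff[OF a y, of i m v v "fst p"] approx_support[of n "iter n" m] iter_support[of n] \<open>n < m\<close> by simp
    moreover have "(norm (approx i ?d m 0 (fst p) (snd p)))\<^sup>2 < \<epsilon>\<^sup>2"
    proof -
      have "sobolev 2 ?d m \<le> sobolev 3 ?d m" by (rule sobolev_mono[OF cc]) auto
      then have "C0 * sobolev 2 ?d m \<le> C0 * sobolev 3 ?d m" using C0 by simp
      moreover have "C0 * sobolev 3 ?d m \<le> C0 * (12 * \<mu>\<^sup>2 / sqrt (real n + 1))" using C0 iter_dist3[of n m] \<open>n < m\<close> by (intro mult_left_mono) auto
      moreover have "i = 0 \<or> i = 1" using assms by auto
      ultimately show ?thesis using approx0_sup[OF cc y, of m "fst p"] M[OF \<open>n \<ge> M\<close>] by auto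
    qed
    ultimately show "dist (approx i (iter n) n v (fst p) (snd p)) (approx i (iter m) m v (fst p) (snd p)) < \<epsilon>"
      using \<epsilon> by (simp add: dist_norm norm_minus_commute power2_less_imp_less)
  qed
qed

lemma approx_limit:
  assumes "i \<le> 1"
  obtains Flim where "uniform_limit (UNIV \<times> {0..1}) (\<lambda>n p. approx i (iter n) n v (fst p) (snd p)) (\<lambda>p. Flim (fst p) (snd p)) sequentially"
    and "continuous_on (UNIV \<times> {0..1}) (\<lambda>p. Flim (fst p) (snd p))"
proof -
  obtain l where l: "uniform_limit (UNIV \<times> {0..1}) (\<lambda>n p. approx i (iter n) n v (fst p) (snd p)) l sequentially"
    using Cauchy_uniformly_convergent[OF approx_uniformly_Cauchy[OF assms]] uniformly_convergent_on_def by blast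
  define Flim where "Flim x y = l (x, y)" for x y
  have l': "uniform_limit (UNIV \<times> {0..1}) (\<lambda>n p. approx i (iter n) n v (fst p) (snd p)) (\<lambda>p. Flim (fst p) (snd p)) sequentially"
    using l by (simp add: Flim_def)
  have "continuous_on (UNIV \<times> {0..1}) (\<lambda>p. Flim (fst p) (snd p))"
  proof (rule uniform_limit_theorem[OF _ l'])
    have "continuous_on (UNIV \<times> {0..1}) (\<lambda>p. approx i (iter n) n v (fst p) (snd p))" for n
      using adm_iter[of n n] by (intro continuous_intros) auto
    then show "\<forall>\<^sub>F n in sequentially. continuous_on (UNIV \<times> {0..1}) (\<lambda>p. approx i (iter n) n v (fst p) (snd p))" by simp
  qed simp
  with l' show ?thesis by (rule that)
qed

text \<open>
  The iterates and their derivatives in \<open>x\<close> converge uniformly, but nothing is known about the convergence of their derivatives in \<open>y\<close>.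
  The equation therefore passes to the limit in its form integrated over \<open>y\<close> and tested against \<open>exp (- i k x)\<close>:
  the iterate \<open>Suc m\<close> satisfies it, with the right-hand side computed from the iterate \<open>m\<close>, exactly for the frequencies \<open>\<bar>k\<bar> \<le> m\<close>. Completeness of the trigonometric system then yields the
  integrated equation at every point, and differentiating it gives the claim. The last three conclusions bound the solution and its derivative
  and compare the latter with that of the unperturbed \<open>a + sin(z) b\<close>.
\<close>

theorem strip_solution:
  obtains F0 F1 :: "real \<Rightarrow> real \<Rightarrow> 'v" where
    "continuous_on (UNIV \<times> {0..1}) (\<lambda>p. F0 (fst p) (snd p))"
    "continuous_on (UNIV \<times> {0..1}) (\<lambda>p. F1 (fst p) (snd p))"
    "\<And>x y. y \<in> {0..1} \<Longrightarrow> ((\<lambda>x. F0 x y) has_vector_derivative F1 x y) (at x)"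
    "\<And>x y. x \<in> {-pi..pi} \<Longrightarrow> y \<in> {0..1} \<Longrightarrow>
       ((\<lambda>y. F0 x y) has_vector_derivative J (F1 x y) + G (F0 x y) (F1 x y)) (at y within {0..1})"
    "\<And>x. \<tau> (F0 x 0) = F0 x 0" "F0 0 t0 = v"
    "\<And>x y. y \<in> {0..1} \<Longrightarrow> F0 x y \<in> ball 0 R" "\<And>x y. y \<in> {0..1} \<Longrightarrow> norm (F1 x y) \<le> R"
    "\<And>x y. y \<in> {0..1} \<Longrightarrow> norm (F1 x y - cm (sine 1 x y) (odd_part v)) \<le> sqrt C0 * \<mu>"
proof -
  define S where "S = (UNIV :: real set) \<times> {0..1::real}"
  let ?f = "\<lambda>i n x y. approx i (iter n) n v x y"
  obtain F0 where F0: "uniform_limit S (\<lambda>n p. ?f 0 n (fst p) (snd p)) (\<lambda>p. F0 (fst p) (snd p)) sequentially"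
    "continuous_on S (\<lambda>p. F0 (fst p) (snd p))" unfolding S_def by (rule approx_limit[of 0]) auto
  obtain F1 where F1: "uniform_limit S (\<lambda>n p. ?f 1 n (fst p) (snd p)) (\<lambda>p. F1 (fst p) (snd p)) sequentially"
    "continuous_on S (\<lambda>p. F1 (fst p) (snd p))" unfolding S_def by (rule approx_limit[of 1]) auto
  have ad: "admissible (iter n) n" for n by (rule adm_iter) simp
  have lim: "(\<lambda>n. ?f 0 n x y) \<longlonglongrightarrow> F0 x y" "(\<lambda>n. ?f 1 n x y) \<longlonglongrightarrow> F1 x y" if "y \<in> {0..1}" for x y
    using tendsto_uniform_limitI[OF F0(1), of "(x, y)"] tendsto_uniform_limitI[OF F1(1), of "(x, y)"] that
    by (auto simp: S_def)
  have ball: "norm (F0 x y) \<le> c0 * norm v + sqrt C0 * \<mu>" if y: "y \<in> {0..1}" for x y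
  proof (rule Lim_bounded[OF tendsto_norm[OF lim(1)[OF y]], of 0], intro allI impI)
    fix n
    have "?f 0 n x y = approx 0 (\<lambda>k y. 0) n v x y + approx 0 (iter n) n 0 x y" using ad y by (intro approx_split) auto
    then show "norm (?f 0 n x y) \<le> c0 * norm v + sqrt C0 * \<mu>"
      using adm_approx0[OF ad y, of 0 n x] approx_zero_bound[OF y, of 0 n v x]
        norm_triangle_ineq[of "approx 0 (\<lambda>k y. 0) n v x y" "approx 0 (iter n) n 0 x y"] by simp
  qed
  have ball': "F0 x y \<in> ball 0 R" if "y \<in> {0..1}" for x y using that R ball[OF that, of x] by simp
  have F1R: "norm (F1 x y) \<le> R" if y: "y \<in> {0..1}" for x y
    by (rule Lim_bounded[OF tendsto_norm[OF lim(2)[OF y]], of 0]) (use adm_approx[OF ad y, of 1 _ x] in \<open>auto intro: less_imp_le\<close>)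
  have F1\<phi>: "norm (F1 x y - cm (sine 1 x y) (odd_part v)) \<le> sqrt C0 * \<mu>" if y: "y \<in> {0..1}" for x y
  proof (rule Lim_bounded[OF tendsto_norm[OF tendsto_diff[OF lim(2)[OF y] tendsto_const]], of 0], intro allI impI)
    fix n
    have "?f 1 n x y = approx 1 (\<lambda>k y. 0) n v x y + approx 1 (iter n) n 0 x y" using ad y by (intro approx_split) auto
    moreover have "approx 1 (\<lambda>k y. 0) n v x y = cm (sine 1 x y) (odd_part v)" by (simp add: approx_def defect_def wave_zero)
    ultimately show "norm (?f 1 n x y - cm (sine 1 x y) (odd_part v)) \<le> sqrt C0 * \<mu>"
      using adm_approx0[OF ad y, of 1 n x] by simp
  qed
  have re: "\<tau> (F0 x 0) = F0 x 0" for x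
  proof (rule LIMSEQ_unique)
    show "(\<lambda>n. \<tau> (?f 0 n x 0)) \<longlonglongrightarrow> \<tau> (F0 x 0)"
      by (rule bounded_linear.tendsto[OF bounded_linear_\<tau> lim(1)]) simp
    show "(\<lambda>n. \<tau> (?f 0 n x 0)) \<longlonglongrightarrow> F0 x 0" using lim(1)[of 0 x] by (simp add: approx_real)
  qed
  have ce: "F0 0 t0 = v"
    using lim(1)[of t0 0] t0 by (simp add: approx_center LIMSEQ_const_iff)
  have dx: "((\<lambda>x. F0 x y) has_vector_derivative F1 x y) (at x)" if y: "y \<in> {0..1}" for x y
  proof -
    have "\<exists>g. \<forall>x\<in>UNIV. (\<lambda>n. ?f 0 n x y) \<longlonglongrightarrow> g x \<and> (g has_derivative (\<lambda>h. h *\<^sub>R F1 x y)) (at x within UNIV)"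
    proof (rule has_derivative_sequence[where f' = "\<lambda>n x h. h *\<^sub>R ?f 1 n x y"])
      show "((\<lambda>x. ?f 0 n x y) has_derivative (\<lambda>h. h *\<^sub>R ?f 1 n x y)) (at x within UNIV)" for n x
        using approx_has_vector_derivative_x[of 0 "iter n" n v y x UNIV] by (simp add: has_vector_derivative_def)
      show "(\<lambda>n. ?f 0 n x y) \<longlonglongrightarrow> F0 x y" by (rule lim(1)[OF y])
      fix e :: real assume "e > 0"
      from uniform_limitD[OF F1(1) this]
      show "\<forall>\<^sub>F n in sequentially. \<forall>x\<in>UNIV. \<forall>h. norm (h *\<^sub>R ?f 1 n x y - h *\<^sub>R F1 x y) \<le> e * norm h"
      proof eventually_elim
        case (elim n)
        have "dist (?f 1 n x y) (F1 x y) < e" for x using elim y by (auto simp: S_def)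
        then have "norm (?f 1 n x y - F1 x y) \<le> e" for x by (auto simp: dist_norm less_imp_le)
        then have "\<bar>h\<bar> * norm (?f 1 n x y - F1 x y) \<le> e * \<bar>h\<bar>" for x h :: real
          by (subst mult.commute[of e]) (intro mult_left_mono; simp)
        then show ?case by (auto simp flip: scaleR_diff_right)
      qed
    qed auto
    then obtain g where g: "\<And>x. (\<lambda>n. ?f 0 n x y) \<longlonglongrightarrow> g x" "\<And>x. (g has_derivative (\<lambda>h. h *\<^sub>R F1 x y)) (at x)" by auto
    have "g = (\<lambda>x. F0 x y)" using LIMSEQ_unique[OF g(1) lim(1)[OF y]] by auto
    then show ?thesis using g(2) by (simp add: has_vector_derivative_def)
  qed
  define H where "H x y = G (F0 x y) (F1 x y)" for x y
  have cG: "continuous_on (ball 0 R) G"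
    using G_deriv by (meson continuous_at_imp_continuous_on has_derivative_continuous)
  have cH: "continuous_on S (\<lambda>p. H (fst p) (snd p))"
    unfolding H_def using ball' F0(2) F1(2)
    by (intro bounded_bilinear.continuous_on[OF bounded_bilinear_blinfun_apply] continuous_on_compose2[OF cG])
      (auto simp: S_def)
  let ?h = "\<lambda>n x y. rhs (iter n) n x y"
  have hH: "norm (?h n x y - H x y) \<le> \<sigma> * norm (?f 1 n x y - F1 x y) + \<sigma> * norm (?f 0 n x y - F0 x y) * R"
    if y: "y \<in> {0..1}" for n x y
  proof -
    have b: "?f 0 n x y \<in> ball 0 R" by (rule adm_approx_ball[OF ad y])
    have eq: "?h n x y - H x y = G (?f 0 n x y) (?f 1 n x y - F1 x y) + (G (?f 0 n x y) - G (F0 x y)) (F1 x y)"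
      by (simp add: rhs_def H_def blinfun.diff_left blinfun.diff_right)
    show ?thesis unfolding eq
    proof (intro norm_triangle_le add_mono norm_Gb(1) b)
      have "norm ((G (?f 0 n x y) - G (F0 x y)) (F1 x y)) \<le> norm (G (?f 0 n x y) - G (F0 x y)) * norm (F1 x y)" by (rule norm_blinfun)
      also have "\<dots> \<le> (\<sigma> * norm (?f 0 n x y - F0 x y)) * R"
        using R_pos \<sigma>_nonneg by (intro mult_mono G_Lipschitz b ball' y F1R) auto
      finally show "norm ((G (?f 0 n x y) - G (F0 x y)) (F1 x y)) \<le> (\<sigma> * norm (?f 0 n x y - F0 x y)) * R" .
    qed
  qed
  have Fx: "continuous_on X (\<lambda>p. F0 (a p) (b p))" "continuous_on X (\<lambda>p. F1 (a p) (b p))" "continuous_on X (\<lambda>p. H (a p) (b p))"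
    if "continuous_on X a" "continuous_on X b" "b ` X \<subseteq> {0..1}" for X :: "'x::topological_space set" and a b
  proof -
    have c: "continuous_on X (\<lambda>p. (a p, b p))" using that by (intro continuous_intros)
    have i: "(\<lambda>p. (a p, b p)) ` X \<subseteq> S" using that by (auto simp: S_def)
    show "continuous_on X (\<lambda>p. F0 (a p) (b p))" using continuous_on_compose2[OF F0(2) c i] by simp
    show "continuous_on X (\<lambda>p. F1 (a p) (b p))" using continuous_on_compose2[OF F1(2) c i] by simp
    show "continuous_on X (\<lambda>p. H (a p) (b p))" using continuous_on_compose2[OF cH c i] by simp
  qed
  have perF: "F0 (x + 2 * pi) y = F0 x y" "F1 (x + 2 * pi) y = F1 x y" if "y \<in> {0..1}" for x y
    using LIMSEQ_unique[OF lim(1)[OF that, of "x + 2 * pi", unfolded approx_periodic] lim(1)[OF that, of x]]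
      LIMSEQ_unique[OF lim(2)[OF that, of "x + 2 * pi", unfolded approx_periodic] lim(2)[OF that, of x]] by auto
  have integral_eq: "F0 x y = F0 x 0 + integral {0..y} (\<lambda>s. J (F1 x s) + H x s)"
    if x: "x \<in> {-pi..pi}" and y: "y \<in> {0..1}" for x y
  proof -
    \<comment> \<open>\<open>\<Phi>\<close> is the error of the limit in the integrated equation, \<open>\<Psi> m\<close> that of the iterate \<open>Suc m\<close>,
      whose modes solve the equation with right-hand side \<open>P (Suc m)\<close>, the truncation of the one computed from the iterate \<open>m\<close>.\<close>
    define \<Phi> where "\<Phi> x = F0 x y - F0 x 0 - integral {0..y} (\<lambda>s. J (F1 x s) + H x s)" for x
    define P where "P n x s = (\<Sum>k\<in>{-int n..int n}. cm (ek k x) (iter n k s))" for n x s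
    define \<Psi> where "\<Psi> m x = integral {0..y} (\<lambda>s. P (Suc m) x s - ?h m x s)" for m x
    have y': "{0..y} \<subseteq> {0..1}" using y by auto
    have cJH: "continuous_on X (\<lambda>p. J (F1 (a p) (b p)) + H (a p) (b p))"
      if "continuous_on X a" "continuous_on X b" "b ` X \<subseteq> {0..1}" for X :: "'x::topological_space set" and a b
      by (intro continuous_intros bounded_linear.continuous_on[OF bounded_linear_J] Fx that)
    have cP: "continuous_on X (\<lambda>p. P n (a p) (b p))" if "continuous_on X a" "continuous_on X b" "b ` X \<subseteq> {0..1}" for X :: "'x::topological_space set" and a b n
    proof -
      have "continuous_on {0..1} (iter n k)" for k using ad by blast
      then show ?thesis unfolding P_def by (intro continuous_intros continuous_on_compose2[OF _ that(2,3)] that)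
    qed
    have ch: "continuous_on X (\<lambda>p. ?h m (a p) (b p))" if "continuous_on X a" "continuous_on X b" "b ` X \<subseteq> {0..1}" for X :: "'x::topological_space set" and a b m
      by (intro continuous_on_rhs ad that)
    have capprox: "continuous_on X (\<lambda>p. ?f i m (a p) (b p))" if "continuous_on X a" "continuous_on X b" "b ` X \<subseteq> {0..1}" for X :: "'x::topological_space set" and a b m i
      using ad that by (intro continuous_on_approx) auto
    have cPhi: "continuous_on UNIV \<Phi>"
    proof -
      have "continuous_on (UNIV \<times> cbox 0 y) (\<lambda>(x, s). J (F1 x s) + H x s)"
        unfolding case_prod_unfold using y by (intro cJH continuous_intros) auto
      from integral_continuous_on_param[OF this]
      have "continuous_on UNIV (\<lambda>x. integral {0..y} (\<lambda>s. J (F1 x s) + H x s))" by simp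
      then show ?thesis unfolding \<Phi>_def using y by (intro continuous_intros Fx) auto
    qed
    have cPsi: "continuous_on UNIV (\<Psi> m)" for m
    proof -
      have "continuous_on (UNIV \<times> cbox 0 y) (\<lambda>(x, s). P (Suc m) x s - ?h m x s)"
        unfolding case_prod_unfold using y by (intro continuous_on_diff cP ch continuous_intros) auto
      from integral_continuous_on_param[OF this] show ?thesis by (simp add: \<Psi>_def[abs_def])
    qed
    have perPhi: "\<Phi> (x + 2 * pi) = \<Phi> x" for x
    proof -
      have "integral {0..y} (\<lambda>s. J (F1 (x + 2 * pi) s) + H (x + 2 * pi) s) = integral {0..y} (\<lambda>s. J (F1 x s) + H x s)"
        using y' by (intro integral_cong) (auto simp: H_def perF)
      then show ?thesis using perF(1)[OF y] perF(1)[of 0] by (simp add: \<Phi>_def)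
    qed
    have Psi_eq: "\<Psi> m x = ?f 0 (Suc m) x y - ?f 0 (Suc m) x 0 - integral {0..y} (\<lambda>s. J (?f 1 (Suc m) x s) + ?h m x s)" for m x
    proof -
      have "((\<lambda>s. J (?f 1 (Suc m) x s) + P (Suc m) x s) has_integral ?f 0 (Suc m) x y - ?f 0 (Suc m) x 0) {0..y}"
      proof (rule fundamental_theorem_of_calculus)
        fix s assume s: "s \<in> {0..y}"
        then have "s \<in> {0..1}" using y' by blast
        then have "((\<lambda>y. ?f 0 (Suc m) x y) has_vector_derivative J (?f 1 (Suc m) x s) + P (Suc m) x s) (at s within {0..1})"
          unfolding P_def by (intro approx_has_vector_derivative_y conjunct1[OF ad])
        then show "((\<lambda>y. ?f 0 (Suc m) x y) has_vector_derivative J (?f 1 (Suc m) x s) + P (Suc m) x s) (at s within {0..y})"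
          by (rule has_vector_derivative_within_subset[OF _ y'])
      qed (use y in auto)
      moreover have "((\<lambda>s. J (?f 1 (Suc m) x s) + ?h m x s) has_integral integral {0..y} (\<lambda>s. J (?f 1 (Suc m) x s) + ?h m x s)) {0..y}"
        using y by (intro integrable_integral integrable_continuous_interval continuous_on_add ch bounded_linear.continuous_on[OF bounded_linear_J] capprox continuous_intros) auto
      ultimately have "((\<lambda>s. (J (?f 1 (Suc m) x s) + P (Suc m) x s) - (J (?f 1 (Suc m) x s) + ?h m x s)) has_integral
          (?f 0 (Suc m) x y - ?f 0 (Suc m) x 0) - integral {0..y} (\<lambda>s. J (?f 1 (Suc m) x s) + ?h m x s)) {0..y}"
        by (rule has_integral_diff)
      then have "((\<lambda>s. P (Suc m) x s - ?h m x s) has_integral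
          (?f 0 (Suc m) x y - ?f 0 (Suc m) x 0) - integral {0..y} (\<lambda>s. J (?f 1 (Suc m) x s) + ?h m x s)) {0..y}" by simp
      then show ?thesis unfolding \<Psi>_def by (rule integral_unique)
    qed
    have coefPsi: "coef (\<Psi> m) k = 0" if "\<bar>k\<bar> \<le> int m" for k m
      unfolding \<Psi>_def
    proof (rule coef_integral)
      show "continuous_on ({-pi..pi} \<times> {0..y}) (\<lambda>p. P (Suc m) (fst p) (snd p) - ?h m (fst p) (snd p))"
        using y by (intro continuous_on_diff cP ch continuous_intros) auto
      fix s assume "s \<in> {0..y}"
      then have s: "s \<in> {0..1}" using y' by blast
      have "coef (\<lambda>x. P (Suc m) x s) k = iter (Suc m) k s"
        unfolding P_def using that by (subst coef_sum_ek) auto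
      moreover have "\<dots> = coef (\<lambda>x. ?h m x s) k" using that by (simp add: rhs_coef_def)
      moreover have "coef (\<lambda>x. P (Suc m) x s - ?h m x s) k = coef (\<lambda>x. P (Suc m) x s) k - coef (\<lambda>x. ?h m x s) k"
        using s by (intro coef_diff cP ch continuous_intros) auto
      ultimately show "coef (\<lambda>x. P (Suc m) x s - ?h m x s) k = 0" by simp
    qed
    have "coef \<Phi> k = 0" for k
    proof -
      have "norm (coef \<Phi> k) \<le> 0 + \<epsilon>" if "\<epsilon> > 0" for \<epsilon>
      proof -
        \<comment> \<open>If two iterates are \<open>d\<close>-close to the limit in \<open>C\<^sup>1\<close>, then \<open>\<Psi> m\<close> is \<open>K d\<close>-close to \<open>\<Phi>\<close>.\<close>
        define K where "K = 3 + \<sigma> * (1 + R)"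
        have K: "K > 0" using \<sigma>_nonneg R_pos by (auto simp: K_def intro!: add_pos_nonneg mult_nonneg_nonneg)
        define d where "d = \<epsilon> / K"
        have d: "d > 0" using \<open>\<epsilon> > 0\<close> K by (simp add: d_def)
        obtain M where M: "\<And>n p. n \<ge> M \<Longrightarrow> p \<in> S \<Longrightarrow> dist (?f 0 n (fst p) (snd p)) (F0 (fst p) (snd p)) < d"
          "\<And>n p. n \<ge> M \<Longrightarrow> p \<in> S \<Longrightarrow> dist (?f 1 n (fst p) (snd p)) (F1 (fst p) (snd p)) < d"
          using eventually_conj[OF uniform_limitD[OF F0(1) d] uniform_limitD[OF F1(1) d]] unfolding eventually_sequentially by blast
        define m where "m = max M (nat \<bar>k\<bar>)"
        have m: "m \<ge> M" "Suc m \<ge> M" "\<bar>k\<bar> \<le> int m" by (auto simp: m_def)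
        have n0: "norm (?f 0 n x s - F0 x s) \<le> d" "norm (?f 1 n x s - F1 x s) \<le> d" if "s \<in> {0..1}" "n \<ge> M" for x s n
          using M(1)[OF that(2), of "(x, s)"] M(2)[OF that(2), of "(x, s)"] that(1) by (auto simp: S_def dist_norm)
        have "norm (\<Phi> x - \<Psi> m x) \<le> \<epsilon>" for x
        proof -
          have i: "(\<lambda>s. J (F1 x s) + H x s) integrable_on {0..y}" "(\<lambda>s. J (?f 1 (Suc m) x s) + ?h m x s) integrable_on {0..y}"
            using y by (intro integrable_continuous_interval cJH continuous_on_add ch bounded_linear.continuous_on[OF bounded_linear_J] capprox continuous_intros; auto)+
          have "norm (integral {0..y} (\<lambda>s. (J (?f 1 (Suc m) x s) + ?h m x s) - (J (F1 x s) + H x s))) \<le> integral {0..y} (\<lambda>s::real. d + (\<sigma> * d + \<sigma> * d * R))"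
          proof (rule integral_norm_bound_integral)
            fix s assume "s \<in> {0..y}"
            then have s: "s \<in> {0..1}" using y' by blast
            have "norm ((J (?f 1 (Suc m) x s) + ?h m x s) - (J (F1 x s) + H x s)) = norm (J (?f 1 (Suc m) x s - F1 x s) + (?h m x s - H x s))"
              by (simp add: J_diff algebra_simps)
            also have "\<dots> \<le> d + (\<sigma> * d + \<sigma> * d * R)"
            proof (intro norm_triangle_le add_mono)
              show "norm (J (?f 1 (Suc m) x s - F1 x s)) \<le> d" using n0(2)[OF s m(2)] by simp
              have "norm (?h m x s - H x s) \<le> \<sigma> * norm (?f 1 m x s - F1 x s) + \<sigma> * norm (?f 0 m x s - F0 x s) * R" by (rule hH[OF s])
              also have "\<dots> \<le> \<sigma> * d + \<sigma> * d * R"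
                using \<sigma>_nonneg R_pos by (intro add_mono mult_left_mono mult_right_mono n0 s m) auto
              finally show "norm (?h m x s - H x s) \<le> \<sigma> * d + \<sigma> * d * R" .
            qed
            finally show "norm ((J (?f 1 (Suc m) x s) + ?h m x s) - (J (F1 x s) + H x s)) \<le> d + (\<sigma> * d + \<sigma> * d * R)" .
          qed (intro integrable_diff i integrable_const_ivl)+
          also have "\<dots> \<le> d + (\<sigma> * d + \<sigma> * d * R)"
            using y d \<sigma>_nonneg R_pos mult_right_mono[of y 1 "d + (\<sigma> * d + \<sigma> * d * R)"] by simp
          finally have I: "norm (integral {0..y} (\<lambda>s. J (?f 1 (Suc m) x s) + ?h m x s) - integral {0..y} (\<lambda>s. J (F1 x s) + H x s)) \<le> d + (\<sigma> * d + \<sigma> * d * R)"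
            by (subst (asm) integral_diff[OF i(2,1)])
          have "\<Phi> x - \<Psi> m x = (F0 x y - ?f 0 (Suc m) x y) - (F0 x 0 - ?f 0 (Suc m) x 0)
              + (integral {0..y} (\<lambda>s. J (?f 1 (Suc m) x s) + ?h m x s) - integral {0..y} (\<lambda>s. J (F1 x s) + H x s))"
            by (simp add: \<Phi>_def Psi_eq)
          also have "norm \<dots> \<le> (d + d) + (d + (\<sigma> * d + \<sigma> * d * R))"
          proof -
            have tri: "norm (a - b + c) \<le> (d + d) + r" if "norm a \<le> d" "norm b \<le> d" "norm c \<le> r" for a b c :: 'v and r
              using that norm_triangle_ineq[of "a - b" c] norm_triangle_ineq4[of a b] by linarith
            show ?thesis
              by (rule tri[OF _ _ I]) (subst norm_minus_commute, rule n0(1)[OF _ m(2)], use y in simp)+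
          qed
          also have "\<dots> = K * d" by (simp add: K_def algebra_simps)
          also have "\<dots> = \<epsilon>" using K by (simp add: d_def)
          finally show ?thesis .
        qed
        then have "norm (coef (\<lambda>x. \<Phi> x - \<Psi> m x) k) \<le> \<epsilon>"
          by (intro norm_coef_le continuous_on_diff continuous_on_subset[OF cPhi] continuous_on_subset[OF cPsi]) auto
        moreover have "coef (\<lambda>x. \<Phi> x - \<Psi> m x) k = coef \<Phi> k - coef (\<Psi> m) k"
          by (intro coef_diff continuous_on_subset[OF cPhi] continuous_on_subset[OF cPsi]) auto
        ultimately show ?thesis using coefPsi[OF m(3)] by simp
      qed
      then have "norm (coef \<Phi> k) \<le> 0" by (rule field_le_epsilon)
      then show ?thesis by simp
    qed
    then have "\<Phi> x = 0" by (intro coef_complete[OF cPhi perPhi _ x])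
    then show ?thesis by (simp add: \<Phi>_def algebra_simps)
  qed
  have dy: "((\<lambda>y. F0 x y) has_vector_derivative J (F1 x y) + G (F0 x y) (F1 x y)) (at y within {0..1})"
    if x: "x \<in> {-pi..pi}" and y: "y \<in> {0..1}" for x y
  proof -
    have c: "continuous_on {0..1} (\<lambda>s. J (F1 x s) + H x s)"
      by (intro continuous_intros bounded_linear.continuous_on[OF bounded_linear_J] Fx) auto
    have "((\<lambda>y. F0 x 0 + integral {0..y} (\<lambda>s. J (F1 x s) + H x s)) has_vector_derivative 0 + (J (F1 x y) + H x y)) (at y within {0..1})"
      by (intro has_vector_derivative_add has_vector_derivative_const integral_has_vector_derivative c y)
    then have "((\<lambda>y. F0 x y) has_vector_derivative 0 + (J (F1 x y) + H x y)) (at y within {0..1})"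
      by (rule has_vector_derivative_transform[OF y, rotated]) (rule integral_eq[OF x])
    then show ?thesis by (simp add: H_def)
  qed
  show ?thesis
    using F0(2) F1(2) dx dy re ce ball' F1R F1\<phi> unfolding S_def by (rule that)
qed

end

section \<open>Linear algebra of a generic subspace\<close>

text \<open>
  Take \<open>B \<subseteq> S\<close> maximal with \<open>B \<union> I B\<close> independent. The span of \<open>B \<union> I B\<close> is invariant under \<open>I\<close>. If it did not contain
  some \<open>s \<in> S\<close>, then \<open>s\<close> and \<open>I s\<close> could both be added: a relation \<open>I s - k s \<in> span (B \<union> I B)\<close> would give, after applying \<open>I\<close>, that
  \<open>(1 + k\<^sup>2) s\<close> is in the span.
\<close>

lemma totally_real_basis:
  fixes I :: "'e::euclidean_space \<Rightarrow> 'e"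
  assumes I: "linear I" "\<And>v. I (I v) = - v" and S: "subspace S"
    and gen: "\<And>v. \<exists>u\<in>S. \<exists>w\<in>S. v = u + I w"
  obtains B where "B \<subseteq> S" "finite B" "independent (B \<union> I ` B)" "B \<inter> I ` B = {}" "span (B \<union> I ` B) = UNIV"
proof -
  interpret I: linear I by fact
  define P where "P B \<longleftrightarrow> B \<subseteq> S \<and> finite B \<and> independent (B \<union> I ` B)" for B
  have P0: "P {}" by (simp add: P_def independent_empty)
  have bd: "card B \<le> DIM('e)" if "P B" for B
  proof -
    have "card B \<le> card (B \<union> I ` B)" using that by (intro card_mono) (auto simp: P_def)
    also have "\<dots> \<le> DIM('e)" using independent_bound[of "B \<union> I ` B"] that by (auto simp: P_def)
    finally show ?thesis .
  qed
  obtain B where B: "P B" and mx: "\<And>B'. P B' \<Longrightarrow> card B' \<le> card B"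
    using ex_has_greatest_nat[of P "{}" card "Suc DIM('e)"] P0 bd by (auto simp: less_Suc_eq_le)
  let ?X = "B \<union> I ` B"
  have disj: "B \<inter> I ` B = {}"
  proof (rule ccontr)
    assume "B \<inter> I ` B \<noteq> {}"
    then obtain b b' where b: "b \<in> B" "b' \<in> B" "b = I b'" by auto
    then have "- b' \<in> I ` B" using I(2)[of b'] by (metis imageI)
    moreover have nz: "b' \<noteq> 0" using B b by (metis P_def UnI1 dependent_zero)
    then have "b' \<noteq> - b'" by (simp add: equation_minus_iff[symmetric] eq_neg_iff_add_eq_0 flip: scaleR_2)
    then have "- b' \<in> span (?X - {- b'})" using b by (intro span_neg span_base) auto
    ultimately show False using B unfolding P_def dependent_def by blast
  qed
  have "span ?X = UNIV"
  proof (rule ccontr)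
    assume ne: "span ?X \<noteq> UNIV"
    have inv: "I v \<in> span ?X" if "v \<in> span ?X" for v
      using that
    proof (induction rule: span_induct_alt)
      case base
      show ?case by (simp add: I.zero span_zero)
    next
      case (step c x y)
      have "I x \<in> span ?X"
      proof (cases "x \<in> B")
        case True
        then show ?thesis by (auto intro: span_base)
      next
        case False
        then obtain b where "b \<in> B" "x = I b" using step by auto
        then show ?thesis using I(2)[of b] by (simp add: span_neg span_base)
      qed
      then show ?case using step by (simp add: I.add I.scaleR span_add span_scale)
    qed
    obtain s where s: "s \<in> S" "s \<notin> span ?X"
    proof (rule ccontr)
      assume "\<not> thesis"
      then have "S \<subseteq> span ?X" using that by blast
      then have "v \<in> span ?X" for v using gen[of v] inv by (metis span_add subsetD)
      then show False using ne by blast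
    qed
    have 1: "independent (insert s ?X)" using B s by (simp add: P_def independent_insert)
    have 2: "I s \<notin> span (insert s ?X)"
    proof
      assume "I s \<in> span (insert s ?X)"
      then obtain k where k: "I s - k *\<^sub>R s \<in> span ?X" by (auto simp: span_breakdown_eq)
      define w where "w = I s - k *\<^sub>R s"
      have Iw: "I w = - s - k *\<^sub>R (w + k *\<^sub>R s)" by (simp add: w_def I.diff I.scaleR I(2))
      have eq: "(1 + k * k) *\<^sub>R s = - (I w + k *\<^sub>R w)" unfolding Iw by (simp add: algebra_simps)
      have nz: "1 + k * k \<noteq> 0" by (smt (verit) zero_le_square)
      have "- (I w + k *\<^sub>R w) \<in> span ?X" using k inv by (intro span_neg span_add span_scale) (auto simp: w_def)
      then have "(1 / (1 + k * k)) *\<^sub>R (- (I w + k *\<^sub>R w)) \<in> span ?X" by (rule span_scale)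
      moreover have "(1 / (1 + k * k)) *\<^sub>R (- (I w + k *\<^sub>R w)) = s" unfolding eq[symmetric] using nz by simp
      ultimately show False using s by simp
    qed
    have "P (insert s B)"
    proof -
      have "insert s B \<union> I ` insert s B = insert (I s) (insert s ?X)" by auto
      moreover have "independent (insert (I s) (insert s ?X))" using 1 2 by (simp add: independent_insert)
      ultimately show ?thesis using B s by (simp add: P_def)
    qed
    moreover have "s \<notin> B" using s by (auto intro: span_base)
    ultimately show False using mx[of "insert s B"] B by (simp add: P_def)
  qed
  then show ?thesis using that[of B] B disj by (auto simp: P_def)
qed

text \<open>
  \<open>L\<close> maps the basis \<open>B \<union> I B\<close> to the standard basis, which makes the transported structure \<open>J\<close> orthogonal; \<open>M\<close> is its inverse. The
  conjugation \<open>\<tau>\<close> fixes \<open>L B\<close> and changes the sign on \<open>L (I B)\<close>. The functional \<open>l\<close> will be the differential of a defining function, and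
  \<open>b\<close> a direction of \<open>S\<close> for which \<open>I b\<close> points into the domain: \<open>l\<close> vanishes on \<open>B\<close>, so it cannot vanish on all of \<open>I B\<close>.
\<close>

lemma complex_frame:
  fixes I :: "'e::euclidean_space \<Rightarrow> 'e" and l :: "'e \<Rightarrow> real"
  assumes I: "linear I" "\<And>v. I (I v) = - v" and S: "subspace S"
    and gen: "\<And>v. \<exists>u\<in>S. \<exists>w\<in>S. v = u + I w"
    and l: "linear l" "\<And>v. v \<in> S \<Longrightarrow> l v = 0" "\<exists>v. l v \<noteq> 0"
  obtains L M J \<tau> :: "'e \<Rightarrow> 'e" and b where "linear L" "linear M" "\<And>v. L (M v) = v" "\<And>v. M (L v) = v"
    "real_structure J \<tau>" "\<And>v. L (I v) = J (L v)" "\<And>v. \<tau> v = v \<Longrightarrow> M v \<in> S" "b \<in> S" "\<tau> (L b) = L b" "l (I b) < 0"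
proof -
  obtain B where B: "B \<subseteq> S" "finite B" "independent (B \<union> I ` B)" "B \<inter> I ` B = {}" "span (B \<union> I ` B) = UNIV"
    using totally_real_basis[OF I S gen] by blast
  interpret I: linear I by fact
  interpret l: linear l by fact
  let ?X = "B \<union> I ` B"
  have injI: "inj I" by (metis I(2) injI minus_equation_iff)
  have "card ?X = DIM('e)" using B(3,5) by (metis dim_UNIV dim_eq_card_independent dim_span)
  then obtain \<phi> where \<phi>: "bij_betw \<phi> ?X (Basis :: 'e set)"
    using finite_same_card_bij[of ?X "Basis :: 'e set"] B(2) by auto
  obtain L where L: "linear L" "\<And>x. x \<in> ?X \<Longrightarrow> L x = \<phi> x"
    using linear_independent_extend[OF B(3), of \<phi>] by blast
  obtain M where M: "linear M" "\<And>e. e \<in> Basis \<Longrightarrow> M e = inv_into ?X \<phi> e"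
    using linear_independent_extend[OF independent_Basis, of "inv_into ?X \<phi>"] by blast
  interpret L: linear L by fact
  interpret M: linear M by fact
  have MoL: "M (L v) = v" for v
  proof -
    have "(M \<circ> L) v = id v"
    proof (rule linear_eq_on_span[where B = ?X and f = "M \<circ> L" and g = id and x = v])
      show "linear (M \<circ> L)" "linear (id :: 'e \<Rightarrow> 'e)" by (auto intro: linear_compose L M linear_id)
      show "(M \<circ> L) x = id x" if "x \<in> ?X" for x
        using that \<phi> M(2)[of "\<phi> x"] L(2)[OF that] by (auto simp: bij_betw_def)
      show "v \<in> span ?X" using B by simp
    qed
    then show ?thesis by simp
  qed
  have LoM: "L (M v) = v" for v
  proof -
    have "surj L" using MoL L(1) by (metis injI linear_injective_imp_surjective inj_on_inverseI)
    then obtain u where "v = L u" by blast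
    then show ?thesis using MoL by simp
  qed
  define J where "J v = L (I (M v))" for v
  obtain \<tau> where \<tau>: "linear \<tau>" "\<And>e. e \<in> Basis \<Longrightarrow> \<tau> e = (if M e \<in> B then e else - e)"
    using linear_independent_extend[OF independent_Basis, of "\<lambda>e. if M e \<in> B then e else - e"] by blast
  interpret \<tau>: linear \<tau> by fact
  have linJ: "linear J" unfolding J_def by (intro linearI) (simp_all add: L.add L.scaleR M.add M.scaleR I.add I.scaleR)
  interpret J: linear J by fact
  have JJ: "J (J v) = - v" for v by (simp add: J_def MoL I(2) L.neg LoM)
  have Bas: "\<exists>x\<in>?X. e = L x" if "e \<in> Basis" for e
    using that \<phi> L(2) by (metis bij_betw_imp_surj_on imageE)
  have LB: "L x \<in> Basis" if "x \<in> ?X" for x using that \<phi> L(2) by (metis bij_betwE)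
  have \<tau>1: "\<tau> (L b) = L b" if "b \<in> B" for b using \<tau>(2)[of "L b"] LB[of b] that MoL by auto
  have \<tau>2: "\<tau> (L (I b)) = - L (I b)" if "b \<in> B" for b
    using \<tau>(2)[of "L (I b)"] LB[of "I b"] that MoL B(4) by auto
  have J1: "J (L b) = L (I b)" and J2: "J (L (I b)) = - L b" for b by (simp_all add: J_def MoL I(2) L.neg)
  have on: "inner (J e) (J e') = inner e e'" if eB: "e \<in> Basis" "e' \<in> Basis" for e e'
  proof -
    have inj: "L x = L y \<longleftrightarrow> x = y" for x y using MoL by metis
    have ip: "inner (L x) (L y) = (if x = y then 1 else 0)" if "x \<in> ?X" "y \<in> ?X" for x y
      using LB[OF that(1)] LB[OF that(2)] inj by (simp add: inner_Basis)
    obtain x where x: "x \<in> ?X" "e = L x" using Bas[OF eB(1)] by blast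
    obtain y where y: "y \<in> ?X" "e' = L y" using Bas[OF eB(2)] by blast
    consider (1) "x \<in> B" "y \<in> B" | (2) b where "x \<in> B" "b \<in> B" "y = I b" | (3) b where "b \<in> B" "x = I b" "y \<in> B"
      | (4) b c where "b \<in> B" "x = I b" "c \<in> B" "y = I c" using x y by auto
    then show ?thesis
    proof cases
      case 1 then show ?thesis using injI x y by (simp add: J1 ip inj_eq)
    next
      case 2 then show ?thesis using injI x y B(4) by (auto simp: J1 I(2) L.neg ip)
    next
      case 3 then show ?thesis using injI x y B(4) by (auto simp: J1 I(2) L.neg ip)
    next
      case 4 then show ?thesis using injI x y by (simp add: J1 I(2) L.neg ip inj_eq)
    qed
  qed
  have norm_of: "norm (T v) = norm v" if T: "linear T" "\<And>e e'. e \<in> Basis \<Longrightarrow> e' \<in> Basis \<Longrightarrow> inner (T e) (T e') = inner e e'" for T :: "'e \<Rightarrow> 'e" and v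
  proof -
    interpret T: linear T by fact
    have "T v = (\<Sum>e\<in>Basis. inner v e *\<^sub>R T e)"
      by (subst euclidean_representation[symmetric, of v]) (simp only: T.sum T.scaleR)
    then have "inner (T v) (T v) = (\<Sum>e\<in>Basis. \<Sum>e'\<in>Basis. inner v e * (inner v e' * inner (T e') (T e)))"
      by (simp add: inner_sum_left inner_sum_right sum_distrib_left)
    also have "\<dots> = (\<Sum>e\<in>Basis. \<Sum>e'\<in>Basis. if e = e' then inner v e * inner v e else 0)"
      by (intro sum.cong refl) (simp add: T(2) inner_Basis)
    also have "\<dots> = inner v v" by (simp add: euclidean_inner[of v v])
    finally show ?thesis by (simp add: norm_eq_sqrt_inner)
  qed
  have rs: "real_structure J \<tau>"
  proof
    show "norm (J v) = norm v" for v by (rule norm_of[OF linJ on])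
    show "norm (\<tau> v) = norm v" for v
      by (rule norm_of[OF \<tau>(1)]) (auto simp: \<tau>(2) inner_Basis)
    have eqB: "f v = g v" if "linear f" "linear g" "\<And>e. e \<in> Basis \<Longrightarrow> f e = g e" for f g :: "'e \<Rightarrow> 'e" and v
      using linear_eq_stdbasis[OF that(1,2)] that(3) by metis
    show "\<tau> (\<tau> v) = v" for v
    proof (rule eqB[where f = "\<lambda>v. \<tau> (\<tau> v)" and g = "\<lambda>v. v"])
      show "linear (\<lambda>v. \<tau> (\<tau> v))" "linear (\<lambda>v::'e. v)" by (auto intro!: linearI simp: \<tau>.add \<tau>.scaleR)
    qed (auto simp: \<tau>(2) \<tau>.neg)
    show "\<tau> (J v) = - J (\<tau> v)" for v
    proof (rule eqB[where f = "\<lambda>v. \<tau> (J v)" and g = "\<lambda>v. - J (\<tau> v)"])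
      show "linear (\<lambda>v. \<tau> (J v))" "linear (\<lambda>v. - J (\<tau> v))" by (auto intro!: linearI simp: \<tau>.add \<tau>.scaleR J.add J.scaleR)
      fix e :: 'e assume "e \<in> Basis"
      then obtain x where x: "x \<in> ?X" "e = L x" using Bas by blast
      then show "\<tau> (J e) = - J (\<tau> e)"
        by (auto simp: J1 I(2) L.neg \<tau>1 \<tau>2 \<tau>.neg J.neg)
    qed
  qed (fact linJ JJ \<tau>(1))+
  have fixS: "M v \<in> S" if v: "\<tau> v = v" for v
  proof -
    have 0: "inner v e = 0" if e: "e \<in> Basis" "M e \<notin> B" for e
    proof -
      have "inner (\<tau> v) e = - inner v e"
      proof -
        have "\<tau> v = (\<Sum>e'\<in>Basis. inner v e' *\<^sub>R \<tau> e')"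
          by (subst euclidean_representation[symmetric, of v]) (simp only: \<tau>.sum \<tau>.scaleR)
        then have "inner (\<tau> v) e = (\<Sum>e'\<in>Basis. inner v e' * inner (\<tau> e') e)" by (simp add: inner_sum_left)
        also have "\<dots> = (\<Sum>e'\<in>Basis. if e' = e then - inner v e else 0)"
          using e by (intro sum.cong refl) (auto simp: \<tau>(2) inner_Basis)
        also have "\<dots> = - inner v e" using e by simp
        finally show ?thesis .
      qed
      then show ?thesis using v by simp
    qed
    have "M v = (\<Sum>e\<in>Basis. inner v e *\<^sub>R M e)"
      by (subst euclidean_representation[symmetric, of v]) (simp only: M.sum M.scaleR)
    also have "\<dots> \<in> S"
    proof (rule subspace_sum[OF S])
      fix e :: 'e assume "e \<in> Basis"
      then show "inner v e *\<^sub>R M e \<in> S"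
        using 0[of e] B(1) S by (cases "M e \<in> B") (auto intro: subspace_scale subspace_0)
    qed
    finally show ?thesis .
  qed
  have "\<exists>b0\<in>B. l (I b0) \<noteq> 0"
  proof (rule ccontr)
    assume "\<not> (\<exists>b0\<in>B. l (I b0) \<noteq> 0)"
    then have "l x = 0" if "x \<in> ?X" for x using that B(1) l(2) by auto
    then have "l v = 0" for v using linear_eq_on_span[of l "\<lambda>_. 0" ?X v] l(1) linear_zero B(5) by auto
    then show False using l(3) by blast
  qed
  then obtain b0 where b0: "b0 \<in> B" "l (I b0) \<noteq> 0" by blast
  define b where "b = (if l (I b0) < 0 then b0 else - b0)"
  have "b \<in> S" "\<tau> (L b) = L b" "l (I b) < 0"
    using b0 B(1) S \<tau>1[OF b0(1)] by (auto simp: b_def subspace_neg I.neg l.neg L.neg \<tau>.neg)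
  moreover have "L (I v) = J (L v)" for v by (simp add: J_def MoL)
  ultimately show ?thesis using that[OF L(1) M(1) LoM MoL rs _ fixS] by blast
qed

section \<open>Small discs attached to a linear subspace\<close>

text \<open>
  Partial derivatives are assembled into total ones, with values in spaces of bounded linear maps, by means of the operators
  \<open>v \<mapsto> \<langle>v, i\<rangle> u\<close>.
\<close>

definition rank_one :: "'e::euclidean_space \<Rightarrow> 'c::real_normed_vector \<Rightarrow> 'e \<Rightarrow>\<^sub>L 'c" where
  "rank_one i u = Blinfun (\<lambda>v. inner v i *\<^sub>R u)"

lemma rank_one_apply: "blinfun_apply (rank_one i u) v = inner v i *\<^sub>R u"
  unfolding rank_one_def by (subst bounded_linear_Blinfun_apply) (auto intro!: bounded_linear_intros)

lemma bounded_linear_rank_one: "bounded_linear (rank_one i)"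
proof (rule bounded_linear_intro[of _ "norm i"])
  show "norm (rank_one i u) \<le> norm u * norm i" for u
    by (rule norm_blinfun_bound) (auto simp: rank_one_apply intro: order_trans[OF mult_right_mono[OF Cauchy_Schwarz_ineq2]])
qed (auto intro!: blinfun_eqI simp: rank_one_apply blinfun.bilinear_simps algebra_simps)

lemma has_derivative_partial_sum:
  fixes P :: "'e::euclidean_space \<Rightarrow> 'c::real_normed_vector"
  assumes "P differentiable (at x)"
  shows "(P has_derivative blinfun_apply (\<Sum>k\<in>Basis. rank_one k (frechet_derivative P (at x) k))) (at x)"
proof -
  have d: "(P has_derivative frechet_derivative P (at x)) (at x)" using assms by (simp add: frechet_derivative_works)
  interpret D: bounded_linear "frechet_derivative P (at x)" using d by (rule has_derivative_bounded_linear)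
  have "frechet_derivative P (at x) = blinfun_apply (\<Sum>k\<in>Basis. rank_one k (frechet_derivative P (at x) k))"
  proof
    fix v
    have "frechet_derivative P (at x) v = (\<Sum>k\<in>Basis. inner v k *\<^sub>R frechet_derivative P (at x) k)"
      by (subst euclidean_representation[symmetric, of v]) (simp only: D.sum D.scaleR)
    then show "frechet_derivative P (at x) v = blinfun_apply (\<Sum>k\<in>Basis. rank_one k (frechet_derivative P (at x) k)) v"
      by (simp add: blinfun.sum_left rank_one_apply)
  qed
  then show ?thesis using d by simp
qed

text \<open>
  The components of the structure are twice continuously differentiable in the sense of iterated directional derivatives; the estimates need the
  corresponding operator-valued functions.
\<close>

lemma smooth_endomorphism_field:
  fixes Jm :: "'e::euclidean_space \<Rightarrow> 'e \<Rightarrow> 'e"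
  assumes sm: "\<And>a. Ck_on 2 U (\<lambda>x. Jm x a)" and lin: "\<And>x. x \<in> U \<Longrightarrow> linear (Jm x)"
  obtains A :: "'e \<Rightarrow> 'e \<Rightarrow>\<^sub>L 'e" and A1 :: "'e \<Rightarrow> 'e \<Rightarrow>\<^sub>L ('e \<Rightarrow>\<^sub>L 'e)" and A2 :: "'e \<Rightarrow> 'e \<Rightarrow>\<^sub>L ('e \<Rightarrow>\<^sub>L ('e \<Rightarrow>\<^sub>L 'e))"
  where "\<And>x v. x \<in> U \<Longrightarrow> A x v = Jm x v"
    "\<And>x. x \<in> U \<Longrightarrow> (A has_derivative blinfun_apply (A1 x)) (at x)"
    "\<And>x. x \<in> U \<Longrightarrow> (A1 has_derivative blinfun_apply (A2 x)) (at x)"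
    "continuous_on U A2"
proof -
  define P where "P i x = Jm x i" for i x
  define P1 where "P1 i k x = frechet_derivative (P i) (at x) k" for i k x
  define P2 where "P2 i k j x = frechet_derivative (P1 i k) (at x) j" for i k j x
  have sm': "Ck_on (Suc (Suc 0)) U (P i)" for i unfolding P_def using sm[of i] by (simp add: numeral_2_eq_2)
  have d: "P i differentiable (at x)" if "x \<in> U" for i x using sm'[of i] that by simp
  have "Ck_on (Suc 0) U (P1 i k)" for i k using sm'[of i] unfolding P1_def by simp
  then have d1: "x \<in> U \<Longrightarrow> P1 i k differentiable (at x)" and c2: "continuous_on U (P2 i k j)" for i k j x
    unfolding P2_def by simp_all
  define A where "A x = (\<Sum>i\<in>Basis. rank_one i (P i x))" for x
  define A1 where "A1 x = (\<Sum>i\<in>Basis. \<Sum>k\<in>Basis. rank_one k (rank_one i (P1 i k x)))" for x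
  define A2 where "A2 x = (\<Sum>i\<in>Basis. \<Sum>k\<in>Basis. \<Sum>j\<in>Basis. rank_one j (rank_one k (rank_one i (P2 i k j x))))" for x
  have rank_one_commute: "rank_one j (T u) v = T (rank_one j u v)" if "bounded_linear T" for j u v and T :: "'c::real_normed_vector \<Rightarrow> 'd::real_normed_vector"
    using that by (simp add: rank_one_apply bounded_linear.linear linear_scale)
  have 1: "A x v = Jm x v" if "x \<in> U" for x v
  proof -
    interpret linear "Jm x" by (rule lin[OF that])
    have "Jm x v = (\<Sum>i\<in>Basis. inner v i *\<^sub>R Jm x i)"
      by (subst euclidean_representation[symmetric, of v]) (simp only: sum scaleR)
    then show ?thesis by (simp add: A_def blinfun.sum_left rank_one_apply P_def)
  qed
  have 2: "(A has_derivative blinfun_apply (A1 x)) (at x)" if "x \<in> U" for x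
  proof -
    have "(A has_derivative (\<lambda>v. \<Sum>i\<in>Basis. rank_one i (blinfun_apply (\<Sum>k\<in>Basis. rank_one k (P1 i k x)) v))) (at x)"
      unfolding A_def P1_def
      by (intro has_derivative_sum bounded_linear.has_derivative[OF bounded_linear_rank_one] has_derivative_partial_sum d that)
    also have "(\<lambda>v. \<Sum>i\<in>Basis. rank_one i (blinfun_apply (\<Sum>k\<in>Basis. rank_one k (P1 i k x)) v)) = blinfun_apply (A1 x)"
      by (intro ext) (simp add: A1_def blinfun.sum_left rank_one_commute[OF bounded_linear_rank_one] linear_sum[OF bounded_linear.linear[OF bounded_linear_rank_one]])
    finally show ?thesis .
  qed
  have 3: "(A1 has_derivative blinfun_apply (A2 x)) (at x)" if "x \<in> U" for x
  proof -
    have "(A1 has_derivative (\<lambda>v. \<Sum>i\<in>Basis. \<Sum>k\<in>Basis. rank_one k (rank_one i (blinfun_apply (\<Sum>j\<in>Basis. rank_one j (P2 i k j x)) v)))) (at x)"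
      unfolding A1_def P2_def
      by (intro has_derivative_sum bounded_linear.has_derivative[OF bounded_linear_rank_one] has_derivative_partial_sum d1 that)
    also have "(\<lambda>v. \<Sum>i\<in>Basis. \<Sum>k\<in>Basis. rank_one k (rank_one i (blinfun_apply (\<Sum>j\<in>Basis. rank_one j (P2 i k j x)) v))) = blinfun_apply (A2 x)"
      by (intro ext) (simp add: A2_def blinfun.sum_left rank_one_commute[OF bounded_linear_rank_one] linear_sum[OF bounded_linear.linear[OF bounded_linear_rank_one]])
    finally show ?thesis .
  qed
  have 4: "continuous_on U A2"
    unfolding A2_def by (intro continuous_on_sum bounded_linear.continuous_on[OF bounded_linear_rank_one] c2)
  show ?thesis using 1 2 3 4 by (rule that)
qed

lemma scaled_has_derivative:
  fixes A :: "'e::real_normed_vector \<Rightarrow> 'c::real_normed_vector" and \<Theta> :: "'c \<Rightarrow>\<^sub>L 'd::real_normed_vector" and Mb :: "'e \<Rightarrow>\<^sub>L 'e"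
  assumes "(A has_derivative blinfun_apply A1) (at (p0 + \<epsilon> *\<^sub>R Mb X))"
  shows "((\<lambda>X. \<Theta> (A (p0 + \<epsilon> *\<^sub>R Mb X))) has_derivative blinfun_apply (\<epsilon> *\<^sub>R (\<Theta> o\<^sub>L A1 o\<^sub>L Mb))) (at X)"
proof -
  have "((\<lambda>X. p0 + \<epsilon> *\<^sub>R Mb X) has_derivative (\<lambda>h. \<epsilon> *\<^sub>R Mb h)) (at X)"
    by (auto intro!: derivative_eq_intros)
  from has_derivative_compose[OF this assms]
  have "((\<lambda>X. A (p0 + \<epsilon> *\<^sub>R Mb X)) has_derivative (\<lambda>h. A1 (\<epsilon> *\<^sub>R Mb h))) (at X)" .
  from bounded_linear.has_derivative[OF blinfun.bounded_linear_right this]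
  have "((\<lambda>X. \<Theta> (A (p0 + \<epsilon> *\<^sub>R Mb X))) has_derivative (\<lambda>h. \<Theta> (A1 (\<epsilon> *\<^sub>R Mb h)))) (at X)" .
  then show ?thesis by (simp add: blinfun.scaleR_right scaleR_blinfun.rep_eq)
qed

text \<open>
  The part of the strip that is used. Its interior contains the upper half unit disc.
\<close>

definition half_box :: "complex set" where "half_box = {z. \<bar>Re z\<bar> \<le> 1 \<and> 0 \<le> Im z \<and> Im z \<le> 1}"
definition half_box_interior :: "complex set" where "half_box_interior = {z. \<bar>Re z\<bar> < 1 \<and> 0 < Im z \<and> Im z < 1}"

text \<open>
  The real part of \<open>cos (x + i y)\<close> is \<open>cos x cosh y\<close>.
\<close>

lemma Re_sine_1:
  assumes "\<bar>x\<bar> \<le> 1" shows "Re (sine 1 x y) \<ge> 1 / 2"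
proof -
  have c: "cos z = sin (z + of_real (pi / 2))" for z :: complex
    by (simp only: sin_add cos_of_real sin_of_real) simp
  have "sine 1 x y = cos (strip_point x y)" unfolding sine_def c by simp
  then have e: "Re (sine 1 x y) = cos x * ((exp y + exp (- y)) / 2)" by (simp add: Re_cos strip_point_def)
  have "cos \<bar>x\<bar> \<ge> cos (pi / 3)" using assms pi_gt3 by (intro cos_monotone_0_pi_le) auto
  then have 1: "cos x \<ge> 1 / 2" by (simp add: cos_60)
  have "2 \<le> exp y + exp (- y)"
    using exp_ge_add_one_self[of y] exp_ge_add_one_self[of "- y"] by linarith
  then have 2: "1 \<le> (exp y + exp (- y)) / 2" by simp
  show ?thesis unfolding e using mult_mono[OF 1 2] 1 by simp
qed

text \<open>
  The map \<open>F(z) = p0 + \<epsilon> M(f z)\<close> is \<open>Jm\<close>-complex if \<open>f\<close> solves the equation of the strip with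
  \<open>G X = L \<circ> Jm (p0 + \<epsilon> M X) \<circ> M - J\<close>, and \<open>G\<close> is of order \<open>\<epsilon>\<close> together with its derivatives. The prescribed value ranges over a ball around
  \<open>v0 = sinh t0 J(L b)\<close>, the value at \<open>i t0\<close> of \<open>sin(z) L b\<close>; so \<open>f\<^sub>y\<close> is close to
  \<open>J(cos(z) L b)\<close>, and \<open>\<rho>' p0\<close> applied to the corresponding vector of \<open>F\<close> is close to \<open>- \<epsilon> Re (cos z) q\<close> with
  \<open>q = - \<rho>' p0 (I b) > 0\<close>. All errors together are at most half of this, which yields the linear decrease of \<open>\<rho>\<close> in \<open>y\<close>.
\<close>

theorem attached_discs:
  fixes Jm :: "'e::euclidean_space \<Rightarrow> 'e \<Rightarrow> 'e" and \<rho> :: "'e \<Rightarrow> real" and \<rho>' :: "'e \<Rightarrow> 'e \<Rightarrow>\<^sub>L real"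
  assumes U: "open U" "p0 \<in> U"
    and sm: "\<And>a. Ck_on 2 U (\<lambda>x. Jm x a)" and lin: "\<And>x. x \<in> U \<Longrightarrow> linear (Jm x)"
    and sq: "\<And>x v. x \<in> U \<Longrightarrow> Jm x (Jm x v) = - v"
    and S: "subspace S" "p0 \<in> S" and gen: "\<And>v. \<exists>u\<in>S. \<exists>w\<in>S. v = u + Jm p0 w"
    and \<rho>: "\<And>x. x \<in> U \<Longrightarrow> (\<rho> has_derivative blinfun_apply (\<rho>' x)) (at x)" and \<rho>'c: "continuous_on U \<rho>'"
    and l: "\<And>v. v \<in> S \<Longrightarrow> \<rho>' p0 v = 0" "\<rho>' p0 \<noteq> 0"
    and t0: "0 < t0" "t0 \<le> 1"
  obtains V where "open V" "V \<noteq> {}"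
    "\<And>w. w \<in> V \<Longrightarrow> \<exists>F D c C. c > 0 \<and> F ` half_box \<subseteq> U \<and> F (\<i> * of_real t0) = w \<and> (\<forall>x. \<bar>x\<bar> \<le> 1 \<longrightarrow> F (of_real x) \<in> S)
      \<and> (\<forall>z\<in>half_box. \<forall>z'\<in>half_box. norm (F z - F z') \<le> C * norm (z - z'))
      \<and> (\<forall>z\<in>half_box. \<rho> (F z) \<le> \<rho> (F (of_real (Re z))) - c * Im z)
      \<and> (\<forall>z\<in>half_box_interior. (F has_derivative D z) (at z) \<and> (\<forall>h. D z (\<i> * h) = Jm (F z) (D z h)))
      \<and> (\<forall>h. continuous_on half_box_interior (\<lambda>z. D z h))"
proof -
  define I where "I = Jm p0"
  have "\<exists>v. blinfun_apply (\<rho>' p0) v \<noteq> 0" using l(2) by (metis blinfun_eqI zero_blinfun.rep_eq)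
  note lne = this
  have prem: "linear I" "I (I u) = - u" "\<exists>u'\<in>S. \<exists>w\<in>S. u = u' + I w" "linear (blinfun_apply (\<rho>' p0))" for u
    using lin[OF U(2)] sq[OF U(2)] gen bounded_linear.linear[OF blinfun.bounded_linear_right] by (simp_all add: I_def)
  obtain L M J \<tau> :: "'e \<Rightarrow> 'e" and b where fr: "linear L" "linear M" "\<And>v. L (M v) = v" "\<And>v. M (L v) = v"
    "real_structure J \<tau>" "\<And>v. L (I v) = J (L v)" "\<And>v. \<tau> v = v \<Longrightarrow> M v \<in> S" "b \<in> S" "\<tau> (L b) = L b" "\<rho>' p0 (I b) < 0"
    by (rule complex_frame[OF prem(1,2) S(1) prem(3,4) l(1) lne]) (assumption | rule that)+
  interpret real_structure J \<tau> by fact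
  interpret centred_real_structure J \<tau> t0 using t0 by unfold_locales
  have MJ: "M (J v) = I (M v)" for v by (metis fr(3,4,6))
  define Lb Mb Jb where "Lb = Blinfun L" and "Mb = Blinfun M" and "Jb = Blinfun J"
  have ap: "blinfun_apply Lb = L" "blinfun_apply Mb = M" "blinfun_apply Jb = J"
    unfolding Lb_def Mb_def Jb_def using fr(1,2) bounded_linear_J
    by (auto intro!: bounded_linear_Blinfun_apply simp: linear_conv_bounded_linear)
  obtain A A1 A2 where A: "\<And>x v. x \<in> U \<Longrightarrow> blinfun_apply (A x) v = Jm x v"
    "\<And>x. x \<in> U \<Longrightarrow> (A has_derivative blinfun_apply (A1 x)) (at x)"
    "\<And>x. x \<in> U \<Longrightarrow> (A1 has_derivative blinfun_apply (A2 x)) (at x)" "continuous_on U A2"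
    using smooth_endomorphism_field[of U Jm, OF sm lin] by blast
  have cA: "continuous_on U A" "continuous_on U A1"
    using A(2,3) by (meson continuous_at_imp_continuous_on has_derivative_continuous)+
  define q where "q = - \<rho>' p0 (I b)"
  define nl where "nl = norm (\<rho>' p0) + 1"
  define KM where "KM = norm Mb + 1"
  define s0 where "s0 = sinh t0"
  have pos: "q > 0" "nl > 0" "KM > 0" "s0 > 0" "sqrt C0 > 0"
    using fr(10) sinh_pos C0 norm_ge_zero[of "\<rho>' p0"] norm_ge_zero[of Mb] by (simp_all add: q_def nl_def KM_def s0_def add_nonneg_pos)
  have M: "norm (M v) \<le> KM * norm v" for v
    using norm_blinfun[of Mb v] unfolding ap(2) KM_def by (simp add: distrib_right add_increasing2)
  obtain r1 where r1: "r1 > 0" "cball p0 r1 \<subseteq> U" using U open_contains_cball by blast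
  have cmp: "compact (cball p0 r1)" by simp
  obtain K where K: "K \<ge> 0" "\<And>x. x \<in> cball p0 r1 \<Longrightarrow> norm (A1 x) \<le> K" "\<And>x. x \<in> cball p0 r1 \<Longrightarrow> norm (A2 x) \<le> K"
  proof -
    have "bounded (A1 ` cball p0 r1)" "bounded (A2 ` cball p0 r1)"
      using cA(2) A(4) r1(2) by (auto intro!: compact_imp_bounded compact_continuous_image cmp elim: continuous_on_subset)
    then obtain a1 a2 where "\<And>x. x \<in> cball p0 r1 \<Longrightarrow> norm (A1 x) \<le> a1" "\<And>x. x \<in> cball p0 r1 \<Longrightarrow> norm (A2 x) \<le> a2"
      unfolding bounded_iff by blast
    then show ?thesis using that[of "\<bar>a1\<bar> + \<bar>a2\<bar>"] by fastforce
  qed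
  \<comment> \<open>\<open>\<mu>\<close>, \<open>\<nu>\<close> and \<open>\<sigma>\<close> are chosen such that each of the three errors of \<open>f\<^sub>y\<close> contributes at most \<open>q / 32\<close>; \<open>\<eta>\<close> is chosen such that the variation of
    \<open>\<rho>'\<close> contributes at most \<open>q / 8\<close>.\<close>
  define \<mu> where "\<mu> = q / (32 * nl * KM * sqrt C0)"
  have \<mu>: "\<mu> > 0" "nl * KM * (sqrt C0 * \<mu>) \<le> q / 32" using pos by (simp_all add: \<mu>_def field_simps)
  define v0 where "v0 = s0 *\<^sub>R J (L b)"
  define R where "R = c0 * (norm v0 + 1) + sqrt C0 * \<mu> + 1"
  have R: "R \<ge> 1" using c0 pos \<mu> by (auto simp: R_def intro!: add_nonneg_nonneg mult_nonneg_nonneg)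
  note Rge = R and mu = \<mu>
  define \<nu> where "\<nu> = min 1 (q * s0 / (96 * nl * KM))"
  have \<nu>: "\<nu> > 0" "\<nu> \<le> 1" using pos by (simp_all add: \<nu>_def)
  have \<nu>2: "nl * KM * (3 * (\<nu> / s0)) \<le> q / 32"
  proof -
    have "\<nu> \<le> q * s0 / (96 * nl * KM)" by (simp add: \<nu>_def)
    then show ?thesis using pos by (simp add: field_simps)
  qed
  define \<eta> where "\<eta> = q / (16 * KM * R)"
  have \<eta>: "\<eta> > 0" "\<eta> * (KM * (2 * R)) \<le> q / 8" using pos R by (simp_all add: \<eta>_def field_simps)
  obtain r2 where r2: "r2 > 0" "r2 \<le> r1" "\<And>x. x \<in> ball p0 r2 \<Longrightarrow> norm (\<rho>' x - \<rho>' p0) \<le> \<eta>"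
  proof -
    have "isCont \<rho>' p0" using \<rho>'c U continuous_on_eq_continuous_at by blast
    then obtain d where "d > 0" "\<And>x. dist x p0 < d \<Longrightarrow> dist (\<rho>' x) (\<rho>' p0) < \<eta>"
      using \<eta>(1) unfolding continuous_at_eps_delta by blast
    then have "norm (\<rho>' x - \<rho>' p0) \<le> \<eta>" if "x \<in> ball p0 (min d r1)" for x
      using that by (simp add: dist_norm norm_minus_commute[of p0] less_imp_le)
    then show ?thesis using that[of "min d r1"] r1 \<open>d > 0\<close> by simp
  qed
  define k1 where "k1 = norm Lb * norm Mb"
  define K' where "K' = k1 * K * (norm Mb * R + norm Mb + norm Mb * norm Mb)"
  have k1: "k1 \<ge> 0" by (simp add: k1_def)
  have K': "K' \<ge> 0" using K R k1 by (simp add: K'_def)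
  \<comment> \<open>The scale \<open>\<epsilon>\<close> is chosen last: every condition on it holds in the limit \<open>\<epsilon> \<rightarrow> 0\<close>.\<close>
  have "\<forall>\<^sub>F \<epsilon> in at_right 0. (0 < \<epsilon> \<and> \<epsilon> < 1) \<and> \<epsilon> * (KM * R) < r2 \<and> (\<epsilon> * K')\<^sup>2 * (10 * R\<^sup>2 + 81 * R ^ 4 + 3 * R ^ 6) < \<mu>\<^sup>2
     \<and> (\<epsilon> * K')\<^sup>2 * C0 * (2 * (1 + R\<^sup>2) + 4 * (R ^ 4 + 22 * R\<^sup>2 + 1)) < 1 \<and> nl * KM * (\<epsilon> * K' * R) < q / 32 \<and> \<epsilon> * K' < (1::real)"
  proof (intro eventually_conj)
    show "\<forall>\<^sub>F \<epsilon> in at_right 0. (0::real) < \<epsilon>" by (simp add: eventually_at_right_less)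
    show "\<forall>\<^sub>F \<epsilon> in at_right 0. \<epsilon> < (1::real)" by (rule order_tendstoD) (auto intro!: tendsto_eq_intros)
    show "\<forall>\<^sub>F \<epsilon> in at_right 0. \<epsilon> * (KM * R) < r2" by (rule order_tendstoD(2)[of _ 0]) (auto intro!: tendsto_eq_intros r2)
    show "\<forall>\<^sub>F \<epsilon> in at_right 0. (\<epsilon> * K')\<^sup>2 * (10 * R\<^sup>2 + 81 * R ^ 4 + 3 * R ^ 6) < \<mu>\<^sup>2"
      by (rule order_tendstoD(2)[of _ 0]) (use \<mu> in \<open>auto intro!: tendsto_eq_intros\<close>)
    show "\<forall>\<^sub>F \<epsilon> in at_right 0. (\<epsilon> * K')\<^sup>2 * C0 * (2 * (1 + R\<^sup>2) + 4 * (R ^ 4 + 22 * R\<^sup>2 + 1)) < 1"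
      by (rule order_tendstoD(2)[of _ 0]) (auto intro!: tendsto_eq_intros)
    show "\<forall>\<^sub>F \<epsilon> in at_right 0. nl * KM * (\<epsilon> * K' * R) < q / 32"
      by (rule order_tendstoD(2)[of _ 0]) (use pos in \<open>auto intro!: tendsto_eq_intros\<close>)
    show "\<forall>\<^sub>F \<epsilon> in at_right 0. \<epsilon> * K' < (1::real)" by (rule order_tendstoD(2)[of _ 0]) (auto intro!: tendsto_eq_intros)
  qed
  then obtain \<epsilon> :: real where \<epsilon>: "0 < \<epsilon>" "\<epsilon> < 1" "\<epsilon> * (KM * R) < r2" "(\<epsilon> * K')\<^sup>2 * (10 * R\<^sup>2 + 81 * R ^ 4 + 3 * R ^ 6) < \<mu>\<^sup>2"
    "(\<epsilon> * K')\<^sup>2 * C0 * (2 * (1 + R\<^sup>2) + 4 * (R ^ 4 + 22 * R\<^sup>2 + 1)) < 1" "nl * KM * (\<epsilon> * K' * R) < q / 32" "\<epsilon> * K' < 1"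
    using eventually_happens'[OF trivial_limit_at_right_real] by blast
  define \<sigma> where "\<sigma> = \<epsilon> * K'"
  define \<Theta> :: "('e \<Rightarrow>\<^sub>L 'e) \<Rightarrow>\<^sub>L ('e \<Rightarrow>\<^sub>L 'e)" where "\<Theta> = Blinfun (\<lambda>T. Lb o\<^sub>L T o\<^sub>L Mb)"
  have \<Theta>: "\<Theta> T = Lb o\<^sub>L T o\<^sub>L Mb" for T
    unfolding \<Theta>_def by (subst bounded_linear_Blinfun_apply) (auto intro!: bounded_linear_intros)
  have n\<Theta>: "norm \<Theta> \<le> k1"
  proof (rule norm_blinfun_bound[OF k1])
    fix T
    have "norm (Lb o\<^sub>L T o\<^sub>L Mb) \<le> norm Lb * norm T * norm Mb"
      by (meson norm_blinfun_compose mult_right_mono norm_ge_zero order_trans)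
    then show "norm (\<Theta> T) \<le> k1 * norm T" by (simp add: \<Theta> k1_def mult_ac)
  qed
  define \<Theta>2 :: "('e \<Rightarrow>\<^sub>L ('e \<Rightarrow>\<^sub>L 'e)) \<Rightarrow>\<^sub>L ('e \<Rightarrow>\<^sub>L ('e \<Rightarrow>\<^sub>L 'e))" where "\<Theta>2 = Blinfun (\<lambda>T. \<epsilon> *\<^sub>R (\<Theta> o\<^sub>L T o\<^sub>L Mb))"
  have \<Theta>2: "\<Theta>2 T = \<epsilon> *\<^sub>R (\<Theta> o\<^sub>L T o\<^sub>L Mb)" for T
    unfolding \<Theta>2_def by (subst bounded_linear_Blinfun_apply) (auto intro!: bounded_linear_intros)
  have n3: "norm (X o\<^sub>L T o\<^sub>L Mb) \<le> x * t * norm Mb" if "norm X \<le> x" "norm T \<le> t"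
    for X :: "'c::real_normed_vector \<Rightarrow>\<^sub>L 'd::real_normed_vector" and T and x t
  proof -
    have "norm (X o\<^sub>L T o\<^sub>L Mb) \<le> norm X * norm T * norm Mb"
      by (meson norm_blinfun_compose mult_right_mono norm_ge_zero order_trans)
    also have "\<dots> \<le> x * t * norm Mb" using that by (intro mult_right_mono mult_mono) (auto intro: order_trans[OF norm_ge_zero])
    finally show ?thesis .
  qed
  have n\<Theta>2: "norm \<Theta>2 \<le> \<epsilon> * (k1 * norm Mb)"
  proof (rule norm_blinfun_bound)
    fix T
    show "norm (\<Theta>2 T) \<le> \<epsilon> * (k1 * norm Mb) * norm T"
      using n3[OF n\<Theta>, of T "norm T"] \<epsilon>(1) by (simp add: \<Theta>2 mult_ac)
  qed (use \<epsilon> k1 in simp)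
  define P where "P X = p0 + \<epsilon> *\<^sub>R M X" for X
  define G where "G X = \<Theta> (A (P X)) - Jb" for X
  define G1 where "G1 X = \<Theta>2 (A1 (P X))" for X
  define G2 where "G2 X = \<epsilon> *\<^sub>R (\<Theta>2 o\<^sub>L A2 (P X) o\<^sub>L Mb)" for X
  have PX: "P X \<in> ball p0 r2" "norm (P X - p0) \<le> \<epsilon> * (norm Mb * R)" if "X \<in> ball 0 R" for X
  proof -
    have X: "norm X \<le> R" using that by simp
    have "norm (M X) \<le> KM * R" using M[of X] mult_left_mono[OF X, of KM] pos by linarith
    then have "\<epsilon> * norm (M X) \<le> \<epsilon> * (KM * R)" using \<epsilon>(1) by (intro mult_left_mono) auto
    then have "\<epsilon> * norm (M X) < r2" using \<epsilon>(3) by linarith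
    then show "P X \<in> ball p0 r2" using \<epsilon>(1) by (simp add: P_def dist_norm)
    have "norm (M X) \<le> norm Mb * R" using norm_blinfun[of Mb X] mult_left_mono[OF X norm_ge_zero[of Mb]] by (simp add: ap)
    then show "norm (P X - p0) \<le> \<epsilon> * (norm Mb * R)" using \<epsilon> by (simp add: P_def)
  qed
  have r21: "ball p0 r2 \<subseteq> cball p0 r1" using r2(2) by (auto simp: subset_iff)
  have PU: "P X \<in> U" "P X \<in> cball p0 r1" if "X \<in> ball 0 R" for X using PX(1)[OF that] r21 r1(2) by auto
  \<comment> \<open>Hence \<open>G\<close> vanishes at the centre, and its size is that of the increment of \<open>A\<close> between \<open>p0\<close> and \<open>P X\<close>.\<close>
  have Ap0: "\<Theta> (A p0) = Jb"
  proof (rule blinfun_eqI)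
    show "\<Theta> (A p0) v = Jb v" for v
      by (simp add: \<Theta> ap A(1)[OF U(2)] I_def[symmetric] fr)
  qed
  have G: "G X v = L (Jm (P X) (M v)) - J v" if "X \<in> ball 0 R" for X v
    by (simp add: G_def \<Theta> ap A(1)[OF PU(1)[OF that]] minus_blinfun.rep_eq)
  have K'1: "k1 * K * (norm Mb * R) \<le> K'" "k1 * K * norm Mb \<le> K'" "k1 * K * (norm Mb * norm Mb) \<le> K'"
    unfolding K'_def using k1 K R by (intro mult_left_mono; simp)+
  have \<sigma>1: "\<epsilon> * (k1 * K * (norm Mb * R)) \<le> \<sigma>" "\<epsilon> * (k1 * K * norm Mb) \<le> \<sigma>"
    unfolding \<sigma>_def using K'1 \<epsilon>(1) by (auto intro: mult_left_mono simp del: mult_le_cancel_left_pos)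
  show ?thesis
  proof (rule that)
    define W where "W = (\<lambda>w. (1 / \<epsilon>) *\<^sub>R L (w - p0)) -` ball v0 \<nu>"
    have cL: "continuous_on UNIV L" using fr(1) by (simp add: linear_continuous_on linear_conv_bounded_linear)
    show "open W" unfolding W_def
      by (intro open_vimage open_ball continuous_intros continuous_on_compose2[OF cL]) auto
    have "p0 + \<epsilon> *\<^sub>R M v0 \<in> W" using \<epsilon>(1) \<nu>(1) fr(1,3) by (simp add: W_def linear_scale)
    then show "W \<noteq> {}" by blast
    fix w assume w: "w \<in> W"
    define v where "v = (1 / \<epsilon>) *\<^sub>R L (w - p0)"
    have v: "norm (v - v0) < \<nu>" using w by (simp add: W_def v_def dist_norm norm_minus_commute)
    have vR: "c0 * norm v + sqrt C0 * \<mu> < R"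
    proof -
      have "norm v \<le> norm v0 + 1" using v \<nu>(2) norm_triangle_ineq2[of v v0] by linarith
      then have "c0 * norm v \<le> c0 * (norm v0 + 1)" using c0 by simp
      then show ?thesis unfolding R_def by linarith
    qed
    interpret strip_equation J \<tau> t0 G G1 G2 R \<sigma> \<mu> v
    proof
      fix X :: 'e assume X: "X \<in> ball 0 R"
      show "(G has_derivative blinfun_apply (G1 X)) (at X)"
      proof -
        have "((\<lambda>X. \<Theta> (A (P X)) - Jb) has_derivative (\<lambda>h. blinfun_apply (\<epsilon> *\<^sub>R (\<Theta> o\<^sub>L A1 (P X) o\<^sub>L Mb)) h - 0)) (at X)"
          using scaled_has_derivative[of A "A1 (P X)" p0 \<epsilon> Mb X \<Theta>] A(2)[OF PU(1)[OF X]]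
          by (intro has_derivative_diff has_derivative_const) (simp add: P_def ap)
        then show ?thesis unfolding G_def G1_def by (simp add: \<Theta>2)
      qed
      show "(G1 has_derivative blinfun_apply (G2 X)) (at X)"
        using scaled_has_derivative[of A1 "A2 (P X)" p0 \<epsilon> Mb X \<Theta>2] A(3)[OF PU(1)[OF X]]
        unfolding G1_def G2_def by (simp add: P_def ap)
      have "norm (A (P X) - A p0) \<le> K * norm (P X - p0)"
      proof (rule differentiable_bound[of "cball p0 r1" A "\<lambda>x. blinfun_apply (A1 x)"])
        show "(A has_derivative blinfun_apply (A1 x)) (at x within cball p0 r1)" if "x \<in> cball p0 r1" for x
          by (rule has_derivative_at_withinI[OF A(2)]) (use r1(2) that in auto)
        show "onorm (blinfun_apply (A1 x)) \<le> K" if "x \<in> cball p0 r1" for x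
          using K(2)[OF that] by (simp add: norm_blinfun.rep_eq)
      qed (use PU(2)[OF X] r1 in auto)
      also have "\<dots> \<le> K * (\<epsilon> * (norm Mb * R))" using PX(2)[OF X] K(1) by (intro mult_left_mono)
      finally have "norm (\<Theta> (A (P X) - A p0)) \<le> k1 * (K * (\<epsilon> * (norm Mb * R)))"
        by (intro order_trans[OF norm_blinfun] mult_mono n\<Theta> k1) auto
      then have "norm (G X) \<le> \<epsilon> * (k1 * K * (norm Mb * R))"
        by (simp add: G_def Ap0[symmetric] blinfun.diff_right mult_ac)
      then show "norm (G X) \<le> \<sigma>" using \<sigma>1(1) by linarith
      have "norm (G1 X) \<le> \<epsilon> * (k1 * K * norm Mb)"
        unfolding G1_def \<Theta>2 using n3[OF n\<Theta> K(2)[OF PU(2)[OF X]]] \<epsilon>(1) by simp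
      then show "norm (G1 X) \<le> \<sigma>" using \<sigma>1(2) by linarith
      have "norm (G2 X) \<le> \<epsilon> * (\<epsilon> * (k1 * norm Mb) * K * norm Mb)"
        unfolding G2_def using n3[OF n\<Theta>2 K(3)[OF PU(2)[OF X]]] \<epsilon>(1) by simp
      also have "\<dots> = \<epsilon> * (\<epsilon> * (k1 * K * (norm Mb * norm Mb)))" by (simp add: mult_ac)
      also have "\<dots> \<le> \<epsilon> * (1 * K')" using \<epsilon>(1,2) K'1(3) k1 K(1) by (intro mult_left_mono mult_mono) auto
      finally show "norm (G2 X) \<le> \<sigma>" by (simp add: \<sigma>_def)
    next
      have "continuous_on (ball 0 R) P" unfolding P_def
        using fr(2) by (intro continuous_intros linear_continuous_on) (simp add: linear_conv_bounded_linear)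
      then have "continuous_on (ball 0 R) (\<lambda>X. A2 (P X))" using PU(1) by (intro continuous_on_compose2[OF A(4)]) auto
      then show "continuous_on (ball 0 R) G2" unfolding G2_def by (intro continuous_intros)
    qed (use \<mu>(1) vR \<epsilon> in \<open>auto simp: \<sigma>_def\<close>)
    note R = Rge and \<mu> = mu
    obtain F0 F1 where F: "continuous_on (UNIV \<times> {0..1}) (\<lambda>p. F0 (fst p) (snd p))"
      "continuous_on (UNIV \<times> {0..1}) (\<lambda>p. F1 (fst p) (snd p))"
      "\<And>x y. y \<in> {0..1} \<Longrightarrow> ((\<lambda>x. F0 x y) has_vector_derivative F1 x y) (at x)"
      "\<And>x y. x \<in> {-pi..pi} \<Longrightarrow> y \<in> {0..1} \<Longrightarrow>
         ((\<lambda>y. F0 x y) has_vector_derivative J (F1 x y) + G (F0 x y) (F1 x y)) (at y within {0..1})"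
      "\<And>x. \<tau> (F0 x 0) = F0 x 0" "F0 0 t0 = v"
      "\<And>x y. y \<in> {0..1} \<Longrightarrow> F0 x y \<in> ball 0 R" "\<And>x y. y \<in> {0..1} \<Longrightarrow> norm (F1 x y) \<le> R"
      "\<And>x y. y \<in> {0..1} \<Longrightarrow> norm (F1 x y - cm (sine 1 x y) (odd_part v)) \<le> sqrt C0 * \<mu>"
      using strip_solution by blast
    define Fy where "Fy x y = J (F1 x y) + G (F0 x y) (F1 x y)" for x y
    have MFy: "M (Fy x y) = Jm (P (F0 x y)) (M (F1 x y))" if "y \<in> {0..1}" for x y
      using G[OF F(7)[OF that], of x "F1 x y"] by (simp add: Fy_def fr(4))
    have GF1: "norm (G (F0 x y) (F1 x y)) \<le> \<sigma> * R" if y: "y \<in> {0..1}" for x y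
      using order_trans[OF norm_Gb(1)[OF F(7)[OF y]] mult_left_mono[OF F(8)[OF y] \<sigma>_nonneg]] .
    have \<sigma>R: "\<sigma> * R \<le> R" using \<epsilon>(7) R mult_right_mono[of \<sigma> 1 R] by (simp add: \<sigma>_def)
    have nFy: "norm (Fy x y) \<le> 2 * R" if y: "y \<in> {0..1}" for x y
      unfolding Fy_def using GF1[OF y, of x] F(8)[OF y, of x] \<sigma>R norm_triangle_ineq[of "J (F1 x y)" "G (F0 x y) (F1 x y)"] by simp
    define Fz where "Fz z = P (F0 (Re z) (Im z))" for z
    define w1 where "w1 z = \<epsilon> *\<^sub>R M (F1 (Re z) (Im z))" for z
    \<comment> \<open>The derivative of \<open>Fz\<close>; its second summand is \<open>Jm\<close> applied to the derivative in direction \<open>x\<close>.\<close>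
    define D where "D z h = Re h *\<^sub>R w1 z + Im h *\<^sub>R A (Fz z) (w1 z)" for z h
    interpret M: bounded_linear M using fr(2) by (simp add: linear_conv_bounded_linear)
    have half_boxD: "Im z \<in> {0..1}" "Re z \<in> {-pi..pi}" if "z \<in> half_box" for z using that pi_gt3 by (auto simp: half_box_def)
    have interior_half_box: "half_box_interior \<subseteq> half_box" by (auto simp: half_box_def half_box_interior_def)
    have FU: "Fz z \<in> U" "Fz z \<in> ball p0 r2" if "z \<in> half_box" for z
      unfolding Fz_def using PU(1) PX(1) F(7) half_boxD(1)[OF that] by auto
    have center: "Fz (\<i> * of_real t0) = w"
      using \<epsilon>(1) by (simp add: Fz_def F(6) P_def v_def M.scaleR fr(4))
    have inS: "Fz (of_real x) \<in> S" for x
    proof -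
      have "M (F0 x 0) \<in> S" by (rule fr(7)[OF F(5)])
      then show ?thesis using S by (simp add: Fz_def P_def subspace_add subspace_scale)
    qed
    have Fdy: "((\<lambda>y. F0 x y) has_vector_derivative Fy x y) (at y within {0..1})" if "\<bar>x\<bar> \<le> 1" "y \<in> {0..1}" for x y
      unfolding Fy_def using that pi_gt3 by (intro F(4)) auto
    have lip: "norm (Fz z - Fz z') \<le> (\<epsilon> * (KM * (3 * R))) * norm (z - z')" if z: "z \<in> half_box" and z': "z' \<in> half_box" for z z'
    proof -
      have "norm (F0 (Re z) (Im z) - F0 (Re z') (Im z)) \<le> R * norm (Re z - Re z')"
        by (rule differentiable_bound[of UNIV "\<lambda>x. F0 x (Im z)" "\<lambda>x h. h *\<^sub>R F1 x (Im z)"])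
          (use F(3)[OF half_boxD(1)[OF z]] F(8)[OF half_boxD(1)[OF z]] in \<open>auto simp: has_vector_derivative_def onorm_scaleR_left onorm_id\<close>)
      moreover have "norm (F0 (Re z') (Im z) - F0 (Re z') (Im z')) \<le> 2 * R * norm (Im z - Im z')"
      proof (rule differentiable_bound[of "{0..1}" "\<lambda>y. F0 (Re z') y" "\<lambda>y h. h *\<^sub>R Fy (Re z') y"])
        show "((\<lambda>y. F0 (Re z') y) has_derivative (\<lambda>h. h *\<^sub>R Fy (Re z') y)) (at y within {0..1})" if "y \<in> {0..1}" for y
          using Fdy[OF _ that, of "Re z'"] z' by (auto simp: has_vector_derivative_def half_box_def)
        show "onorm (\<lambda>h. h *\<^sub>R Fy (Re z') y) \<le> 2 * R" if "y \<in> {0..1}" for y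
          using nFy[OF that] by (simp add: onorm_scaleR_left onorm_id)
      qed (use half_boxD[OF z] half_boxD[OF z'] in auto)
      moreover have "norm (Re z - Re z') \<le> norm (z - z')" "norm (Im z - Im z') \<le> norm (z - z')"
        using abs_Re_le_cmod[of "z - z'"] abs_Im_le_cmod[of "z - z'"] by simp_all
      then have "R * norm (Re z - Re z') \<le> R * norm (z - z')" "2 * R * norm (Im z - Im z') \<le> 2 * R * norm (z - z')"
        using R by (intro mult_left_mono; simp)+
      ultimately have n: "norm (F0 (Re z) (Im z) - F0 (Re z') (Im z')) \<le> 3 * R * norm (z - z')"
        using norm_triangle_ineq[of "F0 (Re z) (Im z) - F0 (Re z') (Im z)" "F0 (Re z') (Im z) - F0 (Re z') (Im z')"] by simp
      have "norm (Fz z - Fz z') = \<epsilon> * norm (M (F0 (Re z) (Im z) - F0 (Re z') (Im z')))"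
        using \<epsilon>(1) by (simp add: Fz_def P_def M.diff flip: scaleR_diff_right)
      also have "\<dots> \<le> \<epsilon> * (KM * (3 * R * norm (z - z')))"
        using \<epsilon>(1) pos by (intro mult_left_mono order_trans[OF M] n) auto
      finally show ?thesis by (simp add: mult_ac)
    qed
    have drop: "\<rho> (Fz z) \<le> \<rho> (Fz (of_real (Re z))) - (\<epsilon> * q / 4) * Im z" if z: "z \<in> half_box" for z
    proof (cases "Im z = 0")
      case True
      then have "z = of_real (Re z)" by (simp add: complex_eq_iff)
      then show ?thesis using True by simp
    next
      case False
      define x where "x = Re z"
      have x: "\<bar>x\<bar> \<le> 1" using z by (simp add: x_def half_box_def)
      have Im: "0 < Im z" "Im z \<le> 1" using z False by (auto simp: half_box_def)
      let ?g = "\<lambda>y. \<rho> (P (F0 x y))"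
      have dg: "(?g has_derivative (\<lambda>h. h * \<rho>' (P (F0 x y)) (\<epsilon> *\<^sub>R M (Fy x y)))) (at y within {0..Im z})" if y: "0 \<le> y" "y \<le> Im z" for y
      proof -
        have y': "y \<in> {0..1}" using y Im by auto
        have "((\<lambda>y. F0 x y) has_vector_derivative Fy x y) (at y within {0..Im z})"
          by (rule has_vector_derivative_within_subset[OF Fdy[OF x y']]) (use Im in auto)
        then have "((\<lambda>y. P (F0 x y)) has_vector_derivative \<epsilon> *\<^sub>R M (Fy x y)) (at y within {0..Im z})"
          unfolding P_def by (auto intro!: derivative_eq_intros M.has_vector_derivative)
        from has_vector_derivative_compose_total[OF this \<rho>[OF PU(1)[OF F(7)[OF y']]]]
        show ?thesis by (simp add: has_vector_derivative_def)
      qed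
      obtain y where y: "y \<in> {0<..<Im z}" "?g (Im z) - ?g 0 = (Im z - 0) * \<rho>' (P (F0 x y)) (\<epsilon> *\<^sub>R M (Fy x y))"
        using mvt_simple[OF Im(1) dg] by blast
      have y': "y \<in> {0..1}" using y Im by auto
      define s where "s = sine 1 x y"
      have sr: "Re s \<ge> 1 / 2" unfolding s_def by (rule Re_sine_1[OF x])
      \<comment> \<open>The imaginary part of \<open>s\<close> multiplies \<open>b \<in> S\<close>, on which \<open>\<rho>' p0\<close> vanishes.\<close>
      have main: "\<rho>' p0 (M (J (cm s (L b)))) \<le> - q / 2"
      proof -
        have "M (J (cm s (L b))) = Re s *\<^sub>R I b - Im s *\<^sub>R b"
          by (simp add: cm_def J_add J_scale M.add M.scaleR M.neg M.diff MJ fr(4))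
        then have "\<rho>' p0 (M (J (cm s (L b)))) = Re s * \<rho>' p0 (I b) - Im s * \<rho>' p0 b"
          by (simp add: blinfun.diff_right blinfun.scaleR_right)
        also have "\<dots> = - (Re s * q)" using l(1)[OF fr(8)] by (simp add: q_def)
        finally show ?thesis using mult_right_mono[OF sr, of q] pos by simp
      qed
      have Bv0: "odd_part v0 = L b"
      proof -
        have "\<tau> v0 = - v0" by (simp add: v0_def \<tau>_scale \<tau>_J fr(9))
        then show ?thesis using pos(4) by (simp add: odd_part_def v0_def J_add J_scale J_diff J_minus s0_def flip: scaleR_add_left)
      qed
      have e1: "norm (Fy x y - J (cm s (L b))) \<le> sqrt C0 * \<mu> + 3 * (\<nu> / s0) + \<sigma> * R"
      proof -
        have "norm (cm s (odd_part v - L b)) \<le> 3 * (\<nu> / s0)"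
        proof -
          have "norm (odd_part v - L b) = norm (odd_part (v - v0))" by (simp add: odd_part_diff Bv0)
          also have "\<dots> \<le> norm (v - v0) / s0" unfolding s0_def by (rule norm_odd_part)
          also have "\<dots> \<le> \<nu> / s0" using v pos by (simp add: divide_right_mono)
          finally show ?thesis unfolding norm_cm s_def using norm_sine[OF y', of 1 x] by (intro mult_mono) auto
        qed
        moreover have "Fy x y - J (cm s (L b)) = J (F1 x y - cm s (odd_part v)) + J (cm s (odd_part v - L b)) + G (F0 x y) (F1 x y)"
          by (simp add: Fy_def J_diff cm.diff_right)
        moreover have "norm (J (F1 x y - cm s (odd_part v))) \<le> sqrt C0 * \<mu>" using F(9)[OF y', of x] by (simp add: s_def)
        ultimately show ?thesis
          using GF1[OF y', of x] norm_triangle_ineq[of "J (F1 x y - cm s (odd_part v)) + J (cm s (odd_part v - L b))" "G (F0 x y) (F1 x y)"]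
            norm_triangle_ineq[of "J (F1 x y - cm s (odd_part v))" "J (cm s (odd_part v - L b))"] by simp
      qed
      have e2: "\<rho>' p0 (M (Fy x y - J (cm s (L b)))) \<le> 3 * (q / 32)"
      proof -
        have "\<rho>' p0 (M (Fy x y - J (cm s (L b)))) \<le> nl * norm (M (Fy x y - J (cm s (L b))))"
          using norm_blinfun[of "\<rho>' p0" "M (Fy x y - J (cm s (L b)))"] mult_right_mono[of "norm (\<rho>' p0)" nl "norm (M (Fy x y - J (cm s (L b))))"]
          by (simp add: nl_def)
        also have "\<dots> \<le> nl * (KM * (sqrt C0 * \<mu> + 3 * (\<nu> / s0) + \<sigma> * R))"
          using pos by (intro mult_left_mono order_trans[OF M] e1) auto
        also have "\<dots> = nl * KM * (sqrt C0 * \<mu>) + nl * KM * (3 * (\<nu> / s0)) + nl * KM * (\<epsilon> * K' * R)"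
          by (simp add: \<sigma>_def algebra_simps)
        also have "\<dots> \<le> q / 32 + q / 32 + q / 32" using \<mu>(2) \<nu>2 \<epsilon>(6) by simp
        finally show ?thesis by simp
      qed
      have e3: "(\<rho>' (P (F0 x y)) - \<rho>' p0) (M (Fy x y)) \<le> q / 8"
      proof -
        have "(\<rho>' (P (F0 x y)) - \<rho>' p0) (M (Fy x y)) \<le> norm (\<rho>' (P (F0 x y)) - \<rho>' p0) * norm (M (Fy x y))"
          using norm_blinfun[of "\<rho>' (P (F0 x y)) - \<rho>' p0" "M (Fy x y)"] by simp
        also have "\<dots> \<le> \<eta> * (KM * (2 * R))"
          using r2(3)[OF PX(1)[OF F(7)[OF y']]] \<eta>(1) pos nFy[OF y']
          by (intro mult_mono order_trans[OF M]) auto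
        finally show ?thesis using \<eta>(2) by linarith
      qed
      have "\<rho>' (P (F0 x y)) (M (Fy x y)) = \<rho>' p0 (M (J (cm s (L b)))) + \<rho>' p0 (M (Fy x y - J (cm s (L b)))) + (\<rho>' (P (F0 x y)) - \<rho>' p0) (M (Fy x y))"
        by (simp add: M.diff blinfun.diff_right blinfun.diff_left)
      then have "\<rho>' (P (F0 x y)) (M (Fy x y)) \<le> - q / 4" using main e2 e3 pos by linarith
      then have "\<epsilon> * \<rho>' (P (F0 x y)) (M (Fy x y)) \<le> \<epsilon> * (- q / 4)" using \<epsilon>(1) by (intro mult_left_mono) auto
      from mult_left_mono[OF this less_imp_le[OF Im(1)]]
      have "Im z * (\<epsilon> * \<rho>' (P (F0 x y)) (M (Fy x y))) \<le> Im z * (\<epsilon> * (- q / 4))" .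
      then have "?g (Im z) - ?g 0 \<le> - (\<epsilon> * q / 4) * Im z"
        unfolding y(2) by (simp add: blinfun.scaleR_right mult_ac)
      then show ?thesis by (simp add: Fz_def x_def)
    qed
    have open_interior: "open half_box_interior"
    proof -
      have "half_box_interior = {z. \<bar>Re z\<bar> < 1} \<inter> ({z. 0 < Im z} \<inter> {z. Im z < 1})" by (auto simp: half_box_interior_def)
      moreover have "open \<dots>" by (intro open_Int open_Collect_less continuous_intros)
      ultimately show ?thesis by simp
    qed
    have cz: "continuous_on half_box_interior (\<lambda>z. (Re z, Im z))" "(\<lambda>z. (Re z, Im z)) ` half_box_interior \<subseteq> UNIV \<times> {0..1}"
      by (intro continuous_intros) (auto simp: half_box_interior_def)
    have cRI: "continuous_on half_box_interior (\<lambda>z. F0 (Re z) (Im z))" "continuous_on half_box_interior (\<lambda>z. F1 (Re z) (Im z))"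
      using continuous_on_compose2[OF F(1) cz] continuous_on_compose2[OF F(2) cz] by simp_all
    have cw1: "continuous_on half_box_interior w1" unfolding w1_def by (intro continuous_intros M.continuous_on cRI)
    have cFz: "continuous_on half_box_interior Fz" unfolding Fz_def P_def by (intro continuous_intros M.continuous_on cRI)
    have cAF: "continuous_on half_box_interior (\<lambda>z. A (Fz z))" by (rule continuous_on_compose2[OF cA(1) cFz]) (use FU(1) interior_half_box in auto)
    have cD: "continuous_on half_box_interior (\<lambda>z. D z h)" for h
      unfolding D_def by (intro continuous_intros cw1 cAF bounded_bilinear.continuous_on[OF bounded_bilinear_blinfun_apply])
    have dD: "(Fz has_derivative D z) (at z)" if z: "z \<in> half_box_interior" for z
    proof -
      let ?X = "{-1<..<1::real}" and ?Y = "{0<..<1::real}"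
      define fy where "fy x y = blinfun_scaleR_left (Fy x y)" for x y
      have Fyc: "continuous_on (?X \<times> ?Y) (\<lambda>p. Fy (fst p) (snd p))"
      proof -
        have e: "Fy x y = L (A (P (F0 x y)) (M (F1 x y)))" if "(x, y) \<in> ?X \<times> ?Y" for x y
          using MFy[of y x] that A(1)[OF PU(1)[OF F(7)]] fr(3)[of "Fy x y"] by auto
        have c0: "continuous_on (?X \<times> ?Y) (\<lambda>p. F0 (fst p) (snd p))" "continuous_on (?X \<times> ?Y) (\<lambda>p. F1 (fst p) (snd p))"
          by (rule continuous_on_subset[OF F(1)], force) (rule continuous_on_subset[OF F(2)], force)
        have cP: "continuous_on (?X \<times> ?Y) (\<lambda>p. P (F0 (fst p) (snd p)))"
          unfolding P_def by (intro continuous_intros M.continuous_on c0)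
        have "continuous_on (?X \<times> ?Y) (\<lambda>p. A (P (F0 (fst p) (snd p))))"
          by (rule continuous_on_compose2[OF cA(1) cP]) (use PU(1) F(7) in auto)
        then have "continuous_on (?X \<times> ?Y) (\<lambda>p. L (A (P (F0 (fst p) (snd p))) (M (F1 (fst p) (snd p)))))"
          by (intro continuous_on_compose2[OF cL] bounded_bilinear.continuous_on[OF bounded_bilinear_blinfun_apply] M.continuous_on c0) auto
        then show ?thesis by (rule continuous_on_eq) (use e in auto)
      qed
      have xy: "Re z \<in> ?X" "Im z \<in> ?Y" using z by (auto simp: half_box_interior_def)
      have "((\<lambda>(x, y). F0 x y) has_derivative (\<lambda>(tx, ty). tx *\<^sub>R F1 (Re z) (Im z) + blinfun_apply (fy (Re z) (Im z)) ty)) (at (Re z, Im z) within ?X \<times> ?Y)"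
      proof (rule has_derivative_partialsI)
        show "((\<lambda>x. F0 x (Im z)) has_derivative (\<lambda>tx. tx *\<^sub>R F1 (Re z) (Im z))) (at (Re z) within ?X)"
          using F(3)[of "Im z" "Re z"] xy by (auto simp: has_vector_derivative_def intro: has_derivative_at_withinI)
        show "((\<lambda>y. F0 x y) has_derivative blinfun_apply (fy x y)) (at y within ?Y)" if "x \<in> ?X" "y \<in> ?Y" for x y
        proof -
          have "((\<lambda>y. F0 x y) has_vector_derivative Fy x y) (at y within ?Y)"
            by (rule has_vector_derivative_within_subset[OF Fdy]) (use that in auto)
          then show ?thesis by (simp add: has_vector_derivative_def fy_def blinfun_scaleR_left.rep_eq)
        qed
        have "continuous_on (?X \<times> ?Y) (\<lambda>p. fy (fst p) (snd p))"
          unfolding fy_def by (intro bounded_linear.continuous_on[OF bounded_linear_blinfun_scaleR_left] Fyc)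
        then show "continuous (at (Re z, Im z) within ?X \<times> ?Y) (\<lambda>(x, y). fy x y)"
          using xy by (auto simp: continuous_on_eq_continuous_within case_prod_unfold)
      qed (use xy in auto)
      then have d: "((\<lambda>(x, y). F0 x y) has_derivative (\<lambda>(tx, ty). tx *\<^sub>R F1 (Re z) (Im z) + ty *\<^sub>R Fy (Re z) (Im z))) (at (Re z, Im z))"
        using xy by (simp add: fy_def blinfun_scaleR_left.rep_eq at_within_open[of _ "?X \<times> ?Y"] open_Times)
      have "((\<lambda>z. (Re z, Im z)) has_derivative (\<lambda>h. (Re h, Im h))) (at z)"
        by (intro has_derivative_Pair bounded_linear_imp_has_derivative bounded_linear_Re bounded_linear_Im)
      from has_derivative_compose[OF this d]
      have "((\<lambda>z. F0 (Re z) (Im z)) has_derivative (\<lambda>h. Re h *\<^sub>R F1 (Re z) (Im z) + Im h *\<^sub>R Fy (Re z) (Im z))) (at z)" by simp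
      then have "(Fz has_derivative (\<lambda>h. 0 + \<epsilon> *\<^sub>R M (Re h *\<^sub>R F1 (Re z) (Im z) + Im h *\<^sub>R Fy (Re z) (Im z)))) (at z)"
        unfolding Fz_def P_def
        by (intro has_derivative_add has_derivative_const has_derivative_scaleR_right M.has_derivative)
      also have "(\<lambda>h. 0 + \<epsilon> *\<^sub>R M (Re h *\<^sub>R F1 (Re z) (Im z) + Im h *\<^sub>R Fy (Re z) (Im z))) = D z"
      proof
        fix h
        have y: "Im z \<in> {0..1}" using xy by auto
        have "A (Fz z) (w1 z) = \<epsilon> *\<^sub>R M (Fy (Re z) (Im z))"
          using MFy[OF y, of "Re z"] A(1)[OF PU(1)[OF F(7)[OF y]]] by (simp add: Fz_def w1_def blinfun.scaleR_right)
        then show "0 + \<epsilon> *\<^sub>R M (Re h *\<^sub>R F1 (Re z) (Im z) + Im h *\<^sub>R Fy (Re z) (Im z)) = D z h"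
          by (simp add: D_def w1_def M.add M.scaleR algebra_simps)
      qed
      finally show ?thesis .
    qed
    have hol: "D z (\<i> * h) = Jm (Fz z) (D z h)" if z: "z \<in> half_box_interior" for z h
    proof -
      have zU: "Fz z \<in> U" using FU(1) interior_half_box z by blast
      interpret Jl: linear "Jm (Fz z)" by (rule lin[OF zU])
      show ?thesis by (simp add: D_def A(1)[OF zU] Jl.add Jl.scaleR sq[OF zU])
    qed
    show "\<exists>F D c C. c > 0 \<and> F ` half_box \<subseteq> U \<and> F (\<i> * of_real t0) = w \<and> (\<forall>x. \<bar>x\<bar> \<le> 1 \<longrightarrow> F (of_real x) \<in> S)
      \<and> (\<forall>z\<in>half_box. \<forall>z'\<in>half_box. norm (F z - F z') \<le> C * norm (z - z'))
      \<and> (\<forall>z\<in>half_box. \<rho> (F z) \<le> \<rho> (F (of_real (Re z))) - c * Im z)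
      \<and> (\<forall>z\<in>half_box_interior. (F has_derivative D z) (at z) \<and> (\<forall>h. D z (\<i> * h) = Jm (F z) (D z h)))
      \<and> (\<forall>h. continuous_on half_box_interior (\<lambda>z. D z h))"
    proof (rule exI[of _ Fz], rule exI[of _ D], rule exI[of _ "\<epsilon> * q / 4"], rule exI[of _ "\<epsilon> * (KM * (3 * R))"], intro conjI ballI allI impI)
      show "\<epsilon> * q / 4 > 0" using \<epsilon>(1) pos by simp
      show "Fz ` half_box \<subseteq> U" using FU(1) by blast
    qed (fact center | rule inS lip drop dD hol cD; assumption?)+
  qed
qed

section \<open>A conformal map onto the half disc and the two-constants estimate\<close>

text \<open>
  The Cayley transform maps the disc to the upper half plane and the lower half of the unit circle to the positive real axis; the square root maps
  this to the first quadrant with the same arc, and a second Cayley transform maps the quadrant to the upper half disc, the positive axis going to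
  \<open>(-1, 1)\<close>.
\<close>

definition cayley :: "complex \<Rightarrow> complex" where "cayley z = \<i> * (1 + z) / (1 - z)"
definition half_disc_map :: "complex \<Rightarrow> complex" where "half_disc_map z = (csqrt (cayley z) - 1) / (csqrt (cayley z) + 1)"
definition half_disc_deriv :: "complex \<Rightarrow> complex" where
  "half_disc_deriv z = 2 / (csqrt (cayley z) + 1)\<^sup>2 * ((2 * \<i> / (1 - z)\<^sup>2) / (2 * csqrt (cayley z)))"

lemma cayley_pos:
  assumes "norm z < 1" shows "Im (cayley z) > 0"
proof -
  have n: "1 - z \<noteq> 0" using assms by auto
  have "cayley z = \<i> * (1 + z) * cnj (1 - z) / of_real ((norm (1 - z))\<^sup>2)"
    unfolding cayley_def by (subst complex_div_cnj) (simp add: complex_norm_square)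
  also have "Im \<dots> = (1 - (norm z)\<^sup>2) / (norm (1 - z))\<^sup>2"
    by (simp add: Im_divide_of_real cmod_power2) (simp add: power2_eq_square algebra_simps)
  finally show ?thesis using assms n by (simp add: power_less_one_iff abs_square_less_1)
qed

lemma csqrt_quadrant:
  assumes "Im w > 0" shows "Re (csqrt w) > 0" "Im (csqrt w) > 0"
proof -
  define s where "s = csqrt w"
  have "s * s = w" unfolding s_def by (metis power2_csqrt power2_eq_square)
  then have e: "2 * (Re s * Im s) = Im w" by auto
  have r0: "0 \<le> Re s" unfolding s_def by (rule Re_csqrt)
  have "Re s \<noteq> 0" using e assms by auto
  then have r1: "Re s > 0" using r0 by linarith
  have "Re s * Im s > 0" using e assms by linarith
  then have "Im s > 0" using r1 zero_less_mult_pos by blast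
  then show "Re (csqrt w) > 0" "Im (csqrt w) > 0" using r1 unfolding s_def by blast+
qed

lemma Cayley_quadrant:
  assumes "Re s > 0" shows "norm ((s - 1) / (s + 1)) < 1" "Im ((s - 1) / (s + 1)) = 2 * Im s / (norm (s + 1))\<^sup>2"
    "Re ((s - 1) / (s + 1)) = ((norm s)\<^sup>2 - 1) / (norm (s + 1))\<^sup>2" "s + 1 \<noteq> 0"
proof -
  show n: "s + 1 \<noteq> 0" using assms by (auto simp: complex_eq_iff)
  have "(norm (s - 1))\<^sup>2 < (norm (s + 1))\<^sup>2" using assms by (simp add: cmod_power2) (simp add: power2_eq_square algebra_simps)
  then have "norm (s - 1) < norm (s + 1)" by (rule power2_less_imp_less) simp
  then show "norm ((s - 1) / (s + 1)) < 1" using n by (simp add: norm_divide divide_less_eq)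
  have "(s - 1) / (s + 1) = (s - 1) * cnj (s + 1) / of_real ((norm (s + 1))\<^sup>2)"
    by (subst complex_div_cnj) (simp add: complex_norm_square)
  then show "Im ((s - 1) / (s + 1)) = 2 * Im s / (norm (s + 1))\<^sup>2" "Re ((s - 1) / (s + 1)) = ((norm s)\<^sup>2 - 1) / (norm (s + 1))\<^sup>2"
    by (simp_all add: Im_divide_of_real Re_divide_of_real cmod_power2) (simp_all add: power2_eq_square algebra_simps)
qed

lemma half_disc_map_range:
  assumes "norm z < 1" shows "norm (half_disc_map z) < 1" "Im (half_disc_map z) > 0"
proof -
  note s = csqrt_quadrant[OF cayley_pos[OF assms]]
  show "norm (half_disc_map z) < 1" unfolding half_disc_map_def by (rule Cayley_quadrant[OF s(1)])
  show "Im (half_disc_map z) > 0" unfolding half_disc_map_def Cayley_quadrant(2)[OF s(1)] using s Cayley_quadrant(4)[OF s(1)] by simp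
qed

lemma half_disc_map_interior: "norm z < 1 \<Longrightarrow> half_disc_map z \<in> half_box_interior"
  using half_disc_map_range[of z] abs_Re_le_cmod[of "half_disc_map z"] abs_Im_le_cmod[of "half_disc_map z"] by (auto simp: half_box_interior_def)

lemma half_disc_map_has_field_derivative:
  assumes "z \<noteq> 1" "cayley z \<notin> \<real>\<^sub>\<le>\<^sub>0"
  shows "(half_disc_map has_field_derivative half_disc_deriv z) (at z)"
proof -
  define s where "s = csqrt (cayley z)"
  have ss: "s * s = cayley z" unfolding s_def by (metis power2_csqrt power2_eq_square)
  have "Re s \<noteq> 0"
  proof
    assume "Re s = 0"
    then have "Im (cayley z) = 0" and re: "Re (cayley z) = - (Im s * Im s)"
      using arg_cong[OF ss, of Im] arg_cong[OF ss, of Re] by auto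
    moreover have "Re (cayley z) \<le> 0" unfolding re using zero_le_square[of "Im s"] by linarith
    ultimately have "Im (cayley z) = 0" "Re (cayley z) \<le> 0" by auto
    then show False using assms(2) by (simp add: complex_nonpos_Reals_iff)
  qed
  moreover have "0 \<le> Re s" unfolding s_def by (rule Re_csqrt)
  ultimately have "s + 1 \<noteq> 0" by (auto simp: complex_eq_iff)
  then have n: "csqrt (cayley z) + 1 \<noteq> 0" by (simp add: s_def)
  have n': "1 - z \<noteq> 0" using assms by auto
  have "(cayley has_field_derivative (2 * \<i> / (1 - z)\<^sup>2)) (at z)"
    unfolding cayley_def using n' by (auto intro!: derivative_eq_intros simp: field_simps power2_eq_square)
  from has_field_derivative_csqrt'[OF this assms(2)]
  have c: "((\<lambda>z. csqrt (cayley z)) has_field_derivative (2 * \<i> / (1 - z)\<^sup>2) / (2 * csqrt (cayley z))) (at z)" .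
  define d where "d = (2 * \<i> / (1 - z)\<^sup>2) / (2 * csqrt (cayley z))"
  have "(half_disc_map has_field_derivative ((d * (csqrt (cayley z) + 1) - (csqrt (cayley z) - 1) * d) / ((csqrt (cayley z) + 1) * (csqrt (cayley z) + 1)))) (at z)"
  proof -
    have "((\<lambda>z. csqrt (cayley z) - 1) has_field_derivative d - 0) (at z)" "((\<lambda>z. csqrt (cayley z) + 1) has_field_derivative d + 0) (at z)"
      using c unfolding d_def by (intro DERIV_diff DERIV_add DERIV_const; assumption)+
    from DERIV_divide[OF this n] show ?thesis by (simp add: half_disc_map_def[abs_def])
  qed
  also have "(d * (csqrt (cayley z) + 1) - (csqrt (cayley z) - 1) * d) / ((csqrt (cayley z) + 1) * (csqrt (cayley z) + 1)) = half_disc_deriv z"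
    using n unfolding half_disc_deriv_def d_def[symmetric] by (simp add: power2_eq_square algebra_simps)
  finally show ?thesis .
qed

lemma half_disc_map_deriv_disc:
  assumes "norm z < 1" shows "(half_disc_map has_field_derivative half_disc_deriv z) (at z)"
  using assms cayley_pos[OF assms] by (intro half_disc_map_has_field_derivative) (auto simp: complex_nonpos_Reals_iff)

lemma continuous_on_half_disc_deriv: "continuous_on (ball 0 1) half_disc_deriv"
proof -
  have c: "continuous_on (ball 0 1) cayley" unfolding cayley_def by (intro continuous_intros) auto
  have s: "continuous_on (ball 0 1) (\<lambda>z. csqrt (cayley z))"
  proof (rule continuous_on_compose2[OF _ c])
    show "continuous_on (- \<real>\<^sub>\<le>\<^sub>0) csqrt" by (auto intro!: continuous_at_imp_continuous_on continuous_at_csqrt)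
    show "cayley ` ball 0 1 \<subseteq> - \<real>\<^sub>\<le>\<^sub>0" using cayley_pos by (fastforce simp: complex_nonpos_Reals_iff)
  qed
  have n: "csqrt (cayley z) + 1 \<noteq> 0" "csqrt (cayley z) \<noteq> 0" if "z \<in> ball 0 1" for z
    using csqrt_quadrant(1)[OF cayley_pos, of z] that by (auto simp: complex_eq_iff simp del: csqrt.sel)
  show ?thesis unfolding half_disc_deriv_def using n by (intro continuous_intros s) auto
qed

lemma half_disc_map_0: "half_disc_map 0 = \<i> * of_real (Im (half_disc_map 0))" "0 < Im (half_disc_map 0)" "Im (half_disc_map 0) \<le> 1"
proof -
  have C: "cayley 0 = \<i>" by (simp add: cayley_def)
  have "(norm (csqrt \<i>))\<^sup>2 = 1" by (metis norm_ii norm_power power2_csqrt)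
  moreover have "Re (csqrt \<i>) > 0" by (rule csqrt_quadrant) simp
  ultimately have "Re (half_disc_map 0) = 0" unfolding half_disc_map_def C using Cayley_quadrant(3)[of "csqrt \<i>"] by simp
  then show "half_disc_map 0 = \<i> * of_real (Im (half_disc_map 0))" by (simp add: complex_eq_iff)
  show "0 < Im (half_disc_map 0)" "Im (half_disc_map 0) \<le> 1" using half_disc_map_range[of 0] abs_Im_le_cmod[of "half_disc_map 0"] by auto
qed

text \<open>
  On the open lower arc the map extends holomorphically, and its radial derivative is a positive multiple of \<open>- i\<close>. Hence
  the image of the radius leaves the real axis in the normal direction; the constant \<open>1/2\<close> could be any number below \<open>1\<close>.
\<close>

lemma half_disc_map_boundary:
  assumes t: "pi < t" "t < 2 * pi"
  shows "Im (half_disc_map (cis t)) = 0" "\<bar>Re (half_disc_map (cis t))\<bar> \<le> 1"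
    "\<forall>\<^sub>F r in at_left 1. Im (half_disc_map (of_real r * cis t)) \<ge> (1/2) * norm (half_disc_map (of_real r * cis t) - half_disc_map (cis t))"
    "((\<lambda>r. half_disc_map (of_real r * cis t)) \<longlongrightarrow> half_disc_map (cis t)) (at_left 1)"
proof -
  have st: "sin t < 0" using t sin_lt_zero by simp
  have ct: "cos t < 1"
  proof -
    have "(cos t)\<^sup>2 < 1" using st sin_cos_squared_add[of t] by (smt (verit) zero_less_power2)
    then show ?thesis by (simp add: abs_square_less_1 abs_less_iff)
  qed
  define z where "z = cis t"
  have z1: "1 - z \<noteq> 0" using st by (auto simp: z_def complex_eq_iff)
  have "cayley z = \<i> * (1 + z) * cnj (1 - z) / of_real ((norm (1 - z))\<^sup>2)"
    unfolding cayley_def by (subst complex_div_cnj) (simp add: complex_norm_square)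
  also have "\<i> * (1 + z) * cnj (1 - z) = of_real (- 2 * sin t)"
    by (simp add: z_def complex_eq_iff algebra_simps)
  finally have C: "cayley z = of_real (- 2 * sin t / (norm (1 - z))\<^sup>2)" by simp
  define p where "p = sqrt (- 2 * sin t / (norm (1 - z))\<^sup>2)"
  have Cp: "- 2 * sin t / (norm (1 - z))\<^sup>2 > 0" using st z1 by (intro divide_pos_pos) auto
  have p: "p > 0" using Cp by (simp add: p_def)
  have s: "csqrt (cayley z) = of_real p"
    unfolding C p_def using Cp by (subst csqrt_of_real_nonneg) auto
  have h: "half_disc_map z = of_real ((p - 1) / (p + 1))" by (simp add: half_disc_map_def s)
  show "Im (half_disc_map (cis t)) = 0" "\<bar>Re (half_disc_map (cis t))\<bar> \<le> 1"
    using p by (simp_all add: h[unfolded z_def] abs_le_iff divide_le_eq le_divide_eq)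
  have nz: "cayley z \<notin> \<real>\<^sub>\<le>\<^sub>0" unfolding C using Cp by (simp del: of_real_divide)
  define \<kappa> where "\<kappa> = 1 / ((p + 1)\<^sup>2 * p * (1 - cos t))"
  have \<kappa>: "\<kappa> > 0" unfolding \<kappa>_def using p ct by (intro divide_pos_pos mult_pos_pos) auto
  have "sin t * sin t = 1 - cos t * cos t" using sin_squared_eq[of t] by (simp add: power2_eq_square)
  then have "(1 - z)\<^sup>2 = z * of_real (2 * cos t - 2)"
    by (simp add: z_def complex_eq_iff power2_eq_square algebra_simps)
  then have dz: "z * half_disc_deriv z = - (\<i> * of_real \<kappa>)"
  proof -
    assume e: "(1 - z)\<^sup>2 = z * of_real (2 * cos t - 2)"
    have zn: "z \<noteq> 0" by (simp add: z_def)
    have "z * half_disc_deriv z = 2 / (of_real p + 1)\<^sup>2 * ((2 * \<i> / of_real (2 * cos t - 2)) / (2 * of_real p))"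
      unfolding half_disc_deriv_def s e using zn by simp
    also have "\<dots> = - (\<i> * of_real \<kappa>)"
    proof -
      define k where "k = complex_of_real (1 - cos t)"
      have k: "complex_of_real (2 * cos t - 2) = - 2 * k" by (simp add: k_def)
      have \<kappa>k: "complex_of_real \<kappa> = 1 / ((of_real p + 1)\<^sup>2 * of_real p * k)" by (simp add: \<kappa>_def k_def)
      have "of_real p + 1 \<noteq> (0 :: complex)" using p by (auto simp: complex_eq_iff)
      moreover have "k \<noteq> 0" unfolding k_def of_real_eq_0_iff using ct by simp
      moreover have "of_real p \<noteq> (0 :: complex)" using p by simp
      moreover have "2 / q\<^sup>2 * ((2 * \<i> / (- 2 * k)) / (2 * P)) = - (\<i> * (1 / (q\<^sup>2 * P * k)))" if "q \<noteq> 0" "k \<noteq> 0" "P \<noteq> 0" for q P k :: complex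
        using that by (simp add: field_simps)
      ultimately show ?thesis unfolding k \<kappa>k by blast
    qed
    finally show ?thesis .
  qed
  have "((\<lambda>r. half_disc_map (of_real r * z)) has_vector_derivative z * half_disc_deriv z) (at 1)"
  proof -
    have "((\<lambda>w. half_disc_map (w * z)) has_field_derivative z * half_disc_deriv z) (at (of_real 1))"
    proof -
      have "((\<lambda>w. w * z) has_field_derivative z) (at 1)" by (auto intro!: derivative_eq_intros)
      moreover have "(half_disc_map has_field_derivative half_disc_deriv z) (at (1 * z))" using half_disc_map_has_field_derivative[OF _ nz] z1 by auto
      ultimately have "((\<lambda>w. half_disc_map (w * z)) has_field_derivative half_disc_deriv z * z) (at 1)" by (rule DERIV_chain2[rotated])
      then show ?thesis by (simp add: mult.commute)
    qed
    then show ?thesis by (rule has_vector_derivative_real_field)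
  qed
  then have hd: "((\<lambda>r. half_disc_map (of_real r * z)) has_derivative (\<lambda>h. h *\<^sub>R (- (\<i> * of_real \<kappa>)))) (at 1)"
    by (simp add: has_vector_derivative_def dz)
  have "isCont (\<lambda>r. half_disc_map (of_real r * z)) 1" by (rule has_derivative_continuous[OF hd])
  then show "((\<lambda>r. half_disc_map (of_real r * cis t)) \<longlongrightarrow> half_disc_map (cis t)) (at_left 1)"
    unfolding isCont_def z_def by (simp add: filterlim_at_split)
  obtain d where d: "d > 0" "\<And>r. norm (r - 1) < d \<Longrightarrow> norm (half_disc_map (of_real r * z) - half_disc_map (of_real 1 * z) - (r - 1) *\<^sub>R (- (\<i> * of_real \<kappa>))) \<le> (\<kappa> / 3) * norm (r - 1)"
    using hd[unfolded has_derivative_at_alt] \<kappa> by (metis divide_pos_pos zero_less_numeral)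
  have "\<forall>\<^sub>F r in at_left 1. r \<in> {1 - d<..<1}" using d(1) by (intro eventually_at_leftI[of "1 - d"]) auto
  then show "\<forall>\<^sub>F r in at_left 1. Im (half_disc_map (of_real r * cis t)) \<ge> (1/2) * norm (half_disc_map (of_real r * cis t) - half_disc_map (cis t))"
  proof eventually_elim
    case (elim r)
    define x where "x = 1 - r"
    have x: "x > 0" "norm (r - 1) = x" using elim by (auto simp: x_def)
    define w where "w = half_disc_map (of_real r * z) - half_disc_map z"
    have "norm (w - \<i> * of_real (x * \<kappa>)) \<le> (\<kappa> / 3) * x"
      using d(2)[of r] elim x by (simp add: w_def x_def scaleR_conv_of_real algebra_simps)
    then have n: "norm (w - \<i> * of_real (x * \<kappa>)) \<le> x * \<kappa> / 3" by (simp add: mult.commute)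
    have "\<bar>Im w - x * \<kappa>\<bar> \<le> x * \<kappa> / 3" using abs_Im_le_cmod[of "w - \<i> * of_real (x * \<kappa>)"] n by simp
    moreover have "norm w \<le> x * \<kappa> / 3 + x * \<kappa>"
    proof -
      have "norm (\<i> * complex_of_real (x * \<kappa>)) = x * \<kappa>" using x(1) \<kappa> by (simp add: norm_mult)
      then show ?thesis
        using norm_triangle_ineq[of "w - \<i> * of_real (x * \<kappa>)" "\<i> * of_real (x * \<kappa>)"] n unfolding diff_add_cancel by linarith
    qed
    moreover have "Im w = Im (half_disc_map (of_real r * z))" using h by (simp add: w_def)
    moreover have "x * \<kappa> > 0" using x(1) \<kappa> by simp
    ultimately have "Im (half_disc_map (of_real r * z)) \<ge> (1/2) * norm w" by linarith
    then show ?case by (simp add: w_def z_def)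
  qed
qed

text \<open>
  \<open>v 0\<close> is at least the mean of \<open>v\<close> over circles of radius tending to \<open>1\<close>. By Fatou's lemma the lower limit of these means is at least the mean of
  the radial lower limits, and the latter are at least \<open>1\<close> on an arc of length \<open>pi\<close>.
\<close>

lemma superharmonic_center_bound:
  assumes sub: "subharmonic_on (ball 0 1) (\<lambda>z. - v z)" and pos: "\<And>z. z \<in> ball 0 1 \<Longrightarrow> v z \<ge> 0"
    and lim: "\<And>t y. pi < t \<Longrightarrow> t < 2 * pi \<Longrightarrow> y < 1 \<Longrightarrow> \<forall>\<^sub>F r in at_left 1. y < v (of_real r * cis t)"
  shows "v 0 \<ge> ereal (1 / 2)"
proof -
  define r where "r n = 1 - 1 / (real n + 2)" for n
  have r: "0 < r n" "r n < 1" for n by (auto simp: r_def field_simps)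
  have rlim: "filterlim r (at_left 1) sequentially"
  proof -
    have "(\<lambda>n. 1 / (2 + real n)) \<longlonglongrightarrow> 0"
      by (intro tendsto_divide_0[OF tendsto_const] filterlim_at_top_imp_at_infinity
          filterlim_tendsto_add_at_top[OF tendsto_const] filterlim_real_sequentially)
    then have "r \<longlonglongrightarrow> 1 - 0" unfolding r_def by (intro tendsto_diff tendsto_const) (simp add: add.commute)
    then show ?thesis using r by (auto simp: filterlim_at less_imp_neq intro!: always_eventually)
  qed
  define g where "g n t = e2ennreal (v (of_real (r n) * cis t))" for n t
  define I where "I n = (\<integral>\<^sup>+t\<in>{0..2*pi}. g n t \<partial>lborel)" for n
  have inb: "of_real (r n) * cis t \<in> ball 0 1" for n t using r[of n] by (simp add: norm_mult)
  have meas: "(\<lambda>t. g n t) \<in> borel_measurable borel" for n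
  proof -
    have "(\<lambda>t. v (of_real (r n) * cis t)) \<in> borel_measurable borel"
    proof (rule borel_measurableI_greater)
      fix a
      have "openin (top_of_set (ball 0 1)) {x \<in> ball 0 1. - v x < - a}"
        using sub unfolding subharmonic_on_def usc_on_def by blast
      also have "{x \<in> ball 0 1. - v x < - a} = {x \<in> ball 0 1. a < v x}" by auto
      finally have "open {x \<in> ball 0 1. a < v x}" by (rule openin_open_trans) simp
      then have "open ((\<lambda>t. of_real (r n) * cis t) -` {x \<in> ball 0 1. a < v x})"
        by (intro open_vimage continuous_intros continuous_on_cis)
      also have "(\<lambda>t. of_real (r n) * cis t) -` {x \<in> ball 0 1. a < v x} = {t \<in> space borel. a < v (of_real (r n) * cis t)}"
        using inb by auto
      finally show "{t \<in> space borel. a < v (of_real (r n) * cis t)} \<in> sets borel" by simp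
    qed
    then show ?thesis unfolding g_def by measurable
  qed
  have bound: "enn2ereal (I n) \<le> ereal (2 * pi) * v 0" for n
  proof -
    have "- v 0 \<le> circle_mean (\<lambda>z. - v z) 0 (r n)"
    proof -
      have "0 < r n \<and> cball 0 (r n) \<subseteq> ball (0::complex) 1" using r[of n] by auto
      then show ?thesis using sub unfolding subharmonic_on_def by blast
    qed
    also have "circle_mean (\<lambda>z. - v z) 0 (r n) = (0 - enn2ereal (I n)) / ereal (2 * pi)"
    proof -
      have "e2ennreal (- v (of_real (r n) * cis t)) = 0" for t
        using pos[OF inb, of n t] by (simp add: e2ennreal_neg)
      then show ?thesis by (simp add: circle_mean_def I_def g_def zero_ennreal.rep_eq)
    qed
    finally have "enn2ereal (I n) / ereal (2 * pi) \<le> v 0"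
      by (simp add: ereal_minus_le_minus)
    then show ?thesis by (simp add: ereal_divide_le_pos)
  qed
  have low: "ennreal pi \<le> liminf I"
  proof -
    have "ennreal pi = (\<integral>\<^sup>+t. indicator {pi<..<2*pi} t \<partial>lborel)" by simp
    also have "\<dots> \<le> (\<integral>\<^sup>+t. liminf (\<lambda>n. g n t * indicator {0..2*pi} t) \<partial>lborel)"
    proof (rule nn_integral_mono)
      fix t :: real
      show "indicator {pi<..<2*pi} t \<le> liminf (\<lambda>n. g n t * indicator {0..2*pi} t)"
      proof (cases "t \<in> {pi<..<2*pi}")
        case True
        then have t: "pi < t" "t < 2 * pi" "t \<in> {0..2*pi}" by (auto intro: order_trans[OF pi_ge_zero])
        have "1 \<le> liminf (\<lambda>n. g n t)"
          unfolding le_Liminf_iff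
        proof (intro allI impI)
          fix y :: ennreal assume "y < 1"
          then have "enn2ereal y < 1" by (simp add: less_ennreal.rep_eq one_ennreal.rep_eq)
          from filterlim_iff[THEN iffD1, OF rlim, rule_format, OF lim[OF t(1,2) this]]
          show "\<forall>\<^sub>F n in sequentially. y < g n t"
          proof eventually_elim
            case (elim n)
            then show ?case unfolding g_def less_ennreal.rep_eq
              using pos[OF inb, of n t] by (simp add: enn2ereal_e2ennreal)
          qed
        qed
        then show ?thesis using t True by simp
      qed simp
    qed
    also have "\<dots> \<le> liminf (\<lambda>n. \<integral>\<^sup>+t. g n t * indicator {0..2*pi} t \<partial>lborel)"
      using meas by (intro nn_integral_liminf) simp
    finally show ?thesis by (simp add: I_def[abs_def])
  qed
  show ?thesis
  proof (rule ccontr)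
    assume "\<not> ?thesis"
    then have v: "v 0 < ereal (1 / 2)" by simp
    have "v 0 \<ge> 0" by (rule pos) simp
    then obtain c where c: "v 0 = ereal c" "0 \<le> c" using v by (cases "v 0") auto
    have c2: "c < 1 / 2" using v c by simp
    have "I n \<le> ennreal (2 * pi * c)" for n
    proof -
      have "enn2ereal (I n) \<le> enn2ereal (ennreal (2 * pi * c))" using bound[of n] c by simp
      then show ?thesis by (simp add: less_eq_ennreal.rep_eq)
    qed
    then have "liminf I \<le> ennreal (2 * pi * c)"
      by (intro order_trans[OF Liminf_le_Limsup Limsup_bounded]) auto
    then have "ennreal pi \<le> ennreal (2 * pi * c)" using low by (rule order_trans[rotated])
    then have "pi \<le> 2 * pi * c" using c by simp
    then show False using c2 pi_gt_zero by (simp add: field_simps)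
  qed
qed

section \<open>Continuously differentiable maps and charts\<close>

lemma Ck_on_subset: "Ck_on k T f \<Longrightarrow> S \<subseteq> T \<Longrightarrow> Ck_on k S f"
  by (induction k arbitrary: f) (auto intro: continuous_on_subset)

lemma Ck1: "Ck_on 1 S f \<longleftrightarrow> (\<forall>x\<in>S. f differentiable (at x)) \<and> (\<forall>v. continuous_on S (\<lambda>x. frechet_derivative f (at x) v))"
  by simp

lemma smooth_on_imp_Ck: "smooth_on S f \<Longrightarrow> Ck_on k S f"
  by (simp add: smooth_on_def)

lemma Ck1_I:
  assumes "\<And>x. x \<in> S \<Longrightarrow> (f has_derivative f' x) (at x)" "\<And>v. continuous_on S (\<lambda>x. f' x v)"
  shows "Ck_on 1 S f"
  unfolding Ck1
proof (intro conjI ballI allI)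
  show "f differentiable (at x)" if "x \<in> S" for x using assms(1)[OF that] by (auto simp: differentiable_def)
  show "continuous_on S (\<lambda>x. frechet_derivative f (at x) v)" for v
    using assms(2)[of v] by (rule continuous_on_eq) (use frechet_derivative_at[OF assms(1)] in metis)
qed

lemma Ck1_has_derivative: "Ck_on 1 S f \<Longrightarrow> x \<in> S \<Longrightarrow> (f has_derivative frechet_derivative f (at x)) (at x)"
  unfolding Ck1 using frechet_derivative_works by blast

lemma Ck1_continuous: "Ck_on 1 S f \<Longrightarrow> continuous_on S f"
  by (meson Ck1_has_derivative continuous_at_imp_continuous_on has_derivative_continuous)

lemma Ck1_local:
  assumes "\<And>x. x \<in> S \<Longrightarrow> \<exists>N. open N \<and> x \<in> N \<and> Ck_on 1 N f"
  shows "Ck_on 1 S f"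
  unfolding Ck1
proof (intro conjI ballI allI)
  fix x assume "x \<in> S"
  then obtain N where "x \<in> N" "Ck_on 1 N f" using assms by blast
  then show "f differentiable (at x)" unfolding Ck1 by blast
next
  fix v
  show "continuous_on S (\<lambda>x. frechet_derivative f (at x) v)"
  proof (rule continuous_at_imp_continuous_on, rule ballI)
    fix x assume "x \<in> S"
    then obtain N where N: "open N" "x \<in> N" "Ck_on 1 N f" using assms by blast
    then show "isCont (\<lambda>x. frechet_derivative f (at x) v) x"
      unfolding Ck1 using continuous_on_eq_continuous_at by blast
  qed
qed

lemma Ck1_cong:
  assumes "open S" "Ck_on 1 S f" "\<And>x. x \<in> S \<Longrightarrow> g x = f x"
  shows "Ck_on 1 S g"
proof (rule Ck1_I)
  fix x assume x: "x \<in> S"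
  show "(g has_derivative frechet_derivative f (at x)) (at x)"
    using has_derivative_transform_within_open[OF Ck1_has_derivative[OF assms(2) x] assms(1) x] assms(3) by metis
qed (use assms(2) in \<open>simp add: Ck1\<close>)

text \<open>
  By the chain rule the directional derivative of \<open>g \<circ> f\<close> is a sum, over the standard basis, of products of components of the derivative of \<open>f\<close> with
  partial derivatives of \<open>g\<close>, which are continuous by assumption.
\<close>

lemma Ck1_compose:
  fixes f :: "'a::euclidean_space \<Rightarrow> 'b::euclidean_space" and g :: "'b \<Rightarrow> 'c::euclidean_space"
  assumes f: "Ck_on 1 S f" and g: "Ck_on 1 T g" and "f ` S \<subseteq> T"
  shows "Ck_on 1 S (g \<circ> f)"
proof (rule Ck1_I)
  fix x assume x: "x \<in> S"
  have fx: "f x \<in> T" using assms(3) x by blast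
  have d: "(g has_derivative frechet_derivative g (at (f x))) (at (f x))" by (rule Ck1_has_derivative[OF g fx])
  interpret D: bounded_linear "frechet_derivative g (at (f x))" using d by (rule has_derivative_bounded_linear)
  have e: "frechet_derivative g (at (f x)) w = (\<Sum>b\<in>Basis. inner w b *\<^sub>R frechet_derivative g (at (f x)) b)" for w
    by (subst euclidean_representation[symmetric, of w]) (simp only: D.sum D.scaleR)
  have "((g \<circ> f) has_derivative (\<lambda>v. frechet_derivative g (at (f x)) (frechet_derivative f (at x) v))) (at x)"
    using diff_chain_at[OF Ck1_has_derivative[OF f x] d] by (simp add: o_def)
  then show "((g \<circ> f) has_derivative (\<lambda>v. \<Sum>b\<in>Basis. inner (frechet_derivative f (at x) v) b *\<^sub>R frechet_derivative g (at (f x)) b)) (at x)"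
    unfolding e[symmetric] .
next
  fix v
  have "continuous_on S (\<lambda>x. frechet_derivative g (at (f x)) b)" for b
    using g assms(3) by (intro continuous_on_compose2[OF _ Ck1_continuous[OF f]]) (auto simp: Ck1)
  then show "continuous_on S (\<lambda>x. \<Sum>b\<in>Basis. inner (frechet_derivative f (at x) v) b *\<^sub>R frechet_derivative g (at (f x)) b)"
    using f by (intro continuous_intros) (auto simp: Ck1)
qed

lemma chartsD:
  assumes "c \<in> charts A"
  shows "is_chart c" "open (fst c)" "open (snd c ` fst c)" "\<And>d. d \<in> A \<Longrightarrow> compatible c d"
  using assms by (auto simp: charts_def is_chart_def)

lemma chart_inv:
  assumes "is_chart c"
  shows "\<And>p. p \<in> fst c \<Longrightarrow> chart_inv c (snd c p) = p"
    "\<And>x. x \<in> snd c ` fst c \<Longrightarrow> snd c (chart_inv c x) = x \<and> chart_inv c x \<in> fst c"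
    "continuous_on (fst c) (snd c)" "continuous_on (snd c ` fst c) (chart_inv c)"
proof -
  obtain \<psi> where \<psi>: "homeomorphism (fst c) (snd c ` fst c) (snd c) \<psi>" using assms by (auto simp: is_chart_def)
  have inj: "inj_on (snd c) (fst c)" using \<psi> by (metis homeomorphism_def inj_on_inverseI)
  show 1: "\<And>p. p \<in> fst c \<Longrightarrow> chart_inv c (snd c p) = p"
    using inj by (simp add: chart_inv_def)
  show "\<And>x. x \<in> snd c ` fst c \<Longrightarrow> snd c (chart_inv c x) = x \<and> chart_inv c x \<in> fst c"
    using 1 by auto
  show "continuous_on (fst c) (snd c)" using \<psi> by (simp add: homeomorphism_def)
  have "continuous_on (snd c ` fst c) \<psi>" using \<psi> by (simp add: homeomorphism_def)
  then show "continuous_on (snd c ` fst c) (chart_inv c)"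
    by (rule continuous_on_eq) (use 1 \<psi> in \<open>auto simp: homeomorphism_def\<close>)
qed

lemma chart_image_open:
  assumes c: "is_chart c" and O: "open O'"
  shows "open (snd c ` (fst c \<inter> O'))"
proof -
  have o: "open (snd c ` fst c)" using c by (simp add: is_chart_def)
  have "snd c ` (fst c \<inter> O') = snd c ` fst c \<inter> chart_inv c -` O'"
    using chart_inv(1,2)[OF c] by (auto simp: image_iff)
  then show ?thesis using continuous_open_preimage[OF chart_inv(4)[OF c] o O] by simp
qed

lemma chart_preimage_open:
  assumes c: "is_chart c" and V: "open V"
  shows "open {p \<in> fst c. snd c p \<in> V}"
proof -
  have "{p \<in> fst c. snd c p \<in> V} = fst c \<inter> snd c -` V" by auto
  then show ?thesis using continuous_open_preimage[OF chart_inv(3)[OF c] _ V] c by (simp add: is_chart_def)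
qed

text \<open>
  Charts of the maximal atlas are by definition smoothly related to those of the given atlas only. Locally, insert one of these between \<open>c\<close> and \<open>c'\<close>.
\<close>

lemma transition_C1:
  assumes A: "smooth_atlas A" and c: "c \<in> charts A" and c': "c' \<in> charts A"
  shows "Ck_on 1 (snd c ` (fst c \<inter> fst c')) (snd c' \<circ> chart_inv c)"
proof (rule Ck1_local)
  fix x assume "x \<in> snd c ` (fst c \<inter> fst c')"
  then obtain p where p: "p \<in> fst c" "p \<in> fst c'" "x = snd c p" by blast
  obtain d where d: "d \<in> A" "p \<in> fst d" using A by (metis (no_types, lifting) UNIV_I UN_iff smooth_atlas_def)
  note ch = chartsD[OF c] chartsD[OF c']
  have dch: "is_chart d" using A d by (simp add: smooth_atlas_def)
  let ?N = "snd c ` (fst c \<inter> (fst c' \<inter> fst d))"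
  have od: "open (fst d)" using dch by (simp add: is_chart_def)
  have oN: "open ?N" using chart_image_open[OF ch(1)] open_Int[OF ch(6) od] by blast
  have s1: "Ck_on 1 ?N (snd d \<circ> chart_inv c)"
  proof -
    have "smooth_on (snd c ` (fst c \<inter> fst d)) (snd d \<circ> chart_inv c)" using ch(4)[OF d(1)] by (simp add: compatible_def)
    from smooth_on_imp_Ck[OF this] show ?thesis by (rule Ck_on_subset) auto
  qed
  have s2: "Ck_on 1 (snd d ` (fst d \<inter> fst c')) (snd c' \<circ> chart_inv d)"
    using ch(8)[OF d(1)] by (intro smooth_on_imp_Ck) (simp add: compatible_def Int_commute)
  have im: "(snd d \<circ> chart_inv c) ` ?N \<subseteq> snd d ` (fst d \<inter> fst c')"
    using chart_inv(1)[OF ch(1)] by (auto intro!: imageI)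
  have "Ck_on 1 ?N ((snd c' \<circ> chart_inv d) \<circ> (snd d \<circ> chart_inv c))" by (rule Ck1_compose[OF s1 s2 im])
  then have "Ck_on 1 ?N (snd c' \<circ> chart_inv c)"
    by (rule Ck1_cong[OF oN]) (use chart_inv(1)[OF ch(1)] chart_inv(1)[OF dch] in auto)
  then show "\<exists>N. open N \<and> x \<in> N \<and> Ck_on 1 N (snd c' \<circ> chart_inv c)" using oN p d by blast
qed

lemma transition_has_derivative:
  assumes A: "smooth_atlas A" and c: "c \<in> charts A" and c': "c' \<in> charts A" and p: "p \<in> fst c" "p \<in> fst c'"
  shows "((snd c' \<circ> chart_inv c) has_derivative frechet_derivative (snd c' \<circ> chart_inv c) (at (snd c p))) (at (snd c p))"
  using Ck1_has_derivative[OF transition_C1[OF A c c']] p by blast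

lemma chart_inv_comp:
  assumes A: "smooth_atlas A" and c0: "c0 \<in> charts A" and S: "open S" and f: "Ck_on 1 S f" and im: "f ` S \<subseteq> snd c0 ` fst c0"
    and c: "c \<in> charts A"
  shows "open {x \<in> S. chart_inv c0 (f x) \<in> fst c}" "Ck_on 1 {x \<in> S. chart_inv c0 (f x) \<in> fst c} (snd c \<circ> (chart_inv c0 \<circ> f))"
proof -
  note ch = chartsD[OF c0] chartsD[OF c]
  have cf: "continuous_on S (\<lambda>x. chart_inv c0 (f x))"
    by (rule continuous_on_compose2[OF chart_inv(4)[OF ch(1)] Ck1_continuous[OF f] im])
  have "{x \<in> S. chart_inv c0 (f x) \<in> fst c} = S \<inter> (\<lambda>x. chart_inv c0 (f x)) -` fst c" by auto
  then show o: "open {x \<in> S. chart_inv c0 (f x) \<in> fst c}"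
    using continuous_open_preimage[OF cf S ch(6)] by simp
  have "Ck_on 1 {x \<in> S. chart_inv c0 (f x) \<in> fst c} ((snd c \<circ> chart_inv c0) \<circ> f)"
  proof (rule Ck1_compose[OF Ck_on_subset[OF f] transition_C1[OF A c0 c]])
    show "f ` {x \<in> S. chart_inv c0 (f x) \<in> fst c} \<subseteq> snd c0 ` (fst c0 \<inter> fst c)"
    proof safe
      fix x assume x: "x \<in> S" "chart_inv c0 (f x) \<in> fst c"
      then have "snd c0 (chart_inv c0 (f x)) = f x" "chart_inv c0 (f x) \<in> fst c0" using chart_inv(2)[OF ch(1)] im by blast+
      then show "f x \<in> snd c0 ` (fst c0 \<inter> fst c)" using x by (metis IntI imageI)
    qed
  qed auto
  then show "Ck_on 1 {x \<in> S. chart_inv c0 (f x) \<in> fst c} (snd c \<circ> (chart_inv c0 \<circ> f))" by (simp add: o_assoc)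
qed

lemma Ck_map_chart_inv:
  assumes A: "smooth_atlas A" and c0: "c0 \<in> charts A" and S: "open S" and f: "Ck_on 1 S f" and im: "f ` S \<subseteq> snd c0 ` fst c0"
  shows "Ck_map A 1 S (chart_inv c0 \<circ> f)"
  unfolding Ck_map_def
proof (intro conjI ballI)
  show "continuous_on S (chart_inv c0 \<circ> f)"
    by (rule continuous_on_compose[OF Ck1_continuous[OF f] continuous_on_subset[OF chart_inv(4)[OF chartsD(1)[OF c0]] im]])
  show "Ck_on 1 {x \<in> S. (chart_inv c0 \<circ> f) x \<in> fst c} (snd c \<circ> (chart_inv c0 \<circ> f))" if "c \<in> charts A" for c
    using chart_inv_comp(2)[OF A c0 S f im that] by simp
qed

text \<open>
  The tangent vector with coordinates \<open>a\<close> in the chart \<open>c0\<close>, at the point with coordinates \<open>x\<close>.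
\<close>

definition coord_vec :: "('m::topological_space, 'e::euclidean_space) chart set \<Rightarrow> ('m, 'e) chart \<Rightarrow> 'e \<Rightarrow> 'e \<Rightarrow> ('m, 'e) tvec" where
  "coord_vec A c0 x a = differential A (chart_inv c0) x a"

lemma coord_vec_apply:
  "coord_vec A c0 x a c = (if c \<in> charts_at A (chart_inv c0 x) then frechet_derivative (snd c \<circ> chart_inv c0) (at x) a else 0)"
  by (simp add: coord_vec_def differential_def)

context
  fixes A :: "('m::{t2_space,second_countable_topology}, 'e::euclidean_space) chart set" and c0
  assumes A: "smooth_atlas A" and c0: "c0 \<in> charts A"
begin

lemma charts_atD: "c \<in> charts_at A p \<Longrightarrow> c \<in> charts A" "c \<in> charts_at A p \<Longrightarrow> p \<in> fst c"
  by (auto simp: charts_at_def)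

lemma chart_inv_point:
  assumes "x \<in> snd c0 ` fst c0"
  shows "chart_inv c0 x \<in> fst c0" "snd c0 (chart_inv c0 x) = x" "c0 \<in> charts_at A (chart_inv c0 x)"
  using chart_inv(2)[OF chartsD(1)[OF c0] assms] c0 by (auto simp: charts_at_def)

lemma transition_derivative:
  assumes "x \<in> snd c0 ` fst c0" "c \<in> charts_at A (chart_inv c0 x)"
  shows "((snd c \<circ> chart_inv c0) has_derivative frechet_derivative (snd c \<circ> chart_inv c0) (at x)) (at x)"
  using transition_has_derivative[OF A c0 charts_atD(1)[OF assms(2)] chart_inv_point(1)[OF assms(1)] charts_atD(2)[OF assms(2)]]
  by (simp add: chart_inv_point(2)[OF assms(1)])

text \<open>
  Together with \<open>tangent_eq_coord_vec\<close>, this identifies the tangent space with the model space.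
\<close>

lemma coord_vec_own_chart:
  assumes x: "x \<in> snd c0 ` fst c0" shows "coord_vec A c0 x a c0 = a"
proof -
  have "((\<lambda>x. x) has_derivative (\<lambda>x. x)) (at x)" by simp
  then have "((snd c0 \<circ> chart_inv c0) has_derivative (\<lambda>x. x)) (at x)"
    by (rule has_derivative_transform_within_open[OF _ chartsD(3)[OF c0] x]) (simp add: chart_inv_point(2))
  then have "frechet_derivative (snd c0 \<circ> chart_inv c0) (at x) = (\<lambda>x. x)" using frechet_derivative_at by metis
  then show ?thesis using chart_inv_point(3)[OF x] by (simp add: coord_vec_apply)
qed

lemma coord_vec_linear:
  assumes x: "x \<in> snd c0 ` fst c0"
  shows "coord_vec A c0 x (\<alpha> *\<^sub>R a + \<beta> *\<^sub>R b) = (\<lambda>c. \<alpha> *\<^sub>R coord_vec A c0 x a c + \<beta> *\<^sub>R coord_vec A c0 x b c)"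
proof
  fix c
  show "coord_vec A c0 x (\<alpha> *\<^sub>R a + \<beta> *\<^sub>R b) c = \<alpha> *\<^sub>R coord_vec A c0 x a c + \<beta> *\<^sub>R coord_vec A c0 x b c"
  proof (cases "c \<in> charts_at A (chart_inv c0 x)")
    case True
    interpret bounded_linear "frechet_derivative (snd c \<circ> chart_inv c0) (at x)"
      by (rule has_derivative_bounded_linear[OF transition_derivative[OF x True]])
    show ?thesis using True by (simp add: coord_vec_apply add scaleR)
  qed (simp add: coord_vec_apply)
qed

lemma coord_vec_tangent:
  assumes x: "x \<in> snd c0 ` fst c0"
  shows "coord_vec A c0 x a \<in> tangent_space A (chart_inv c0 x)"
  unfolding tangent_space_def
proof (intro CollectI conjI allI impI ballI)
  show "coord_vec A c0 x a c = 0" if "c \<notin> charts_at A (chart_inv c0 x)" for c using that by (simp add: coord_vec_apply)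
  fix c c' assume c: "c \<in> charts_at A (chart_inv c0 x)" and c': "c' \<in> charts_at A (chart_inv c0 x)"
  let ?p = "chart_inv c0 x"
  have d1: "((snd c \<circ> chart_inv c0) has_derivative frechet_derivative (snd c \<circ> chart_inv c0) (at x)) (at x)" by (rule transition_derivative[OF x c])
  have d2: "((snd c' \<circ> chart_inv c) has_derivative frechet_derivative (snd c' \<circ> chart_inv c) (at (snd c ?p))) (at ((snd c \<circ> chart_inv c0) x))"
    using transition_has_derivative[OF A charts_atD(1)[OF c] charts_atD(1)[OF c'] charts_atD(2)[OF c] charts_atD(2)[OF c']] by simp
  let ?N = "snd c0 ` (fst c0 \<inter> fst c)"
  have N: "open ?N" "x \<in> ?N"
    using chart_image_open[OF chartsD(1)[OF c0] chartsD(2)[OF charts_atD(1)[OF c]]] chart_inv_point(1,2)[OF x] charts_atD(2)[OF c] by (auto intro: rev_image_eqI)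
  have "((snd c' \<circ> chart_inv c0) has_derivative (frechet_derivative (snd c' \<circ> chart_inv c) (at (snd c ?p)) \<circ> frechet_derivative (snd c \<circ> chart_inv c0) (at x))) (at x)"
    by (rule has_derivative_transform_within_open[OF diff_chain_at[OF d1 d2] N])
      (use chart_inv(1)[OF chartsD(1)[OF c0]] chart_inv(1)[OF chartsD(1)[OF charts_atD(1)[OF c]]] in auto)
  then have "frechet_derivative (snd c' \<circ> chart_inv c0) (at x) = (frechet_derivative (snd c' \<circ> chart_inv c) (at (snd c ?p)) \<circ> frechet_derivative (snd c \<circ> chart_inv c0) (at x))"
    using frechet_derivative_at by metis
  then show "coord_vec A c0 x a c' = frechet_derivative (snd c' \<circ> chart_inv c) (at (snd c ?p)) (coord_vec A c0 x a c)"
    using c c' by (simp add: coord_vec_apply)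
qed

lemma tangent_eq_coord_vec:
  assumes x: "x \<in> snd c0 ` fst c0" and v: "v \<in> tangent_space A (chart_inv c0 x)"
  shows "v = coord_vec A c0 x (v c0)"
proof
  fix c
  have "c \<notin> charts_at A (chart_inv c0 x) \<Longrightarrow> v c = 0"
    and "c \<in> charts_at A (chart_inv c0 x) \<Longrightarrow> v c = frechet_derivative (snd c \<circ> chart_inv c0) (at (snd c0 (chart_inv c0 x))) (v c0)"
    using v chart_inv_point(3)[OF x] unfolding tangent_space_def by blast+
  then show "v c = coord_vec A c0 x (v c0) c" unfolding coord_vec_apply chart_inv_point(2)[OF x] by simp
qed

lemma differential_chart_inv:
  assumes f: "(f has_derivative f') (at z)" and x: "f z \<in> snd c0 ` fst c0"
  shows "differential A (chart_inv c0 \<circ> f) z w = coord_vec A c0 (f z) (f' w)"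
proof
  fix c
  show "differential A (chart_inv c0 \<circ> f) z w c = coord_vec A c0 (f z) (f' w) c"
  proof (cases "c \<in> charts_at A (chart_inv c0 (f z))")
    case True
    have "((snd c \<circ> chart_inv c0) \<circ> f has_derivative frechet_derivative (snd c \<circ> chart_inv c0) (at (f z)) \<circ> f') (at z)"
      by (rule diff_chain_at[OF f transition_derivative[OF x True]])
    then have "frechet_derivative (snd c \<circ> (chart_inv c0 \<circ> f)) (at z) = frechet_derivative (snd c \<circ> chart_inv c0) (at (f z)) \<circ> f'"
      using frechet_derivative_at by (metis o_assoc)
    then show ?thesis using True by (simp add: differential_def coord_vec_apply)
  qed (simp add: differential_def coord_vec_apply)
qed

lemma velocity_in_chart:
  assumes \<gamma>: "Ck_map A 1 {-\<epsilon><..<\<epsilon>} \<gamma>" "\<epsilon> > 0" and c: "c \<in> charts_at A (\<gamma> 0)"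
  shows "((snd c \<circ> \<gamma>) has_derivative (\<lambda>h. h *\<^sub>R velocity A \<gamma> 0 c)) (at 0)"
    and "\<forall>\<^sub>F t in at 0. \<gamma> t \<in> fst c \<and> t \<in> {-\<epsilon><..<\<epsilon>}"
proof -
  let ?T = "{t \<in> {-\<epsilon><..<\<epsilon>}. \<gamma> t \<in> fst c}"
  have ck: "Ck_on 1 ?T (snd c \<circ> \<gamma>)" and cont: "continuous_on {-\<epsilon><..<\<epsilon>} \<gamma>"
    using \<gamma>(1) charts_atD(1)[OF c] unfolding Ck_map_def by blast+
  have "\<gamma> 0 \<in> fst c" by (rule charts_atD(2)[OF c])
  then have 0: "0 \<in> ?T" using \<gamma>(2) by simp
  have d: "((snd c \<circ> \<gamma>) has_derivative frechet_derivative (snd c \<circ> \<gamma>) (at 0)) (at 0)"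
    by (rule Ck1_has_derivative[OF ck 0])
  interpret D: bounded_linear "frechet_derivative (snd c \<circ> \<gamma>) (at 0)" using d by (rule has_derivative_bounded_linear)
  have "frechet_derivative (snd c \<circ> \<gamma>) (at 0) = (\<lambda>h. h *\<^sub>R velocity A \<gamma> 0 c)"
  proof
    fix h :: real
    show "frechet_derivative (snd c \<circ> \<gamma>) (at 0) h = h *\<^sub>R velocity A \<gamma> 0 c"
      using c D.scaleR[of h 1] unfolding differential_def by simp
  qed
  then show "((snd c \<circ> \<gamma>) has_derivative (\<lambda>h. h *\<^sub>R velocity A \<gamma> 0 c)) (at 0)" using d by simp
  have "open ({-\<epsilon><..<\<epsilon>} \<inter> \<gamma> -` fst c)"
    by (rule continuous_open_preimage[OF cont _ chartsD(2)[OF charts_atD(1)[OF c]]]) simp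
  then have "\<forall>\<^sub>F t in nhds 0. t \<in> {-\<epsilon><..<\<epsilon>} \<inter> \<gamma> -` fst c" using 0 by (intro eventually_nhds_in_open) auto
  then show "\<forall>\<^sub>F t in at 0. \<gamma> t \<in> fst c \<and> t \<in> {-\<epsilon><..<\<epsilon>}"
    unfolding eventually_at_filter by eventually_elim auto
qed

end

lemma derivative_in_subspace:
  fixes f :: "real \<Rightarrow> 'e::euclidean_space"
  assumes d: "(f has_derivative (\<lambda>h. h *\<^sub>R v)) (at 0)" and S: "subspace S" and f0: "f 0 \<in> S" and e: "\<forall>\<^sub>F t in at 0. f t \<in> S"
  shows "v \<in> S"
proof -
  have "v \<in> closure S"
    unfolding closure_approachable
  proof (intro allI impI)
    fix \<eta> :: real assume \<eta>: "\<eta> > 0"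
    obtain r where r: "r > 0" "\<And>t. norm (t - 0) < r \<Longrightarrow> norm (f t - f 0 - (t - 0) *\<^sub>R v) \<le> (\<eta> / 2) * norm (t - 0)"
      using d[unfolded has_derivative_at_alt] \<eta> half_gt_zero by blast
    obtain r' where r': "r' > 0" "\<And>t. t \<noteq> 0 \<Longrightarrow> dist t 0 < r' \<Longrightarrow> f t \<in> S"
      using e unfolding eventually_at by auto
    define t where "t = min r r' / 2"
    have t: "t > 0" "t < r" "t < r'" using r(1) r'(1) by (auto simp: t_def)
    have "f t \<in> S" using r'(2)[of t] t by simp
    then have "(1 / t) *\<^sub>R (f t - f 0) \<in> S" by (intro subspace_scale[OF S] subspace_diff[OF S] f0)
    moreover have "dist ((1 / t) *\<^sub>R (f t - f 0)) v < \<eta>"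
    proof -
      have "norm (f t - f 0 - t *\<^sub>R v) \<le> (\<eta> / 2) * t" using r(2)[of t] t by simp
      moreover have "(1 / t) *\<^sub>R (f t - f 0) - v = (1 / t) *\<^sub>R (f t - f 0 - t *\<^sub>R v)" using t by (simp add: algebra_simps)
      ultimately have "norm ((1 / t) *\<^sub>R (f t - f 0) - v) \<le> \<eta> / 2" using t by (simp add: divide_le_eq)
      then show ?thesis using \<eta> by (simp add: dist_norm)
    qed
    ultimately show "\<exists>y\<in>S. dist y v < \<eta>" by blast
  qed
  then show ?thesis using closed_subspace[OF S] by simp
qed

section \<open>Non-tangential approach\<close>

lemma bilinear_form_bound:
  fixes b :: "'e::euclidean_space \<Rightarrow> 'e \<Rightarrow> real"
  assumes "\<And>v. linear (\<lambda>u. b u v)" "\<And>u. linear (b u)" and B: "\<And>i j. i \<in> Basis \<Longrightarrow> j \<in> Basis \<Longrightarrow> \<bar>b i j\<bar> \<le> B"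
  shows "b u u \<le> (real DIM('e))\<^sup>2 * B * (norm u)\<^sup>2"
proof -
  have 1: "b u v = (\<Sum>i\<in>Basis. inner u i * b i v)" for u v
  proof -
    interpret linear "\<lambda>u. b u v" by fact
    have "b u v = b (\<Sum>i\<in>Basis. inner u i *\<^sub>R i) v" by (simp add: euclidean_representation)
    also have "\<dots> = (\<Sum>i\<in>Basis. inner u i * b i v)" unfolding sum by (simp add: scaleR)
    finally show ?thesis .
  qed
  have 2: "b i v = (\<Sum>j\<in>Basis. inner v j * b i j)" for i v
  proof -
    interpret linear "b i" by fact
    have "b i v = b i (\<Sum>j\<in>Basis. inner v j *\<^sub>R j)" by (simp add: euclidean_representation)
    also have "\<dots> = (\<Sum>j\<in>Basis. inner v j * b i j)" unfolding sum by (simp add: scaleR)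
    finally show ?thesis .
  qed
  have "b u u = (\<Sum>i\<in>Basis. \<Sum>j\<in>Basis. inner u i * (inner u j * b i j))"
    by (subst 1, subst 2) (simp add: sum_distrib_left)
  also have "\<dots> \<le> (\<Sum>i\<in>(Basis::'e set). \<Sum>j\<in>(Basis::'e set). norm u * (norm u * B))"
  proof (intro sum_mono)
    fix i j :: 'e assume ij: "i \<in> Basis" "j \<in> Basis"
    have "\<bar>inner u i * (inner u j * b i j)\<bar> \<le> norm u * (norm u * B)"
      unfolding abs_mult using ij by (intro mult_mono Basis_le_norm B) auto
    then show "inner u i * (inner u j * b i j) \<le> norm u * (norm u * B)" by linarith
  qed
  also have "\<dots> = (real DIM('e))\<^sup>2 * B * (norm u)\<^sup>2" by (simp add: power2_eq_square)
  finally show ?thesis .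
qed

text \<open>
  In a chart the metric is a continuous field of bilinear forms, hence bounded on a compact ball by a multiple of the Euclidean one. So
  the preimage of a segment is a path of length at most \<open>K\<close> times its Euclidean length.
\<close>

lemma riemannian_dist_le:
  fixes A :: "('m::{t2_space,second_countable_topology}, 'e::euclidean_space) chart set"
  assumes A: "smooth_atlas A" and c0: "c0 \<in> charts A" and g: "riemannian_metric A g" and X0: "X0 \<in> snd c0 ` fst c0"
  obtains K r where "K \<ge> 0" "r > 0" "\<And>X. X \<in> ball X0 r \<Longrightarrow>
    riemannian_dist A g (chart_inv c0 X) (chart_inv c0 X0) \<le> ennreal (K * norm (X - X0))"
proof -
  let ?U = "snd c0 ` fst c0"
  obtain r where r: "r > 0" "cball X0 r \<subseteq> ?U" using X0 chartsD(3)[OF c0] open_contains_cball by blast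
  define b where "b x u v = g (chart_inv c0 x) (coord_vec A c0 x u) (coord_vec A c0 x v)" for x u v
  have sm: "continuous_on ?U (\<lambda>x. b x i j)" for i j
  proof -
    have "smooth_on ?U (\<lambda>x. b x i j)" unfolding b_def coord_vec_def using g c0 by (auto simp: riemannian_metric_def)
    then have "Ck_on 0 ?U (\<lambda>x. b x i j)" unfolding smooth_on_def by blast
    then show ?thesis by simp
  qed
  have "\<exists>B. \<forall>x\<in>cball X0 r. \<bar>b x i j\<bar> \<le> B" for i j
  proof -
    have "bounded ((\<lambda>x. b x i j) ` cball X0 r)"
      by (intro compact_imp_bounded compact_continuous_image continuous_on_subset[OF sm r(2)] compact_cball)
    then show ?thesis by (auto simp: bounded_iff)
  qed
  then obtain Bf where Bf: "\<And>i j x. x \<in> cball X0 r \<Longrightarrow> \<bar>b x i j\<bar> \<le> Bf i j" by metis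
  define B where "B = (\<Sum>i\<in>(Basis::'e set). \<Sum>j\<in>(Basis::'e set). \<bar>Bf i j\<bar>)"
  have B: "\<bar>b x i j\<bar> \<le> B" if "x \<in> cball X0 r" "i \<in> Basis" "j \<in> Basis" for x i j
  proof -
    have "\<bar>b x i j\<bar> \<le> \<bar>Bf i j\<bar>" using Bf[OF that(1), of i j] by linarith
    also have "\<dots> \<le> (\<Sum>j\<in>(Basis::'e set). \<bar>Bf i j\<bar>)" using that by (intro member_le_sum) auto
    also have "\<dots> \<le> B" unfolding B_def using that(2) by (intro member_le_sum[of i _ "\<lambda>i. \<Sum>j\<in>(Basis::'e set). \<bar>Bf i j\<bar>"] sum_nonneg) auto
    finally show ?thesis .
  qed
  have B0: "B \<ge> 0" unfolding B_def by (intro sum_nonneg) auto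
  have bb: "b x u u \<le> (real DIM('e))\<^sup>2 * B * (norm u)\<^sup>2" if x: "x \<in> cball X0 r" for x u
  proof (rule bilinear_form_bound[where b = "b x"])
    have xU: "x \<in> ?U" using x r(2) by blast
    note vt = coord_vec_tangent[OF A c0 xU]
    have lin1: "g (chart_inv c0 x) (\<lambda>c. \<alpha> *\<^sub>R v c + \<beta> *\<^sub>R w c) u = \<alpha> * g (chart_inv c0 x) v u + \<beta> * g (chart_inv c0 x) w u"
      if "u \<in> tangent_space A (chart_inv c0 x)" "v \<in> tangent_space A (chart_inv c0 x)" "w \<in> tangent_space A (chart_inv c0 x)" for u v w \<alpha> \<beta>
      using g that unfolding riemannian_metric_def by blast
    have sym: "g (chart_inv c0 x) v w = g (chart_inv c0 x) w v"
      if "v \<in> tangent_space A (chart_inv c0 x)" "w \<in> tangent_space A (chart_inv c0 x)" for v w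
      using g that unfolding riemannian_metric_def by blast
    have l: "b x (\<alpha> *\<^sub>R u + \<beta> *\<^sub>R u') v = \<alpha> * b x u v + \<beta> * b x u' v" for u u' v \<alpha> \<beta>
      unfolding b_def coord_vec_linear[OF A c0 xU] by (rule lin1[OF vt vt vt])
    have s: "b x u v = b x v u" for u v unfolding b_def by (rule sym[OF vt vt])
    show L: "linear (\<lambda>u. b x u v)" for v
      using l[of 1 _ 1] l[of _ _ 0 0] by (intro linearI) auto
    show "\<bar>b x i j\<bar> \<le> B" if "i \<in> Basis" "j \<in> Basis" for i j by (rule B[OF x that])
    have "b x u = (\<lambda>v. b x v u)" for u by (rule ext) (rule s)
    then show "linear (b x u)" for u using L[of u] by metis
  qed
  define K where "K = sqrt ((real DIM('e))\<^sup>2 * B)"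
  have K: "K \<ge> 0" using B0 by (simp add: K_def)
  show ?thesis
  proof (rule that[OF K r(1)])
    fix X assume X: "X \<in> ball X0 r"
    define l where "l t = X + t *\<^sub>R (X0 - X)" for t :: real
    define \<gamma> where "\<gamma> = chart_inv c0 \<circ> l"
    have lball: "l t \<in> ball X0 r" if "t \<in> {0..1}" for t
    proof -
      have "l t = (1 - t) *\<^sub>R X + t *\<^sub>R X0" by (simp add: l_def algebra_simps)
      also have "\<dots> \<in> ball X0 r" using that X r(1) by (intro convexD_alt[OF convex_ball]) auto
      finally show ?thesis .
    qed
    have lU: "l t \<in> ?U" if "t \<in> {0..1}" for t using lball[OF that] r(2) by (meson ball_subset_cball subsetD)
    have dl: "(l has_derivative (\<lambda>h. h *\<^sub>R (X0 - X))) (at t)" for t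
      unfolding l_def by (auto intro!: derivative_eq_intros)
    have cl: "continuous_on S l" for S unfolding l_def by (intro continuous_intros)
    have Cl: "Ck_on 1 S l" for S by (rule Ck1_I[OF dl]) (intro continuous_intros)
    have pc: "piecewise_C1_path A \<gamma>"
      unfolding piecewise_C1_path_def
    proof
      show "continuous_on {0..1} \<gamma>" unfolding \<gamma>_def
        by (rule continuous_on_compose[OF cl continuous_on_subset[OF chart_inv(4)[OF chartsD(1)[OF c0]]]]) (use lU in auto)
      have "Ck_map A 1 ({0<..<1} - {}) \<gamma>" unfolding \<gamma>_def
        by (rule Ck_map_chart_inv[OF A c0 _ Cl]) (use lU in auto)
      then show "\<exists>F. finite F \<and> Ck_map A 1 ({0<..<1} - F) \<gamma>" by blast
    qed
    have \<gamma>01: "\<gamma> 0 = chart_inv c0 X" "\<gamma> 1 = chart_inv c0 X0" by (simp_all add: \<gamma>_def l_def)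
    have speed: "sqrt (g (\<gamma> t) (velocity A \<gamma> t) (velocity A \<gamma> t)) \<le> K * norm (X - X0)" if t: "t \<in> {0..1}" for t
    proof -
      have "velocity A \<gamma> t = coord_vec A c0 (l t) (X0 - X)"
        unfolding \<gamma>_def using differential_chart_inv[OF A c0 dl lU[OF t], of 1] by simp
      then have "g (\<gamma> t) (velocity A \<gamma> t) (velocity A \<gamma> t) = b (l t) (X0 - X) (X0 - X)"
        by (simp add: b_def \<gamma>_def)
      also have "\<dots> \<le> (real DIM('e))\<^sup>2 * B * (norm (X0 - X))\<^sup>2"
        using lball[OF t] by (intro bb) auto
      finally have "sqrt (g (\<gamma> t) (velocity A \<gamma> t) (velocity A \<gamma> t)) \<le> sqrt ((real DIM('e))\<^sup>2 * B * (norm (X0 - X))\<^sup>2)" by simp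
      also have "\<dots> = K * norm (X - X0)" by (simp add: K_def real_sqrt_mult norm_minus_commute)
      finally show ?thesis .
    qed
    have "riemannian_dist A g (chart_inv c0 X) (chart_inv c0 X0) \<le> curve_length A g \<gamma>"
      unfolding riemannian_dist_def using pc \<gamma>01 by (intro INF_lower) simp
    also have "\<dots> \<le> (\<integral>\<^sup>+t\<in>{0..1::real}. ennreal (K * norm (X - X0)) \<partial>lborel)"
      unfolding curve_length_def
    proof (rule nn_integral_mono)
      fix t :: real
      show "ennreal (sqrt (g (\<gamma> t) (velocity A \<gamma> t) (velocity A \<gamma> t))) * indicator {0..1} t \<le> ennreal (K * norm (X - X0)) * indicator {0..1} t"
        using ennreal_leI[OF speed[of t]] by (simp add: indicator_def)
    qed
    also have "\<dots> = ennreal (K * norm (X - X0))" by (simp add: nn_integral_cmult_indicator)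
    finally show "riemannian_dist A g (chart_inv c0 X) (chart_inv c0 X0) \<le> ennreal (K * norm (X - X0))" .
  qed
qed

lemma constant_velocity:
  fixes A :: "('m::topological_space, 'e::euclidean_space) chart set"
  assumes "q \<in> E"
  shows "velocity A (\<lambda>_. q) 0 \<in> tangent_space_of A E q"
proof -
  have "Ck_map A 1 {-1<..<1::real} (\<lambda>_. q)"
    unfolding Ck_map_def by (auto intro!: Ck1_I[where f' = "\<lambda>_ _. 0", unfolded One_nat_def] simp: o_def simp del: Ck_on.simps)
  then show ?thesis
    unfolding tangent_space_of_def using assms by (intro CollectI exI[of _ "\<lambda>_. q"]) (auto intro!: exI[of _ 1])
qed

text \<open>
  Curves in the boundary are curves in the zero set of \<open>\<rho>\<close>, so the tangent vectors of the boundary lie in the kernel of \<open>\<rho>'\<close>. The value of \<open>\<rho>'\<close> at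
  \<open>p - q\<close> is therefore its value at \<open>p - y\<close> for every \<open>y\<close> in the tangent plane.
\<close>

lemma tangent_plane_dist:
  fixes A :: "('m::{t2_space,second_countable_topology}, 'e::euclidean_space) chart set" and \<rho> :: "'e \<Rightarrow> real"
  assumes A: "smooth_atlas A" and c: "c \<in> charts_at A q" and q: "q \<in> frontier \<Omega>"
    and W: "open W" "q \<in> W" and zero: "\<And>p. p \<in> frontier \<Omega> \<Longrightarrow> p \<in> W \<Longrightarrow> p \<in> fst c \<Longrightarrow> \<rho> (snd c p) = 0"
    and d: "(\<rho> has_derivative \<rho>') (at (snd c q))"
  shows "\<bar>\<rho>' (snd c p - snd c q)\<bar> \<le> onorm \<rho>' * dist_to_tangent_plane A \<Omega> c q p"
proof -
  interpret D: bounded_linear \<rho>' using d by (rule has_derivative_bounded_linear)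
  let ?T = "tangent_plane_in_chart A \<Omega> c q"
  have cA: "c \<in> charts A" using c by (simp add: charts_at_def)
  have ne: "?T \<noteq> {}"
  proof -
    have "velocity A (\<lambda>_. q) 0 \<in> tangent_space_of A (frontier \<Omega>) q" using q by (rule constant_velocity)
    then show ?thesis unfolding tangent_plane_in_chart_def by blast
  qed
  have ker: "\<rho>' (v c) = 0" if v: "v \<in> tangent_space_of A (frontier \<Omega>) q" for v
  proof -
    obtain \<gamma> \<epsilon> where \<gamma>: "v = velocity A \<gamma> 0" "\<gamma> 0 = q" "\<epsilon> > 0" "Ck_map A 1 {-\<epsilon><..<\<epsilon>} \<gamma>" "\<gamma> ` {-\<epsilon><..<\<epsilon>} \<subseteq> frontier \<Omega>"
      using v unfolding tangent_space_of_def by blast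
    have c': "c \<in> charts_at A (\<gamma> 0)" using c \<gamma> by simp
    note vc = velocity_in_chart[OF A cA \<gamma>(4,3) c']
    have "continuous_on {-\<epsilon><..<\<epsilon>} \<gamma>" using \<gamma>(4) by (simp add: Ck_map_def)
    then have "open ({-\<epsilon><..<\<epsilon>} \<inter> \<gamma> -` W)" by (rule continuous_open_preimage) (use W in auto)
    then have eW: "\<forall>\<^sub>F t in nhds 0. t \<in> {-\<epsilon><..<\<epsilon>} \<inter> \<gamma> -` W" using \<gamma> W by (intro eventually_nhds_in_open) auto
    have d1: "((\<lambda>t. \<rho> ((snd c \<circ> \<gamma>) t)) has_derivative (\<lambda>h. \<rho>' (h *\<^sub>R v c))) (at 0)"
      using has_derivative_compose[OF vc(1), of \<rho> \<rho>'] d \<gamma>(1,2) by simp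
    have "\<forall>\<^sub>F t in nhds 0. \<rho> ((snd c \<circ> \<gamma>) t) = 0"
      using eW vc(2)[unfolded eventually_at_filter]
    proof eventually_elim
      case (elim t)
      then have "\<gamma> t \<in> frontier \<Omega>" "\<gamma> t \<in> W" "\<gamma> t \<in> fst c" using \<gamma> c q(1) by (auto simp: charts_at_def)
      then show ?case using zero by simp
    qed
    then have z: "\<forall>\<^sub>F t in at 0. 0 = \<rho> ((snd c \<circ> \<gamma>) t)" "0 = \<rho> ((snd c \<circ> \<gamma>) 0)"
      by (auto simp: eventually_at_filter eventually_mono dest: eventually_nhds_x_imp_x)
    have "((\<lambda>t. \<rho> ((snd c \<circ> \<gamma>) t)) has_derivative (\<lambda>h. 0)) (at 0)"
      by (rule has_derivative_transform_eventually[OF has_derivative_const z]) simp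
    from has_derivative_unique[OF d1 this] have "\<rho>' (1 *\<^sub>R v c) = 0" by (rule fun_cong)
    then show ?thesis by simp
  qed
  have n0: "onorm \<rho>' \<ge> 0" using D.bounded_linear_axioms by (rule onorm_pos_le)
  show ?thesis
  proof (cases "onorm \<rho>' = 0")
    case True
    then have "\<rho>' w = 0" for w using onorm[OF D.bounded_linear_axioms, of w] by simp
    then show ?thesis using True by simp
  next
    case False
    have "\<bar>\<rho>' (snd c p - snd c q)\<bar> / onorm \<rho>' \<le> infdist (snd c p) ?T"
      unfolding infdist_notempty[OF ne]
    proof (rule cINF_greatest[OF ne])
      fix y assume "y \<in> ?T"
      then obtain v where v: "v \<in> tangent_space_of A (frontier \<Omega>) q" "y = snd c q + v c"
        unfolding tangent_plane_in_chart_def by blast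
      have "\<rho>' (snd c p - snd c q) = \<rho>' (snd c p - y)" using ker[OF v(1)] by (simp add: v(2) D.diff D.add)
      also have "\<bar>\<dots>\<bar> \<le> onorm \<rho>' * dist (snd c p) y" using onorm[OF D.bounded_linear_axioms, of "snd c p - y"] by (simp add: dist_norm)
      finally show "\<bar>\<rho>' (snd c p - snd c q)\<bar> / onorm \<rho>' \<le> dist (snd c p) y"
        using False n0 by (simp add: divide_le_eq mult.commute)
    qed
    then show ?thesis using False n0 by (simp add: dist_to_tangent_plane_def divide_le_eq mult.commute)
  qed
qed

text \<open>
  In the chart \<open>\<kappa> q\<close>, the linearisation of the defining function at \<open>q\<close> is at most \<open>- c s + o(s)\<close> along the curve, whence the distance
  to the tangent plane is at least a multiple of \<open>s\<close>. The Riemannian distance to \<open>q\<close> is at most a multiple of \<open>s\<close> by the Lipschitz condition. The quotient of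
  the two constants gives the aperture \<open>\<alpha>\<close>.
\<close>

lemma nontangential_approach:
  fixes A :: "('m::{t2_space,second_countable_topology}, 'e::euclidean_space) chart set" and \<rho> :: "'e \<Rightarrow> real"
  assumes A: "smooth_atlas A" and g: "riemannian_metric A g" and c0: "c0 \<in> charts A"
    and \<kappa>: "\<kappa> q \<in> charts_at A q" and q: "q \<in> frontier \<Omega>" "q \<in> fst c0"
    and W: "open W" "q \<in> W" "W \<subseteq> fst c0" and zero: "\<And>p. p \<in> frontier \<Omega> \<Longrightarrow> p \<in> W \<Longrightarrow> \<rho> (snd c0 p) = 0"
    and d: "Ck_on 1 (snd c0 ` W) \<rho>"
    and X: "\<forall>\<^sub>F t in Fl. X t \<in> snd c0 ` fst c0 \<and> chart_inv c0 (X t) \<in> \<Omega>"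
    and lip: "\<forall>\<^sub>F t in Fl. norm (X t - snd c0 q) \<le> C * s t" and s: "\<forall>\<^sub>F t in Fl. s t > 0" "(s \<longlongrightarrow> 0) Fl"
    and drop: "\<forall>\<^sub>F t in Fl. \<rho> (X t) \<le> - c * s t" "c > 0"
  obtains \<alpha> where "\<alpha> > 1" "\<forall>\<^sub>F t in Fl. chart_inv c0 (X t) \<in> approach_region A g \<kappa> \<Omega> \<alpha> q"
    "((\<lambda>t. chart_inv c0 (X t)) \<longlongrightarrow> q) Fl"
proof -
  define X0 where "X0 = snd c0 q"
  have X0: "X0 \<in> snd c0 ` fst c0" "chart_inv c0 X0 = q" using q(2) chart_inv(1)[OF chartsD(1)[OF c0]] by (auto simp: X0_def)
  obtain K r where K: "K \<ge> 0" "r > 0" "\<And>X. X \<in> ball X0 r \<Longrightarrow>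
    riemannian_dist A g (chart_inv c0 X) (chart_inv c0 X0) \<le> ennreal (K * norm (X - X0))"
    using riemannian_dist_le[OF A c0 g X0(1)] by blast
  have XX0: "\<forall>\<^sub>F t in Fl. norm (X t - X0) \<le> \<bar>C\<bar> * s t"
    using lip s(1)
  proof eventually_elim
    case (elim t)
    have "C * s t \<le> \<bar>C\<bar> * s t" using elim(2) by (intro mult_right_mono) auto
    with elim(1) show ?case by (simp add: X0_def)
  qed
  have Xlim: "(X \<longlongrightarrow> X0) Fl"
  proof (rule LIM_zero_cancel, rule Lim_null_comparison)
    show "\<forall>\<^sub>F t in Fl. norm (X t - X0) \<le> \<bar>C\<bar> * s t" by (rule XX0)
    show "((\<lambda>t. \<bar>C\<bar> * s t) \<longlongrightarrow> 0) Fl" using tendsto_mult_left[OF s(2), of "\<bar>C\<bar>"] by simp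
  qed
  let ?c = "\<kappa> q"
  have cA: "?c \<in> charts A" and qc: "q \<in> fst ?c" using \<kappa> by (auto simp: charts_at_def)
  note ch0 = chartsD[OF c0] and chc = chartsD[OF cA]
  have invlim: "((\<lambda>t. chart_inv c0 (X t)) \<longlongrightarrow> q) Fl"
    using continuous_on_tendsto_compose[OF chart_inv(4)[OF ch0(1)] Xlim X0(1)] X X0(2) by (simp add: eventually_conj_iff)
  define Y0 where "Y0 = snd ?c q"
  define \<theta> where "\<theta> = snd ?c \<circ> chart_inv c0"
  \<comment> \<open>The inverse of the change of charts \<open>\<theta>\<close>; it carries \<open>\<rho>\<close> over to the chart \<open>\<kappa> q\<close>.\<close>
  define T where "T = snd c0 \<circ> chart_inv ?c"
  define \<theta>' where "\<theta>' = frechet_derivative \<theta> (at X0)"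
  have d\<theta>: "(\<theta> has_derivative \<theta>') (at X0)"
    unfolding \<theta>'_def \<theta>_def X0_def by (rule transition_has_derivative[OF A c0 cA q(2) qc])
  have dT: "(T has_derivative frechet_derivative T (at Y0)) (at Y0)"
    unfolding T_def Y0_def by (rule transition_has_derivative[OF A cA c0 qc q(2)])
  have TY0: "T Y0 = X0" by (simp add: T_def Y0_def X0_def chart_inv(1)[OF chc(1) qc])
  have \<theta>X0: "\<theta> X0 = Y0" by (simp add: \<theta>_def Y0_def X0(2))
  have "(\<rho> has_derivative frechet_derivative \<rho> (at X0)) (at X0)"
    by (rule Ck1_has_derivative[OF d]) (use W(2) in \<open>simp add: X0_def\<close>)
  then obtain lam where dl: "((\<rho> \<circ> T) has_derivative lam) (at Y0)"
    using diff_chain_at[OF dT, of \<rho>] TY0 by auto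
  interpret L: bounded_linear lam using dl by (rule has_derivative_bounded_linear)
  interpret T: bounded_linear \<theta>' using d\<theta> by (rule has_derivative_bounded_linear)
  let ?dd = "\<lambda>p. dist_to_tangent_plane A \<Omega> ?c q p"
  have plane: "\<bar>lam (snd ?c p - Y0)\<bar> \<le> onorm lam * ?dd p" for p
    unfolding Y0_def
  proof (rule tangent_plane_dist[OF A \<kappa> q(1) W(1,2), where \<rho> = "\<rho> \<circ> T"])
    show "(\<rho> \<circ> T) (snd ?c p) = 0" if "p \<in> frontier \<Omega>" "p \<in> W" "p \<in> fst ?c" for p
      using zero[OF that(1,2)] by (simp add: T_def chart_inv(1)[OF chc(1) that(3)])
    show "((\<rho> \<circ> T) has_derivative lam) (at (snd ?c q))" using dl by (simp add: Y0_def)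
  qed
  have N0: "onorm lam \<ge> 0" by (rule onorm_pos_le[OF L.bounded_linear_axioms])
  define L' where "L' = onorm \<theta>' + 1"
  have L'0: "L' > 0" using onorm_pos_le[OF T.bounded_linear_axioms] by (simp add: L'_def)
  have \<theta>lip: "\<forall>\<^sub>F x in nhds X0. norm (\<theta> x - Y0) \<le> L' * norm (x - X0)"
  proof -
    obtain r where r: "r > 0" "\<And>x. norm (x - X0) < r \<Longrightarrow> norm (\<theta> x - \<theta> X0 - \<theta>' (x - X0)) \<le> 1 * norm (x - X0)"
      using d\<theta>[unfolded has_derivative_at_alt] zero_less_one by blast
    have "norm (\<theta> x - Y0) \<le> L' * norm (x - X0)" if "dist x X0 < r" for x
    proof -
      have "norm (\<theta> x - \<theta> X0) \<le> norm (\<theta> x - \<theta> X0 - \<theta>' (x - X0)) + norm (\<theta>' (x - X0))"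
        using norm_triangle_ineq[of "\<theta> x - \<theta> X0 - \<theta>' (x - X0)" "\<theta>' (x - X0)"] by simp
      then show ?thesis using r(2)[of x] that onorm[OF T.bounded_linear_axioms, of "x - X0"]
        by (simp add: dist_norm L'_def distrib_right \<theta>X0)
    qed
    then show ?thesis using r(1) unfolding eventually_nhds_metric by blast
  qed
  \<comment> \<open>The relative linearisation error \<open>\<eta>\<close> is small enough to cost at most half of the decrease \<open>c s\<close>.\<close>
  define \<eta> where "\<eta> = c / (2 * (L' * \<bar>C\<bar> + 1))"
  have P: "L' * \<bar>C\<bar> + 1 > 0" using L'0 by (simp add: add_nonneg_pos)
  have \<eta>: "\<eta> > 0" using P drop(2) by (simp add: \<eta>_def)
  have \<eta>C: "\<eta> * (L' * \<bar>C\<bar>) \<le> c / 2"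
  proof -
    have "\<eta> * (L' * \<bar>C\<bar>) \<le> \<eta> * (L' * \<bar>C\<bar> + 1)" using \<eta> by simp
    also have "\<dots> = c / 2" using P unfolding \<eta>_def by (simp only: times_divide_eq_left) (metis mult.commute nonzero_mult_divide_mult_cancel_right less_numeral_extra(3))
    finally show ?thesis .
  qed
  have \<rho>approx: "\<forall>\<^sub>F y in nhds Y0. norm ((\<rho> \<circ> T) y - (\<rho> \<circ> T) Y0 - lam (y - Y0)) \<le> \<eta> * norm (y - Y0)"
    using dl[unfolded has_derivative_at_alt] \<eta> unfolding eventually_nhds_metric dist_norm by blast
  have \<theta>lim: "((\<lambda>t. \<theta> (X t)) \<longlongrightarrow> Y0) Fl"
  proof -
    have "isCont \<theta> X0" by (rule has_derivative_continuous[OF d\<theta>])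
    from isCont_tendsto_compose[OF this Xlim] show ?thesis by (simp add: \<theta>X0)
  qed
  have \<rho>0: "(\<rho> \<circ> T) Y0 = 0" using zero[OF q(1) W(2)] TY0 by (simp add: X0_def)
  have inc: "\<forall>\<^sub>F t in Fl. chart_inv c0 (X t) \<in> fst ?c"
    by (rule topological_tendstoD[OF invlim chc(2) qc])
  have inr: "\<forall>\<^sub>F t in Fl. X t \<in> ball X0 r"
    by (rule topological_tendstoD[OF Xlim open_ball]) (use K(2) in simp)
  define \<alpha> where "\<alpha> = 2 + K * \<bar>C\<bar> * ((2 / c) * onorm lam)"
  show ?thesis
  proof (rule that)
    have "K * \<bar>C\<bar> * ((2 / c) * onorm lam) \<ge> 0" using K(1) N0 drop(2) by (intro mult_nonneg_nonneg) auto
    then show "\<alpha> > 1" by (simp add: \<alpha>_def)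
    show "((\<lambda>t. chart_inv c0 (X t)) \<longlongrightarrow> q) Fl" by (rule invlim)
    show "\<forall>\<^sub>F t in Fl. chart_inv c0 (X t) \<in> approach_region A g \<kappa> \<Omega> \<alpha> q"
      using inc inr X XX0 s(1) drop(1) filterlim_iff[THEN iffD1, OF Xlim, rule_format, OF \<theta>lip]
        filterlim_iff[THEN iffD1, OF \<theta>lim, rule_format, OF \<rho>approx]
    proof eventually_elim
      case (elim t)
      define p where "p = chart_inv c0 (X t)"
      have Tp: "T (\<theta> (X t)) = X t"
        using elim(1,3) chart_inv(2)[OF ch0(1), of "X t"] by (simp add: T_def \<theta>_def chart_inv(1)[OF chc(1)])
      have m: "norm (\<theta> (X t) - Y0) \<le> L' * \<bar>C\<bar> * s t"
        using order_trans[OF elim(7) mult_left_mono[OF elim(4) less_imp_le[OF L'0]]] by (simp only: mult.assoc)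
      have em: "\<eta> * norm (\<theta> (X t) - Y0) \<le> c / 2 * s t"
      proof -
        have "\<eta> * norm (\<theta> (X t) - Y0) \<le> \<eta> * (L' * \<bar>C\<bar> * s t)" using m \<eta> by (intro mult_left_mono) auto
        also have "\<dots> = \<eta> * (L' * \<bar>C\<bar>) * s t" by simp
        also have "\<dots> \<le> c / 2 * s t" using elim(5) by (intro mult_right_mono \<eta>C) auto
        finally show ?thesis .
      qed
      have "lam (\<theta> (X t) - Y0) \<le> \<rho> (X t) + \<eta> * norm (\<theta> (X t) - Y0)"
        using elim(8) \<rho>0 Tp by (simp add: abs_le_iff)
      also have "\<dots> \<le> - c * s t + c / 2 * s t" using elim(6) em by linarith
      also have "\<dots> = - (c / 2 * s t)" by simp
      finally have "c / 2 * s t \<le> \<bar>lam (\<theta> (X t) - Y0)\<bar>" by linarith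
      also have "\<dots> \<le> onorm lam * ?dd p" using plane[of p] by (simp add: \<theta>_def p_def)
      finally have st: "s t \<le> (2 / c) * onorm lam * ?dd p" using drop(2) by (simp add: field_simps)
      have dd0: "?dd p \<ge> 0" by (simp add: dist_to_tangent_plane_def infdist_nonneg)
      have "K * norm (X t - X0) \<le> K * (\<bar>C\<bar> * s t)" using elim(4) K(1) by (rule mult_left_mono)
      also have "\<dots> = K * \<bar>C\<bar> * s t" by simp
      also have "\<dots> \<le> K * \<bar>C\<bar> * ((2 / c) * onorm lam * ?dd p)" using K(1) by (intro mult_left_mono st) auto
      also have "\<dots> \<le> \<alpha> * ?dd p" using dd0 by (simp add: \<alpha>_def distrib_right)
      finally have "ennreal (K * norm (X t - X0)) \<le> ennreal (\<alpha> * ?dd p)" by (rule ennreal_leI)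
      then have "riemannian_dist A g p q \<le> ennreal (\<alpha> * ?dd p)"
        using K(3)[OF elim(2)] X0(2) unfolding p_def by simp
      then show ?case using elim(1,3) by (simp add: approach_region_def p_def)
    qed
  qed
qed

section \<open>Discs attached to a generic submanifold of the boundary\<close>

lemma complex_structure_in_chart:
  fixes A :: "('m::{t2_space,second_countable_topology}, 'e::euclidean_space) chart set"
  assumes A: "smooth_atlas A" and c0: "c0 \<in> charts A" and J: "almost_complex_structure A J"
  defines "Jm \<equiv> \<lambda>x a. J (chart_inv c0 x) (coord_vec A c0 x a) c0"
  shows "\<And>x a. x \<in> snd c0 ` fst c0 \<Longrightarrow> J (chart_inv c0 x) (coord_vec A c0 x a) = coord_vec A c0 x (Jm x a)"
    and "\<And>x. x \<in> snd c0 ` fst c0 \<Longrightarrow> linear (Jm x)"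
    and "\<And>x a. x \<in> snd c0 ` fst c0 \<Longrightarrow> Jm x (Jm x a) = - a"
    and "\<And>k a. Ck_on k (snd c0 ` fst c0) (\<lambda>x. Jm x a)"
proof -
  have J1: "\<And>p v. v \<in> tangent_space A p \<Longrightarrow> J p v \<in> tangent_space A p \<and> J p (J p v) = (\<lambda>c. - v c)"
    and J2: "\<And>p v w a b. v \<in> tangent_space A p \<Longrightarrow> w \<in> tangent_space A p \<Longrightarrow>
        J p (\<lambda>c. a *\<^sub>R v c + b *\<^sub>R w c) = (\<lambda>c. a *\<^sub>R J p v c + b *\<^sub>R J p w c)"
    and J3: "\<And>a. smooth_on (snd c0 ` fst c0) (\<lambda>x. J (chart_inv c0 x) (coord_vec A c0 x a) c0)"
    using J c0 unfolding almost_complex_structure_def coord_vec_def by blast+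
  show 1: "J (chart_inv c0 x) (coord_vec A c0 x a) = coord_vec A c0 x (Jm x a)" if x: "x \<in> snd c0 ` fst c0" for x a
    unfolding Jm_def using tangent_eq_coord_vec[OF A c0 x] J1[OF coord_vec_tangent[OF A c0 x]] by blast
  show "linear (Jm x)" if x: "x \<in> snd c0 ` fst c0" for x
  proof -
    have l: "Jm x (\<alpha> *\<^sub>R a + \<beta> *\<^sub>R b) = \<alpha> *\<^sub>R Jm x a + \<beta> *\<^sub>R Jm x b" for \<alpha> \<beta> a b
      unfolding Jm_def coord_vec_linear[OF A c0 x] J2[OF coord_vec_tangent[OF A c0 x] coord_vec_tangent[OF A c0 x]] ..
    show ?thesis using l[of 1 _ 1] l[of _ _ 0 0] by (intro linearI) auto
  qed
  show "Jm x (Jm x a) = - a" if x: "x \<in> snd c0 ` fst c0" for x a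
  proof -
    have "Jm x (Jm x a) = J (chart_inv c0 x) (J (chart_inv c0 x) (coord_vec A c0 x a)) c0"
      unfolding 1[OF x] by (simp only: coord_vec_own_chart[OF A c0 x])
    also have "\<dots> = - a" using J1[OF coord_vec_tangent[OF A c0 x]] coord_vec_own_chart[OF A c0 x] by simp
    finally show ?thesis .
  qed
  show "Ck_on k (snd c0 ` fst c0) (\<lambda>x. Jm x a)" for k a
    unfolding Jm_def by (rule smooth_on_imp_Ck[OF J3])
qed

text \<open>
  The coordinate expression of a curve in \<open>E\<close> stays in the closed set \<open>S\<close>, and so do its difference quotients and their limit.
\<close>

lemma tangent_vector_in_subspace:
  fixes A :: "('m::{t2_space,second_countable_topology}, 'e::euclidean_space) chart set"
  assumes A: "smooth_atlas A" and c0: "c0 \<in> charts_at A p" and S: "subspace S"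
    and E: "snd c0 ` (E \<inter> fst c0) \<subseteq> S" and v: "v \<in> tangent_space_of A E p"
  shows "v c0 \<in> S"
proof -
  obtain \<gamma> \<epsilon> where \<gamma>: "v = velocity A \<gamma> 0" "\<gamma> 0 = p" "\<epsilon> > 0" "Ck_map A 1 {-\<epsilon><..<\<epsilon>} \<gamma>" "\<gamma> ` {-\<epsilon><..<\<epsilon>} \<subseteq> E"
    using v unfolding tangent_space_of_def by blast
  have cA: "c0 \<in> charts A" and c': "c0 \<in> charts_at A (\<gamma> 0)" using c0 \<gamma>(2) by (auto simp: charts_at_def)
  note vc = velocity_in_chart[OF A cA \<gamma>(4,3) c']
  have "velocity A \<gamma> 0 c0 \<in> S"
  proof (rule derivative_in_subspace[OF vc(1) S])
    have in_S: "(snd c0 \<circ> \<gamma>) t \<in> S" if "\<gamma> t \<in> fst c0" "t \<in> {-\<epsilon><..<\<epsilon>}" for t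
      using \<gamma>(5) E that by force
    show "(snd c0 \<circ> \<gamma>) 0 \<in> S" using in_S c' \<gamma>(3) by (simp add: charts_at_def)
    show "\<forall>\<^sub>F t in at 0. (snd c0 \<circ> \<gamma>) t \<in> S" using vc(2) by eventually_elim (use in_S in blast)
  qed
  then show ?thesis by (simp add: \<gamma>(1))
qed

text \<open>
  The local defining function comes with a chart of its own; composing it with the change of charts keeps its differential non-zero because the change
  of charts is invertible.
\<close>

lemma defining_function_in_chart:
  fixes A :: "('m::{t2_space,second_countable_topology}, 'e::euclidean_space) chart set"
  assumes A: "smooth_atlas A" and \<Omega>: "smoothly_bounded_domain A \<Omega>" and p0: "p0 \<in> frontier \<Omega>" and c0: "c0 \<in> charts_at A p0"
  obtains \<rho> :: "'e \<Rightarrow> real" and W v where "open W" "p0 \<in> W" "W \<subseteq> fst c0" "Ck_on 1 (snd c0 ` W) \<rho>"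
    "\<And>p. p \<in> W \<Longrightarrow> p \<in> \<Omega> \<longleftrightarrow> \<rho> (snd c0 p) < 0"
    "\<And>p. p \<in> frontier \<Omega> \<Longrightarrow> p \<in> W \<Longrightarrow> \<rho> (snd c0 p) = 0"
    "frechet_derivative \<rho> (at (snd c0 p0)) v \<noteq> 0"
proof -
  have "\<exists>c\<in>charts_at A p0. \<exists>\<rho>::'e \<Rightarrow> real. smooth_on (snd c ` fst c) \<rho> \<and>
      (\<forall>x\<in>snd c ` fst c. \<exists>v. frechet_derivative \<rho> (at x) v \<noteq> 0) \<and> \<Omega> \<inter> fst c = {p \<in> fst c. \<rho> (snd c p) < 0}"
    using \<Omega>[unfolded smoothly_bounded_domain_def] p0 by simp
  then obtain c1 and \<rho>1 :: "'e \<Rightarrow> real" where c1: "c1 \<in> charts_at A p0"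
    and sm: "smooth_on (snd c1 ` fst c1) \<rho>1"
    and nz': "\<forall>x\<in>snd c1 ` fst c1. \<exists>v. frechet_derivative \<rho>1 (at x) v \<noteq> 0"
    and sub: "\<Omega> \<inter> fst c1 = {p \<in> fst c1. \<rho>1 (snd c1 p) < 0}"
    by (elim bexE exE conjE)
  have nz: "\<exists>v. frechet_derivative \<rho>1 (at x) v \<noteq> 0" if "x \<in> snd c1 ` fst c1" for x
    using nz' that by (rule bspec)
  have o\<Omega>: "open \<Omega>" using \<Omega> by (simp add: smoothly_bounded_domain_def)
  have c0': "c0 \<in> charts A" "p0 \<in> fst c0" and c1': "c1 \<in> charts A" "p0 \<in> fst c1"
    using c0 c1 by (auto simp: charts_at_def)
  note ch0 = chartsD[OF c0'(1)] and ch1 = chartsD[OF c1'(1)]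
  define W where "W = fst c0 \<inter> fst c1"
  define T where "T = snd c1 \<circ> chart_inv c0"
  define \<rho> where "\<rho> = \<rho>1 \<circ> T"
  have ck1: "Ck_on 1 (snd c1 ` fst c1) \<rho>1" by (rule smooth_on_imp_Ck[OF sm])
  have \<rho>: "\<rho> (snd c0 p) = \<rho>1 (snd c1 p)" if "p \<in> W" for p
    using that by (simp add: \<rho>_def T_def W_def chart_inv(1)[OF ch0(1)])
  have ck: "Ck_on 1 (snd c0 ` W) \<rho>"
    unfolding \<rho>_def T_def W_def
    by (rule Ck1_compose[OF transition_C1[OF A c0'(1) c1'(1)] ck1]) (auto simp: chart_inv(1)[OF ch0(1)])
  have zero: "\<rho>1 (snd c1 p) = 0" if p: "p \<in> frontier \<Omega>" "p \<in> fst c1" for p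
  proof (rule ccontr)
    assume ne: "\<rho>1 (snd c1 p) \<noteq> 0"
    have "p \<notin> \<Omega>" using p(1) o\<Omega> by (simp add: frontier_def interior_open)
    then have "\<rho>1 (snd c1 p) > 0" using sub p(2) ne by force
    moreover have cont: "continuous_on (fst c1) (\<lambda>p. \<rho>1 (snd c1 p))"
      by (rule continuous_on_compose2[OF Ck1_continuous[OF ck1] chart_inv(3)[OF ch1(1)]]) simp
    ultimately have "p \<in> fst c1 \<inter> (\<lambda>p. \<rho>1 (snd c1 p)) -` {0<..}" (is "p \<in> ?N") using p(2) by simp
    moreover have "open ?N" by (rule continuous_open_preimage[OF cont ch1(2)]) simp
    ultimately obtain y where "y \<in> ?N" "y \<in> \<Omega>"
      using p(1) open_Int_closure_eq_empty[of ?N \<Omega>] unfolding frontier_def by blast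
    then show False using sub by force
  qed
  obtain v where v: "frechet_derivative \<rho>1 (at (snd c1 p0)) v \<noteq> 0" using nz c1'(2) by blast
  define R where "R = snd c0 \<circ> chart_inv c1"
  have dR: "(R has_derivative frechet_derivative R (at (snd c1 p0))) (at (snd c1 p0))"
    unfolding R_def by (rule transition_has_derivative[OF A c1'(1) c0'(1) c1'(2) c0'(2)])
  have R0: "R (snd c1 p0) = snd c0 p0" by (simp add: R_def chart_inv(1)[OF ch1(1) c1'(2)])
  have p0W: "p0 \<in> W" using c0' c1' by (simp add: W_def)
  have d\<rho>: "(\<rho> has_derivative frechet_derivative \<rho> (at (snd c0 p0))) (at (R (snd c1 p0)))"
    unfolding R0 by (rule Ck1_has_derivative[OF ck]) (use p0W in simp)
  have "((\<rho> \<circ> R) has_derivative (frechet_derivative \<rho> (at (snd c0 p0)) \<circ> frechet_derivative R (at (snd c1 p0)))) (at (snd c1 p0))"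
    by (rule diff_chain_at[OF dR d\<rho>])
  moreover have "open (snd c1 ` (fst c1 \<inter> fst c0))" "snd c1 p0 \<in> snd c1 ` (fst c1 \<inter> fst c0)"
    using chart_image_open[OF ch1(1) ch0(2)] c0' c1' by auto
  moreover have "(\<rho> \<circ> R) y = \<rho>1 y" if "y \<in> snd c1 ` (fst c1 \<inter> fst c0)" for y
    using that \<rho> by (auto simp: R_def chart_inv(1)[OF ch1(1)] W_def)
  ultimately have "(\<rho>1 has_derivative (frechet_derivative \<rho> (at (snd c0 p0)) \<circ> frechet_derivative R (at (snd c1 p0)))) (at (snd c1 p0))"
    by (rule has_derivative_transform_within_open)
  from frechet_derivative_at[OF this] v
  have "frechet_derivative \<rho> (at (snd c0 p0)) (frechet_derivative R (at (snd c1 p0)) v) \<noteq> 0" by (metis comp_apply)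
  then show ?thesis
  proof (rule that[rotated -1])
    show "open W" unfolding W_def using ch0(2) ch1(2) by (rule open_Int)
    show "p \<in> \<Omega> \<longleftrightarrow> \<rho> (snd c0 p) < 0" if "p \<in> W" for p
      using \<rho>[OF that] sub that unfolding W_def by auto
    show "\<rho> (snd c0 p) = 0" if "p \<in> frontier \<Omega>" "p \<in> W" for p
      using \<rho>[OF that(2)] zero that by (simp add: W_def)
    show "W \<subseteq> fst c0" by (simp add: W_def)
  qed (fact p0W ck)+
qed

lemma blinfun_derivative:
  fixes \<rho> :: "'e::euclidean_space \<Rightarrow> real"
  assumes "Ck_on 1 U \<rho>"
  obtains \<rho>' :: "'e \<Rightarrow> 'e \<Rightarrow>\<^sub>L real" where "\<And>x. x \<in> U \<Longrightarrow> (\<rho> has_derivative blinfun_apply (\<rho>' x)) (at x)" "continuous_on U \<rho>'"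
proof
  show "(\<rho> has_derivative blinfun_apply (\<Sum>k\<in>Basis. rank_one k (frechet_derivative \<rho> (at x) k))) (at x)" if "x \<in> U" for x
    using assms that by (intro has_derivative_partial_sum) (simp add: Ck1)
  show "continuous_on U (\<lambda>x. \<Sum>k\<in>Basis. rank_one k (frechet_derivative \<rho> (at x) k))"
    using assms by (intro continuous_on_sum bounded_linear.continuous_on[OF bounded_linear_rank_one]) (simp add: Ck1)
qed

text \<open>
  The hypotheses say that \<open>F\<close> is \<open>J\<close>-complex on the half box in coordinates; precomposition with the holomorphic map \<open>half_disc_map\<close> preserves this.
\<close>

lemma J_disc_chart_inv:
  fixes A :: "('m::{t2_space,second_countable_topology}, 'e::euclidean_space) chart set"
  assumes A: "smooth_atlas A" and c0: "c0 \<in> charts A" and J: "almost_complex_structure A J"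
    and F: "\<And>z. z \<in> half_box_interior \<Longrightarrow> F z \<in> snd c0 ` fst c0"
    and D: "\<And>z. z \<in> half_box_interior \<Longrightarrow> (F has_derivative D z) (at z)"
    and hol: "\<And>z h. z \<in> half_box_interior \<Longrightarrow> D z (\<i> * h) = J (chart_inv c0 (F z)) (coord_vec A c0 (F z) (D z h)) c0"
    and Dc: "\<And>h. continuous_on half_box_interior (\<lambda>z. D z h)"
  shows "J_disc A J (chart_inv c0 \<circ> (F \<circ> half_disc_map))"
proof -
  have b: "norm z < 1" if "z \<in> ball 0 1" for z :: complex using that by simp
  have d: "((F \<circ> half_disc_map) has_derivative (\<lambda>h. D (half_disc_map z) (half_disc_deriv z * h))) (at z)" if z: "z \<in> ball 0 1" for z
    using diff_chain_at[OF half_disc_map_deriv_disc[OF b[OF z], unfolded has_field_derivative_def] D[OF half_disc_map_interior[OF b[OF z]]]]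
    by (simp add: o_def)
  have im: "F (half_disc_map z) \<in> snd c0 ` fst c0" if "z \<in> ball 0 1" for z by (rule F[OF half_disc_map_interior[OF b[OF that]]])
  have ck: "Ck_on 1 (ball 0 1) (F \<circ> half_disc_map)"
  proof (rule Ck1_I[OF d])
    fix h
    have chm: "continuous_on (ball 0 1) half_disc_map"
      by (auto intro!: continuous_at_imp_continuous_on DERIV_isCont[OF half_disc_map_deriv_disc])
    have cD: "continuous_on (ball 0 1) (\<lambda>z. D (half_disc_map z) h)" for h
      by (rule continuous_on_compose2[OF Dc chm]) (use half_disc_map_interior in auto)
    have "continuous_on (ball 0 1) (\<lambda>z. Re (half_disc_deriv z * h) *\<^sub>R D (half_disc_map z) 1 + Im (half_disc_deriv z * h) *\<^sub>R D (half_disc_map z) \<i>)"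
      by (intro continuous_intros cD continuous_on_half_disc_deriv)
    then show "continuous_on (ball 0 1) (\<lambda>z. D (half_disc_map z) (half_disc_deriv z * h))"
    proof (rule continuous_on_eq)
      fix z :: complex assume z: "z \<in> ball 0 1"
      interpret bounded_linear "D (half_disc_map z)" by (rule has_derivative_bounded_linear[OF D[OF half_disc_map_interior[OF b[OF z]]]])
      define w where "w = half_disc_deriv z * h"
      have "w = Re w *\<^sub>R 1 + Im w *\<^sub>R \<i>" by (simp add: complex_eq_iff)
      then show "Re (half_disc_deriv z * h) *\<^sub>R D (half_disc_map z) 1 + Im (half_disc_deriv z * h) *\<^sub>R D (half_disc_map z) \<i> = D (half_disc_map z) (half_disc_deriv z * h)"
        unfolding w_def[symmetric] by (metis add scaleR)
    qed
  qed
  show ?thesis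
    unfolding J_disc_def
  proof (intro conjI ballI allI)
    show "Ck_map A 1 (ball 0 1) (chart_inv c0 \<circ> (F \<circ> half_disc_map))"
      by (rule Ck_map_chart_inv[OF A c0 open_ball ck]) (use im in auto)
    fix z :: complex and w assume z: "z \<in> ball 0 1"
    have df: "differential A (chart_inv c0 \<circ> (F \<circ> half_disc_map)) z h = coord_vec A c0 (F (half_disc_map z)) (D (half_disc_map z) (half_disc_deriv z * h))" for h
      using differential_chart_inv[OF A c0 d[OF z]] im[OF z] by simp
    have "D (half_disc_map z) (half_disc_deriv z * (\<i> * w)) = D (half_disc_map z) (\<i> * (half_disc_deriv z * w))" by (simp add: mult.left_commute)
    also have "\<dots> = J (chart_inv c0 (F (half_disc_map z))) (coord_vec A c0 (F (half_disc_map z)) (D (half_disc_map z) (half_disc_deriv z * w))) c0"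
      by (rule hol[OF half_disc_map_interior[OF b[OF z]]])
    finally show "differential A (chart_inv c0 \<circ> (F \<circ> half_disc_map)) z (\<i> * w) =
        J ((chart_inv c0 \<circ> (F \<circ> half_disc_map)) z) (differential A (chart_inv c0 \<circ> (F \<circ> half_disc_map)) z w)"
      unfolding df using complex_structure_in_chart(1)[OF A c0 J im[OF z]] by simp
  qed
qed

text \<open>
  Transport of \<open>attached_discs\<close> to the manifold, in a chart that maps \<open>E\<close> to a linear subspace. The set \<open>U\<close> is so small that its points on the
  subspace belong to \<open>E \<inter> B\<close> and a defining function of \<open>\<Omega>\<close> lives on it. This function vanishes on \<open>E\<close> and decreases at a linear rate
  along the discs, so these lie in \<open>\<Omega>\<close> and approach \<open>E\<close> non-tangentially.
\<close>

lemma attached_J_discs: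
  fixes A :: "('m::{t2_space,second_countable_topology}, 'e::euclidean_space) chart set"
  assumes A: "smooth_atlas A" and J: "almost_complex_structure A J" and g: "riemannian_metric A g"
    and \<Omega>: "smoothly_bounded_domain A \<Omega>" and \<kappa>: "\<And>q. q \<in> frontier \<Omega> \<Longrightarrow> \<kappa> q \<in> charts_at A q"
    and E: "generic_submanifold A J E" "E \<subseteq> frontier \<Omega>" and B: "open B" "p0 \<in> E" "p0 \<in> B"
  obtains V where "open V" "V \<noteq> {}"
    "\<And>p. p \<in> V \<Longrightarrow> \<exists>\<Phi>. J_disc A J \<Phi> \<and> \<Phi> ` ball 0 1 \<subseteq> \<Omega> \<and> \<Phi> 0 = p \<and>
      (\<forall>t. pi < t \<and> t < 2 * pi \<longrightarrow> (\<exists>q\<in>E \<inter> B. \<exists>\<alpha>>1.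
        (\<forall>\<^sub>F r in at_left 1. \<Phi> (of_real r * cis t) \<in> approach_region A g \<kappa> \<Omega> \<alpha> q) \<and>
        ((\<lambda>r. \<Phi> (of_real r * cis t)) \<longlongrightarrow> q) (at_left 1)))"
proof -
  note E1 = E(1)[unfolded generic_submanifold_def]
  obtain k where sub: "submanifold A k E" using conjunct1[OF E1] by (rule exE)
  note gen = bspec[OF conjunct2[OF E1] B(2)]
  obtain c0 S where c0: "c0 \<in> charts_at A p0" and S: "subspace S" "snd c0 ` (E \<inter> fst c0) = snd c0 ` fst c0 \<inter> S"
    using bspec[OF sub[unfolded submanifold_def] B(2)] by (elim bexE exE conjE)
  have cA: "c0 \<in> charts A" and p0c: "p0 \<in> fst c0" using c0 by (auto simp: charts_at_def)
  note ch = chartsD[OF cA] and inv = chart_inv[OF chartsD(1)[OF cA]]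
  have p0f: "p0 \<in> frontier \<Omega>" using E(2) B(2) by blast
  obtain \<rho> :: "'e \<Rightarrow> real" and W v0 where W: "open W" "p0 \<in> W" "W \<subseteq> fst c0" and ck: "Ck_on 1 (snd c0 ` W) \<rho>"
    and dom: "\<And>p. p \<in> W \<Longrightarrow> p \<in> \<Omega> \<longleftrightarrow> \<rho> (snd c0 p) < 0"
    and zero: "\<And>p. p \<in> frontier \<Omega> \<Longrightarrow> p \<in> W \<Longrightarrow> \<rho> (snd c0 p) = 0"
    and v0: "frechet_derivative \<rho> (at (snd c0 p0)) v0 \<noteq> 0"
    using defining_function_in_chart[OF A \<Omega> p0f c0] by metis
  define N where "N = W \<inter> B"
  have N: "open N" "p0 \<in> N" "N \<subseteq> fst c0" "N \<subseteq> W" using W B by (auto simp: N_def)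
  define U where "U = snd c0 ` N"
  have oU: "open U" using chart_image_open[OF ch(1) N(1)] N(3) by (simp add: U_def Int_absorb1)
  have Uc: "U \<subseteq> snd c0 ` fst c0" using N(3) by (auto simp: U_def)
  have invU: "chart_inv c0 x \<in> N" "snd c0 (chart_inv c0 x) = x" if "x \<in> U" for x
    using that N(3) inv(1) by (auto simp: U_def)
  have SE: "chart_inv c0 x \<in> E" if x: "x \<in> U" "x \<in> S" for x
  proof -
    have "x \<in> snd c0 ` (E \<inter> fst c0)" unfolding S(2) using x Uc by blast
    then show ?thesis using inv(1) by auto
  qed
  define x0 where "x0 = snd c0 p0"
  have x0: "x0 \<in> U" "x0 \<in> S" "chart_inv c0 x0 = p0" "x0 \<in> snd c0 ` fst c0"
    using N B(2) p0c S(2) inv(1) by (auto simp: x0_def U_def)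
  define Jm where "Jm x a = J (chart_inv c0 x) (coord_vec A c0 x a) c0" for x a
  note cs = complex_structure_in_chart[OF A cA J, folded Jm_def]
  have gen': "\<exists>u\<in>S. \<exists>w\<in>S. a = u + Jm x0 w" for a
  proof -
    have "coord_vec A c0 x0 a \<in> tangent_space A p0" using coord_vec_tangent[OF A cA x0(4)] x0(3) by simp
    then obtain v w where vw: "coord_vec A c0 x0 a = (\<lambda>c. v c + J p0 w c)" "v \<in> tangent_space_of A E p0" "w \<in> tangent_space_of A E p0"
      unfolding gen[symmetric] by blast
    have in_S: "v c0 \<in> S" if "v \<in> tangent_space_of A E p0" for v
      by (rule tangent_vector_in_subspace[OF A c0 S(1) _ that]) (use S(2) in blast)
    \<comment> \<open>The velocity of a constant curve is zero; in the description of the tangent space by genericity this exhibits every \<open>w\<close> as a tangent vector of \<open>M\<close>.\<close>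
    have z: "coord_vec A c0 x0 0 = (\<lambda>c. 0)" using coord_vec_linear[OF A cA x0(4), of 0 0 0 0] by simp
    have "((\<lambda>_::real. x0) has_derivative (\<lambda>_. 0)) (at 0)" by simp
    from differential_chart_inv[OF A cA this x0(4), of 1] have "velocity A (\<lambda>_. p0) 0 = (\<lambda>c. 0)"
      by (simp add: o_def x0(3) z)
    then have "(\<lambda>c. 0) \<in> tangent_space_of A E p0" using constant_velocity[OF B(2), of A] by simp
    moreover have "J p0 (\<lambda>c. 0) = (\<lambda>c. 0)"
      using cs(1)[OF x0(4), of 0] linear_0[OF cs(2)[OF x0(4)]] by (simp add: z x0(3))
    ultimately have wT: "w \<in> tangent_space A p0"
      unfolding gen[symmetric] using vw(3) by (intro CollectI exI[of _ w] exI[of _ "\<lambda>c. 0"]) simp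
    have "w = coord_vec A c0 x0 (w c0)" using tangent_eq_coord_vec[OF A cA x0(4)] wT x0(3) by simp
    then have "J p0 w c0 = Jm x0 (w c0)" unfolding Jm_def x0(3) by simp
    moreover have "a = v c0 + J p0 w c0" using fun_cong[OF vw(1), of c0] coord_vec_own_chart[OF A cA x0(4)] by simp
    ultimately show ?thesis using in_S vw(2,3) by metis
  qed
  obtain \<rho>' :: "'e \<Rightarrow> 'e \<Rightarrow>\<^sub>L real" where \<rho>': "\<And>x. x \<in> U \<Longrightarrow> (\<rho> has_derivative blinfun_apply (\<rho>' x)) (at x)" "continuous_on U \<rho>'"
    using blinfun_derivative[OF Ck_on_subset[OF ck]] N(4) by (metis U_def image_mono)
  have \<rho>S: "\<rho> x = 0" if "x \<in> U" "x \<in> S" for x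
    using zero[of "chart_inv c0 x"] SE[OF that] invU[OF that(1)] E(2) N(4) by auto
  have ker: "\<rho>' x0 u = 0" if u: "u \<in> S" for u
  proof -
    have "((\<lambda>t::real. x0 + t *\<^sub>R u) has_derivative (\<lambda>t. t *\<^sub>R u)) (at 0)" by (auto intro!: derivative_eq_intros)
    then have d: "((\<lambda>t. \<rho> (x0 + t *\<^sub>R u)) has_derivative (\<lambda>t. \<rho>' x0 (t *\<^sub>R u))) (at 0)"
      by (rule has_derivative_compose) (use \<rho>'(1)[OF x0(1)] in simp)
    have "\<forall>\<^sub>F t in at (0::real). x0 + t *\<^sub>R u \<in> U"
    proof (rule topological_tendstoD[OF _ oU x0(1)])
      show "((\<lambda>t::real. x0 + t *\<^sub>R u) \<longlongrightarrow> x0) (at 0)" by (auto intro!: tendsto_eq_intros)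
    qed
    then have "\<forall>\<^sub>F t in at 0. 0 = \<rho> (x0 + t *\<^sub>R u)"
      by eventually_elim (use \<rho>S subspace_add[OF S(1) x0(2) subspace_scale[OF S(1) u]] in simp)
    then have "((\<lambda>t. \<rho> (x0 + t *\<^sub>R u)) has_derivative (\<lambda>t. 0)) (at 0)"
      by (rule has_derivative_transform_eventually[OF has_derivative_const]) (use \<rho>S[OF x0(1,2)] in auto)
    from fun_cong[OF has_derivative_unique[OF d this], of 1] show ?thesis by simp
  qed
  have ne: "\<rho>' x0 \<noteq> 0"
  proof
    assume "\<rho>' x0 = 0"
    with frechet_derivative_at[OF \<rho>'(1)[OF x0(1)]] v0 show False unfolding x0_def by (metis zero_blinfun.rep_eq)
  qed
  have smU: "Ck_on 2 U (\<lambda>x. Jm x a)" for a by (rule Ck_on_subset[OF cs(4) Uc])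
  have linU: "linear (Jm x)" and sqU: "Jm x (Jm x a) = - a" if "x \<in> U" for x a
    using cs(2,3)[OF subsetD[OF Uc that]] by simp_all
  let ?attached = "\<lambda>w. \<exists>F D c C. c > 0 \<and> F ` half_box \<subseteq> U \<and> F (\<i> * of_real (Im (half_disc_map 0))) = w \<and> (\<forall>x. \<bar>x\<bar> \<le> 1 \<longrightarrow> F (of_real x) \<in> S)
      \<and> (\<forall>z\<in>half_box. \<forall>z'\<in>half_box. norm (F z - F z') \<le> C * norm (z - z'))
      \<and> (\<forall>z\<in>half_box. \<rho> (F z) \<le> \<rho> (F (of_real (Re z))) - c * Im z)
      \<and> (\<forall>z\<in>half_box_interior. (F has_derivative D z) (at z) \<and> (\<forall>h. D z (\<i> * h) = Jm (F z) (D z h)))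
      \<and> (\<forall>h. continuous_on half_box_interior (\<lambda>z. D z h))"
  obtain V where V: "open V" "V \<noteq> {}" "\<And>w. w \<in> V \<Longrightarrow> ?attached w"
  proof (rule attached_discs[OF oU x0(1) smU linU sqU S(1) x0(2) gen' \<rho>' ker ne half_disc_map_0(2,3)])
    fix V assume "open V" "V \<noteq> {}" "\<And>w. w \<in> V \<Longrightarrow> ?attached w"
    then show thesis by (rule that)
  qed
  have interior_half_box: "z \<in> half_box" if "z \<in> half_box_interior" for z using that by (auto simp: half_box_def half_box_interior_def)
  have reQ: "of_real x \<in> half_box" if "\<bar>x\<bar> \<le> 1" for x using that by (simp add: half_box_def)
  have hm0Q: "\<i> * of_real (Im (half_disc_map 0)) \<in> half_box" using half_disc_map_0(2,3) by (simp add: half_box_def)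
  show ?thesis
  proof (rule that)
    show "open {p \<in> fst c0. snd c0 p \<in> V}" by (rule chart_preimage_open[OF ch(1) V(1)])
    obtain w where w: "w \<in> V" using V(2) by blast
    then have "w \<in> U" using V(3)[OF w] hm0Q by blast
    then show "{p \<in> fst c0. snd c0 p \<in> V} \<noteq> {}" using invU[of w] N(3) w by (intro notI) auto
    fix p assume "p \<in> {p \<in> fst c0. snd c0 p \<in> V}"
    then have p: "p \<in> fst c0" "snd c0 p \<in> V" by auto
    obtain F D c C where c: "c > 0" and FQ: "F ` half_box \<subseteq> U" and F0: "F (\<i> * of_real (Im (half_disc_map 0))) = snd c0 p"
      and F: "\<forall>x. \<bar>x\<bar> \<le> 1 \<longrightarrow> F (of_real x) \<in> S"
        "\<forall>z\<in>half_box. \<forall>z'\<in>half_box. norm (F z - F z') \<le> C * norm (z - z')"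
        "\<forall>z\<in>half_box. \<rho> (F z) \<le> \<rho> (F (of_real (Re z))) - c * Im z"
        "\<forall>z\<in>half_box_interior. (F has_derivative D z) (at z) \<and> (\<forall>h. D z (\<i> * h) = Jm (F z) (D z h))"
        "\<forall>h. continuous_on half_box_interior (\<lambda>z. D z h)"
      using V(3)[OF p(2)] by (elim exE conjE)
    note FS = F(1)[rule_format] and lip = F(2)[rule_format] and drop = F(3)[rule_format] and Dc = F(5)[rule_format]
    have D: "(F has_derivative D z) (at z)" and hol: "D z (\<i> * h) = Jm (F z) (D z h)" if "z \<in> half_box_interior" for z h
      using F(4) that by simp_all
    have FU: "F z \<in> U" if "z \<in> half_box" for z using FQ that by blast
    have \<rho>z: "\<rho> (F z) \<le> - c * Im z" if z: "z \<in> half_box" for z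
    proof -
      have "\<bar>Re z\<bar> \<le> 1" using z by (simp add: half_box_def)
      then have "\<rho> (F (of_real (Re z))) = 0" by (intro \<rho>S FU reQ FS)
      then show ?thesis using drop[OF z] by simp
    qed
    define \<Phi> where "\<Phi> = chart_inv c0 \<circ> (F \<circ> half_disc_map)"
    have b: "half_disc_map z \<in> half_box_interior" "half_disc_map z \<in> half_box" if "norm z < 1" for z using half_disc_map_interior[OF that] interior_half_box by auto
    have in\<Omega>: "\<Phi> z \<in> \<Omega>" if z: "norm z < 1" for z
    proof -
      have x: "F (half_disc_map z) \<in> U" by (rule FU[OF b(2)[OF z]])
      have "0 < c * Im (half_disc_map z)" using c half_disc_map_range(2)[OF z] by simp
      then have "\<rho> (F (half_disc_map z)) < 0" using \<rho>z[OF b(2)[OF z]] by simp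
      then show ?thesis using dom[of "\<Phi> z"] invU[OF x] N(4) by (auto simp: \<Phi>_def)
    qed
    have disc: "J_disc A J \<Phi>"
      unfolding \<Phi>_def by (rule J_disc_chart_inv[OF A cA J _ D hol[unfolded Jm_def] Dc]) (use FU interior_half_box Uc in blast)+
    show "\<exists>\<Phi>. J_disc A J \<Phi> \<and> \<Phi> ` ball 0 1 \<subseteq> \<Omega> \<and> \<Phi> 0 = p \<and>
      (\<forall>t. pi < t \<and> t < 2 * pi \<longrightarrow> (\<exists>q\<in>E \<inter> B. \<exists>\<alpha>>1.
        (\<forall>\<^sub>F r in at_left 1. \<Phi> (of_real r * cis t) \<in> approach_region A g \<kappa> \<Omega> \<alpha> q) \<and>
        ((\<lambda>r. \<Phi> (of_real r * cis t)) \<longlongrightarrow> q) (at_left 1)))"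
    proof (intro exI[of _ \<Phi>] conjI allI impI)
      show "J_disc A J \<Phi>" by (rule disc)
      show "\<Phi> ` ball 0 1 \<subseteq> \<Omega>" using in\<Omega> by auto
      show "\<Phi> 0 = p" using F0 half_disc_map_0(1) inv(1)[OF p(1)] by (metis \<Phi>_def comp_apply)
      fix t assume "pi < t \<and> t < 2 * pi"
      then have t: "pi < t" "t < 2 * pi" by auto
      note hb = half_disc_map_boundary[OF t]
      define \<xi> where "\<xi> = Re (half_disc_map (cis t))"
      have \<xi>: "half_disc_map (cis t) = of_real \<xi>" "\<bar>\<xi>\<bar> \<le> 1" using hb(1,2) by (simp_all add: \<xi>_def complex_eq_iff)
      define q where "q = chart_inv c0 (F (of_real \<xi>))"
      have x: "F (of_real \<xi>) \<in> U" "F (of_real \<xi>) \<in> S" using FU reQ FS \<xi>(2) by auto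
      have qE: "q \<in> E" and qN: "q \<in> N" and sq: "snd c0 q = F (of_real \<xi>)"
        using SE[OF x] invU[OF x(1)] by (auto simp: q_def)
      have qf: "q \<in> frontier \<Omega>" using qE E(2) by blast
      define s where "s r = norm (half_disc_map (of_real r * cis t) - half_disc_map (cis t))" for r
      have r: "\<forall>\<^sub>F r in at_left 1. norm (of_real r * cis t) < 1"
        unfolding eventually_at_left_field by (intro exI[of _ 0]) (auto simp: norm_mult)
      have xr: "\<forall>\<^sub>F r in at_left 1. F (half_disc_map (of_real r * cis t)) \<in> snd c0 ` fst c0 \<and> chart_inv c0 (F (half_disc_map (of_real r * cis t))) \<in> \<Omega>"
        using r
      proof eventually_elim
        case (elim r)
        then show ?case using in\<Omega>[OF elim] FU[OF b(2)[OF elim]] Uc by (auto simp: \<Phi>_def)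
      qed
      have lipr: "\<forall>\<^sub>F r in at_left 1. norm (F (half_disc_map (of_real r * cis t)) - snd c0 q) \<le> C * s r"
        using r by eventually_elim (use lip[OF b(2) reQ[OF \<xi>(2)]] in \<open>simp add: s_def \<xi>(1) sq\<close>)
      have spos: "\<forall>\<^sub>F r in at_left 1. s r > 0"
        using r
      proof eventually_elim
        case (elim r)
        have "Im (half_disc_map (of_real r * cis t)) \<noteq> Im (half_disc_map (cis t))" using half_disc_map_range(2)[OF elim] hb(1) by simp
        then show ?case by (auto simp: s_def)
      qed
      have slim: "(s \<longlongrightarrow> 0) (at_left 1)"
        unfolding s_def by (rule tendsto_norm_zero[OF LIM_zero[OF hb(4)]])
      have dropr: "\<forall>\<^sub>F r in at_left 1. \<rho> (F (half_disc_map (of_real r * cis t))) \<le> - (c / 2) * s r"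
        using r hb(3)
      proof eventually_elim
        case (elim r)
        have "c * ((1/2) * s r) \<le> c * Im (half_disc_map (of_real r * cis t))" using elim(2) c by (intro mult_left_mono) (auto simp: s_def)
        then show ?case using \<rho>z[OF b(2)[OF elim(1)]] by simp
      qed
      obtain \<alpha> where \<alpha>: "\<alpha> > 1" "\<forall>\<^sub>F r in at_left 1. chart_inv c0 (F (half_disc_map (of_real r * cis t))) \<in> approach_region A g \<kappa> \<Omega> \<alpha> q"
        "((\<lambda>r. chart_inv c0 (F (half_disc_map (of_real r * cis t)))) \<longlongrightarrow> q) (at_left 1)"
      proof (rule nontangential_approach[where \<rho> = \<rho> and X = "\<lambda>r. F (half_disc_map (of_real r * cis t))" and s = s and C = C
            and c = "c / 2" and Fl = "at_left 1" and W = W and ?c0.0 = c0 and q = q and \<kappa> = \<kappa>])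
        fix \<alpha> assume "\<alpha> > 1" "\<forall>\<^sub>F r in at_left 1. chart_inv c0 (F (half_disc_map (of_real r * cis t))) \<in> approach_region A g \<kappa> \<Omega> \<alpha> q"
          "((\<lambda>r. chart_inv c0 (F (half_disc_map (of_real r * cis t)))) \<longlongrightarrow> q) (at_left 1)"
        then show thesis by (rule that)
      next
        show "q \<in> fst c0" "q \<in> W" "c / 2 > 0" using qN N(3,4) c by auto
        show "\<rho> (snd c0 p) = 0" if "p \<in> frontier \<Omega>" "p \<in> W" for p by (rule zero[OF that])
      qed (rule A g cA \<kappa>[OF qf] qf W(1,3) ck xr lipr spos slim dropr)+
      show "\<exists>q\<in>E \<inter> B. \<exists>\<alpha>>1.
        (\<forall>\<^sub>F r in at_left 1. \<Phi> (of_real r * cis t) \<in> approach_region A g \<kappa> \<Omega> \<alpha> q) \<and>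
        ((\<lambda>r. \<Phi> (of_real r * cis t)) \<longlongrightarrow> q) (at_left 1)"
        using qE qN \<alpha> unfolding \<Phi>_def o_def N_def by blast
    qed
  qed
qed

theorem theorem5p1:
  fixes n :: nat
    and A :: "('m::{t2_space,second_countable_topology}, 'e::euclidean_space) chart set"
    and J :: "'m \<Rightarrow> ('m, 'e) tvec \<Rightarrow> ('m, 'e) tvec"
    and g :: "'m \<Rightarrow> ('m, 'e) tvec \<Rightarrow> ('m, 'e) tvec \<Rightarrow> real"
    and \<kappa> :: "'m \<Rightarrow> ('m, 'e) chart"
    and \<Omega> E K :: "'m set"
  assumes "almost_complex_manifold n A J"
    and "riemannian_metric A g"
    and "smoothly_bounded_domain A \<Omega>"
    and "\<forall>q\<in>frontier \<Omega>. \<kappa> q \<in> charts_at A q"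
    and "generic_submanifold A J E" and "E \<subseteq> frontier \<Omega>"
    and "K \<subseteq> E" and "(top_of_set E) interior_of K \<noteq> {}"
  shows "\<not> (\<forall>p\<in>\<Omega>. plurisuperharmonic_measure A J g \<kappa> p K \<Omega> = 0)"
proof
  assume vanish: "\<forall>p\<in>\<Omega>. plurisuperharmonic_measure A J g \<kappa> p K \<Omega> = 0"
  have A: "smooth_atlas A" and J: "almost_complex_structure A J"
    using assms(1) by (auto simp: almost_complex_manifold_def)
  have o\<Omega>: "open \<Omega>" using assms(3) by (simp add: smoothly_bounded_domain_def)
  obtain p0 B where B: "open B" "p0 \<in> E" "p0 \<in> B" "E \<inter> B \<subseteq> K"
  proof -
    obtain p0 where "p0 \<in> (top_of_set E) interior_of K" using assms(8) by blast
    then obtain T where "openin (top_of_set E) T" "p0 \<in> T" "T \<subseteq> K" by (auto simp: interior_of_def)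
    then show ?thesis using that by (metis IntE openin_open)
  qed
  have \<kappa>: "\<kappa> q \<in> charts_at A q" if "q \<in> frontier \<Omega>" for q using assms(4) that by blast
  \<comment> \<open>The bound \<open>1/2\<close> holds for all \<open>u\<close> of the class at once because the discs do not depend on \<open>u\<close>.\<close>
  let ?filled = "\<lambda>p. \<exists>\<Phi>. J_disc A J \<Phi> \<and> \<Phi> ` ball 0 1 \<subseteq> \<Omega> \<and> \<Phi> 0 = p \<and>
      (\<forall>t. pi < t \<and> t < 2 * pi \<longrightarrow> (\<exists>q\<in>E \<inter> B. \<exists>\<alpha>>1.
        (\<forall>\<^sub>F r in at_left 1. \<Phi> (of_real r * cis t) \<in> approach_region A g \<kappa> \<Omega> \<alpha> q) \<and>
        ((\<lambda>r. \<Phi> (of_real r * cis t)) \<longlongrightarrow> q) (at_left 1)))"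
  obtain V where V: "open V" "V \<noteq> {}" "\<And>p. p \<in> V \<Longrightarrow> ?filled p"
  proof (rule attached_J_discs[OF A J assms(2,3) \<kappa> assms(5,6) B(1-3)])
    fix V assume "open V" "V \<noteq> {}" "\<And>p. p \<in> V \<Longrightarrow> ?filled p"
    then show thesis by (rule that)
  qed assumption
  have half: "ereal (1/2) \<le> u p" if p: "p \<in> V" and u: "u \<in> psh_measure_class A J g \<kappa> K \<Omega>" for p u
  proof -
    obtain \<Phi> where \<Phi>: "J_disc A J \<Phi>" "\<Phi> ` ball 0 1 \<subseteq> \<Omega>" "\<Phi> 0 = p"
      and bd: "\<And>t. pi < t \<Longrightarrow> t < 2 * pi \<Longrightarrow> \<exists>q\<in>E \<inter> B. \<exists>\<alpha>>1.
        (\<forall>\<^sub>F r in at_left 1. \<Phi> (of_real r * cis t) \<in> approach_region A g \<kappa> \<Omega> \<alpha> q) \<and>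
        ((\<lambda>r. \<Phi> (of_real r * cis t)) \<longlongrightarrow> q) (at_left 1)"
      using V(3)[OF p] by blast
    have u1: "plurisubharmonic_on A J \<Omega> (\<lambda>p. - u p)" and u0: "\<And>p. p \<in> \<Omega> \<Longrightarrow> u p \<ge> 0"
      and uK: "\<And>q. q \<in> K \<Longrightarrow> lower_boundary_extension A g \<kappa> \<Omega> u q \<ge> 1"
      using u by (auto simp: psh_measure_class_def plurisuperharmonic_on_def)
    have "ereal (1/2) \<le> (u \<circ> \<Phi>) 0"
    proof (rule superharmonic_center_bound)
      have "subharmonic_on (ball 0 1) ((\<lambda>p. - u p) \<circ> \<Phi>)" using u1 \<Phi>(1,2) by (simp add: plurisubharmonic_on_def)
      then show "subharmonic_on (ball 0 1) (\<lambda>z. - (u \<circ> \<Phi>) z)" by (simp add: o_def)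
      show "(u \<circ> \<Phi>) z \<ge> 0" if "z \<in> ball 0 1" for z using u0[of "\<Phi> z"] \<Phi>(2) that by (simp add: image_subset_iff)
      fix t :: real and y :: ereal assume t: "pi < t" "t < 2 * pi" and y: "y < 1"
      obtain q \<alpha> where q: "q \<in> E" "q \<in> B" "\<alpha> > 1"
        and ap: "\<forall>\<^sub>F r in at_left 1. \<Phi> (of_real r * cis t) \<in> approach_region A g \<kappa> \<Omega> \<alpha> q"
        and tq: "((\<lambda>r. \<Phi> (of_real r * cis t)) \<longlongrightarrow> q) (at_left 1)"
        using bd[OF t] by blast
      have q\<Omega>: "q \<notin> \<Omega>" using q(1) assms(6) o\<Omega> by (auto simp: frontier_def interior_open)
      have "1 \<le> lower_boundary_extension A g \<kappa> \<Omega> u q" using uK q B(4) by blast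
      also have "\<dots> \<le> Liminf (at q within approach_region A g \<kappa> \<Omega> \<alpha> q) u"
        unfolding lower_boundary_extension_def if_not_P[OF q\<Omega>] by (rule INF_lower) (use q(3) in simp)
      finally have "y < Liminf (at q within approach_region A g \<kappa> \<Omega> \<alpha> q) u" using y by simp
      then have ev: "\<forall>\<^sub>F p in at q within approach_region A g \<kappa> \<Omega> \<alpha> q. y < u p" by (rule less_LiminfD)
      have "filterlim (\<lambda>r. \<Phi> (of_real r * cis t)) (at q within approach_region A g \<kappa> \<Omega> \<alpha> q) (at_left 1)"
        unfolding filterlim_at
      proof
        show "\<forall>\<^sub>F r in at_left 1. \<Phi> (of_real r * cis t) \<in> approach_region A g \<kappa> \<Omega> \<alpha> q \<and> \<Phi> (of_real r * cis t) \<noteq> q"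
          using ap by eventually_elim (use q\<Omega> in \<open>auto simp: approach_region_def\<close>)
      qed (rule tq)
      from filterlim_iff[THEN iffD1, OF this, rule_format, OF ev]
      show "\<forall>\<^sub>F r in at_left 1. y < (u \<circ> \<Phi>) (of_real r * cis t)" by simp
    qed
    then show ?thesis by (simp add: \<Phi>(3))
  qed
  obtain p where p: "p \<in> V" using V(2) by blast
  have p\<Omega>: "p \<in> \<Omega>"
  proof -
    obtain \<Phi> where "\<Phi> ` ball (0::complex) 1 \<subseteq> \<Omega>" "\<Phi> 0 = p" using V(3)[OF p] by blast
    then show ?thesis by (auto simp: image_subset_iff dest!: bspec[of _ _ 0])
  qed
  have "ereal (1/2) \<le> Liminf (nhds p) (\<lambda>q. omega_pre A J g \<kappa> q K \<Omega>)"
  proof (rule Liminf_bounded)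
    show "\<forall>\<^sub>F q in nhds p. ereal (1/2) \<le> omega_pre A J g \<kappa> q K \<Omega>"
      using eventually_nhds_in_open[OF V(1) p]
      by eventually_elim (auto simp: omega_pre_def intro: INF_greatest half)
  qed
  also have "\<dots> = 0" using vanish p\<Omega> by (simp add: plurisuperharmonic_measure_def)
  finally show False by simp
qed

end
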